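(* For every $n$ with $1\leq n\leq 6$, let $\mathbb B_n:=\mathbb Q(\cos(\pi/2^{n+1}))$, let $RE_n^+:=\{\epsilon\in\mathcal O_{\mathbb B_n}^\times\mid \mathrm{N}_{\mathbb B_n/\mathbb B_{n-1}}(\epsilon)=1\}$, and let $c_1:=2$, $c_n:=2\cdot\mathrm{round}(2^n/5)$ for $n\geq 2$. Then $$\min\{\mathrm{Tr}_{\mathbb B_n/\mathbb Q}(\epsilon^2)\mid \epsilon\in RE_n^+,\ \epsilon\neq\pm1\}=2^n(1+8c_n).$$
   Context: $\mathbb B_n$ is the $n$th layer of the cyclotomic $\mathbb Z_2$-extension of $\mathbb Q$ (with $\mathbb B_0=\mathbb Q$), of degree $2^n$; $\mathrm{N}_{\mathbb B_n/\mathbb B_{n-1}}$ is the relative norm to the index-$2$ subfield $\mathbb B_{n-1}$; $\mathrm{round}(x)$ is the nearest integer to $x$. The values are $c_1=2,c_2=2,c_3=4,c_4=6,c_5=12,c_6=26$. *)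

theory Defs
  imports
    Complex_Main
    "HOL-Algebra.Generated_Fields"
    "HOL-Algebra.Embedded_Algebras"
    "HOL-Algebra.Algebraic_Closure_Type"
    "Jordan_Normal_Form.Determinant"
begin

text \<open>All fields below are subfields of the reals, given by their carrier sets.\<close>

abbreviation RR :: "real ring" where
  "RR \<equiv> ring_of_type_algebra"

text \<open>Since \<open>generate_field\<close> always contains \<open>1\<close>, the generated subfield of the reals
  contains the rationals.\<close>

definition BB :: "nat \<Rightarrow> real set" where
  "BB n = generate_field RR {cos (pi / 2 ^ (n + 1))}"

definition integers_of :: "real set \<Rightarrow> real set" where
  "integers_of L = {x \<in> L. algebraic_int x}"

definition units_of_integers :: "real set \<Rightarrow> real set" where
  "units_of_integers L = Units (RR\<lparr>carrier := integers_of L\<rparr>)"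

definition basis_over :: "real set \<Rightarrow> real set \<Rightarrow> real list \<Rightarrow> bool" where
  "basis_over K L bs \<longleftrightarrow> ring.independent RR K bs \<and> ring.Span RR K bs = L"

text \<open>\<open>A\<close> is the matrix of the \<open>K\<close>-linear map \<open>y \<mapsto> x * y\<close> on \<open>L\<close>
  with respect to some \<open>K\<close>-basis of \<open>L\<close>.\<close>

definition represents_mult :: "real set \<Rightarrow> real set \<Rightarrow> real \<Rightarrow> real mat \<Rightarrow> bool" where
  "represents_mult K L x A \<longleftrightarrow>
     (\<exists>bs. basis_over K L bs \<and>
        A \<in> carrier_mat (length bs) (length bs) \<and> elements_mat A \<subseteq> K \<and>
        (\<forall>j<length bs. x * bs ! j = (\<Sum>i<length bs. A $$ (i, j) * bs ! i)))"

text \<open>Matrices of the same map with respect to different bases are similar, so for a finite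
  extension the determinant and the trace below do not depend on the choice made here.\<close>

definition mult_matrix :: "real set \<Rightarrow> real set \<Rightarrow> real \<Rightarrow> real mat" where
  "mult_matrix K L x = (SOME A. represents_mult K L x A)"

definition field_norm :: "real set \<Rightarrow> real set \<Rightarrow> real \<Rightarrow> real" where
  "field_norm K L x = det (mult_matrix K L x)"

definition field_trace :: "real set \<Rightarrow> real set \<Rightarrow> real \<Rightarrow> real" where
  "field_trace K L x = (let A = mult_matrix K L x in \<Sum>i<dim_row A. A $$ (i, i))"

definition RE_plus :: "nat \<Rightarrow> real set" where
  "RE_plus n = {\<epsilon> \<in> units_of_integers (BB n). field_norm (BB (n - 1)) (BB n) \<epsilon> = 1}"

text \<open>Only the values for \<open>n \<ge> 1\<close> are meaningful.\<close>

definition c_seq :: "nat \<Rightarrow> int" where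
  "c_seq n = (if n = 1 then 2 else 2 * round (2 ^ n / 5 :: real))"

lemma BB_0: "BB 0 = \<rat>"
proof -
  interpret field RR by (rule field_from_type_algebra)
  have inv_RR: "inv\<^bsub>RR\<^esub> x = inverse x" if "x \<noteq> 0" for x :: real
    using that by (intro comm_inv_char) (auto simp: ring_of_type_algebra_def)
  have neg_RR: "\<ominus>\<^bsub>RR\<^esub> x = - x" for x :: real
    using r_neg[of x] by (auto simp: ring_of_type_algebra_def)
  note ops = ring_of_type_algebra_def
  have sf: "subfield (BB 0) RR"
    unfolding BB_def by (rule generate_field_is_subfield) (auto simp: ops)
  have one_in: "1 \<in> BB 0"
    using generate_field.one[of RR] by (simp add: BB_def ops)
  have add_in: "x + y \<in> BB 0" if "x \<in> BB 0" "y \<in> BB 0" for x y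
    using generate_field.eng_add[of x RR _ y] that by (simp add: BB_def ops)
  have mult_in: "x * y \<in> BB 0" if "x \<in> BB 0" "y \<in> BB 0" for x y
    using generate_field.eng_mult[of x RR _ y] that by (simp add: BB_def ops)
  have neg_in: "- x \<in> BB 0" if "x \<in> BB 0" for x
    using generate_field.a_inv[of x RR] that by (simp add: BB_def neg_RR)
  have inv_in: "inverse x \<in> BB 0" if "x \<in> BB 0" for x
  proof (cases "x = 0")
    case False
    then show ?thesis
      using generate_field.m_inv[of x RR] that inv_RR[of x] by (simp add: BB_def ops)
  qed (use that in simp)
  have zero_in: "0 \<in> BB 0"
    using add_in[OF one_in neg_in[OF one_in]] by simp
  have nat_in: "real k \<in> BB 0" for k
    by (induction k) (auto intro: zero_in one_in add_in)
  have int_in: "real_of_int k \<in> BB 0" for k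
    by (cases k rule: int_cases2) (auto intro: nat_in neg_in)
  show ?thesis
  proof
    show "BB 0 \<subseteq> \<rat>"
    proof
      fix x assume "x \<in> BB 0"
      then have "x \<in> generate_field RR {0}" by (simp add: BB_def)
      then show "x \<in> \<rat>"
      proof (induction rule: generate_field.induct)
        case (m_inv h)
        then have "h \<noteq> 0" by (simp add: ops)
        then show ?case using inv_RR[of h] m_inv by simp
      qed (auto simp: neg_RR, auto simp: ops)
    qed
    show "\<rat> \<subseteq> BB 0"
    proof
      fix x :: real assume "x \<in> \<rat>"
      then obtain a b where "x = real_of_int a / real_of_int b"
        by (auto elim: Rats_cases')
      then show "x \<in> BB 0"
        using mult_in[OF int_in inv_in[OF int_in]] by (simp add: divide_inverse)
    qed
  qed
qed

end

theory Submission
  imports Defs "Jordan_Normal_Form.Char_Poly" "HOL-Library.Z2" "HOL-Library.Numeral_Type"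
begin


text \<open>Put n = m + 1 and M = 2^m, let K be the field of level m and th = 2 cos (pi / 2^(n+1)),
  so that th^2 = \<open>prm m\<close> = 2 + \<open>th m\<close> generates the prime of K above 2. A
  unit \<epsilon> = a + b th of relative norm 1 satisfies (a - 1)(a + 1) = \<open>prm m\<close> b^2.
  Comparing valuations at that prime forces a = 1 + 2c and b = 2h with c and h integral
  (\<open>relative_norm_one_halves\<close>). With f = th h this reads c^2 + c = f^2, and the trace
  of \<epsilon>^2 is 2^n (1 + 8t), where t is the trace of f^2 divided by the degree
  (\<open>TT_square\<close>). So the least t belonging to a nonzero f has to be found.

  The integers of these fields are given by coefficient sequences with respect to the powers of a
  root of unity of 2-power order: even, antiperiodic functions on the integers, multiplied by
  convolution, whose constant term is the normalized trace (\<open>val_conv\<close>,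
  \<open>TT_val\<close>, \<open>RI_val\<close>). For the sequences C of c and F of f, the constant
  term of c^2 + c = f^2 gives t in two ways: as the sum of F_k^2 over 0 <= k < 4M, and as C_0^2 +
  C_0 plus twice the sum of C_j^2 over 0 < j < M (\<open>trace_identity\<close>). Hence t is
  positive and even. That it takes the required value is shown by explicit sequences.

  For n >= 3 the values t <= c_n - 2 must be excluded, and the second formula leaves finitely many
  C. Replacing c by -1 - c makes C_0 even, and the Galois group, acting by dilation of indices by
  odd numbers, allows a normalization (\<open>normalizing_dilation\<close>,
  \<open>ex_positive_normalized\<close>). Modulo 2 the equation gives a doubling rule
  (\<open>c_double\<close>), so that the possible parity patterns can be listed, starting from the
  indices most divisible by 2. Modulo 4 it gives, for each pattern, a linear system over the field
  with two elements that links the second binary digits of C to some parities of F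
  (\<open>T_split\<close>). The unknowns from F are eliminated, and a search within the budget left
  by t runs through the solutions. Every candidate is refuted at the prime 257, which splits
  completely: the image e of c under each homomorphism to the integers modulo 257 must make e^2 + e
  a square (\<open>unit_seqs_evaluate\<close>, \<open>not_nonresidue\<close>). The degenerate case
  in which all coefficients at odd indices vanish is treated by hand
  (\<open>even_solution\<close>).\<close>

section \<open>Algebraic integers form a ring\<close>

text \<open>The relation exhibits \<open>y\<close> as an eigenvalue of an integer matrix, whose
  characteristic polynomial is monic with integer coefficients.\<close>

lemma eigen_algebraic_int:
  fixes v :: "nat \<Rightarrow> real" and M :: "nat \<Rightarrow> nat \<Rightarrow> int"
  assumes eq: "\<And>i. i < n \<Longrightarrow> y * v i = (\<Sum>j<n. of_int (M i j) * v j)"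
    and nz: "i0 < n" "v i0 \<noteq> 0"
  shows "algebraic_int y"
proof -
  define A where "A = mat n n (\<lambda>(i, j). M i j)"
  let ?A = "map_mat real_of_int A"
  let ?v = "vec n v"
  have A: "A \<in> carrier_mat n n" "?A \<in> carrier_mat n n" by (auto simp: A_def)
  have "?v \<noteq> 0\<^sub>v n" using nz by (metis index_vec index_zero_vec(1))
  moreover have "?A *\<^sub>v ?v = y \<cdot>\<^sub>v ?v"
    by (rule eq_vecI) (auto simp: A_def scalar_prod_def eq lessThan_atLeast0 intro!: sum.cong)
  ultimately have "eigenvector ?A ?v y" using A by (auto simp: eigenvector_def)
  then have "eigenvalue ?A y" by (auto simp: eigenvalue_def)
  then have root: "poly (char_poly ?A) y = 0" using eigenvalue_root_char_poly[OF A(2)] by simp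
  have hom: "char_poly ?A = map_poly of_int (char_poly A)"
    by (rule of_int_hom.char_poly_hom[OF A(1)])
  show ?thesis
  proof (rule algebraic_int.intros)
    show "lead_coeff (char_poly ?A) = 1" using degree_monic_char_poly[OF A(2)] by simp
    show "\<forall>i. coeff (char_poly ?A) i \<in> \<int>" unfolding hom by (simp add: coeff_map_poly)
    show "poly (char_poly ?A) y = 0" by (rule root)
  qed
qed

inductive_set zspan :: "real set \<Rightarrow> real set" for B where
  zero: "0 \<in> zspan B"
| base: "b \<in> B \<Longrightarrow> b \<in> zspan B"
| add: "x \<in> zspan B \<Longrightarrow> y \<in> zspan B \<Longrightarrow> x + y \<in> zspan B"
| neg: "x \<in> zspan B \<Longrightarrow> - x \<in> zspan B"

lemma zspan_of_int_mult:
  assumes "x \<in> zspan B"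
  shows "of_int k * x \<in> zspan B"
proof -
  have nat: "real n * x \<in> zspan B" for n
    by (induction n) (auto simp: algebra_simps intro: zspan.intros assms)
  show ?thesis
  proof (cases k rule: int_cases2)
    case (nonneg n) then show ?thesis using nat by simp
  next
    case (nonpos n) then show ?thesis using zspan.neg[OF nat[of n]] by simp
  qed
qed

lemma zspan_sum: "(\<And>i. i \<in> I \<Longrightarrow> f i \<in> zspan B) \<Longrightarrow> sum f I \<in> zspan B"
  by (induction I rule: infinite_finite_induct) (auto intro: zspan.intros)

lemma zspan_mult_closed:
  assumes "\<And>b. b \<in> B \<Longrightarrow> y * b \<in> zspan B" "x \<in> zspan B"
  shows "y * x \<in> zspan B"
  using assms(2)
proof induction
  case (add x z) then show ?case by (simp add: distrib_left zspan.add)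
next
  case (neg x) then show ?case using zspan.neg by fastforce
qed (auto intro: zspan.intros assms(1))

lemma zspan_coeffs:
  assumes "finite B" "x \<in> zspan B"
  shows "\<exists>c. x = (\<Sum>b\<in>B. of_int (c b) * b)"
  using assms(2)
proof induction
  case zero show ?case by (intro exI[of _ "\<lambda>_. 0"]) simp
next
  case (base b)
  have "(\<Sum>d\<in>B. of_int (if d = b then 1 else 0) * d) = (\<Sum>d\<in>B. if b = d then d else 0)"
    by (rule sum.cong) auto
  also have "\<dots> = b" using base assms(1) by simp
  finally show ?case by (intro exI[of _ "\<lambda>d. if d = b then 1 else 0"]) simp
next
  case (add x y)
  then obtain c d where "x = (\<Sum>b\<in>B. of_int (c b) * b)" "y = (\<Sum>b\<in>B. of_int (d b) * b)" by blast
  then show ?case by (intro exI[of _ "\<lambda>b. c b + d b"]) (simp add: sum.distrib distrib_right)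
next
  case (neg x)
  then obtain c where "x = (\<Sum>b\<in>B. of_int (c b) * b)" by blast
  then show ?case by (intro exI[of _ "\<lambda>b. - c b"]) (simp add: sum_negf)
qed

text \<open>The determinant trick: multiplication by \<open>y\<close> on a finitely generated group
  is described by an integer matrix with the generators as eigenvector.\<close>

lemma algebraic_int_zspan:
  assumes fin: "finite B" and nz: "b0 \<in> B" "b0 \<noteq> 0"
    and closed: "\<And>b. b \<in> B \<Longrightarrow> y * b \<in> zspan B"
  shows "algebraic_int y"
proof -
  obtain h where h: "bij_betw h {..<card B} B"
    using ex_bij_betw_nat_finite[OF fin] by (auto simp: lessThan_atLeast0)
  have "\<exists>c. y * b = (\<Sum>d\<in>B. of_int (c d) * d)" if "b \<in> B" for b
    using zspan_coeffs[OF fin closed[OF that]] .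
  then obtain c where c: "\<And>b. b \<in> B \<Longrightarrow> y * b = (\<Sum>d\<in>B. of_int (c b d) * d)" by metis
  obtain i0 where i0: "i0 < card B" "h i0 = b0"
  proof -
    have "b0 \<in> h ` {..<card B}" using nz(1) h by (simp add: bij_betw_def)
    then show ?thesis using that by auto
  qed
  show ?thesis
  proof (rule eigen_algebraic_int[where v = h and n = "card B" and M = "\<lambda>i j. c (h i) (h j)"])
    fix i assume "i < card B"
    then have "h i \<in> B" using h by (auto simp: bij_betw_def)
    then have "y * h i = (\<Sum>d\<in>B. of_int (c (h i) d) * d)" by (rule c)
    also have "\<dots> = (\<Sum>j<card B. of_int (c (h i) (h j)) * h j)"
      by (rule sum.reindex_bij_betw[OF h, symmetric])
    finally show "y * h i = (\<Sum>j<card B. of_int (c (h i) (h j)) * h j)" .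
  qed (use i0 nz in auto)
qed

lemma algebraic_int_power_zspan:
  fixes x :: real
  assumes "algebraic_int x"
  obtains d where "d > 0" "x ^ d \<in> zspan ((^) x ` {..<d})"
proof -
  obtain p :: "real poly" where p: "lead_coeff p = 1" "\<forall>i. coeff p i \<in> \<int>" "poly p x = 0"
    using assms by (elim algebraic_int.cases) blast
  define d where "d = degree p"
  have "d > 0"
  proof (rule ccontr)
    assume "\<not> d > 0"
    then obtain a where a: "p = [:a:]" using degree_eq_zeroE[of p] by (auto simp: d_def)
    then have "a = 1" using p(1) by simp
    then show False using p(3) a by simp
  qed
  obtain c where c: "\<And>i. coeff p i = of_int (c i)"
  proof -
    have "\<forall>i. \<exists>k. coeff p i = of_int k" using p(2) by (auto elim: Ints_cases)
    then show ?thesis using that by metis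
  qed
  have "0 = (\<Sum>i\<le>d. coeff p i * x ^ i)" using p(3) by (simp add: poly_altdef d_def)
  also have "\<dots> = (\<Sum>i<d. coeff p i * x ^ i) + x ^ d"
    using p(1) by (simp add: d_def lessThan_Suc_atMost[symmetric])
  finally have "x ^ d = (\<Sum>i<d. - (of_int (c i) * x ^ i))" by (simp add: c sum_negf)
  also have "\<dots> \<in> zspan ((^) x ` {..<d})"
    by (intro zspan_sum zspan.neg zspan_of_int_mult zspan.base imageI)
  finally show ?thesis using that \<open>d > 0\<close> by blast
qed

text \<open>The finitely many products \<open>x ^ i * y ^ j\<close> below the degrees of the two
  monic equations generate a group stable under \<open>x\<close> and \<open>y\<close>, hence under
  sum and product.\<close>

lemma
  fixes x y :: real
  assumes "algebraic_int x" "algebraic_int y"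
  shows algebraic_int_add: "algebraic_int (x + y)" and algebraic_int_mult: "algebraic_int (x * y)"
proof -
  obtain d where d: "d > 0" "x ^ d \<in> zspan ((^) x ` {..<d})"
    using algebraic_int_power_zspan[OF assms(1)] .
  obtain e where e: "e > 0" "y ^ e \<in> zspan ((^) y ` {..<e})"
    using algebraic_int_power_zspan[OF assms(2)] .
  define B where "B = {x ^ i * y ^ j | i j. i < d \<and> j < e}"
  have B: "x ^ i * y ^ j \<in> zspan B" if "i < d" "j < e" for i j
    using that by (auto simp: B_def intro!: zspan.base)
  have xB: "x * b \<in> zspan B" if "b \<in> B" for b
  proof -
    obtain i j where ij: "i < d" "j < e" "b = x ^ i * y ^ j"
      using \<open>b \<in> B\<close> by (auto simp: B_def)
    have *: "z * y ^ j \<in> zspan B" if "z \<in> zspan ((^) x ` {..<d})" for z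
      using that
      by induction (auto simp: distrib_right intro: zspan.intros B ij(2))
    show ?thesis
    proof (cases "Suc i < d")
      case True then show ?thesis using B[of "Suc i" j] ij by (simp add: mult_ac)
    next
      case False
      then have "Suc i = d" using ij by simp
      then show ?thesis using *[OF d(2)] ij by (metis mult.assoc power_Suc)
    qed
  qed
  have yB: "y * b \<in> zspan B" if "b \<in> B" for b
  proof -
    obtain i j where ij: "i < d" "j < e" "b = x ^ i * y ^ j"
      using \<open>b \<in> B\<close> by (auto simp: B_def)
    have *: "x ^ i * z \<in> zspan B" if "z \<in> zspan ((^) y ` {..<e})" for z
      using that
      by induction (auto simp: distrib_left intro: zspan.intros B ij(1))
    show ?thesis
    proof (cases "Suc j < e")
      case True then show ?thesis using B[of i "Suc j"] ij by (simp add: mult_ac)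
    next
      case False
      then have "Suc j = e" using ij by simp
      then show ?thesis using *[OF e(2)] ij by (metis mult.left_commute power_Suc)
    qed
  qed
  have fin: "finite B" unfolding B_def by (rule finite_image_set2) auto
  have one: "1 \<in> B" using d(1) e(1) by (auto simp: B_def intro!: exI[of _ 0])
  show "algebraic_int (x + y)"
    by (rule algebraic_int_zspan[OF fin one]) (auto simp: distrib_right intro: zspan.add xB yB)
  show "algebraic_int (x * y)"
    by (rule algebraic_int_zspan[OF fin one])
      (auto simp: mult.assoc intro: zspan_mult_closed[of B x, OF xB] yB)
qed


section \<open>The tower of quadratic extensions and its rings of integers\<close>

definition th :: "nat \<Rightarrow> real" where "th n = 2 * cos (pi / 2 ^ (n + 1))"

lemma th_0 [simp]: "th 0 = 0"
  by (simp add: th_def)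

lemma th_Suc_sq: "(th (Suc n))\<^sup>2 = 2 + th n"
proof -
  have "pi / 2 ^ (n + 1) = 2 * (pi / 2 ^ (Suc n + 1))" by simp
  then show ?thesis
    unfolding th_def using cos_double_cos[of "pi / 2 ^ (Suc n + 1)"]
    by (simp only: power_mult_distrib) simp
qed

lemma th_nonneg: "th n \<ge> 0"
proof -
  have "pi / 2 ^ (n + 1) \<le> pi / 2"
    using power_increasing[of 1 "n + 1" "2::real"] by (intro divide_left_mono) auto
  moreover have "0 \<le> pi / 2 ^ (n + 1)" by simp
  ultimately show ?thesis unfolding th_def by (intro mult_nonneg_nonneg cos_ge_zero) linarith+
qed

text \<open>It has two roles: a generator of the prime above 2 on level \<open>n\<close>, and the
  element whose square root \<open>th (Suc n)\<close> is adjoined to reach the next level.\<close>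

definition prm :: "nat \<Rightarrow> real" where "prm n = 2 + th n"

lemma th_sq: "th (Suc n) * th (Suc n) = prm n"
  using th_Suc_sq[of n] by (simp add: prm_def power2_eq_square)

lemma prm_pos: "prm n > 0"
  using th_nonneg[of n] by (simp add: prm_def)

lemma th_Suc_pos: "th (Suc n) > 0"
  using th_nonneg[of "Suc n"] th_sq[of n] prm_pos[of n] by (cases "th (Suc n) = 0") auto

text \<open>One construction serves twice: over the rationals it yields the fields, over the
  integers their rings of integers.\<close>

primrec tower :: "real set \<Rightarrow> nat \<Rightarrow> real set" where
  "tower S 0 = S"
| "tower S (Suc n) = {a + th (Suc n) * b | a b. a \<in> tower S n \<and> b \<in> tower S n}"

definition subring_set :: "real set \<Rightarrow> bool" where
  "subring_set S \<longleftrightarrow> 1 \<in> S \<and> (\<forall>x\<in>S. \<forall>y\<in>S. x + y \<in> S \<and> x * y \<in> S) \<and> (\<forall>x\<in>S. - x \<in> S)"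

lemma subring_setD:
  assumes "subring_set S"
  shows "1 \<in> S" "0 \<in> S" "x \<in> S \<Longrightarrow> y \<in> S \<Longrightarrow> x + y \<in> S" "x \<in> S \<Longrightarrow> y \<in> S \<Longrightarrow> x * y \<in> S"
    "x \<in> S \<Longrightarrow> - x \<in> S" "x \<in> S \<Longrightarrow> y \<in> S \<Longrightarrow> x - y \<in> S" "x \<in> S \<Longrightarrow> x ^ k \<in> S"
    "numeral q \<in> S" "of_int i \<in> S"
proof -
  show b: "1 \<in> S" "x \<in> S \<Longrightarrow> y \<in> S \<Longrightarrow> x + y \<in> S" "x \<in> S \<Longrightarrow> y \<in> S \<Longrightarrow> x * y \<in> S"
    "x \<in> S \<Longrightarrow> - x \<in> S" for x y using assms by (auto simp: subring_set_def)
  show z: "0 \<in> S" using b(2)[OF b(1) b(4)[OF b(1)]] by simp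
  show "x \<in> S \<Longrightarrow> y \<in> S \<Longrightarrow> x - y \<in> S" using b(2)[of x "- y"] b(4)[of y] by simp
  show "x \<in> S \<Longrightarrow> x ^ k \<in> S" by (induction k) (auto intro: b)
  have n: "real k \<in> S" for k by (induction k) (auto intro: b z)
  show "numeral q \<in> S" using n[of "numeral q"] by simp
  show "of_int i \<in> S" by (cases i rule: int_cases2) (auto intro: n b(4))
qed

lemma subring_set_sum:
  "subring_set S \<Longrightarrow> (\<And>i. i \<in> I \<Longrightarrow> f i \<in> S) \<Longrightarrow> sum f I \<in> S"
  by (induction I rule: infinite_finite_induct) (auto intro: subring_setD)

lemma tower_subset_Suc: "0 \<in> tower S n \<Longrightarrow> tower S n \<subseteq> tower S (Suc n)"
proof
  fix x assume "0 \<in> tower S n" "x \<in> tower S n"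
  moreover have "x = x + th (Suc n) * 0" by simp
  ultimately show "x \<in> tower S (Suc n)" unfolding tower.simps by blast
qed

lemma subring_set_tower:
  assumes "subring_set S"
  shows "subring_set (tower S n) \<and> th n \<in> tower S n"
proof (induction n)
  case 0 then show ?case using assms subring_setD by simp
next
  case (Suc n)
  note R = subring_setD[OF conjunct1[OF Suc]]
  have sub: "tower S n \<subseteq> tower S (Suc n)" by (rule tower_subset_Suc) (rule R)
  have "prm n \<in> tower S n" unfolding prm_def using Suc R by auto
  have I: "a + th (Suc n) * b \<in> tower S (Suc n)" if "a \<in> tower S n" "b \<in> tower S n" for a b
    using that by auto
  have "subring_set (tower S (Suc n))"
    unfolding subring_set_def
  proof (intro conjI ballI)
    show "1 \<in> tower S (Suc n)" using sub R(1) by blast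
    fix x assume "x \<in> tower S (Suc n)"
    then obtain a b where x: "a \<in> tower S n" "b \<in> tower S n" "x = a + th (Suc n) * b" by auto
    show "- x \<in> tower S (Suc n)" using I[of "-a" "-b"] x R(5) by simp
    fix y assume "y \<in> tower S (Suc n)"
    then obtain c d where y: "c \<in> tower S n" "d \<in> tower S n" "y = c + th (Suc n) * d" by auto
    show "x + y \<in> tower S (Suc n)"
      using I[of "a + c" "b + d"] x y R(3) by (simp add: algebra_simps)
    have "x * y = a * c + th (Suc n) * th (Suc n) * (b * d) + th (Suc n) * (a * d + b * c)"
      using x y by (simp add: algebra_simps)
    then show "x * y \<in> tower S (Suc n)"
      unfolding th_sq using I[of "a * c + prm n * (b * d)" "a * d + b * c"] x y R(3,4) \<open>prm n \<in> tower S n\<close>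
      by simp
  qed
  moreover have "th (Suc n) \<in> tower S (Suc n)" using I[of 0 1] R(1,2) by simp
  ultimately show ?case by blast
qed

abbreviation KK :: "nat \<Rightarrow> real set" where "KK \<equiv> tower \<rat>"
abbreviation RI :: "nat \<Rightarrow> real set" where "RI \<equiv> tower \<int>"

lemma subring_set_KK: "subring_set (KK n)" and subring_set_RI: "subring_set (RI n)"
  by (rule conjunct1[OF subring_set_tower], simp add: subring_set_def)+

lemmas KKI = subring_setD[OF subring_set_KK]
lemmas RII = subring_setD[OF subring_set_RI]

lemma th_in_KK: "th n \<in> KK n" and th_in_RI: "th n \<in> RI n"
  by (rule conjunct2[OF subring_set_tower], simp add: subring_set_def)+

lemma prm_in_KK: "prm n \<in> KK n" and prm_in_RI: "prm n \<in> RI n"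
  unfolding prm_def by (intro KKI th_in_KK, intro RII th_in_RI)

lemma KK_SucI: "a \<in> KK n \<Longrightarrow> b \<in> KK n \<Longrightarrow> a + th (Suc n) * b \<in> KK (Suc n)"
  and RI_SucI: "a \<in> RI n \<Longrightarrow> b \<in> RI n \<Longrightarrow> a + th (Suc n) * b \<in> RI (Suc n)"
  by auto

lemma KK_SucE:
  assumes "x \<in> KK (Suc n)"
  obtains a b where "a \<in> KK n" "b \<in> KK n" "x = a + th (Suc n) * b"
  using assms by auto

lemma RI_SucE:
  assumes "x \<in> RI (Suc n)"
  obtains a b where "a \<in> RI n" "b \<in> RI n" "x = a + th (Suc n) * b"
  using assms by auto

lemma KK_lift: "x \<in> KK n \<Longrightarrow> x \<in> KK (Suc n)" and RI_lift: "x \<in> RI n \<Longrightarrow> x \<in> RI (Suc n)"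
  using tower_subset_Suc[of \<rat> n] tower_subset_Suc[of \<int> n] KKI(2) RII(2) by blast+

lemma RI_subset_KK: "x \<in> RI n \<Longrightarrow> x \<in> KK n"
proof (induction n arbitrary: x)
  case 0 then show ?case by (auto elim: Ints_cases)
next
  case (Suc n)
  obtain a b where "a \<in> RI n" "b \<in> RI n" "x = a + th (Suc n) * b" using Suc.prems by (rule RI_SucE)
  then show ?case using Suc.IH KK_SucI by simp
qed

lemma algebraic_int_square_imp: "algebraic_int (x\<^sup>2) \<Longrightarrow> algebraic_int (x :: real)"
  by (rule algebraic_int_root[where p = "monom 1 2"]) (auto simp: poly_monom degree_monom_eq)

lemma algebraic_int_th: "algebraic_int (th n)"
proof (induction n)
  case (Suc n)
  have "algebraic_int (2 :: real)" by (rule int_imp_algebraic_int) simp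
  then have "algebraic_int (2 + th n)" using Suc by (rule algebraic_int_add)
  then have "algebraic_int ((th (Suc n))\<^sup>2)" by (simp add: th_Suc_sq)
  then show ?case by (rule algebraic_int_square_imp)
next
  case 0 show ?case unfolding th_0 by (rule algebraic_int_0)
qed

lemma RI_algebraic_int: "x \<in> RI n \<Longrightarrow> algebraic_int x"
proof (induction n arbitrary: x)
  case 0 then show ?case by (simp add: int_imp_algebraic_int)
next
  case (Suc n)
  obtain a b where "a \<in> RI n" "b \<in> RI n" "x = a + th (Suc n) * b" using Suc.prems by (rule RI_SucE)
  then show ?case
    using algebraic_int_add[OF Suc.IH[of a] algebraic_int_mult[OF algebraic_int_th Suc.IH[of b]]] by simp
qed

text \<open>The unit clause carries the induction: with t = \<open>th (Suc n)\<close> and t^2 s = 2,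
  the product (2 + t)(2 - t) s equals 2 (2s - 1), so the cofactor of the next level is s (2 - t)
  v.\<close>

lemma prm_dvd_2: "\<exists>s\<in>RI n. \<exists>v\<in>RI n. 2 = prm n * s \<and> (2 * s - 1) * v = 1"
proof (induction n)
  case 0 show ?case by (intro bexI[of _ 1]) (auto simp: prm_def)
next
  case (Suc n)
  then obtain s v where s: "s \<in> RI n" "v \<in> RI n" "2 = prm n * s" "(2 * s - 1) * v = 1" by blast
  let ?t = "th (Suc n)"
  have t: "?t \<in> RI (Suc n)" "s \<in> RI (Suc n)" "v \<in> RI (Suc n)" by (intro th_in_RI s RI_lift)+
  have e: "?t * ?t * s = 2" using s(3) by (simp add: th_sq)
  have p: "prm n = 2 + th n" "prm (Suc n) = 2 + ?t" by (simp_all add: prm_def)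
  have "prm (Suc n) * (s * (2 - ?t) * v) = (4 * s - ?t * ?t * s) * v" unfolding p by (simp add: algebra_simps power2_eq_square)
  also have "\<dots> = 2 * ((2 * s - 1) * v)" unfolding e by (simp add: algebra_simps)
  finally have "prm (Suc n) * (s * (2 - ?t) * v) = 2" using s(4) by simp
  \<comment> \<open>For the new cofactor s', t^2 s = 2 turns 2s' - 1 into (t s - 1)^2 v. Multiplied
    by (t s + 1)^2 v this becomes the square of (2s - 1) v = 1.\<close>
  moreover have "(2 * (s * (2 - ?t) * v) - 1) * ((?t * s + 1)\<^sup>2 * v) = 1"
  proof -
    have "2 * (s * (2 - ?t) * v) - 1 = (?t * ?t * s * s - 2 * ?t * s + 1) * v"
      using s(4) unfolding e by (simp add: algebra_simps)
    also have "\<dots> = (?t * s - 1)\<^sup>2 * v" by (simp add: algebra_simps power2_eq_square)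
    finally have "(2 * (s * (2 - ?t) * v) - 1) * ((?t * s + 1)\<^sup>2 * v) = ((?t * ?t * s * s - 1) * v)\<^sup>2"
      by (simp add: algebra_simps power2_eq_square)
    then show ?thesis using s(4) unfolding e by simp
  qed
  moreover have "s * (2 - ?t) * v \<in> RI (Suc n)" "(?t * s + 1)\<^sup>2 * v \<in> RI (Suc n)"
    using t by (intro RII; simp)+
  ultimately show ?case by metis
qed

lemma th_eq_prm_mult: "\<exists>u\<in>RI (Suc n). th (Suc n) = prm (Suc n) * u"
proof -
  obtain s where s: "s \<in> RI (Suc n)" "2 = prm (Suc n) * s" using prm_dvd_2 by blast
  have "th (Suc n) = prm (Suc n) * (1 - s)"
    using s(2) by (simp add: prm_def algebra_simps)
  moreover have "1 - s \<in> RI (Suc n)" by (intro RII s)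
  ultimately show ?thesis by blast
qed

text \<open>The residue field at \<open>prm n\<close> has two elements. In the step the lower
  component is reduced by induction, and what is left is divisible by \<open>th (Suc n)\<close>,
  hence by \<open>prm (Suc n)\<close>.\<close>

lemma RI_residue: "x \<in> RI n \<Longrightarrow> \<exists>r\<in>RI n. x = prm n * r \<or> x = 1 + prm n * r"
proof (induction n arbitrary: x)
  case 0
  then obtain k where k: "x = of_int k" by (auto elim: Ints_cases)
  show ?case
  proof (cases "even k")
    case True
    then obtain j where "k = 2 * j" by (elim evenE)
    then show ?thesis using k by (intro bexI[of _ "of_int j"]) (auto simp: prm_def)
  next
    case False
    then obtain j where "k = 2 * j + 1" by (elim oddE)
    then show ?thesis using k by (intro bexI[of _ "of_int j"]) (auto simp: prm_def)
  qed
next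
  case (Suc n)
  then obtain a b where ab: "a \<in> RI n" "b \<in> RI n" "x = a + th (Suc n) * b" by (elim RI_SucE)
  obtain r where r: "r \<in> RI n" "a = prm n * r \<or> a = 1 + prm n * r" using Suc.IH[OF ab(1)] by blast
  obtain u where u: "u \<in> RI (Suc n)" "th (Suc n) = prm (Suc n) * u" using th_eq_prm_mult by blast
  have m: "u * (th (Suc n) * r + b) \<in> RI (Suc n)"
    by (intro RII u th_in_RI RI_lift ab r)
  have "prm n * r + th (Suc n) * b = th (Suc n) * (th (Suc n) * r + b)"
    using th_sq[of n] by (simp add: algebra_simps)
  then have "prm n * r + th (Suc n) * b = prm (Suc n) * (u * (th (Suc n) * r + b))"
    using u(2) by simp
  then show ?case using m r(2) ab(3) by (metis add.assoc)
qed

text \<open>Since \<open>prm (Suc n)\<close> is a multiple of \<open>th (Suc n)\<close> by an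
  integral factor, an integral inverse would make 1 / \<open>th (Suc n)\<close> integral, and so its
  square 1 / \<open>prm n\<close>. At the bottom this is 1/2.\<close>

lemma not_algebraic_int_inverse_prm: "\<not> algebraic_int (1 / prm n)"
proof (induction n)
  case 0
  show ?case
  proof
    assume "algebraic_int (1 / prm 0)"
    then have "1 / prm 0 \<in> \<int>" by (rule rational_algebraic_int_is_int) (simp add: prm_def)
    then obtain k where "1 / 2 = real_of_int k" by (auto simp: prm_def elim: Ints_cases)
    then have "real_of_int (2 * k) = 1" by simp
    then have "2 * k = 1" by linarith
    then show False by presburger
  qed
next
  case (Suc n)
  show ?case
  proof
    assume 1: "algebraic_int (1 / prm (Suc n))"
    obtain s where s: "s \<in> RI n" "2 = prm n * s" using prm_dvd_2 by blast
    have "prm (Suc n) = th (Suc n) * (1 + th (Suc n) * s)"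
      using s(2) by (simp add: prm_def[of "Suc n"] distrib_left mult.assoc[symmetric] th_sq)
    then have "1 / th (Suc n) = 1 / prm (Suc n) * (1 + th (Suc n) * s)"
      using prm_pos[of "Suc n"] th_Suc_pos[of n] by (simp add: field_simps)
    moreover have "algebraic_int (1 + th (Suc n) * s)"
      by (rule RI_algebraic_int[of _ "Suc n"]) (intro RI_SucI s RII)
    ultimately have "algebraic_int (1 / th (Suc n))" using algebraic_int_mult[OF 1] by simp
    from algebraic_int_mult[OF this this] show False using Suc by (simp add: th_sq)
  qed
qed

lemma prm_not_algebraic_unit:
  assumes "algebraic_int r"
  shows "prm n * r \<noteq> 1"
proof
  assume "prm n * r = 1"
  then have "r = 1 / prm n" by (metis mult_zero_left nonzero_mult_div_cancel_left zero_neq_one)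
  then show False using assms not_algebraic_int_inverse_prm[of n] by simp
qed

lemma prm_not_unit: "r \<in> RI n \<Longrightarrow> prm n * r \<noteq> 1"
  by (rule prm_not_algebraic_unit) (rule RI_algebraic_int)

text \<open>Total ramification of 2: the square of \<open>prm (Suc n)\<close> is
  \<open>prm n\<close> times a unit, so exponents double along the tower.\<close>

lemma prm_power_eq: "\<exists>k. \<exists>u\<in>RI n. \<exists>u'\<in>RI n. u * u' = 1 \<and> prm n ^ k = 2 * u"
proof (induction n)
  case 0 show ?case by (intro exI[of _ 1] bexI[of _ 1]) (auto simp: prm_def)
next
  case (Suc n)
  then obtain k u u' where u: "u \<in> RI n" "u' \<in> RI n" "u * u' = 1" "prm n ^ k = 2 * u" by blast
  obtain s v where s: "s \<in> RI n" "v \<in> RI n" "2 = prm n * s" "(2 * s - 1) * v = 1"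
    using prm_dvd_2 by blast
  let ?t = "th (Suc n)"
  define w where "w = (1 + ?t * s)\<^sup>2"
  define w' where "w' = ((?t * s - 1) * v)\<^sup>2"
  have e: "?t * ?t * s = 2" using s(3) by (simp add: th_sq)
  have "w * w' = ((?t * ?t * s * s - 1) * v)\<^sup>2" unfolding w_def w'_def by (simp add: algebra_simps power2_eq_square)
  then have ww: "w * w' = 1" using s(4) unfolding e by simp
  have "prm (Suc n) = ?t * (1 + ?t * s)"
    using e by (simp add: prm_def[of "Suc n"] distrib_left mult.assoc[symmetric])
  then have sq: "(prm (Suc n))\<^sup>2 = prm n * w"
    by (simp add: w_def power_mult_distrib th_Suc_sq prm_def)
  have "prm (Suc n) ^ (2 * k) = 2 * (u * w ^ k)"
    by (simp add: power_mult sq power_mult_distrib u(4))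
  moreover have "(u * w ^ k) * (u' * w' ^ k) = (u * u') * (w * w') ^ k"
    by (simp add: power_mult_distrib mult_ac)
  moreover have "u * w ^ k \<in> RI (Suc n)" "u' * w' ^ k \<in> RI (Suc n)"
    unfolding w_def w'_def by (intro RII th_in_RI RI_lift u s)+
  ultimately show ?case using u(3) ww by (metis mult_1 power_one)
qed

text \<open>\<open>RI n\<close> is already maximal at 2: if the product had residue 1, the identity
  1 = \<open>prm n\<close> times an algebraic integer would follow, so one factor can be cancelled
  at a time.\<close>

lemma RI_descent:
  assumes "algebraic_int x"
  shows "prm n ^ k * x \<in> RI n \<Longrightarrow> x \<in> RI n"
proof (induction k)
  case (Suc k)
  obtain r where r: "r \<in> RI n" "prm n ^ Suc k * x = prm n * r \<or> prm n ^ Suc k * x = 1 + prm n * r"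
    using RI_residue[OF Suc.prems] by blast
  from r(2) show ?case
  proof
    assume "prm n ^ Suc k * x = prm n * r"
    then have "prm n ^ k * x = r" using prm_pos[of n] by simp
    then show ?thesis using Suc.IH r(1) by simp
  next
    assume "prm n ^ Suc k * x = 1 + prm n * r"
    then have e: "prm n * (prm n ^ k * x + - r) = 1" by (simp add: algebra_simps)
    have "algebraic_int (prm n ^ k)" by (rule RI_algebraic_int[OF RII(7)[OF prm_in_RI]])
    moreover have "algebraic_int (- r)" by (rule RI_algebraic_int[OF RII(5)[OF r(1)]])
    ultimately have "algebraic_int (prm n ^ k * x + - r)"
      using algebraic_int_add[OF algebraic_int_mult[OF _ assms]] by blast
    then show ?thesis using prm_not_algebraic_unit e by blast
  qed
qed simp

text \<open>A generator of the prime above 2 is not a square. The integrality statement is a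
  premise, so that the lemma can be used inside the induction that proves it.\<close>

lemma th_notin_KK_aux:
  assumes "\<And>x. x \<in> KK n \<Longrightarrow> algebraic_int x \<Longrightarrow> x \<in> RI n"
  shows "th (Suc n) \<notin> KK n"
proof
  assume "th (Suc n) \<in> KK n"
  then have t: "th (Suc n) \<in> RI n" using assms algebraic_int_th by blast
  obtain r where r: "r \<in> RI n" "th (Suc n) = prm n * r \<or> th (Suc n) = 1 + prm n * r"
    using RI_residue[OF t] by blast
  from r(2) show False
  proof
    assume "th (Suc n) = prm n * r"
    then have "prm n * (prm n * (r * r)) = prm n" using th_sq[of n] by (simp add: mult_ac)
    then have "prm n * (r * r) = 1" using prm_pos[of n] by simp
    then show False using prm_not_unit[of "r * r" n] RII(4)[OF r(1) r(1)] by simp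
  next
    assume "th (Suc n) = 1 + prm n * r"
    then have "prm n * (1 - 2 * r - prm n * r * r) = 1" using th_sq[of n] by (simp add: algebra_simps)
    moreover have "1 - 2 * r - prm n * r * r \<in> RI n" by (intro RII r prm_in_RI)
    ultimately show False using prm_not_unit by blast
  qed
qed

text \<open>Field property and integral closedness are proved together. Inverses come from the
  relative norm. For an integral x = a + th b the conjugate is integral too; trace and difference
  put 2a and 2 \<open>prm n\<close> b into \<open>RI n\<close>, so a power of
  \<open>prm (Suc n)\<close> times x is in the ring, and \<open>RI_descent\<close> removes
  it.\<close>

lemma KK_integers_aux:
  "(\<forall>x\<in>KK n. inverse x \<in> KK n) \<and> (\<forall>x\<in>KK n. algebraic_int x \<longrightarrow> x \<in> RI n)"
proof (induction n)
  case 0 then show ?case by (auto intro: rational_algebraic_int_is_int)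
next
  case (Suc n)
  then have inv: "\<And>x. x \<in> KK n \<Longrightarrow> inverse x \<in> KK n"
    and int: "\<And>x. x \<in> KK n \<Longrightarrow> algebraic_int x \<Longrightarrow> x \<in> RI n" by auto
  let ?t = "th (Suc n)"
  have irr: "?t \<notin> KK n" by (rule th_notin_KK_aux) (rule int)
  have indep: "a = 0 \<and> b = 0" if "a + ?t * b = 0" "a \<in> KK n" "b \<in> KK n" for a b
  proof (rule ccontr)
    assume "\<not> (a = 0 \<and> b = 0)"
    then have "b \<noteq> 0" using that by auto
    then have "?t = - a * inverse b" using that(1) by (simp add: field_simps)
    then show False using irr that KKI(4,5) inv by metis
  qed
  have "inverse x \<in> KK (Suc n)" if x: "x \<in> KK (Suc n)" for x
  proof (cases "x = 0")
    case False
    obtain a b where ab: "a \<in> KK n" "b \<in> KK n" "x = a + ?t * b" using x by (elim KK_SucE)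
    define N where "N = a * a - prm n * (b * b)"
    have N: "N \<in> KK n" unfolding N_def by (intro KKI ab prm_in_KK)
    have xx: "x * (a - ?t * b) = N" unfolding ab(3) N_def th_sq[symmetric] by (simp add: algebra_simps power2_eq_square)
    have "a - ?t * b \<noteq> 0" using indep[of a "- b"] ab KKI(5) False by auto
    then have "N \<noteq> 0" using xx False by auto
    then have "inverse x = a * inverse N + ?t * (- b * inverse N)"
      using xx False by (simp add: field_simps)
    then show ?thesis using KK_SucI[of "a * inverse N" n "- b * inverse N"] ab inv[OF N] KKI(4,5) by metis
  qed (simp add: KKI del: tower.simps)
  moreover have "x \<in> RI (Suc n)" if x: "x \<in> KK (Suc n)" and ai: "algebraic_int x" for x
  proof -
    obtain a b where ab: "a \<in> KK n" "b \<in> KK n" "x = a + ?t * b" using x by (elim KK_SucE)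
    obtain p :: "real poly" where p: "lead_coeff p = 1" "\<forall>i. coeff p i \<in> \<int>" "poly p x = 0"
      using ai by (elim algebraic_int.cases) blast
    \<comment> \<open>Values of a polynomial with integer coefficients at conjugate points are
      conjugate; so \<open>a - ?t * b\<close> is a root of the same monic polynomial.\<close>
    have "\<exists>A\<in>KK n. \<exists>B\<in>KK n. poly q x = A + ?t * B \<and> poly q (a - ?t * b) = A - ?t * B"
      if "\<forall>i. coeff q i \<in> \<int>" for q
      using that
    proof (induction q)
      case 0 then show ?case by (intro bexI[of _ 0]) (auto intro: KKI)
    next
      case (pCons c q)
      have c: "c \<in> KK n"
        using pCons.prems[THEN spec, of 0] by (auto elim!: Ints_cases intro: KKI)
      have "\<forall>i. coeff q i \<in> \<int>"
      proof
        fix i show "coeff q i \<in> \<int>" using pCons.prems[THEN spec, of "Suc i"] by simp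
      qed
      then obtain A B where AB: "A \<in> KK n" "B \<in> KK n" "poly q x = A + ?t * B"
        "poly q (a - ?t * b) = A - ?t * B" using pCons.IH by blast
      have "poly (pCons c q) x = (c + a * A + prm n * (b * B)) + ?t * (a * B + b * A)"
        unfolding poly_pCons AB(3) unfolding th_sq[symmetric] ab(3) by (simp add: algebra_simps power2_eq_square)
      moreover have "poly (pCons c q) (a - ?t * b) = (c + a * A + prm n * (b * B)) - ?t * (a * B + b * A)"
        unfolding poly_pCons AB(4) th_sq[symmetric] by (simp add: algebra_simps power2_eq_square)
      moreover have "c + a * A + prm n * (b * B) \<in> KK n" "a * B + b * A \<in> KK n"
        by (intro KKI c ab AB prm_in_KK)+
      ultimately show ?case by blast
    qed
    then obtain A B where AB: "A \<in> KK n" "B \<in> KK n" "poly p x = A + ?t * B"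
      "poly p (a - ?t * b) = A - ?t * B" using p(2) by blast
    then have "A = 0 \<and> B = 0" using indep[of A B] p(3) by simp
    then have "poly p (a - ?t * b) = 0" using AB by simp
    then have ai': "algebraic_int (a - ?t * b)" using p algebraic_int.intros by blast
    have "x + (a - ?t * b) = 2 * a" using ab by simp
    then have "algebraic_int (2 * a)" using algebraic_int_add[OF ai ai'] by metis
    then have a2: "2 * a \<in> RI n" by (rule int[OF KKI(4)[OF KKI(8) ab(1)]])
    have b2: "2 * (prm n * b) \<in> RI n"
    proof (rule int)
      have "?t * (x + - (a - ?t * b)) = 2 * (prm n * b)" unfolding ab(3) th_sq[symmetric] by (simp add: algebra_simps power2_eq_square)
      then show "algebraic_int (2 * (prm n * b))"
        using algebraic_int_mult[OF algebraic_int_th algebraic_int_add[OF ai algebraic_int_minus[OF ai']]] by metis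
      show "2 * (prm n * b) \<in> KK n" by (intro KKI prm_in_KK ab)
    qed
    have m: "prm n * (2 * a) + ?t * (2 * (prm n * b)) \<in> RI (Suc n)"
      by (rule RI_SucI[OF RII(4)[OF prm_in_RI a2] b2])
    \<comment> \<open>Up to a unit, \<open>prm (Suc n) ^ (k + 2)\<close> is 2 times
      \<open>prm n\<close>, precisely the denominator to be cleared.\<close>
    obtain k u where u: "u \<in> RI (Suc n)" "prm (Suc n) ^ k = 2 * u" using prm_power_eq[of "Suc n"] by blast
    obtain s where s: "s \<in> RI n" "2 = prm n * s" using prm_dvd_2 by blast
    have "prm (Suc n) = ?t * (1 + ?t * s)"
      using s(2) by (simp add: prm_def[of "Suc n"] distrib_left mult.assoc[symmetric] th_sq)
    then have "prm (Suc n) * prm (Suc n) = prm n * (1 + ?t * s)\<^sup>2"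
      unfolding th_sq[symmetric] by (simp add: algebra_simps power2_eq_square)
    then have "prm (Suc n) ^ (k + 2) = (2 * u) * (prm n * (1 + ?t * s)\<^sup>2)"
      using u(2) by (simp add: power_add power2_eq_square)
    then have "prm (Suc n) ^ (k + 2) * x = u * (1 + ?t * s)\<^sup>2 * (prm n * (2 * a) + ?t * (2 * (prm n * b)))"
      unfolding ab(3) by (simp add: algebra_simps power2_eq_square)
    also have "\<dots> \<in> RI (Suc n)" by (intro RII(3,4,7) RII(1) u m th_in_RI RI_lift s)
    finally show ?thesis by (rule RI_descent[OF ai])
  qed
  ultimately show ?case by blast
qed

lemma KK_inverse: "x \<in> KK n \<Longrightarrow> inverse x \<in> KK n"
  and KK_algebraic_int: "x \<in> KK n \<Longrightarrow> algebraic_int x \<Longrightarrow> x \<in> RI n"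
  using KK_integers_aux by auto

lemma th_notin_KK: "th (Suc n) \<notin> KK n"
  by (rule th_notin_KK_aux) (rule KK_algebraic_int)

lemma KK_indep:
  assumes "a + th (Suc n) * b = a' + th (Suc n) * b'" "a \<in> KK n" "b \<in> KK n" "a' \<in> KK n" "b' \<in> KK n"
  shows "a = a' \<and> b = b'"
proof (rule ccontr)
  assume *: "\<not> (a = a' \<and> b = b')"
  then have "b \<noteq> b'" using assms(1) by auto
  then have "th (Suc n) = (a' - a) * inverse (b - b')" using assms(1) by (simp add: field_simps)
  also have "\<dots> \<in> KK n" by (intro KKI KK_inverse assms)
  finally show False using th_notin_KK by blast
qed


section \<open>Identification of the fields; norm and trace do not depend on the basis\<close>

lemma field_RR: "field RR"
  by (rule field_from_type_algebra)

lemma RR_simps [simp]: "carrier RR = UNIV" "x \<otimes>\<^bsub>RR\<^esub> y = x * y" "x \<oplus>\<^bsub>RR\<^esub> y = x + y" "\<one>\<^bsub>RR\<^esub> = 1" "\<zero>\<^bsub>RR\<^esub> = 0"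
  by (simp_all add: ring_of_type_algebra_def)

lemma ring_RR: "ring RR"
proof -
  interpret field RR by (rule field_RR)
  show ?thesis by (rule ring_axioms)
qed

lemma RR_inv: "x \<noteq> 0 \<Longrightarrow> inv\<^bsub>RR\<^esub> x = inverse x" for x :: real
proof -
  interpret field RR by (rule field_RR)
  assume "x \<noteq> 0"
  then show ?thesis by (intro comm_inv_char) auto
qed

lemma RR_a_inv: "\<ominus>\<^bsub>RR\<^esub> x = - x" for x :: real
proof -
  interpret field RR by (rule field_RR)
  show ?thesis using r_neg[of x] by simp
qed

text \<open>All lower \<open>th j\<close> are obtained from \<open>th n\<close> by
  \<open>th j = th (Suc j) * th (Suc j) - 2\<close>, so the cosine generates the whole
  tower.\<close>

lemma BB_eq_KK: "BB n = KK n"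
proof
  have c: "cos (pi / 2 ^ (n + 1)) = th n * inverse 2" by (simp add: th_def)
  have cK: "cos (pi / 2 ^ (n + 1)) \<in> KK n" unfolding c by (intro KKI KK_inverse th_in_KK)
  show "BB n \<subseteq> KK n"
  proof
    fix x assume "x \<in> BB n"
    then have "x \<in> generate_field RR {cos (pi / 2 ^ (n + 1))}" by (simp add: BB_def)
    then show "x \<in> KK n"
    proof (induction rule: generate_field.induct)
      case (m_inv h) then show ?case using RR_inv[of h] KK_inverse by simp
    next
      case (incl h) then show ?case using cK by simp
    next
      case one then show ?case using KKI(1) by simp
    next
      case (a_inv h) then show ?case using KKI(5) by (simp add: RR_a_inv)
    next
      case (eng_add h k) then show ?case using KKI(3) by simp
    next
      case (eng_mult h k) then show ?case using KKI(4) by simp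
    qed
  qed
  have one_in: "1 \<in> BB n" using generate_field.one[of RR] by (simp add: BB_def)
  have add_in: "x + y \<in> BB n" if "x \<in> BB n" "y \<in> BB n" for x y
    using generate_field.eng_add[of x RR _ y] that by (simp add: BB_def)
  have mult_in: "x * y \<in> BB n" if "x \<in> BB n" "y \<in> BB n" for x y
    using generate_field.eng_mult[of x RR _ y] that by (simp add: BB_def)
  have neg_in: "- x \<in> BB n" if "x \<in> BB n" for x
    using generate_field.a_inv[of x RR] that by (simp add: BB_def RR_a_inv)
  have sub: "subring_set (BB n)" unfolding subring_set_def using one_in add_in mult_in neg_in by blast
  note S = subring_setD[OF sub]
  have inv_in: "inverse x \<in> BB n" if "x \<in> BB n" for x
  proof (cases "x = 0")
    case False
    then show ?thesis using generate_field.m_inv[of x RR] that RR_inv[of x] by (simp add: BB_def)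
  qed (use that in simp)
  have "cos (pi / 2 ^ (n + 1)) \<in> BB n" unfolding BB_def by (rule generate_field.incl) simp
  then have "th n \<in> BB n" unfolding th_def by (intro S(4) S(8))
  then have th: "th (n - k) \<in> BB n" for k
  proof (induction k)
    case (Suc k)
    show ?case
    proof (cases "n - k")
      case 0 then show ?thesis using Suc by simp
    next
      case (Suc j)
      then have j: "n - Suc k = j" by simp
      have "th j = th (Suc j) * th (Suc j) - 2" by (simp add: th_sq prm_def)
      then show ?thesis using \<open>th n \<in> BB n \<Longrightarrow> th (n - k) \<in> BB n\<close> \<open>th n \<in> BB n\<close> S(4,6,8) Suc j by metis
    qed
  qed simp
  have "KK m \<subseteq> BB n" if "m \<le> n" for m
    using that
  proof (induction m)
    case 0
    show ?case
    proof
      fix x assume "x \<in> KK 0"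
      then obtain a b where "x = real_of_int a * inverse (real_of_int b)"
        by (auto simp: divide_inverse elim: Rats_cases')
      then show "x \<in> BB n" using S(4)[OF S(9) inv_in[OF S(9)]] by metis
    qed
  next
    case (Suc m)
    have "th (Suc m) \<in> BB n" using th[of "n - Suc m"] Suc.prems by simp
    show ?case
    proof
      fix x assume "x \<in> KK (Suc m)"
      then obtain a b where "a \<in> KK m" "b \<in> KK m" "x = a + th (Suc m) * b" by (rule KK_SucE)
      then show "x \<in> BB n"
        using S(3)[OF _ S(4)[OF \<open>th (Suc m) \<in> BB n\<close>], of a b] Suc by auto
    qed
  qed
  then show "KK n \<subseteq> BB n" by blast
qed

lemma subfield_KK: "subfield (KK n) RR"
proof -
  interpret field RR by (rule field_RR)
  show ?thesis unfolding BB_eq_KK[symmetric] BB_def by (rule generate_field_is_subfield) auto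
qed

lemma combine_RR:
  "length ks = length us \<Longrightarrow> ring.combine RR ks us = (\<Sum>i<length us. ks ! i * us ! i)"
proof (induction ks us rule: list_induct2)
  case Nil
  interpret ring RR by (rule ring_RR)
  show ?case by simp
next
  case (Cons k ks u us)
  interpret ring RR by (rule ring_RR)
  show ?case using Cons by (simp add: sum.lessThan_Suc_shift del: sum.lessThan_Suc)
qed

lemma Span_RR:
  "ring.Span RR (KK m) us = {\<Sum>i<length us. c i * us ! i | c. \<forall>i<length us. c i \<in> KK m}"
proof -
  interpret field RR by (rule field_RR)
  have "Span (KK m) us = {combine ks us | ks. length ks = length us \<and> set ks \<subseteq> KK m}"
    by (rule Span_eq_combine_set_length_version[OF subfield_KK]) simp
  also have "\<dots> = {\<Sum>i<length us. c i * us ! i | c. \<forall>i<length us. c i \<in> KK m}" (is "?A = ?B")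
  proof
    show "?A \<subseteq> ?B"
    proof
      fix x assume "x \<in> ?A"
      then obtain ks where "x = combine ks us" "length ks = length us" "set ks \<subseteq> KK m" by blast
      then show "x \<in> ?B" by (auto simp: combine_RR set_conv_nth intro!: exI[of _ "(!) ks"])
    qed
    show "?B \<subseteq> ?A"
    proof
      fix x assume "x \<in> ?B"
      then obtain c where c: "x = (\<Sum>i<length us. c i * us ! i)" "\<forall>i<length us. c i \<in> KK m" by blast
      show "x \<in> ?A"
        by (rule CollectI, rule exI[of _ "map c [0..<length us]"]) (use c in \<open>auto simp: combine_RR\<close>)
    qed
  qed
  finally show ?thesis .
qed

definition lin_indep :: "real set \<Rightarrow> real list \<Rightarrow> bool" where
  "lin_indep K us \<longleftrightarrow> (\<forall>c. (\<forall>i<length us. c i \<in> K) \<longrightarrow> (\<Sum>i<length us. c i * us ! i) = 0 \<longrightarrow>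
     (\<forall>i<length us. c i = 0))"

lemma independent_RR: "ring.independent RR (KK m) us \<longleftrightarrow> lin_indep (KK m) us"
proof -
  interpret field RR by (rule field_RR)
  show ?thesis
  proof
    assume ind: "independent (KK m) us"
    show "lin_indep (KK m) us"
      unfolding lin_indep_def
    proof (intro allI impI)
      fix c i assume c: "\<forall>i<length us. c i \<in> KK m" "(\<Sum>i<length us. c i * us ! i) = 0" "i < length us"
      let ?ks = "map c [0..<length us]"
      have "set (take (length us) ?ks) \<subseteq> {\<zero>\<^bsub>RR\<^esub>}"
      proof (rule independent_imp_trivial_combine[OF subfield_KK ind])
        show "set ?ks \<subseteq> KK m" using c(1) by auto
        show "combine ?ks us = \<zero>\<^bsub>RR\<^esub>" using c(2) by (simp add: combine_RR)
      qed
      then show "c i = 0" using c(3) by (auto simp: image_subset_iff)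
    qed
  next
    assume ind: "lin_indep (KK m) us"
    show "independent (KK m) us"
    proof (rule trivial_combine_imp_independent[OF subfield_KK])
      fix ks assume ks: "set ks \<subseteq> KK m" "combine ks us = \<zero>\<^bsub>RR\<^esub>"
      define c where "c i = (if i < length ks then ks ! i else 0)" for i
      have comb: "combine ks us = (\<Sum>i<length us. c i * us ! i)" for us
        unfolding c_def
      proof (induction ks us rule: combine.induct)
        case (1 k Ks u Us)
        then show ?case by (simp add: sum.lessThan_Suc_shift del: sum.lessThan_Suc cong: if_cong)
      qed auto
      have "\<forall>i<length us. c i \<in> KK m" using ks(1) KKI(2) by (auto simp: c_def)
      moreover have "(\<Sum>i<length us. c i * us ! i) = 0" using ks(2) comb[of us] by simp
      ultimately have "\<forall>i<length us. c i = 0" using ind unfolding lin_indep_def by blast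
      then show "set (take (length us) ks) \<subseteq> {\<zero>\<^bsub>RR\<^esub>}"
        by (auto simp: c_def in_set_conv_nth split: if_splits)
    qed simp
  qed
qed

lemma basis_over_KK:
  "basis_over (KK m) L us \<longleftrightarrow> lin_indep (KK m) us \<and>
     L = {\<Sum>i<length us. c i * us ! i | c. \<forall>i<length us. c i \<in> KK m}"
  unfolding basis_over_def independent_RR Span_RR by blast

lemma lin_indepD:
  assumes "lin_indep (KK m) us" "\<And>i. i < length us \<Longrightarrow> c i \<in> KK m" "\<And>i. i < length us \<Longrightarrow> d i \<in> KK m"
    "(\<Sum>i<length us. c i * us ! i) = (\<Sum>i<length us. d i * us ! i)" "i < length us"
  shows "c i = d i"
proof -
  have "(\<Sum>i<length us. (c i - d i) * us ! i) = 0"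
    using assms(4) by (simp add: left_diff_distrib sum_subtractf)
  moreover have "\<forall>i<length us. c i - d i \<in> KK m" using assms(2,3) KKI(6) by blast
  ultimately have "\<forall>i<length us. c i - d i = 0"
    using assms(1) unfolding lin_indep_def by (elim allE[of _ "\<lambda>i. c i - d i"]) blast
  then show ?thesis using assms(5) by simp
qed

lemma KK_sum: "(\<And>i. i \<in> I \<Longrightarrow> f i \<in> KK m) \<Longrightarrow> sum f I \<in> KK m"
  by (rule subring_set_sum[OF subring_set_KK])


lemma det_2x2:
  assumes "A \<in> carrier_mat 2 2"
  shows "det A = A $$ (0, 0) * A $$ (1, 1) - A $$ (0, 1) * (A :: real mat) $$ (1, 0)"
proof -
  have "det A = (\<Sum>i<2. A $$ (i, 0) * cofactor A i 0)"
    by (rule laplace_expansion_column[OF assms]) simp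
  also have "\<dots> = A $$ (0, 0) * cofactor A 0 0 + A $$ (1, 0) * cofactor A 1 0"
    by (simp add: numeral_2_eq_2)
  also have "cofactor A 0 0 = A $$ (1, 1)"
    using assms unfolding cofactor_def by (subst det_single) (auto simp: mat_delete_def)
  also have "cofactor A 1 0 = - A $$ (0, 1)"
    using assms unfolding cofactor_def by (subst det_single) (auto simp: mat_delete_def)
  finally show ?thesis by simp
qed

lemma sum_lessThan_add: "(\<Sum>i<m + n. f i) = (\<Sum>i<m. f i) + (\<Sum>i<n. f (m + i :: nat) :: real)"
  by (induction n) (auto simp: add.assoc)

text \<open>Two bases and the matrices of multiplication by \<open>x\<close> in them; that the bases
  have equal length is proved, not assumed.\<close>

locale two_bases =
  fixes m :: nat and L :: "real set" and bs cs :: "real list" and A B :: "real mat" and x :: real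
  assumes bs: "basis_over (KK m) L bs" and cs: "basis_over (KK m) L cs"
    and A: "A \<in> carrier_mat (length bs) (length bs)" "elements_mat A \<subseteq> KK m"
      "\<And>j. j < length bs \<Longrightarrow> x * bs ! j = (\<Sum>i<length bs. A $$ (i, j) * bs ! i)"
    and B: "B \<in> carrier_mat (length cs) (length cs)" "elements_mat B \<subseteq> KK m"
      "\<And>j. j < length cs \<Longrightarrow> x * cs ! j = (\<Sum>i<length cs. B $$ (i, j) * cs ! i)"
begin

lemma change_of_basis:
  assumes "basis_over (KK m) L us" "basis_over (KK m) L vs"
  obtains P where "\<And>i j. i < length vs \<Longrightarrow> j < length us \<Longrightarrow> P i j \<in> KK m"
    "\<And>j. j < length us \<Longrightarrow> us ! j = (\<Sum>i<length vs. P i j * vs ! i)"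
proof -
  have "\<forall>j. \<exists>c. j < length us \<longrightarrow> (\<forall>i<length vs. c i \<in> KK m) \<and> us ! j = (\<Sum>i<length vs. c i * vs ! i)"
  proof
    fix j
    show "\<exists>c. j < length us \<longrightarrow> (\<forall>i<length vs. c i \<in> KK m) \<and> us ! j = (\<Sum>i<length vs. c i * vs ! i)"
    proof (cases "j < length us")
      case True
      have "us ! j = (\<Sum>i<length us. (if i = j then 1 else 0) * us ! i)"
        using True by (simp add: if_distrib[of "\<lambda>y. y * _"] cong: if_cong)
      then have "us ! j \<in> L"
        using assms(1) KKI(1,2) unfolding basis_over_KK
        by (auto intro!: exI[of _ "\<lambda>i. if i = j then 1 else 0"])
      then show ?thesis using assms(2) unfolding basis_over_KK by blast
    qed simp
  qed
  then obtain P where "\<forall>j. j < length us \<longrightarrow>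
      (\<forall>i<length vs. P j i \<in> KK m) \<and> us ! j = (\<Sum>i<length vs. P j i * vs ! i)"
    by (rule choice[THEN exE])
  then show ?thesis using that[of "\<lambda>i j. P j i"] by blast
qed

lemma product_identity:
  assumes us: "basis_over (KK m) L us"
    and P: "\<And>i j. i < length vs \<Longrightarrow> j < length us \<Longrightarrow> P i j \<in> KK m"
      "\<And>j. j < length us \<Longrightarrow> us ! j = (\<Sum>i<length vs. P i j * vs ! i)"
    and Q: "\<And>i j. i < length us \<Longrightarrow> j < length vs \<Longrightarrow> Q i j \<in> KK m"
      "\<And>j. j < length vs \<Longrightarrow> vs ! j = (\<Sum>i<length us. Q i j * us ! i)"
    and kj: "k < length us" "j < length us"
  shows "(\<Sum>i<length vs. Q k i * P i j) = (if k = j then 1 else 0)"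
proof -
  have "(\<Sum>k<length us. (\<Sum>i<length vs. Q k i * P i j) * us ! k) = us ! j"
  proof -
    have "(\<Sum>k<length us. (\<Sum>i<length vs. Q k i * P i j) * us ! k)
        = (\<Sum>i<length vs. \<Sum>k<length us. P i j * (Q k i * us ! k))"
      unfolding sum_distrib_right by (subst sum.swap) (simp add: mult_ac)
    also have "\<dots> = (\<Sum>i<length vs. P i j * vs ! i)"
      by (intro sum.cong refl) (simp add: sum_distrib_left[symmetric] Q(2)[symmetric])
    finally show ?thesis using P(2)[OF kj(2)] by simp
  qed
  also have "\<dots> = (\<Sum>k<length us. (if k = j then 1 else 0) * us ! k)"
    using kj by (simp add: if_distrib[of "\<lambda>y. y * _"] cong: if_cong)
  finally show ?thesis
    using us kj P(1) Q(1)
    by (intro lin_indepD[of m us "\<lambda>k. \<Sum>i<length vs. Q k i * P i j" "\<lambda>k. if k = j then 1 else 0" k])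
      (auto simp: basis_over_KK intro!: KK_sum KKI)
qed

lemma trace_det_eq: "(\<Sum>i<length bs. A $$ (i, i)) = (\<Sum>i<length cs. B $$ (i, i)) \<and> det A = det B"
proof -
  let ?m = "length bs" and ?n = "length cs"
  obtain P where P: "\<And>i j. i < ?n \<Longrightarrow> j < ?m \<Longrightarrow> P i j \<in> KK m"
    "\<And>j. j < ?m \<Longrightarrow> bs ! j = (\<Sum>i<?n. P i j * cs ! i)" by (rule change_of_basis[OF bs cs]) blast
  obtain Q where Q: "\<And>i j. i < ?m \<Longrightarrow> j < ?n \<Longrightarrow> Q i j \<in> KK m"
    "\<And>j. j < ?n \<Longrightarrow> cs ! j = (\<Sum>i<?m. Q i j * bs ! i)" by (rule change_of_basis[OF cs bs]) blast
  note QP = product_identity[OF bs P Q]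
  note PQ = product_identity[OF cs Q P]
  have AK: "A $$ (i, j) \<in> KK m" if "i < ?m" "j < ?m" for i j
    using elements_matI[OF A(1) that refl] A(2) by blast
  have BK: "B $$ (i, j) \<in> KK m" if "i < ?n" "j < ?n" for i j
    using elements_matI[OF B(1) that refl] B(2) by blast
  \<comment> \<open>The traces of QP and PQ agree, and both products are identity matrices; so the
    two lengths coincide.\<close>
  have "real ?m = (\<Sum>k<?m. \<Sum>i<?n. Q k i * P i k)" using QP by simp
  also have "\<dots> = (\<Sum>i<?n. \<Sum>k<?m. P i k * Q k i)" by (subst sum.swap) (simp add: mult.commute)
  also have "\<dots> = real ?n" using PQ by simp
  finally have mn: "?m = ?n" by simp
  have PA: "(\<Sum>i<?m. P k i * A $$ (i, j)) = (\<Sum>i<?n. B $$ (k, i) * P i j)" if kj: "k < ?n" "j < ?m" for k j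
  proof -
    have "(\<Sum>k<?n. (\<Sum>i<?m. P k i * A $$ (i, j)) * cs ! k) = (\<Sum>i<?m. A $$ (i, j) * (\<Sum>k<?n. P k i * cs ! k))"
      unfolding sum_distrib_right sum_distrib_left by (subst sum.swap) (simp add: mult_ac)
    also have "\<dots> = x * bs ! j" using A(3)[OF kj(2)] P(2) by simp
    also have "\<dots> = (\<Sum>i<?n. P i j * (x * cs ! i))"
      using P(2)[OF kj(2)] by (simp add: sum_distrib_left mult_ac)
    also have "\<dots> = (\<Sum>i<?n. P i j * (\<Sum>k<?n. B $$ (k, i) * cs ! k))" using B(3) by simp
    also have "\<dots> = (\<Sum>k<?n. (\<Sum>i<?n. B $$ (k, i) * P i j) * cs ! k)"
      unfolding sum_distrib_right sum_distrib_left by (subst sum.swap) (simp add: mult_ac)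
    finally show ?thesis
      using cs kj P(1) AK BK
      by (intro lin_indepD[of m cs "\<lambda>k. \<Sum>i<?m. P k i * A $$ (i, j)" "\<lambda>k. \<Sum>i<?n. B $$ (k, i) * P i j" k])
        (auto simp: basis_over_KK intro!: KK_sum KKI)
  qed
  have AQ: "A $$ (i, j) = (\<Sum>k<?n. Q i k * (\<Sum>l<?n. B $$ (k, l) * P l j))" if ij: "i < ?m" "j < ?m" for i j
  proof -
    have "(\<Sum>k<?n. Q i k * (\<Sum>l<?n. B $$ (k, l) * P l j)) = (\<Sum>k<?n. Q i k * (\<Sum>l<?m. P k l * A $$ (l, j)))"
      using PA ij by simp
    also have "\<dots> = (\<Sum>l<?m. (\<Sum>k<?n. Q i k * P k l) * A $$ (l, j))"
      unfolding sum_distrib_right sum_distrib_left by (subst sum.swap) (simp add: mult_ac)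
    also have "\<dots> = (\<Sum>l<?m. (if i = l then 1 else 0) * A $$ (l, j))" using QP ij by simp
    also have "\<dots> = A $$ (i, j)" using ij by (simp add: if_distrib[of "\<lambda>y. y * _"] cong: if_cong)
    finally show ?thesis by simp
  qed
  have "(\<Sum>i<?m. A $$ (i, i)) = (\<Sum>i<?m. \<Sum>k<?n. \<Sum>l<?n. Q i k * (B $$ (k, l) * P l i))"
    using AQ by (simp add: sum_distrib_left)
  also have "\<dots> = (\<Sum>k<?n. \<Sum>l<?n. B $$ (k, l) * (\<Sum>i<?m. P l i * Q i k))"
    unfolding sum_distrib_left
    by (subst sum.swap, rule sum.cong[OF refl], subst sum.swap) (simp add: mult_ac)
  also have "\<dots> = (\<Sum>k<?n. \<Sum>l<?n. B $$ (k, l) * (if l = k then 1 else 0))" using PQ by simp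
  also have "\<dots> = (\<Sum>k<?n. B $$ (k, k))" by (simp add: if_distrib[of "\<lambda>y. _ * y"] cong: if_cong)
  finally have tr: "(\<Sum>i<?m. A $$ (i, i)) = (\<Sum>i<?n. B $$ (i, i))" .
  let ?P = "mat ?n ?n (\<lambda>(i, j). P i j)" and ?Q = "mat ?n ?n (\<lambda>(i, j). Q i j)"
  have "A = ?Q * (B * ?P)"
    using A(1) B(1) mn AQ by (intro eq_matI) (auto simp: scalar_prod_def lessThan_atLeast0)
  then have "det A = det ?Q * (det B * det ?P)"
    using B(1) by (simp add: det_mult[of _ ?n])
  moreover have "?Q * ?P = 1\<^sub>m ?n"
    using mn QP by (intro eq_matI) (auto simp: scalar_prod_def lessThan_atLeast0)
  then have "det ?Q * det ?P = 1" by (simp add: det_mult[of _ ?n, symmetric])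
  ultimately have "det A = det B" by (simp add: mult_ac)
  then show ?thesis using tr by blast
qed

end

lemma represents_mult_unique:
  assumes "represents_mult (KK m) L x A" "represents_mult (KK m) L x B"
  shows "(\<Sum>i<dim_row A. A $$ (i, i)) = (\<Sum>i<dim_row B. B $$ (i, i)) \<and> det A = det B"
proof -
  obtain bs where b: "basis_over (KK m) L bs" "A \<in> carrier_mat (length bs) (length bs)"
    "elements_mat A \<subseteq> KK m" "\<And>j. j < length bs \<Longrightarrow> x * bs ! j = (\<Sum>i<length bs. A $$ (i, j) * bs ! i)"
    using assms(1) unfolding represents_mult_def by blast
  obtain cs where c: "basis_over (KK m) L cs" "B \<in> carrier_mat (length cs) (length cs)"
    "elements_mat B \<subseteq> KK m" "\<And>j. j < length cs \<Longrightarrow> x * cs ! j = (\<Sum>i<length cs. B $$ (i, j) * cs ! i)"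
    using assms(2) unfolding represents_mult_def by blast
  interpret two_bases m L bs cs A B x by unfold_locales (fact b c)+
  show ?thesis using trace_det_eq b(2) c(2) by simp
qed

text \<open>By uniqueness the choice made in \<open>mult_matrix\<close> is harmless: any
  representing matrix may be used.\<close>

lemma
  assumes "represents_mult (KK m) L x A"
  shows field_norm_eq: "field_norm (KK m) L x = det A"
    and field_trace_eq: "field_trace (KK m) L x = (\<Sum>i<dim_row A. A $$ (i, i))"
proof -
  have "represents_mult (KK m) L x (mult_matrix (KK m) L x)"
    unfolding mult_matrix_def by (rule someI[of _ A]) (rule assms)
  from represents_mult_unique[OF this assms]
  show "field_norm (KK m) L x = det A" "field_trace (KK m) L x = (\<Sum>i<dim_row A. A $$ (i, i))"
    by (simp_all add: field_norm_def field_trace_def Let_def)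
qed

text \<open>The matrix in the basis 1, \<open>th (Suc n)\<close> has the columns (a, b) and
  (\<open>prm n\<close> b, a).\<close>

lemma field_norm_KK:
  assumes "a \<in> KK n" "b \<in> KK n"
  shows "field_norm (KK n) (KK (Suc n)) (a + th (Suc n) * b) = a\<^sup>2 - prm n * b\<^sup>2"
proof -
  let ?t = "th (Suc n)"
  let ?A = "mat 2 2 (\<lambda>(i, j). if i = j then a else if i = 0 then prm n * b else b)"
  let ?bs = "[1, ?t]"
  have sum2: "(\<Sum>i<length ?bs. f i) = f 0 + f 1" for f :: "nat \<Rightarrow> real" by simp
  have indep: "lin_indep (KK n) ?bs"
    unfolding lin_indep_def sum2
  proof (intro allI impI)
    fix c i assume c: "\<forall>i<length ?bs. c i \<in> KK n" "c 0 * ?bs ! 0 + c 1 * ?bs ! 1 = 0" "i < length ?bs"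
    then have "c 0 \<in> KK n" "c 1 \<in> KK n" by simp_all
    moreover have "c 0 + ?t * c 1 = 0 + ?t * 0" using c(2) by (simp add: mult.commute)
    ultimately have "c 0 = 0 \<and> c 1 = 0" using KK_indep[of "c 0" n "c 1" 0 0] KKI(2) by blast
    then show "c i = 0" using c(3) by (cases i) auto
  qed
  have "KK (Suc n) = {\<Sum>i<length ?bs. c i * ?bs ! i | c. \<forall>i<length ?bs. c i \<in> KK n}" (is "_ = ?S")
  proof (rule equalityI; rule subsetI)
    fix x assume "x \<in> KK (Suc n)"
    then obtain p q where "p \<in> KK n" "q \<in> KK n" "x = p + ?t * q" by (rule KK_SucE)
    then have "x = (\<Sum>i<length ?bs. (if i = 0 then p else q) * ?bs ! i) \<and>
        (\<forall>i<length ?bs. (if i = 0 then p else q) \<in> KK n)" by (simp add: mult.commute)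
    then show "x \<in> ?S" by (intro CollectI exI[of _ "\<lambda>i. if i = 0 then p else q"])
  next
    fix x assume "x \<in> ?S"
    then obtain c where c: "x = (\<Sum>i<length ?bs. c i * ?bs ! i)" "\<forall>i<length ?bs. c i \<in> KK n" by blast
    have "x = c 0 + ?t * c 1" using c(1) by (simp add: mult.commute)
    then show "x \<in> KK (Suc n)"
      using KK_SucI[of "c 0" n "c 1"] c(2)[rule_format, of 0] c(2)[rule_format, of 1] by simp
  qed
  then have basis: "basis_over (KK n) (KK (Suc n)) ?bs" using indep unfolding basis_over_KK by blast
  have rep: "represents_mult (KK n) (KK (Suc n)) (a + ?t * b) ?A"
    unfolding represents_mult_def
  proof (intro exI[of _ ?bs] conjI basis allI impI)
    show "elements_mat ?A \<subseteq> KK n"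
      using assms KKI(4)[OF prm_in_KK assms(2)] unfolding elements_mat_def by auto
    fix j assume "j < length ?bs"
    then consider "j = 0" | "j = 1" by fastforce
    then show "(a + ?t * b) * ?bs ! j = (\<Sum>i<length ?bs. ?A $$ (i, j) * ?bs ! i)"
    proof cases
      case 1 then show ?thesis by (simp add: mult.commute)
    next
      case 2
      have "(a + ?t * b) * ?t = prm n * b + a * ?t" unfolding th_sq[symmetric] by (simp add: algebra_simps)
      then show ?thesis using 2 by simp
    qed
  qed (simp add: numeral_2_eq_2)
  show ?thesis
    unfolding field_norm_eq[OF rep] by (subst det_2x2) (auto simp: power2_eq_square)
qed


section \<open>The normalized absolute trace\<close>

text \<open>The component fixed by the relative automorphism, that is, half of the relative
  trace.\<close>

definition evp :: "nat \<Rightarrow> real \<Rightarrow> real" where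
  "evp n x = (THE a. \<exists>b. a \<in> KK n \<and> b \<in> KK n \<and> x = a + th (Suc n) * b)"

lemma evp_eq: "a \<in> KK n \<Longrightarrow> b \<in> KK n \<Longrightarrow> evp n (a + th (Suc n) * b) = a"
  unfolding evp_def using KK_indep by (intro the_equality) blast+

text \<open>The trace over the rationals, divided by the degree.\<close>

primrec TT :: "nat \<Rightarrow> real \<Rightarrow> real" where
  "TT 0 x = x"
| "TT (Suc n) x = TT n (evp n x)"

lemma TT_Suc: "a \<in> KK n \<Longrightarrow> b \<in> KK n \<Longrightarrow> TT (Suc n) (a + th (Suc n) * b) = TT n a"
  by (simp add: evp_eq)

lemma TT_lift: "a \<in> KK n \<Longrightarrow> TT (Suc n) a = TT n a"
  using TT_Suc[of a n 0] KKI(2) by simp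

lemma TT_add: "x \<in> KK n \<Longrightarrow> y \<in> KK n \<Longrightarrow> TT n (x + y) = TT n x + TT n y"
proof (induction n arbitrary: x y)
  case (Suc n)
  obtain a b where x: "a \<in> KK n" "b \<in> KK n" "x = a + th (Suc n) * b" using Suc.prems(1) by (rule KK_SucE)
  obtain c d where y: "c \<in> KK n" "d \<in> KK n" "y = c + th (Suc n) * d" using Suc.prems(2) by (rule KK_SucE)
  have "x + y = (a + c) + th (Suc n) * (b + d)" using x y by (simp add: algebra_simps)
  then have "TT (Suc n) (x + y) = TT n (a + c)" using TT_Suc[of "a + c" n "b + d"] x y KKI(3) by metis
  then show ?case using Suc.IH x y TT_Suc by metis
qed simp

lemma KK_Rats: "q \<in> \<rat> \<Longrightarrow> q \<in> KK n"
proof (induction n)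
  case (Suc n) then show ?case using KK_lift by blast
qed simp

lemma TT_scale: "x \<in> KK n \<Longrightarrow> q \<in> \<rat> \<Longrightarrow> TT n (q * x) = q * TT n x"
proof (induction n arbitrary: x)
  case (Suc n)
  have q: "q \<in> KK n" using Suc.prems(2) by (rule KK_Rats)
  obtain a b where x: "a \<in> KK n" "b \<in> KK n" "x = a + th (Suc n) * b" using Suc.prems(1) by (rule KK_SucE)
  have "q * x = q * a + th (Suc n) * (q * b)" using x by (simp add: algebra_simps)
  then have "TT (Suc n) (q * x) = TT n (q * a)" using TT_Suc[of "q * a" n "q * b"] x q KKI(4) by metis
  then show ?case using Suc x TT_Suc by metis
qed simp

text \<open>These are the products of distinct \<open>th j\<close>, not powers of one element. The
  order makes the second half \<open>th (Suc n)\<close> times the first, so that multiplication has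
  block matrices.\<close>

primrec power_basis :: "nat \<Rightarrow> real list" where
  "power_basis 0 = [1]"
| "power_basis (Suc n) = power_basis n @ map (\<lambda>b. th (Suc n) * b) (power_basis n)"

lemma length_power_basis [simp]: "length (power_basis n) = 2 ^ n"
  by (induction n) auto

lemma power_basis_nth_low: "i < 2 ^ n \<Longrightarrow> power_basis (Suc n) ! i = power_basis n ! i"
  and power_basis_nth_high: "i < 2 ^ n \<Longrightarrow> power_basis (Suc n) ! (2 ^ n + i) = th (Suc n) * power_basis n ! i"
  by (simp_all add: nth_append)

lemma sum_power_basis_Suc:
  "(\<Sum>i<2 ^ Suc n. c i * power_basis (Suc n) ! i) =
    (\<Sum>i<2 ^ n. c i * power_basis n ! i) + th (Suc n) * (\<Sum>i<2 ^ n. c (2 ^ n + i) * power_basis n ! i)"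
proof -
  have "(\<Sum>i<2 ^ n. c i * power_basis (Suc n) ! i) = (\<Sum>i<2 ^ n. c i * power_basis n ! i)"
    by (intro sum.cong refl) (simp add: power_basis_nth_low del: power_basis.simps)
  moreover have "(\<Sum>i<2 ^ n. c (2 ^ n + i) * power_basis (Suc n) ! (2 ^ n + i)) =
      th (Suc n) * (\<Sum>i<2 ^ n. c (2 ^ n + i) * power_basis n ! i)"
    unfolding sum_distrib_left
    by (intro sum.cong refl) (simp add: power_basis_nth_high del: power_basis.simps)
  moreover have "(2::nat) ^ Suc n = 2 ^ n + 2 ^ n" by simp
  ultimately show ?thesis by (simp only: sum_lessThan_add)
qed

lemma power_basis_sum_in_KK:
  "(\<And>i. i < 2 ^ n \<Longrightarrow> c i \<in> \<rat>) \<Longrightarrow> (\<Sum>i<2 ^ n. c i * power_basis n ! i) \<in> KK n"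
proof (induction n arbitrary: c)
  case (Suc n)
  show ?case unfolding sum_power_basis_Suc
    by (intro KK_SucI Suc.IH Suc.prems) (simp_all add: trans_less_add2)
qed simp

lemma basis_power_basis: "basis_over (KK 0) (KK n) (power_basis n)"
proof -
  have "lin_indep (KK 0) (power_basis n) \<and> (\<forall>x\<in>KK n. \<exists>c. (\<forall>i<2 ^ n. c i \<in> \<rat>) \<and> x = (\<Sum>i<2 ^ n. c i * power_basis n ! i))"
  proof (induction n)
    case 0
    have "lin_indep (KK 0) (power_basis 0)" unfolding lin_indep_def by simp
    moreover have "\<exists>c. (\<forall>i<2 ^ 0. c i \<in> \<rat>) \<and> x = (\<Sum>i<2 ^ 0. c i * power_basis 0 ! i)"
      if "x \<in> KK 0" for x using that by (intro exI[of _ "\<lambda>_. x"]) simp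
    ultimately show ?case by blast
  next
    case (Suc n)
    have "lin_indep (KK 0) (power_basis (Suc n))"
      unfolding lin_indep_def length_power_basis
    proof (intro allI impI)
      fix c i assume c: "\<forall>i<2 ^ Suc n. c i \<in> KK 0" "(\<Sum>i<2 ^ Suc n. c i * power_basis (Suc n) ! i) = 0"
        "i < (2 :: nat) ^ Suc n"
      let ?a = "\<Sum>i<2 ^ n. c i * power_basis n ! i" and ?b = "\<Sum>i<2 ^ n. c (2 ^ n + i) * power_basis n ! i"
      have "?a \<in> KK n" "?b \<in> KK n" by (rule power_basis_sum_in_KK, use c(1) in simp)+
      moreover have "?a + th (Suc n) * ?b = 0 + th (Suc n) * 0" using c(2) unfolding sum_power_basis_Suc by simp
      ultimately have ab: "?a = 0" "?b = 0" using KK_indep[of ?a n ?b 0 0] KKI(2) by blast+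
      have *: "\<forall>i<2 ^ n. d i = 0" if "(\<Sum>i<2 ^ n. d i * power_basis n ! i) = 0" "\<forall>i<2 ^ n. d i \<in> KK 0" for d
        using Suc conjunct1 that unfolding lin_indep_def length_power_basis by blast
      have "\<forall>i<2 ^ n. c i = 0" "\<forall>i<2 ^ n. c (2 ^ n + i) = 0"
        using *[OF ab(1)] *[OF ab(2)] c(1) by simp_all
      then show "c i = 0"
        using c(3) by (cases "i < 2 ^ n") (auto dest!: spec[of _ "i - 2 ^ n"])
    qed
    moreover have "\<exists>c. (\<forall>i<2 ^ Suc n. c i \<in> \<rat>) \<and> x = (\<Sum>i<2 ^ Suc n. c i * power_basis (Suc n) ! i)"
      if x: "x \<in> KK (Suc n)" for x
    proof -
      obtain a b where ab: "a \<in> KK n" "b \<in> KK n" "x = a + th (Suc n) * b" using x by (rule KK_SucE)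
      obtain c where c: "\<forall>i<2 ^ n. c i \<in> \<rat>" "a = (\<Sum>i<2 ^ n. c i * power_basis n ! i)" using Suc ab(1) by blast
      obtain d where d: "\<forall>i<2 ^ n. d i \<in> \<rat>" "b = (\<Sum>i<2 ^ n. d i * power_basis n ! i)" using Suc ab(2) by blast
      define e where "e i = (if i < 2 ^ n then c i else d (i - 2 ^ n))" for i
      have "x = (\<Sum>i<2 ^ Suc n. e i * power_basis (Suc n) ! i)"
        unfolding sum_power_basis_Suc ab(3) c(2) d(2) e_def by simp
      moreover have "\<forall>i<2 ^ Suc n. e i \<in> \<rat>" using c(1) d(1) by (auto simp: e_def)
      ultimately show ?thesis by blast
    qed
    ultimately show ?case by blast
  qed
  then have ind: "lin_indep (KK 0) (power_basis n)"
    and sp: "\<And>x. x \<in> KK n \<Longrightarrow> \<exists>c. (\<forall>i<2 ^ n. c i \<in> \<rat>) \<and> x = (\<Sum>i<2 ^ n. c i * power_basis n ! i)" by blast+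
  have "KK n = {\<Sum>i<length (power_basis n). c i * power_basis n ! i | c. \<forall>i<length (power_basis n). c i \<in> KK 0}"
  proof (rule equalityI; rule subsetI)
    fix x assume "x \<in> KK n"
    then show "x \<in> {\<Sum>i<length (power_basis n). c i * power_basis n ! i | c. \<forall>i<length (power_basis n). c i \<in> KK 0}"
      using sp[of x] by auto
  next
    fix x assume "x \<in> {\<Sum>i<length (power_basis n). c i * power_basis n ! i | c. \<forall>i<length (power_basis n). c i \<in> KK 0}"
    then show "x \<in> KK n" using power_basis_sum_in_KK by auto
  qed
  then show ?thesis using ind unfolding basis_over_KK by blast
qed

text \<open>Multiplication by a + th b has a block matrix with the matrix of a in both diagonal
  blocks, that of b below and that of \<open>prm n * b\<close> above; its trace is twice that of a,
  while b does not enter.\<close>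

lemma power_basis_matrix:
  "x \<in> KK n \<Longrightarrow> \<exists>A. (\<forall>i<2 ^ n. \<forall>j<2 ^ n. A i j \<in> \<rat>) \<and>
    (\<forall>j<2 ^ n. x * power_basis n ! j = (\<Sum>i<2 ^ n. A i j * power_basis n ! i)) \<and>
    (\<Sum>i<2 ^ n. A i i) = 2 ^ n * TT n x"
proof (induction n arbitrary: x)
  case 0 then show ?case by (intro exI[of _ "\<lambda>_ _. x"]) simp
next
  case (Suc n)
  let ?N = "2 ^ n :: nat"
  obtain a b where ab: "a \<in> KK n" "b \<in> KK n" "x = a + th (Suc n) * b" using Suc.prems by (rule KK_SucE)
  obtain A where A: "\<forall>i<?N. \<forall>j<?N. A i j \<in> \<rat>"
    "\<forall>j<?N. a * power_basis n ! j = (\<Sum>i<?N. A i j * power_basis n ! i)"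
    "(\<Sum>i<?N. A i i) = 2 ^ n * TT n a" using Suc.IH[OF ab(1)] by blast
  obtain B where B: "\<forall>i<?N. \<forall>j<?N. B i j \<in> \<rat>"
    "\<forall>j<?N. b * power_basis n ! j = (\<Sum>i<?N. B i j * power_basis n ! i)" using Suc.IH[OF ab(2)] by blast
  obtain C where C: "\<forall>i<?N. \<forall>j<?N. C i j \<in> \<rat>"
    "\<forall>j<?N. (prm n * b) * power_basis n ! j = (\<Sum>i<?N. C i j * power_basis n ! i)"
    using Suc.IH[OF KKI(4)[OF prm_in_KK ab(2)]] by blast
  define D where "D i j = (if j < ?N then (if i < ?N then A i j else B (i - ?N) j)
    else (if i < ?N then C i (j - ?N) else A (i - ?N) (j - ?N)))" for i j
  have "\<forall>i<2 ^ Suc n. \<forall>j<2 ^ Suc n. D i j \<in> \<rat>" using A(1) B(1) C(1) by (auto simp: D_def)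
  moreover have "\<forall>j<2 ^ Suc n. x * power_basis (Suc n) ! j = (\<Sum>i<2 ^ Suc n. D i j * power_basis (Suc n) ! i)"
  proof (intro allI impI)
    fix j :: nat assume j: "j < 2 ^ Suc n"
    show "x * power_basis (Suc n) ! j = (\<Sum>i<2 ^ Suc n. D i j * power_basis (Suc n) ! i)"
    proof (cases "j < ?N")
      case True
      have "x * power_basis n ! j = a * power_basis n ! j + th (Suc n) * (b * power_basis n ! j)"
        by (simp add: ab(3) algebra_simps)
      then show ?thesis
        unfolding sum_power_basis_Suc using True A(2) B(2)
        by (simp add: D_def power_basis_nth_low del: power_basis.simps)
    next
      case False
      then obtain k where k: "j = ?N + k" "k < ?N" using j by (auto dest!: le_Suc_ex simp: not_less)
      have "x * (th (Suc n) * power_basis n ! k) = (prm n * b) * power_basis n ! k + th (Suc n) * (a * power_basis n ! k)"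
        unfolding th_sq[symmetric] by (simp add: ab(3) algebra_simps)
      then show ?thesis
        unfolding sum_power_basis_Suc using k A(2) C(2)
        by (simp add: D_def power_basis_nth_high del: power_basis.simps)
    qed
  qed
  moreover have "(\<Sum>i<2 ^ Suc n. D i i) = 2 ^ Suc n * TT (Suc n) x"
  proof -
    have "(2::nat) ^ Suc n = ?N + ?N" by simp
    then have "(\<Sum>i<2 ^ Suc n. D i i) = (\<Sum>i<?N. D i i) + (\<Sum>i<?N. D (?N + i) (?N + i))"
      by (simp only: sum_lessThan_add)
    also have "\<dots> = 2 * (\<Sum>i<?N. A i i)" by (simp add: D_def)
    finally show ?thesis using A(3) TT_Suc[OF ab(1,2)] ab(3) by simp
  qed
  ultimately show ?case by blast
qed

lemma field_trace_KK:
  assumes "x \<in> KK n"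
  shows "field_trace \<rat> (KK n) x = 2 ^ n * TT n x"
proof -
  obtain A where A: "\<forall>i<2 ^ n. \<forall>j<2 ^ n. A i j \<in> \<rat>"
    "\<forall>j<2 ^ n. x * power_basis n ! j = (\<Sum>i<2 ^ n. A i j * power_basis n ! i)"
    "(\<Sum>i<2 ^ n. A i i) = 2 ^ n * TT n x" using power_basis_matrix[OF assms] by blast
  let ?A = "mat (2 ^ n) (2 ^ n) (\<lambda>(i, j). A i j)"
  have rep: "represents_mult (KK 0) (KK n) x ?A"
    unfolding represents_mult_def
  proof (intro exI[of _ "power_basis n"] conjI basis_power_basis)
    show "elements_mat ?A \<subseteq> KK 0" using A(1) by (auto simp: elements_mat_def)
    show "\<forall>j<length (power_basis n). x * power_basis n ! j = (\<Sum>i<length (power_basis n). ?A $$ (i, j) * power_basis n ! i)"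
      using A(2) by simp
  qed simp
  show ?thesis using field_trace_eq[OF rep] A(3) by simp
qed


section \<open>Coefficient sequences of real cyclotomic integers\<close>

text \<open>k -> u k + a permutes the residues modulo \<open>N\<close>. This covers shifts,
  reflections and the Galois action at once.\<close>

lemma sum_periodic_affine:
  fixes g :: "int \<Rightarrow> 'a :: comm_monoid_add"
  assumes "N > 0" "\<And>k. g (k + N) = g k" "coprime u N"
  shows "(\<Sum>k\<in>{0..<N}. g (u * k + a)) = (\<Sum>k\<in>{0..<N}. g k)"
proof -
  have per: "g (k mod N) = g k" for k
  proof -
    have nat: "g (x + int i * N) = g x" for x i
    proof (induction i)
      case (Suc i)
      have "x + int (Suc i) * N = (x + int i * N) + N" by (simp add: algebra_simps)
      then show ?case using Suc assms(2) by metis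
    qed simp
    have int: "g (x + i * N) = g x" for x i
    proof (cases i rule: int_cases2)
      case (nonneg n) then show ?thesis using nat by simp
    next
      case (nonpos n)
      then show ?thesis using nat[of "x + i * N" n] by simp
    qed
    show ?thesis using int[of "k mod N" "k div N"] by simp
  qed
  let ?p = "\<lambda>k. (u * k + a) mod N"
  have inj: "inj_on ?p {0..<N}"
  proof (rule inj_onI)
    fix k l assume kl: "k \<in> {0..<N}" "l \<in> {0..<N}" "?p k = ?p l"
    then have "N dvd (u * k + a) - (u * l + a)" by (simp add: mod_eq_dvd_iff)
    then have "N dvd u * (k - l)" by (simp add: algebra_simps)
    then have "N dvd k - l" using assms(3) by (simp add: coprime_commute coprime_dvd_mult_right_iff)
    then have "k mod N = l mod N" by (simp add: mod_eq_dvd_iff)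
    then show "k = l" using kl by simp
  qed
  have "?p ` {0..<N} \<subseteq> {0..<N}" using assms(1) by auto
  then have "?p ` {0..<N} = {0..<N}" using inj by (intro endo_inj_surj) auto
  then have "(\<Sum>k\<in>{0..<N}. g k) = (\<Sum>k\<in>{0..<N}. g (?p k))"
    using sum.reindex[OF inj, of g] by (simp add: o_def)
  then show ?thesis using per by simp
qed

lemma sum_periodic_shift:
  fixes g :: "int \<Rightarrow> 'a :: comm_monoid_add"
  assumes "N > 0" "\<And>k. g (k + N) = g k"
  shows "(\<Sum>k\<in>{0..<N}. g (k + a)) = (\<Sum>k\<in>{0..<N}. g k)"
  using sum_periodic_affine[of N g 1 a, OF assms] by simp

lemma sum_periodic_reflect:
  fixes g :: "int \<Rightarrow> 'a :: comm_monoid_add"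
  assumes "N > 0" "\<And>k. g (k + N) = g k"
  shows "(\<Sum>k\<in>{0..<N}. g (a - k)) = (\<Sum>k\<in>{0..<N}. g k)"
  using sum_periodic_affine[of N g "- 1" a, OF assms] by simp

text \<open>The coefficient sequence of \<open>\<Sum>k. V k * \<zeta> ^ k\<close>, with \<open>\<zeta> = exp (i \<pi> / N)\<close> and \<open>k\<close> ranging over a
  period, for a real element of \<open>\<int>[\<zeta>]\<close>.\<close>

definition aseq :: "int \<Rightarrow> (int \<Rightarrow> int) \<Rightarrow> bool" where
  "aseq N V \<longleftrightarrow> (\<forall>k. V (k + N) = - V k) \<and> (\<forall>k. V (- k) = V k)"

text \<open>The coefficients of a product. The signs of both factors cancel, so the summand has
  period \<open>N\<close> in \<open>k\<close>, and any \<open>N\<close> consecutive indices may be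
  used.\<close>

definition conv :: "int \<Rightarrow> (int \<Rightarrow> int) \<Rightarrow> (int \<Rightarrow> int) \<Rightarrow> int \<Rightarrow> int" where
  "conv N V Y j = (\<Sum>k\<in>{0..<N}. V k * Y (j - k))"

lemma aseqD:
  assumes "aseq N V"
  shows "V (k + N) = - V k" "V (- k) = V k" "V (k - N) = - V k" "V (N - k) = - V k"
    "V (k + 2 * N) = V k" "V (k - 2 * N) = V k"
proof -
  show a: "V (k + N) = - V k" "V (- k) = V k" for k using assms by (auto simp: aseq_def)
  show b: "V (k - N) = - V k" for k using a(1)[of "k - N"] by simp
  show "V (N - k) = - V k" using a(1)[of "- k"] a(2)[of k] by (simp add: add.commute)
  have e: "k + 2 * N = (k + N) + N" "k - 2 * N = (k - N) - N" by simp_all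
  show "V (k + 2 * N) = V k" "V (k - 2 * N) = V k" unfolding e a b by simp_all
qed

lemma aseq_periodic:
  assumes "aseq N V"
  shows "V (j + i * (2 * N)) = V j"
proof (induction i rule: int_induct[where k = 0])
  case base show ?case by simp
next
  case (step1 i)
  have e: "j + (i + 1) * (2 * N) = (j + i * (2 * N)) + 2 * N" by (simp add: algebra_simps)
  show ?case unfolding e aseqD(5)[OF assms] by (rule step1(2))
next
  case (step2 i)
  have e: "j + (i - 1) * (2 * N) = (j + i * (2 * N)) - 2 * N" by (simp add: algebra_simps)
  show ?case unfolding e aseqD(6)[OF assms] by (rule step2(2))
qed

lemma conv_term_periodic:
  assumes "aseq N V" "aseq N Y"
  shows "V (k + N) * Y (j - (k + N)) = V k * Y (j - k)"
  using aseqD(1)[OF assms(1), of k] aseqD(3)[OF assms(2), of "j - k"] by (simp add: algebra_simps)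

lemma aseq_conv:
  assumes "N > 0" "aseq N V" "aseq N Y"
  shows "aseq N (conv N V Y)"
  unfolding aseq_def conv_def
proof (intro conjI allI)
  fix j
  have "Y (j + N - k) = - Y (j - k)" for k using aseqD(1)[OF assms(3), of "j - k"] by (simp add: algebra_simps)
  then show "(\<Sum>k\<in>{0..<N}. V k * Y (j + N - k)) = - (\<Sum>k\<in>{0..<N}. V k * Y (j - k))"
    by (simp add: sum_negf)
  have "V k * Y (- j - k) = V (0 - k) * Y (j - (0 - k))" for k
    using aseqD(2)[OF assms(2), of k] aseqD(2)[OF assms(3), of "j + k"] by (simp add: algebra_simps)
  then have "(\<Sum>k\<in>{0..<N}. V k * Y (- j - k)) = (\<Sum>k\<in>{0..<N}. V (0 - k) * Y (j - (0 - k)))" by simp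
  also have "\<dots> = (\<Sum>k\<in>{0..<N}. V k * Y (j - k))"
    by (rule sum_periodic_reflect[of N "\<lambda>k. V k * Y (j - k)" 0]) (use assms conv_term_periodic in auto)
  finally show "(\<Sum>k\<in>{0..<N}. V k * Y (- j - k)) = (\<Sum>k\<in>{0..<N}. V k * Y (j - k))" .
qed

lemma conv_commute:
  assumes "N > 0" "aseq N V" "aseq N Y"
  shows "conv N V Y j = conv N Y V j"
proof -
  have "conv N V Y j = (\<Sum>k\<in>{0..<N}. V (j - k) * Y (j - (j - k)))"
    unfolding conv_def
    by (rule sum_periodic_reflect[of N "\<lambda>k. V k * Y (j - k)" j, symmetric]) (use assms conv_term_periodic in auto)
  then show ?thesis by (simp add: conv_def mult.commute)
qed

lemma conv_shift:
  assumes "N > 0" "aseq N V" "aseq N Y"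
  shows "conv N (\<lambda>k. V (k + a)) Y j = conv N V Y (j + a)"
proof -
  have "conv N V Y (j + a) = (\<Sum>k\<in>{0..<N}. V (k + a) * Y (j + a - (k + a)))"
    unfolding conv_def
    by (rule sum_periodic_shift[of N "\<lambda>k. V k * Y (j + a - k)" a, symmetric]) (use assms conv_term_periodic in auto)
  then show ?thesis by (simp add: conv_def)
qed

lemma aseq_add: "aseq N V \<Longrightarrow> aseq N Y \<Longrightarrow> aseq N (\<lambda>k. V k + Y k)"
  and aseq_diff: "aseq N V \<Longrightarrow> aseq N Y \<Longrightarrow> aseq N (\<lambda>k. V k - Y k)"
  and aseq_uminus: "aseq N V \<Longrightarrow> aseq N (\<lambda>k. - V k)"
  by (simp_all add: aseq_def)

text \<open>The real element with coefficients \<open>V\<close>; the sine parts of the powers of the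
  root of unity cancel because \<open>V\<close> is even.\<close>

definition val :: "int \<Rightarrow> (int \<Rightarrow> int) \<Rightarrow> real" where
  "val N V = (\<Sum>k\<in>{0..<N}. of_int (V k) * cos (of_int k * pi / of_int N))"

lemma cos_shift_N: "N > 0 \<Longrightarrow> cos (of_int (k + N) * pi / of_int N) = - cos (of_int k * pi / real_of_int N)"
  and sin_shift_N: "N > 0 \<Longrightarrow> sin (of_int (k + N) * pi / of_int N) = - sin (of_int k * pi / real_of_int N)"
proof -
  assume "N > 0"
  then have "of_int (k + N) * pi / of_int N = of_int k * pi / real_of_int N + pi"
    by (simp add: add_divide_distrib distrib_right)
  then show "cos (of_int (k + N) * pi / of_int N) = - cos (of_int k * pi / real_of_int N)"
    "sin (of_int (k + N) * pi / of_int N) = - sin (of_int k * pi / real_of_int N)" by simp_all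
qed

text \<open>The addition theorem for the cosine; the sine sum of \<open>Y\<close> vanishes, being
  its own negative under reflection.\<close>

lemma val_conv:
  assumes N: "N > 0" and V: "aseq N V" and Y: "aseq N Y"
  shows "val N (conv N V Y) = val N V * val N Y"
proof -
  define c where "c k = cos (of_int k * pi / real_of_int N)" for k
  define s where "s k = sin (of_int k * pi / real_of_int N)" for k
  have cs: "c (k + N) = - c k" "s (k + N) = - s k" for k
    using cos_shift_N[OF N] sin_shift_N[OF N] by (simp_all add: c_def s_def)
  have add: "c (k + j) = c k * c j - s k * s j" for k j
    by (simp add: c_def s_def cos_add[symmetric] add_divide_distrib distrib_right)
  have "(\<Sum>k\<in>{0..<N}. of_int (Y k) * s k) = (\<Sum>k\<in>{0..<N}. of_int (Y (0 - k)) * s (0 - k))"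
    by (rule sum_periodic_reflect[of N "\<lambda>k. of_int (Y k) * s k" 0, symmetric])
      (use N aseqD(1)[OF Y] cs in auto)
  also have "\<dots> = - (\<Sum>k\<in>{0..<N}. of_int (Y k) * s k)"
    using aseqD(2)[OF Y] by (simp add: s_def sum_negf)
  finally have s0: "(\<Sum>k\<in>{0..<N}. of_int (Y k) * s k) = 0" by simp
  have inner: "(\<Sum>j\<in>{0..<N}. of_int (Y (j - k)) * c j) = c k * val N Y" for k
  proof -
    have "(\<Sum>j\<in>{0..<N}. of_int (Y (j - k)) * c j) = (\<Sum>j\<in>{0..<N}. of_int (Y (j + k - k)) * c (j + k))"
    proof (rule sum_periodic_shift[of N "\<lambda>j. of_int (Y (j - k)) * c j" k, symmetric])
      fix j
      have "Y (j + N - k) = - Y (j - k)" using aseqD(1)[OF Y, of "j - k"] by (simp add: algebra_simps)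
      then show "of_int (Y (j + N - k)) * c (j + N) = of_int (Y (j - k)) * c j" using cs by simp
    qed (rule N)
    also have "\<dots> = c k * (\<Sum>j\<in>{0..<N}. of_int (Y j) * c j) - s k * (\<Sum>j\<in>{0..<N}. of_int (Y j) * s j)"
      by (simp add: add sum_distrib_left sum_subtractf algebra_simps)
    finally show ?thesis unfolding s0 val_def c_def by simp
  qed
  have "val N (conv N V Y) = (\<Sum>j\<in>{0..<N}. \<Sum>k\<in>{0..<N}. of_int (V k) * (of_int (Y (j - k)) * c j))"
    unfolding val_def conv_def c_def[symmetric] by (simp add: sum_distrib_right mult.assoc)
  also have "\<dots> = (\<Sum>k\<in>{0..<N}. of_int (V k) * (\<Sum>j\<in>{0..<N}. of_int (Y (j - k)) * c j))"
    by (subst sum.swap) (simp add: sum_distrib_left)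
  also have "\<dots> = (\<Sum>k\<in>{0..<N}. of_int (V k) * c k) * val N Y"
    unfolding inner by (simp add: sum_distrib_right mult.assoc)
  finally show ?thesis by (simp add: val_def c_def)
qed

lemma val_add: "val N (\<lambda>k. V k + Y k) = val N V + val N Y"
  by (simp add: val_def sum.distrib distrib_right)

lemma val_diff: "val N (\<lambda>k. V k - Y k) = val N V - val N Y"
  by (simp add: val_def sum_subtractf left_diff_distrib)

definition tc :: "nat \<Rightarrow> nat \<Rightarrow> real" where
  "tc n k = 2 * cos (real k * pi / 2 ^ (n + 1))"

lemma tc_even: "tc (Suc n) (2 * k) = tc n k"
  by (simp add: tc_def mult_ac)

lemma tc_rec: "tc n (k + 2) = th n * tc n (k + 1) - tc n k"
proof -
  define x where "x = pi / 2 ^ (n + 1)"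
  have c: "tc n k = 2 * cos (real k * x)" "th n = 2 * cos x" for k by (simp_all add: tc_def th_def x_def)
  have 1: "real (k + 2) * x = real (k + 1) * x + x" "real k * x = real (k + 1) * x - x"
    by (simp_all add: algebra_simps)
  show ?thesis unfolding c 1 cos_add cos_diff by (simp add: algebra_simps)
qed

text \<open>Both parts follow from the Chebyshev recurrence. Odd multiples of the angle give
  elements that are odd under the relative automorphism, which is why they have no even
  part.\<close>

lemma tc_in_RI: "tc n k \<in> RI n \<and> (\<exists>q\<in>RI n. tc (Suc n) (2 * k + 1) = th (Suc n) * q)"
proof -
  have a: "tc n k \<in> RI n \<and> tc n (k + 1) \<in> RI n" for k
  proof (induction k)
    case 0
    have "tc n 0 = 2" "tc n (0 + 1) = th n" by (simp_all add: tc_def th_def)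
    then show ?case using RII(8) th_in_RI by simp
  next
    case (Suc k)
    then show ?case using tc_rec[of n k] RII(4,6) th_in_RI by simp
  qed
  have "\<exists>q\<in>RI n. tc (Suc n) (2 * k + 1) = th (Suc n) * q"
  proof (induction k)
    case 0
    have "tc (Suc n) (2 * 0 + 1) = th (Suc n) * 1" by (simp add: tc_def th_def)
    then show ?case using RII(1) by blast
  next
    case (Suc k)
    then obtain q where q: "q \<in> RI n" "tc (Suc n) (2 * k + 1) = th (Suc n) * q" by blast
    have "tc (Suc n) (2 * Suc k + 1) = th (Suc n) * tc (Suc n) (2 * (k + 1)) - tc (Suc n) (2 * k + 1)"
      using tc_rec[of "Suc n" "2 * k + 1"] by simp
    also have "\<dots> = th (Suc n) * (tc n (k + 1) - q)"
      unfolding tc_even q(2) by (simp add: right_diff_distrib)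
    finally show ?case using RII(6)[of "tc n (k + 1)" n q] a q(1) by blast
  qed
  then show ?thesis using a by blast
qed

lemma tc_in_KK: "tc n k \<in> KK n \<and> (\<exists>q\<in>KK n. tc (Suc n) (2 * k + 1) = th (Suc n) * q)"
  using tc_in_RI[of n k] RI_subset_KK by blast

text \<open>An even \<open>k\<close> belongs to the level below with half the index; an odd
  \<open>k\<close> has relative trace 0. So the trace vanishes unless \<open>k\<close> is 0.\<close>

lemma TT_tc: "k < 2 ^ (n + 1) \<Longrightarrow> TT n (tc n k) = (if k = 0 then 2 else 0)"
proof (induction n arbitrary: k)
  case 0
  then have "k = 0 \<or> k = 1" by auto
  then show ?case by (auto simp: tc_def)
next
  case (Suc n)
  show ?case
  proof (cases "even k")
    case True
    then obtain j where j: "k = 2 * j" by (elim evenE)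
    then have "TT (Suc n) (tc (Suc n) k) = TT n (tc n j)"
      unfolding j tc_even using TT_lift tc_in_KK by blast
    then show ?thesis using Suc j by simp
  next
    case False
    then obtain j where j: "k = 2 * j + 1" by (elim oddE)
    obtain q where q: "q \<in> KK n" "tc (Suc n) k = th (Suc n) * q" using tc_in_KK[of n j] j by blast
    have "TT (Suc n) (0 + th (Suc n) * q) = TT n 0" by (rule TT_Suc[OF KKI(2) q(1)])
    moreover have "TT n 0 = 0" using TT_scale[of 0 n 0] KKI(2) by simp
    ultimately show ?thesis using q(2) j by simp
  qed
qed

lemma val_eq_tc: "val (2 ^ (n + 1)) V = (\<Sum>k<2 ^ (n + 1). (of_int (V (int k)) / 2) * tc n k)"
proof -
  have "bij_betw int {..<2 ^ (n + 1)} {0..<2 ^ (n + 1)}"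
    using bij_betw_imageI[of int "{..<2 ^ (n + 1)}"] image_int_atLeastLessThan[of 0 "2 ^ (n + 1)"]
    by (simp add: lessThan_atLeast0)
  from sum.reindex_bij_betw[OF this, of "\<lambda>k. of_int (V k) * cos (of_int k * pi / 2 ^ (n + 1))"]
  show ?thesis unfolding val_def tc_def by simp
qed

lemma TT_sum: "(\<And>i. i \<in> I \<Longrightarrow> f i \<in> KK n) \<Longrightarrow> TT n (sum f I) = (\<Sum>i\<in>I. TT n (f i))"
proof (induction I rule: infinite_finite_induct)
  case (insert i I)
  then show ?case using TT_add[of "f i" n "sum f I"] KK_sum[of I f n] by simp
qed (use TT_scale[of 0 n 0] KKI(2) in simp_all)

text \<open>Thus the normalized trace reads off the constant coefficient, and the trace of a square
  becomes a sum of squares.\<close>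

lemma val_in_KK: "val (2 ^ (n + 1)) V \<in> KK n"
  and TT_val: "TT n (val (2 ^ (n + 1)) V) = of_int (V 0)"
proof -
  have r: "of_int x / 2 \<in> \<rat>" for x :: int by simp
  have t: "(of_int (V (int k)) / 2) * tc n k \<in> KK n" for k
    by (rule KKI(4)[OF KK_Rats[OF r]]) (use tc_in_KK in blast)
  show "val (2 ^ (n + 1)) V \<in> KK n" unfolding val_eq_tc by (intro KK_sum t)
  have "TT n (val (2 ^ (n + 1)) V) = (\<Sum>k<2 ^ (n + 1). TT n ((of_int (V (int k)) / 2) * tc n k))"
    unfolding val_eq_tc by (rule TT_sum) (rule t)
  also have "\<dots> = (\<Sum>k<(2::nat) ^ (n + 1). if k = 0 then of_int (V 0) else 0)"
  proof (rule sum.cong[OF refl])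
    fix k :: nat assume "k \<in> {..<2 ^ (n + 1)}"
    then show "TT n ((of_int (V (int k)) / 2) * tc n k) = (if k = 0 then of_int (V 0) else 0)"
      unfolding TT_scale[OF conjunct1[OF tc_in_KK] r] using TT_tc[of k n] by (cases "k = 0") simp_all
  qed
  also have "\<dots> = of_int (V 0)" by simp
  finally show "TT n (val (2 ^ (n + 1)) V) = of_int (V 0)" .
qed

lemma sum_symmetric_half:
  fixes g :: "int \<Rightarrow> 'a :: comm_ring_1"
  assumes "H > 0" "\<And>k. g (2 * H - k) = g k"
  shows "(\<Sum>k\<in>{0..<2 * H}. g k) = g 0 + g H + 2 * (\<Sum>k\<in>{1..<H}. g k)"
proof -
  have "{0..<2 * H} = {0} \<union> {1..<H} \<union> {H} \<union> {H + 1..<2 * H}" using assms(1) by auto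
  then have "(\<Sum>k\<in>{0..<2 * H}. g k) = g 0 + (\<Sum>k\<in>{1..<H}. g k) + g H + (\<Sum>k\<in>{H + 1..<2 * H}. g k)"
    using assms(1) by (simp add: sum.union_disjoint)
  also have "(\<Sum>k\<in>{H + 1..<2 * H}. g k) = (\<Sum>k\<in>{1..<H}. g (2 * H - k))"
    by (rule sum.reindex_bij_witness[of _ "\<lambda>k. 2 * H - k" "\<lambda>k. 2 * H - k"]) auto
  finally show ?thesis using assms(2) by simp
qed

lemma aseq_mid: "aseq (2 * H) V \<Longrightarrow> V H = 0"
  using aseqD(4)[of "2 * H" V H] by simp

lemma val_half:
  assumes "H > 0" "aseq (2 * H) V"
  shows "val (2 * H) V = of_int (V 0) + (\<Sum>k\<in>{1..<H}. of_int (V k) * (2 * cos (of_int k * pi / of_int (2 * H))))"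
proof -
  let ?g = "\<lambda>k. of_int (V k) * cos (of_int k * pi / real_of_int (2 * H))"
  have c: "cos (of_int (2 * H - k) * pi / real_of_int (2 * H)) = - cos (of_int k * pi / real_of_int (2 * H))" for k
    using cos_shift_N[of "2 * H" "- k"] assms(1) by simp
  have "val (2 * H) V = ?g 0 + ?g H + 2 * (\<Sum>k\<in>{1..<H}. ?g k)"
    unfolding val_def
    by (rule sum_symmetric_half) (use assms(1) aseqD(4)[OF assms(2)] c in auto)
  also have "?g H = 0" using aseq_mid[OF assms(2)] by simp
  finally show ?thesis by (simp add: sum_distrib_left mult_ac)
qed

lemma val_in_RI:
  assumes "aseq (2 ^ (n + 1)) V"
  shows "val (2 ^ (n + 1)) V \<in> RI n"
proof -
  have "of_int (V k) * (2 * cos (of_int k * pi / 2 ^ (n + 1))) \<in> RI n" if "k \<in> {1..<2 ^ n}" for k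
  proof -
    have "2 * cos (of_int k * pi / 2 ^ (n + 1)) = tc n (nat k)" using that by (simp add: tc_def)
    then show ?thesis using RII(4,9) tc_in_RI by metis
  qed
  then have "of_int (V 0) + (\<Sum>k\<in>{1..<2 ^ n}. of_int (V k) * (2 * cos (of_int k * pi / 2 ^ (n + 1)))) \<in> RI n"
    by (intro RII(3,9) subring_set_sum subring_set_RI)
  then show ?thesis using val_half[of "2 ^ n" V] assms by simp
qed

lemma val_odd_in_KK:
  assumes "\<And>k. even k \<Longrightarrow> V k = 0"
  shows "\<exists>h\<in>KK n. val (2 ^ (Suc n + 1)) V = th (Suc n) * h"
proof -
  have "\<exists>q\<in>KK n. (of_int (V (int k)) / 2) * tc (Suc n) k = th (Suc n) * q" for k
  proof (cases "even k")
    case True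
    then show ?thesis using assms KKI(2) by (intro bexI[of _ 0]) simp_all
  next
    case False
    then obtain j where "k = 2 * j + 1" by (elim oddE)
    then obtain q where q: "q \<in> KK n" "tc (Suc n) k = th (Suc n) * q" using tc_in_KK[of n j] by blast
    have "of_int (V (int k)) / 2 * q \<in> KK n" by (rule KKI(4)[OF KK_Rats q(1)]) simp
    then show ?thesis using q(2) by (intro bexI[of _ "of_int (V (int k)) / 2 * q"]) simp_all
  qed
  then obtain q where q: "\<And>k. q k \<in> KK n" "\<And>k. (of_int (V (int k)) / 2) * tc (Suc n) k = th (Suc n) * q k" by metis
  have "val (2 ^ (Suc n + 1)) V = th (Suc n) * (\<Sum>k<2 ^ (Suc n + 1). q k)"
    unfolding val_eq_tc q(2) sum_distrib_left ..
  moreover have "(\<Sum>k<2 ^ (Suc n + 1). q k) \<in> KK n" by (rule KK_sum) (rule q)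
  ultimately show ?thesis by blast
qed

text \<open>Positive definiteness: the normalized trace of the square is the sum of
  \<open>V k * V k\<close> over \<open>0 \<le> k < N\<close>.\<close>

lemma val_eq_0_imp:
  assumes V: "aseq (2 ^ (n + 1)) V" and v: "val (2 ^ (n + 1)) V = 0"
  shows "V k = 0"
proof -
  let ?N = "2 ^ (n + 1) :: int"
  have N: "?N > 0" by simp
  have "val ?N (conv ?N V V) = 0" using val_conv[OF N V V] v by simp
  then have "real_of_int (conv ?N V V 0) = 0" using TT_val[of n "conv ?N V V"] TT_scale[of 0 n 0] KKI(2) by simp
  then have "conv ?N V V 0 = 0" by (simp only: of_int_eq_0_iff)
  then have "(\<Sum>k\<in>{0..<?N}. V k * V k) = 0" using aseqD(2)[OF V] by (simp add: conv_def)
  then have z: "\<forall>k\<in>{0..<?N}. V k = 0" by (subst (asm) sum_nonneg_eq_0_iff) auto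
  have z2: "V k = 0" if "k \<in> {0..<2 * ?N}" for k
  proof (cases "k < ?N")
    case True then show ?thesis using z that by auto
  next
    case False
    then have "V (k - ?N) = 0" using z that by auto
    then show ?thesis using aseqD(3)[OF V, of k] by simp
  qed
  note per = aseq_periodic[OF V]
  have "V (k mod (2 * ?N)) = 0" by (rule z2) auto
  then show ?thesis using per[of "k mod (2 * ?N)" "k div (2 * ?N)"] by (simp add: mult.commute)
qed

lemma val_inject:
  assumes "aseq (2 ^ (n + 1)) V" "aseq (2 ^ (n + 1)) Y" "val (2 ^ (n + 1)) V = val (2 ^ (n + 1)) Y"
  shows "V k = Y k"
  using val_eq_0_imp[OF aseq_diff[OF assms(1,2)], of k] assms(3) by (simp add: val_diff)

text \<open>The inclusion into the next level, where the old root of unity is the square of the new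
  one.\<close>

definition stretch :: "(int \<Rightarrow> int) \<Rightarrow> int \<Rightarrow> int" where
  "stretch V k = (if even k then V (k div 2) else 0)"

lemma aseq_stretch:
  assumes "aseq N V"
  shows "aseq (2 * N) (stretch V)"
  unfolding aseq_def
proof (intro conjI allI)
  fix k
  have "(k + 2 * N) div 2 = k div 2 + N" by simp
  then show "stretch V (k + 2 * N) = - stretch V k"
    using aseqD(1)[OF assms, of "k div 2"] by (simp add: stretch_def)
  show "stretch V (- k) = stretch V k"
  proof (cases "even k")
    case True
    then obtain j where j: "k = 2 * j" by (elim evenE)
    have "(- k) div 2 = - j" using j by simp
    then show ?thesis using aseqD(2)[OF assms, of j] j by (simp add: stretch_def)
  qed (simp add: stretch_def)
qed

lemma val_stretch:
  assumes "N > 0"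
  shows "val (2 * N) (stretch V) = val N V"
proof -
  have "val (2 * N) (stretch V) = (\<Sum>k\<in>(\<lambda>j. 2 * j) ` {0..<N}. of_int (stretch V k) * cos (of_int k * pi / of_int (2 * N)))"
    unfolding val_def
  proof (rule sum.mono_neutral_right)
    show "\<forall>k\<in>{0..<2 * N} - (\<lambda>j. 2 * j) ` {0..<N}. of_int (stretch V k) * cos (of_int k * pi / of_int (2 * N)) = 0"
    proof
      fix k assume k: "k \<in> {0..<2 * N} - (\<lambda>j. 2 * j) ` {0..<N}"
      have "odd k"
      proof
        assume "even k"
        then obtain j where "k = 2 * j" by (elim evenE)
        then show False using k by auto
      qed
      then show "of_int (stretch V k) * cos (of_int k * pi / of_int (2 * N)) = 0" by (simp add: stretch_def)
    qed
  qed auto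
  also have "\<dots> = val N V"
    unfolding val_def by (subst sum.reindex) (auto simp: inj_on_def stretch_def)
  finally show ?thesis .
qed

text \<open>Inclusion into the next level followed by multiplication by the sum of the new root of
  unity and its inverse, that is, by \<open>th (Suc n)\<close>.\<close>

definition odd_lift :: "(int \<Rightarrow> int) \<Rightarrow> int \<Rightarrow> int" where
  "odd_lift V k = (if odd k then V (k div 2) + V (k div 2 + 1) else 0)"

lemma aseq_odd_lift:
  assumes "aseq N V"
  shows "aseq (2 * N) (odd_lift V)"
  unfolding aseq_def
proof (intro conjI allI)
  fix k
  have "(k + 2 * N) div 2 = k div 2 + N" by simp
  then show "odd_lift V (k + 2 * N) = - odd_lift V k"
    using aseqD(1)[OF assms, of "k div 2"] aseqD(1)[OF assms, of "k div 2 + 1"]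
    by (simp add: odd_lift_def algebra_simps)
  show "odd_lift V (- k) = odd_lift V k"
  proof (cases "odd k")
    case True
    then obtain j where j: "k = 2 * j + 1" by (elim oddE)
    have "(- k) div 2 = - (j + 1)" using j by simp
    then show ?thesis
      using aseqD(2)[OF assms, of j] aseqD(2)[OF assms, of "j + 1"] j by (simp add: odd_lift_def)
  qed (simp add: odd_lift_def)
qed

lemma val_odd_lift:
  assumes N: "N > 0" and V: "aseq N V"
  shows "val (2 * N) (odd_lift V) = 2 * cos (pi / (2 * of_int N)) * val N V"
proof -
  define c where "c k = cos (of_int k * pi / real_of_int (2 * N))" for k
  have "val (2 * N) (odd_lift V) = (\<Sum>k\<in>(\<lambda>j. 2 * j + 1) ` {0..<N}. of_int (odd_lift V k) * c k)"
    unfolding val_def c_def[symmetric]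
  proof (rule sum.mono_neutral_right)
    show "\<forall>k\<in>{0..<2 * N} - (\<lambda>j. 2 * j + 1) ` {0..<N}. of_int (odd_lift V k) * c k = 0"
    proof
      fix k assume k: "k \<in> {0..<2 * N} - (\<lambda>j. 2 * j + 1) ` {0..<N}"
      have "even k"
      proof (rule ccontr)
        assume "odd k"
        then obtain j where "k = 2 * j + 1" by (elim oddE)
        then show False using k by auto
      qed
      then show "of_int (odd_lift V k) * c k = 0" by (simp add: odd_lift_def)
    qed
  qed auto
  also have "\<dots> = (\<Sum>j\<in>{0..<N}. of_int (V j) * c (2 * j + 1)) + (\<Sum>j\<in>{0..<N}. of_int (V (j + 1)) * c (2 * j + 1))"
    by (subst sum.reindex) (auto simp: inj_on_def odd_lift_def distrib_right sum.distrib)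
  also have "(\<Sum>j\<in>{0..<N}. of_int (V (j + 1)) * c (2 * j + 1)) = (\<Sum>j\<in>{0..<N}. of_int (V (j + 1)) * c (2 * (j + 1) - 1))"
    by (simp add: algebra_simps)
  also have "\<dots> = (\<Sum>j\<in>{0..<N}. of_int (V j) * c (2 * j - 1))"
  proof (rule sum_periodic_shift[of N "\<lambda>j. of_int (V j) * c (2 * j - 1)" 1])
    fix j
    have "c (2 * (j + N) - 1) = - c (2 * j - 1)"
      using cos_shift_N[of "2 * N" "2 * j - 1"] N unfolding c_def by (simp add: algebra_simps)
    then show "of_int (V (j + N)) * c (2 * (j + N) - 1) = of_int (V j) * c (2 * j - 1)"
      using aseqD(1)[OF V] by simp
  qed (rule N)
  also have "(\<Sum>j\<in>{0..<N}. of_int (V j) * c (2 * j + 1)) + \<dots> =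
      (\<Sum>j\<in>{0..<N}. of_int (V j) * (c (2 * j + 1) + c (2 * j - 1)))"
    by (simp add: distrib_left sum.distrib)
  also have "\<dots> = 2 * cos (pi / (2 * of_int N)) * val N V"
  proof -
    have "c (2 * j + 1) + c (2 * j - 1) = 2 * cos (pi / (2 * of_int N)) * cos (of_int j * pi / of_int N)" for j
    proof -
      have e: "of_int (2 * j + 1) * pi / real_of_int (2 * N) = of_int j * pi / of_int N + pi / (2 * of_int N)"
        "of_int (2 * j - 1) * pi / real_of_int (2 * N) = of_int j * pi / of_int N - pi / (2 * of_int N)"
        using N by (simp_all add: field_simps)
      show ?thesis unfolding c_def e cos_add cos_diff by simp
    qed
    then show ?thesis unfolding val_def by (simp add: sum_distrib_left mult_ac)
  qed
  finally show ?thesis .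
qed

lemma RI_val:
  "x \<in> RI n \<Longrightarrow> \<exists>V. aseq (2 ^ (n + 1)) V \<and> val (2 ^ (n + 1)) V = x"
proof (induction n arbitrary: x)
  case 0
  then obtain k where k: "x = of_int k" by (auto elim: Ints_cases)
  \<comment> \<open>The constant \<open>k\<close>: on the lowest level the antiperiod is 2, so the
    value alternates along the even indices.\<close>
  define V where "V j = (if odd j then 0 else if 4 dvd j then k else - k)" for j :: int
  have "aseq 2 V" unfolding aseq_def V_def by (auto simp: elim!: evenE) presburger+
  moreover have "{0..<2::int} = {0, 1}" by auto
  then have "val 2 V = x" by (simp add: val_def V_def k)
  ultimately show ?case by auto
next
  case (Suc n)
  obtain a b where ab: "a \<in> RI n" "b \<in> RI n" "x = a + th (Suc n) * b" using Suc.prems by (rule RI_SucE)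
  let ?N = "2 ^ (n + 1) :: int"
  obtain A where A: "aseq ?N A" "val ?N A = a" using Suc.IH[OF ab(1)] by blast
  obtain B where B: "aseq ?N B" "val ?N B = b" using Suc.IH[OF ab(2)] by blast
  have t: "2 * cos (pi / (2 * of_int ?N)) = th (Suc n)" by (simp add: th_def mult.commute)
  have "val (2 * ?N) (\<lambda>k. stretch A k + odd_lift B k) = x"
    unfolding val_add using val_stretch[of ?N A] val_odd_lift[OF _ B(1)] A(2) B(2) ab(3) t by simp
  moreover have "aseq (2 * ?N) (\<lambda>k. stretch A k + odd_lift B k)"
    by (intro aseq_add aseq_stretch aseq_odd_lift A B)
  moreover have "(2::int) ^ (Suc n + 1) = 2 * ?N" by simp
  ultimately show ?case by metis
qed

lemma th_mult_RI_val:
  assumes "h \<in> RI n"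
  shows "\<exists>F. aseq (2 * 2 ^ (n + 1)) F \<and> (\<forall>k. even k \<longrightarrow> F k = 0) \<and> val (2 * 2 ^ (n + 1)) F = th (Suc n) * h"
proof -
  let ?N = "2 ^ (n + 1) :: int"
  obtain B where B: "aseq ?N B" "val ?N B = h" using RI_val[OF assms] by blast
  have t: "2 * cos (pi / (2 * of_int ?N)) = th (Suc n)" by (simp add: th_def mult.commute)
  show ?thesis
    using aseq_odd_lift[OF B(1)] val_odd_lift[OF _ B(1)] B(2) t
    by (intro exI[of _ "odd_lift B"]) (simp add: odd_lift_def)
qed

lemma conv_odd:
  assumes "\<And>k. even k \<Longrightarrow> F k = 0" "odd j"
  shows "conv N F F j = 0"
  unfolding conv_def
proof (rule sum.neutral, rule ballI)
  fix k
  have "even k \<or> even (j - k)" using assms(2) by auto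
  then show "F k * F (j - k) = 0" using assms(1) by auto
qed


section \<open>Units of relative norm one and the equation c^2 + c = f^2\<close>

text \<open>If the valuation of \<open>x\<close> were below \<open>k\<close>, the left side would
  have even valuation, the right side has odd valuation. The induction strips one factor from
  \<open>x\<close> and from \<open>b\<close>.\<close>

lemma RI_valuation:
  "x \<in> RI n \<Longrightarrow> e \<in> RI n \<Longrightarrow> b \<in> RI n \<Longrightarrow> x * (x + prm n ^ k * e) = prm n * (b * b) \<Longrightarrow>
    \<exists>x'\<in>RI n. x = prm n ^ k * x'"
proof (induction k arbitrary: x b)
  case 0 then show ?case by auto
next
  case (Suc k)
  let ?p = "prm n"
  have p: "?p \<noteq> 0" using prm_pos[of n] by simp
  obtain r where r: "r \<in> RI n" "x = ?p * r \<or> x = 1 + ?p * r" using RI_residue[OF Suc.prems(1)] by blast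
  from r(2) show ?case
  proof
    assume x: "x = ?p * r"
    have "?p * (?p * (r * (r + ?p ^ k * e))) = ?p * (b * b)"
      using Suc.prems(4) unfolding x by (simp add: algebra_simps)
    then have bb: "?p * (r * (r + ?p ^ k * e)) = b * b" using p by simp
    obtain s where s: "s \<in> RI n" "b = ?p * s \<or> b = 1 + ?p * s" using RI_residue[OF Suc.prems(3)] by blast
    from s(2) have b: "b = ?p * s"
    proof
      assume "b = 1 + ?p * s"
      then have "?p * (r * (r + ?p ^ k * e) - 2 * s - ?p * s * s) = 1"
        using bb by (simp add: algebra_simps)
      moreover have "r * (r + ?p ^ k * e) - 2 * s - ?p * s * s \<in> RI n"
        by (intro RII r s prm_in_RI Suc.prems)
      ultimately show ?thesis using prm_not_unit by blast
    qed
    have "?p * (r * (r + ?p ^ k * e)) = ?p * (?p * (s * s))" using bb b by (simp add: mult_ac)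
    then have "r * (r + ?p ^ k * e) = ?p * (s * s)" using p by simp
    then obtain r' where "r' \<in> RI n" "r = ?p ^ k * r'"
      using Suc.IH[OF r(1) Suc.prems(2) s(1)] by blast
    then show ?thesis using x by (intro bexI[of _ r']) simp_all
  next
    assume x: "x = 1 + ?p * r"
    define y where "y = b * b - 2 * r - ?p * r * r - ?p ^ k * e * x"
    have "?p * y = 1" using Suc.prems(4) unfolding y_def x by (simp add: algebra_simps)
    moreover have "y \<in> RI n" unfolding y_def by (intro RII r prm_in_RI Suc.prems)
    ultimately show ?thesis using prm_not_unit by blast
  qed
qed

text \<open>c (c + 1) vanishes in the residue field with two elements, so it is \<open>prm n\<close>
  times an integral g; then h^2 = g makes h integral.\<close>

lemma RI_of_quadratic:
  assumes c: "c \<in> RI n" and h: "h \<in> KK n" and ch: "c * c + c = prm n * (h * h)"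
  shows "h \<in> RI n"
proof -
  have "\<exists>g\<in>RI n. c * c + c = prm n * g"
  proof -
    obtain r where r: "r \<in> RI n" "c = prm n * r \<or> c = 1 + prm n * r" using RI_residue[OF c] by blast
    obtain s where s: "s \<in> RI n" "2 = prm n * s" using prm_dvd_2 by blast
    from r(2) show ?thesis
    proof
      assume "c = prm n * r"
      then have "c * c + c = prm n * (r * c + r)" by (simp add: algebra_simps)
      moreover have "r * c + r \<in> RI n" by (intro RII r c)
      ultimately show ?thesis by blast
    next
      assume e: "c = 1 + prm n * r"
      have "c * c + c = 2 + prm n * (3 * r + prm n * r * r)" unfolding e by (simp add: algebra_simps)
      also have "\<dots> = prm n * (s + (3 * r + prm n * r * r))" using s(2) by (simp add: distrib_left)
      finally have "c * c + c = prm n * (s + (3 * r + prm n * r * r))" .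
      moreover have "s + (3 * r + prm n * r * r) \<in> RI n" by (intro RII r s prm_in_RI)
      ultimately show ?thesis by blast
    qed
  qed
  then obtain g where g: "g \<in> RI n" "c * c + c = prm n * g" by blast
  then have "h * h = g" using ch prm_pos[of n] by simp
  then have "algebraic_int (h\<^sup>2)" using RI_algebraic_int[OF g(1)] by (simp add: power2_eq_square)
  then show ?thesis using h KK_algebraic_int algebraic_int_square_imp by blast
qed

lemma relative_norm_one_halves:
  assumes "a \<in> RI n" "b \<in> RI n" "a\<^sup>2 - prm n * b\<^sup>2 = 1"
  shows "\<exists>c\<in>RI n. \<exists>h\<in>RI n. a = 1 + 2 * c \<and> b = 2 * h \<and> c * c + c = prm n * (h * h)"
proof -
  obtain k u u' where u: "u \<in> RI n" "u' \<in> RI n" "u * u' = 1" "prm n ^ k = 2 * u"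
    using prm_power_eq by blast
  \<comment> \<open>The second factor is a + 1, since 2 is \<open>prm n ^ k\<close> times the unit
    \<open>u'\<close>; divisibility of a - 1 by this power is divisibility by 2.\<close>
  have "(a - 1) * (a - 1 + prm n ^ k * u') = prm n * (b * b)"
  proof -
    have "prm n ^ k * u' = 2" using u(3,4) by simp
    then show ?thesis using assms(3) by (simp add: power2_eq_square algebra_simps)
  qed
  moreover have "a - 1 \<in> RI n" by (intro RII assms)
  ultimately obtain x where x: "x \<in> RI n" "a - 1 = prm n ^ k * x"
    using RI_valuation[OF _ u(2) assms(2)] by blast
  define c where "c = u * x"
  define h where "h = b / 2"
  have c: "c \<in> RI n" unfolding c_def by (intro RII u x)
  have a: "a = 1 + 2 * c" using x(2) unfolding u(4) c_def by simp
  have ch: "c * c + c = prm n * (h * h)"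
    using assms(3) unfolding a h_def by (simp add: power2_eq_square algebra_simps)
  have "h = b * inverse 2" by (simp add: h_def)
  then have "h \<in> KK n" using KKI(4)[OF RI_subset_KK[OF assms(2)] KK_inverse[OF KKI(8)]] by metis
  then have "h \<in> RI n" by (rule RI_of_quadratic[OF c _ ch])
  moreover have "b = 2 * h" by (simp add: h_def)
  ultimately show ?thesis using a c ch by blast
qed

text \<open>The even part of the square is 1 + 4 (c^2 + c) + 4 \<open>prm n\<close> h^2, and both
  summands agree by the equation; the odd part has trace 0.\<close>

lemma TT_square:
  assumes "c \<in> KK n" "h \<in> KK n" "c * c + c = prm n * (h * h)"
  shows "TT (Suc n) ((1 + 2 * c + th (Suc n) * (2 * h))\<^sup>2) = 1 + 8 * TT n (prm n * (h * h))"
proof -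
  have q: "prm n * (h * h) \<in> KK n" by (intro KKI prm_in_KK assms)
  have "(1 + 2 * c + th (Suc n) * (2 * h))\<^sup>2 =
      (1 + 4 * (c * c + c) + 4 * (th (Suc n) * th (Suc n)) * (h * h)) + th (Suc n) * (4 * h * (1 + 2 * c))"
    by (simp add: power2_eq_square algebra_simps)
  also have "\<dots> = (1 + 8 * (prm n * (h * h))) + th (Suc n) * (4 * h * (1 + 2 * c))"
    unfolding assms(3) th_sq by simp
  also have "TT (Suc n) \<dots> = TT n (1 + 8 * (prm n * (h * h)))"
    by (rule TT_Suc) (intro KKI prm_in_KK assms)+
  also have "\<dots> = TT n 1 + TT n (8 * (prm n * (h * h)))"
    by (rule TT_add) (intro KKI prm_in_KK assms)+
  also have "TT n 1 = 1" by (induction n) (auto simp: TT_lift KKI(1) simp del: TT.simps(2))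
  also have "TT n (8 * (prm n * (h * h))) = 8 * TT n (prm n * (h * h))"
    by (rule TT_scale[OF q]) simp
  finally show ?thesis .
qed

text \<open>For the converse, the relative conjugate \<open>1 + 2 * c - th (Suc m) * (2 * h)\<close>
  is integral and is the inverse.\<close>

lemma RE_plus_iff:
  "\<epsilon> \<in> RE_plus (Suc m) \<longleftrightarrow> (\<exists>c\<in>RI m. \<exists>h\<in>RI m. \<epsilon> = 1 + 2 * c + th (Suc m) * (2 * h) \<and> c * c + c = prm m * (h * h))"
  (is "?l \<longleftrightarrow> ?r")
proof
  assume l: ?l
  then have "\<epsilon> \<in> units_of_integers (KK (Suc m))" and norm: "field_norm (KK m) (KK (Suc m)) \<epsilon> = 1"
    by (simp_all add: RE_plus_def BB_eq_KK)
  then have "\<epsilon> \<in> integers_of (KK (Suc m))" by (simp add: units_of_integers_def Units_def)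
  then have "\<epsilon> \<in> RI (Suc m)" using KK_algebraic_int unfolding integers_of_def by blast
  then obtain a b where ab: "a \<in> RI m" "b \<in> RI m" "\<epsilon> = a + th (Suc m) * b" by (rule RI_SucE)
  have "a\<^sup>2 - prm m * b\<^sup>2 = 1"
    using norm field_norm_KK[OF RI_subset_KK[OF ab(1)] RI_subset_KK[OF ab(2)]] ab(3) by simp
  from relative_norm_one_halves[OF ab(1,2) this] obtain c h where
    "c \<in> RI m" "h \<in> RI m" "a = 1 + 2 * c" "b = 2 * h" "c * c + c = prm m * (h * h)" by blast
  then show ?r using ab(3) by (intro bexI[of _ c] bexI[of _ h]) simp_all
next
  assume ?r
  then obtain c h where ch: "c \<in> RI m" "h \<in> RI m" "\<epsilon> = 1 + 2 * c + th (Suc m) * (2 * h)"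
    "c * c + c = prm m * (h * h)" by blast
  have mem: "1 + 2 * c \<in> RI m" "2 * h \<in> RI m" "- (2 * h) \<in> RI m"
    by (intro RII(3)[OF RII(1) RII(4)[OF RII(8) ch(1)]] RII(5) RII(4)[OF RII(8) ch(2)])+
  have e: "\<epsilon> \<in> RI (Suc m)" unfolding ch(3) by (rule RI_SucI[OF mem(1,2)])
  define \<delta> where "\<delta> = 1 + 2 * c + th (Suc m) * (- (2 * h))"
  have d: "\<delta> \<in> RI (Suc m)" unfolding \<delta>_def by (rule RI_SucI[OF mem(1,3)])
  have int: "x \<in> integers_of (KK (Suc m))" if "x \<in> RI (Suc m)" for x
    using that RI_subset_KK RI_algebraic_int unfolding integers_of_def by blast
  have "\<epsilon> * \<delta> = 1 + 4 * (c * c + c) - 4 * (th (Suc m) * th (Suc m)) * (h * h)"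
    unfolding ch(3) \<delta>_def by (simp add: algebra_simps)
  then have ed: "\<epsilon> * \<delta> = 1" unfolding ch(4) th_sq by simp
  then have "\<epsilon> \<in> units_of_integers (KK (Suc m))"
    unfolding units_of_integers_def Units_def
    using int[OF e] int[OF d] ed by (auto simp: mult.commute[of \<delta>] intro!: bexI[of _ \<delta>])
  moreover have "field_norm (KK m) (KK (Suc m)) \<epsilon> = 1"
  proof -
    have "field_norm (KK m) (KK (Suc m)) \<epsilon> = (1 + 2 * c)\<^sup>2 - prm m * (2 * h)\<^sup>2"
      unfolding ch(3) by (rule field_norm_KK) (intro RI_subset_KK mem)+
    also have "\<dots> = 1 + 4 * (c * c + c) - 4 * (prm m * (h * h))"
      by (simp add: power2_eq_square algebra_simps)
    finally show ?thesis unfolding ch(4) by simp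
  qed
  ultimately show ?l by (simp add: RE_plus_def BB_eq_KK)
qed

lemma TT_RE_plus:
  assumes k: "c \<in> KK m" "h \<in> KK m" "c * c + c = prm m * (h * h)"
  shows "field_trace \<rat> (BB (Suc m)) ((1 + 2 * c + th (Suc m) * (2 * h))\<^sup>2) =
    2 ^ Suc m * (1 + 8 * TT (Suc m) (prm m * (h * h)))"
proof -
  have "1 + 2 * c + th (Suc m) * (2 * h) \<in> KK (Suc m)"
    by (rule KK_SucI[OF KKI(3)[OF KKI(1) KKI(4)[OF KKI(8) k(1)]] KKI(4)[OF KKI(8) k(2)]])
  then have "field_trace \<rat> (BB (Suc m)) ((1 + 2 * c + th (Suc m) * (2 * h))\<^sup>2) =
      2 ^ Suc m * TT (Suc m) ((1 + 2 * c + th (Suc m) * (2 * h))\<^sup>2)"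
    unfolding BB_eq_KK by (intro field_trace_KK KKI(7))
  also have "TT (Suc m) ((1 + 2 * c + th (Suc m) * (2 * h))\<^sup>2) = 1 + 8 * TT m (prm m * (h * h))"
    by (rule TT_square[OF k])
  also have "TT m (prm m * (h * h)) = TT (Suc m) (prm m * (h * h))"
    by (rule TT_lift[symmetric]) (intro KKI prm_in_KK k)
  finally show ?thesis .
qed

text \<open>Writing \<open>\<epsilon> = 1 + 2 * c + 2 * f\<close> with \<open>c\<close> in the subfield and \<open>f\<close> odd under the relative
  automorphism, relative norm \<open>1\<close> means \<open>c\<^sup>2 + c = f\<^sup>2\<close>; below this is read off the coefficients.\<close>

definition unit_seqs :: "nat \<Rightarrow> (int \<Rightarrow> int) \<Rightarrow> (int \<Rightarrow> int) \<Rightarrow> bool" where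
  "unit_seqs m C F \<longleftrightarrow> aseq (2 * 2 ^ m) C \<and> aseq (4 * 2 ^ m) F \<and> (\<forall>k. even k \<longrightarrow> F k = 0) \<and>
    (\<forall>j. C j + conv (2 * 2 ^ m) C C j = conv (4 * 2 ^ m) F F (2 * j)) \<and> (\<exists>k. F k \<noteq> 0)"

text \<open>c and f are compared on the upper level, where c occupies the even and f the odd
  indices; injectivity of \<open>val\<close> turns the equation into one for coefficients. A zero f
  would give c = 0 or c = -1, that is \<epsilon> = 1 or -1.\<close>

lemma RE_plus_coefficients:
  assumes "\<epsilon> \<in> RE_plus (Suc m)" "\<epsilon> \<noteq> 1" "\<epsilon> \<noteq> - 1"
  shows "\<exists>C F. unit_seqs m C F \<and>
    field_trace \<rat> (BB (Suc m)) (\<epsilon>\<^sup>2) = 2 ^ Suc m * (1 + 8 * of_int (conv (4 * 2 ^ m) F F 0))"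
proof -
  obtain c h where ch: "c \<in> RI m" "h \<in> RI m" "\<epsilon> = 1 + 2 * c + th (Suc m) * (2 * h)"
    "c * c + c = prm m * (h * h)" using assms(1) unfolding RE_plus_iff by blast
  let ?N = "2 * 2 ^ m :: int"
  have N2: "2 ^ (m + 1) = ?N" "2 ^ (Suc m + 1) = 2 * ?N" "4 * 2 ^ m = 2 * ?N" "?N > 0" "2 * ?N > 0" by simp_all
  obtain C where C: "aseq ?N C" "val ?N C = c" using RI_val[OF ch(1)] unfolding N2 by blast
  obtain F where F: "aseq (2 * ?N) F" "\<forall>k. even k \<longrightarrow> F k = 0" "val (2 * ?N) F = th (Suc m) * h"
    using th_mult_RI_val[OF ch(2)] unfolding N2 by blast
  have vF: "val (2 * ?N) (conv (2 * ?N) F F) = prm m * (h * h)"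
    unfolding val_conv[OF N2(5) F(1) F(1)] F(3) th_sq[symmetric] by (simp add: mult_ac)
  define G where "G j = C j + conv ?N C C j" for j
  have G: "aseq ?N G" unfolding G_def by (intro aseq_add C aseq_conv N2(4))
  have "val ?N G = c + c * c" unfolding G_def val_add val_conv[OF N2(4) C(1) C(1)] C(2) ..
  then have "val (2 * ?N) (stretch G) = val (2 * ?N) (conv (2 * ?N) F F)"
    unfolding val_stretch[OF N2(4)] vF using ch(4) by simp
  then have eq: "stretch G k = conv (2 * ?N) F F k" for k
    using val_inject[of "Suc m", unfolded N2(2), OF aseq_stretch[OF G] aseq_conv[OF N2(5) F(1) F(1)]] by blast
  have eqj: "C j + conv ?N C C j = conv (2 * ?N) F F (2 * j)" for j
    using eq[of "2 * j"] by (simp add: stretch_def G_def)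
  have "\<exists>k. F k \<noteq> 0"
  proof (rule ccontr)
    assume "\<not> (\<exists>k. F k \<noteq> 0)"
    then have "val (2 * ?N) F = 0" by (simp add: val_def)
    then have "h = 0" using F(3) th_Suc_pos[of m] by simp
    then have "c * (c + 1) = 0" using ch(4) by (simp add: algebra_simps)
    then have "c = 0 \<or> c = - 1" by auto
    then show False using ch(3) \<open>h = 0\<close> assms(2,3) by auto
  qed
  then have "unit_seqs m C F" unfolding unit_seqs_def N2(3) using C(1) F(1,2) eqj by blast
  moreover have "TT (Suc m) (prm m * (h * h)) = of_int (conv (2 * ?N) F F 0)"
    unfolding vF[symmetric] using TT_val[of "Suc m"] unfolding N2 by blast
  ultimately show ?thesis
    using TT_RE_plus[OF RI_subset_KK[OF ch(1)] RI_subset_KK[OF ch(2)] ch(4)]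
    unfolding N2(3) ch(3)[symmetric] by metis
qed

lemma RE_plus_of_unit_seqs:
  assumes "unit_seqs m C F"
  shows "\<exists>\<epsilon>\<in>RE_plus (Suc m) - {1, - 1}.
    field_trace \<rat> (BB (Suc m)) (\<epsilon>\<^sup>2) = 2 ^ Suc m * (1 + 8 * of_int (conv (4 * 2 ^ m) F F 0))"
proof -
  let ?N = "2 * 2 ^ m :: int"
  have N2: "2 ^ (m + 1) = ?N" "2 ^ (Suc m + 1) = 2 * ?N" "4 * 2 ^ m = 2 * ?N" "?N > 0" "2 * ?N > 0" by simp_all
  have C: "aseq ?N C" and F: "aseq (2 * ?N) F" "\<And>k. even k \<Longrightarrow> F k = 0"
    and eq: "\<And>j. C j + conv ?N C C j = conv (2 * ?N) F F (2 * j)" and nz: "\<exists>k. F k \<noteq> 0"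
    using assms unfolding unit_seqs_def N2(3) by blast+
  define c where "c = val ?N C"
  have c: "c \<in> RI m" using val_in_RI[of m C] C unfolding c_def N2 by blast
  obtain h where h: "h \<in> KK m" "val (2 * ?N) F = th (Suc m) * h"
    using val_odd_in_KK[of F m] F(2) unfolding N2 by blast
  have vF: "val (2 * ?N) (conv (2 * ?N) F F) = prm m * (h * h)"
    unfolding val_conv[OF N2(5) F(1) F(1)] h(2) th_sq[symmetric] by (simp add: mult_ac)
  have "stretch (\<lambda>j. C j + conv ?N C C j) = conv (2 * ?N) F F"
  proof
    fix k show "stretch (\<lambda>j. C j + conv ?N C C j) k = conv (2 * ?N) F F k"
    proof (cases "even k")
      case True then show ?thesis using eq[of "k div 2"] by (simp add: stretch_def)
    next
      case False then show ?thesis using conv_odd[of F k] F(2) by (simp add: stretch_def)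
    qed
  qed
  from arg_cong[OF this, of "val (2 * ?N)"] have "val ?N (\<lambda>j. C j + conv ?N C C j) = prm m * (h * h)"
    unfolding val_stretch[OF N2(4)] vF .
  then have ch: "c * c + c = prm m * (h * h)"
    unfolding val_add val_conv[OF N2(4) C C] c_def by simp
  have "h \<noteq> 0"
  proof
    assume "h = 0"
    then have "val (2 * ?N) F = 0" using h(2) by simp
    then have "F k = 0" for k using val_eq_0_imp[of "Suc m" F k] F(1) unfolding N2 by blast
    then show False using nz by blast
  qed
  let ?e = "1 + 2 * c + th (Suc m) * (2 * h)"
  have "?e \<in> RE_plus (Suc m)"
    unfolding RE_plus_iff using c RI_of_quadratic[OF c h(1) ch] ch by blast
  moreover have "?e \<noteq> d" if "d \<in> {1, - 1}" for d
  proof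
    assume e: "?e = d"
    have d: "d \<in> KK m" using that KKI(1,5) by auto
    have "1 + 2 * c \<in> KK m" "2 * h \<in> KK m"
      by (intro KKI(3)[OF KKI(1) KKI(4)[OF KKI(8) RI_subset_KK[OF c]]] KKI(4)[OF KKI(8) h(1)])+
    from KK_indep[OF _ this d KKI(2)] e have "2 * h = 0" by simp
    then show False using \<open>h \<noteq> 0\<close> by simp
  qed
  moreover have "TT (Suc m) (prm m * (h * h)) = of_int (conv (2 * ?N) F F 0)"
    unfolding vF[symmetric] using TT_val[of "Suc m"] unfolding N2 by blast
  ultimately show ?thesis
    using TT_RE_plus[OF RI_subset_KK[OF c] h(1) ch] unfolding N2(3)
    by (intro bexI[of _ ?e]) auto
qed

subsection \<open>Minimal units\<close>

fun dotl :: "int list \<Rightarrow> int list \<Rightarrow> int" where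
  "dotl (x # xs) (y # ys) = x * y + dotl xs ys"
| "dotl _ _ = 0"

text \<open>A sliding window: the second argument is a reversed prefix followed by the list. By
  evenness its entry at position i after j moves is the coefficient at j - i, so successive products
  are the convolution.\<close>

fun convl :: "int list \<Rightarrow> int list \<Rightarrow> int list \<Rightarrow> int list" where
  "convl v b [] = [dotl v b]"
| "convl v b (x # xs) = dotl v b # convl v (x # b) xs"

fun every_other :: "int list \<Rightarrow> int list" where
  "every_other (x # y # xs) = x # every_other xs"
| "every_other xs = xs"

fun add_lists :: "int list \<Rightarrow> int list \<Rightarrow> int list" where
  "add_lists (x # xs) (y # ys) = (x + y) # add_lists xs ys"
| "add_lists _ _ = []"

lemma dotl_sum: "length v \<le> length w \<Longrightarrow> dotl v w = (\<Sum>i<length v. v ! i * w ! i)"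
  by (induction v w rule: dotl.induct) (auto simp: sum.lessThan_Suc_shift simp del: sum.lessThan_Suc)

lemma length_convl: "length (convl v b xs) = Suc (length xs)"
  by (induction v b xs rule: convl.induct) auto

lemma nth_convl: "j \<le> length xs \<Longrightarrow> convl v b xs ! j = dotl v (rev (take j xs) @ b)"
proof (induction v b xs arbitrary: j rule: convl.induct)
  case (2 v b x xs)
  then show ?case by (cases j) auto
qed simp

lemma nth_every_other: "2 * j < length xs \<Longrightarrow> every_other xs ! j = xs ! (2 * j)"
proof (induction xs arbitrary: j rule: every_other.induct)
  case (1 x y xs)
  then show ?case by (cases j) auto
qed auto

lemma nth_add_lists: "j < length xs \<Longrightarrow> j < length ys \<Longrightarrow> add_lists xs ys ! j = xs ! j + ys ! j"
proof (induction xs ys arbitrary: j rule: add_lists.induct)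
  case (1 x xs y ys)
  then show ?case by (cases j) auto
qed auto

text \<open>The list is half of a period; the other half carries the opposite sign.\<close>

definition seq_of :: "int list \<Rightarrow> int \<Rightarrow> int" where
  "seq_of vs k = (if nat (k mod (2 * int (length vs))) < length vs then vs ! nat (k mod (2 * int (length vs)))
     else - vs ! (nat (k mod (2 * int (length vs))) - length vs))"

lemma seq_of_nth: "i < length vs \<Longrightarrow> seq_of vs (int i) = vs ! i"
  by (simp add: seq_of_def)

text \<open>The condition on \<open>tl vs\<close> says V (N - k) = - V k, which for an antiperiodic
  sequence is evenness.\<close>

lemma aseq_seq_of:
  assumes "vs \<noteq> []" "rev (map uminus (tl vs)) = tl vs"
  shows "aseq (int (length vs)) (seq_of vs)"
  unfolding aseq_def
proof (intro conjI allI)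
  fix k
  let ?N = "length vs"
  define r where "r = nat (k mod (2 * int ?N))"
  have N: "?N > 0" using assms(1) by simp
  have r: "r < 2 * ?N" "k mod (2 * int ?N) = int r"
  proof -
    have "0 \<le> k mod (2 * int ?N)" "k mod (2 * int ?N) < 2 * int ?N" using N by simp_all
    then show "r < 2 * ?N" "k mod (2 * int ?N) = int r" unfolding r_def by linarith+
  qed
  have 1: "nat ((k + int ?N) mod (2 * int ?N)) = (if r < ?N then r + ?N else r - ?N)"
  proof -
    have "(k + int ?N) mod (2 * int ?N) = (int r + int ?N) mod (2 * int ?N)"
      unfolding r(2)[symmetric] by (simp add: mod_add_left_eq)
    also have "\<dots> = int ((r + ?N) mod (2 * ?N))" by (simp add: zmod_int)
    also have "(r + ?N) mod (2 * ?N) = (if r < ?N then r + ?N else r - ?N)"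
    proof (cases "r < ?N")
      case False
      then obtain q where q: "r = ?N + q" "q < ?N" using r(1) by (auto dest!: le_Suc_ex simp: not_less)
      have "r + ?N = q + 2 * ?N" using q(1) by simp
      then have "(r + ?N) mod (2 * ?N) = q mod (2 * ?N)" by (simp only: mod_add_self2)
      then show ?thesis using q by simp
    qed simp
    finally show ?thesis by simp
  qed
  have s: "seq_of vs k = (if r < ?N then vs ! r else - vs ! (r - ?N))"
    by (simp add: seq_of_def r_def)
  have "r - ?N < ?N" using r(1) N by linarith
  then show "seq_of vs (k + int ?N) = - seq_of vs k"
    unfolding s unfolding seq_of_def 1 by simp
  have sym: "vs ! (?N - i) = - vs ! i" if i: "0 < i" "i < ?N" for i
  proof -
    obtain l where l: "length vs = Suc (i + l)" using i less_iff_Suc_add by metis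
    have "tl vs ! l = rev (map uminus (tl vs)) ! l" using assms(2) by simp
    also have "\<dots> = - tl vs ! (i - 1)" using i l by (simp add: rev_nth)
    finally show ?thesis using i l by (simp add: nth_tl)
  qed
  have 2: "nat ((- k) mod (2 * int ?N)) = (if r = 0 then 0 else 2 * ?N - r)"
    using N r by (auto simp: zmod_zminus1_eq_if nat_diff_distrib nat_mult_distrib)
  show "seq_of vs (- k) = seq_of vs k"
  proof -
    consider "r = 0" | "0 < r" "r < ?N" | "r = ?N" | "?N < r" by linarith
    then show ?thesis
    proof cases
      case 1 then show ?thesis unfolding s unfolding seq_of_def 2 using N by simp
    next
      case c: 2
      have "2 * ?N - r - ?N = ?N - r" "\<not> 2 * ?N - r < ?N" using c by linarith+
      then show ?thesis unfolding s unfolding seq_of_def 2 using c sym[of r] by simp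
    next
      case 3 then show ?thesis unfolding s unfolding seq_of_def 2 using N by simp
    next
      case 4
      have "?N - (r - ?N) = 2 * ?N - r" using 4 r(1) by simp
      then show ?thesis unfolding s unfolding seq_of_def 2 using 4 r(1) sym[of "r - ?N"] by simp
    qed
  qed
qed

lemma convl_conv:
  assumes "vs \<noteq> []" "rev (map uminus (tl vs)) = tl vs" "j < length vs"
  shows "convl vs vs (tl vs) ! j = conv (int (length vs)) (seq_of vs) (seq_of vs) (int j)"
proof -
  let ?V = "seq_of vs"
  note V = aseq_seq_of[OF assms(1,2)]
  have nth: "(rev (take j (tl vs)) @ vs) ! i = ?V (int j - int i)" if i: "i < length vs" for i
  proof (cases "i < j")
    case True
    then have "(rev (take j (tl vs)) @ vs) ! i = vs ! (j - i)"
      using assms(3) by (simp add: nth_append rev_nth nth_tl Suc_diff_Suc)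
    also have "\<dots> = ?V (int (j - i))" using assms(3) by (simp add: seq_of_nth)
    finally show ?thesis using True by (simp add: of_nat_diff)
  next
    case False
    then have "(rev (take j (tl vs)) @ vs) ! i = vs ! (i - j)"
      using assms(3) by (simp add: nth_append)
    also have "\<dots> = ?V (int (i - j))" using i by (simp add: seq_of_nth)
    also have "\<dots> = ?V (- (int j - int i))" using False by (simp add: of_nat_diff)
    also have "\<dots> = ?V (int j - int i)" by (rule aseqD(2)[OF V])
    finally show ?thesis .
  qed
  have "convl vs vs (tl vs) ! j = (\<Sum>i<length vs. vs ! i * (rev (take j (tl vs)) @ vs) ! i)"
    using assms(3) by (simp add: nth_convl dotl_sum)
  also have "\<dots> = (\<Sum>i<length vs. ?V (int i) * ?V (int j - int i))"
    by (intro sum.cong refl) (simp add: nth seq_of_nth)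
  also have "\<dots> = conv (int (length vs)) ?V ?V (int j)"
    unfolding conv_def
    by (rule sum.reindex_bij_witness[of _ nat int]) auto
  finally show ?thesis .
qed

lemma aseq_eqI:
  assumes "N > 0" "aseq N U" "aseq N V" "\<And>j. j \<in> {0..<N} \<Longrightarrow> U j = V j"
  shows "U = V"
proof
  fix k
  have per: "W (j + i * (2 * N)) = W j" if W: "aseq N W" for W j i
    using aseq_periodic[OF W] .
  have low: "U j = V j" if "j \<in> {0..<2 * N}" for j
  proof (cases "j < N")
    case True then show ?thesis using assms(4) that by auto
  next
    case False
    then have "U (j - N) = V (j - N)" using assms(4) that by auto
    then show ?thesis using aseqD(3)[OF assms(2), of j] aseqD(3)[OF assms(3), of j] by simp
  qed
  have "U (k mod (2 * N)) = V (k mod (2 * N))" by (rule low) (use assms(1) in auto)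
  then show "U k = V k"
    using per[OF assms(2), of "k mod (2 * N)" "k div (2 * N)"] per[OF assms(3), of "k mod (2 * N)" "k div (2 * N)"]
    by (simp add: mult.commute)
qed

lemma c_seq_values:
  "c_seq 1 = 2" "c_seq 2 = 2" "c_seq 3 = 4" "c_seq 4 = 6" "c_seq 5 = 12" "c_seq 6 = 26"
  by (simp_all add: c_seq_def round_def floor_eq_iff)

fun all_zero :: "int list \<Rightarrow> bool" where
  "all_zero [] = True"
| "all_zero (x # xs) = (x = 0 \<and> all_zero xs)"

lemma all_zero_nth: "all_zero vs \<Longrightarrow> i < length vs \<Longrightarrow> vs ! i = 0"
proof (induction vs arbitrary: i)
  case (Cons x vs) then show ?case by (cases i) auto
qed simp

lemma length_every_other: "length (every_other xs) = (length xs + 1) div 2"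
  by (induction xs rule: every_other.induct) auto

definition unit_seqs_check :: "int list \<Rightarrow> int list \<Rightarrow> int \<Rightarrow> bool" where
  "unit_seqs_check cs fs s \<longleftrightarrow>
    rev (map uminus (tl cs)) = tl cs \<and> rev (map uminus (tl fs)) = tl fs \<and> all_zero (every_other fs) \<and>
    add_lists cs (convl cs cs (tl cs)) = every_other (convl fs fs (tl fs)) \<and> dotl fs fs = s"

lemma unit_seqs_checkD:
  assumes chk: "unit_seqs_check cs fs s" and s: "s \<noteq> 0" and len: "length cs = 2 * 2 ^ m" "length fs = 4 * 2 ^ m"
  shows "\<exists>C F. unit_seqs m C F \<and> conv (4 * 2 ^ m) F F 0 = s"
proof -
  let ?C = "seq_of cs" and ?F = "seq_of fs" and ?M = "2 ^ m :: nat" and ?M' = "2 ^ m :: int"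
  have ne: "cs \<noteq> []" "fs \<noteq> []" using len by auto
  have sym: "rev (map uminus (tl cs)) = tl cs" "rev (map uminus (tl fs)) = tl fs"
    using chk by (auto simp: unit_seqs_check_def)
  have C: "aseq (2 * ?M') ?C" using aseq_seq_of[OF ne(1) sym(1)] len by simp
  have F: "aseq (4 * ?M') ?F" using aseq_seq_of[OF ne(2) sym(2)] len by simp
  have cC: "convl cs cs (tl cs) ! j = conv (2 * ?M') ?C ?C (int j)" if "j < 2 * ?M" for j
    using convl_conv[OF ne(1) sym(1), of j] that len by simp
  have cF: "convl fs fs (tl fs) ! j = conv (4 * ?M') ?F ?F (int j)" if "j < 4 * ?M" for j
    using convl_conv[OF ne(2) sym(2), of j] that len by simp
  have F': "aseq (2 * ?M') (\<lambda>j. conv (4 * ?M') ?F ?F (2 * j))"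
  proof -
    have "aseq (4 * ?M') (conv (4 * ?M') ?F ?F)" using F by (simp add: aseq_conv)
    from aseqD(1,2)[OF this] show ?thesis unfolding aseq_def by (simp add: distrib_left)
  qed
  have "(\<lambda>j. ?C j + conv (2 * ?M') ?C ?C j) = (\<lambda>j. conv (4 * ?M') ?F ?F (2 * j))"
  proof (rule aseq_eqI[of "2 * ?M'"])
    fix j assume j: "j \<in> {0..<2 * ?M'}"
    then obtain i where i: "j = int i" "i < 2 * ?M" using nonneg_int_cases[of j] by (metis atLeastLessThan_iff numeral_power_eq_of_nat_cancel_iff of_nat_less_iff of_nat_mult of_nat_numeral)
    have "every_other (convl fs fs (tl fs)) ! i = convl fs fs (tl fs) ! (2 * i)"
      by (rule nth_every_other) (use i len in \<open>simp add: length_convl\<close>)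
    also have "\<dots> = conv (4 * ?M') ?F ?F (2 * j)" using cF[of "2 * i"] i by simp
    finally have 1: "every_other (convl fs fs (tl fs)) ! i = conv (4 * ?M') ?F ?F (2 * j)" .
    have "add_lists cs (convl cs cs (tl cs)) ! i = cs ! i + convl cs cs (tl cs) ! i"
      by (rule nth_add_lists) (use i len in \<open>simp_all add: length_convl\<close>)
    also have "\<dots> = ?C j + conv (2 * ?M') ?C ?C j" using cC[of i] i len by (simp add: seq_of_nth)
    finally show "?C j + conv (2 * ?M') ?C ?C j = conv (4 * ?M') ?F ?F (2 * j)"
      using 1 chk by (simp add: unit_seqs_check_def)
  qed (simp_all add: aseq_add C aseq_conv F')
  then have eq: "?C j + conv (2 * ?M') ?C ?C j = conv (4 * ?M') ?F ?F (2 * j)" for j by meson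
  have ev: "?F k = 0" if k: "even k" for k
  proof -
    have z: "fs ! i = 0" if i: "even i" "i < length fs" for i
    proof -
      obtain l where l: "i = 2 * l" using i by (elim evenE)
      have "every_other fs ! l = 0"
        using chk i l by (intro all_zero_nth) (auto simp: unit_seqs_check_def length_every_other)
      then show ?thesis using nth_every_other[of l fs] i l by simp
    qed
    have "even (k mod (2 * int (length fs)))" using k by (simp add: dvd_mod_iff)
    then have e: "even (nat (k mod (2 * int (length fs))))" using even_nat_iff pos_mod_sign[of "2 * int (length fs)" k] ne by simp
    have b: "nat (k mod (2 * int (length fs))) < 2 * length fs"
      using pos_mod_bound[of "2 * int (length fs)" k] ne by (simp add: nat_less_iff)
    have "even (length fs)" using len by simp
    then show ?thesis unfolding seq_of_def using e b by (auto intro!: z)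
  qed
  have "conv (4 * ?M') ?F ?F 0 = dotl fs fs"
    using cF[of 0] nth_convl[of 0 "tl fs" fs fs] by simp
  then have v: "conv (4 * ?M') ?F ?F 0 = s" using chk by (simp add: unit_seqs_check_def)
  have "\<exists>k. ?F k \<noteq> 0"
  proof (rule ccontr)
    assume "\<not> ?thesis"
    then have "conv (4 * ?M') ?F ?F 0 = 0" by (simp add: conv_def)
    then show False using s v by simp
  qed
  then have "unit_seqs m ?C ?F" using C F eq ev unfolding unit_seqs_def by blast
  then show ?thesis using v by blast
qed

text \<open>This and the next five lists are the coefficients of c and f for units attaining the
  minimum. Here c = -2 and f is minus the square root of 2, so \<epsilon> is -3 minus twice that
  root.\<close>

lemma unit_seqs_1: "unit_seqs_check [- 2, 0]
    [0, - 1, 0, 1] 2"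
  unfolding unit_seqs_check_def by code_simp

lemma unit_seqs_2: "unit_seqs_check [0, 1, 0, - 1]
    [0, 1, 0, 0, 0, 0, 0, - 1] 2"
  unfolding unit_seqs_check_def by code_simp

lemma unit_seqs_3: "unit_seqs_check [0, 1, 0, 1, 0, - 1, 0, - 1]
    [0, 1, 0, 0, 0, 1, 0, 0, 0, 0, 0, - 1, 0, 0, 0, - 1] 4"
  unfolding unit_seqs_check_def by code_simp

text \<open>For n = 4 and n = 6 the entries of f repeat with period 10, two of them nonzero; among
  2^(n+1) entries these are about 2^(n+1) / 5, the size of \<open>c_seq\<close>.\<close>

lemma unit_seqs_4: "unit_seqs_check [0, 0, 1, 0, - 1, 0, 0, 1, 0, - 1, 0, 0, 1, 0, - 1, 0]
    [0, 0, 0, 1, 0, 0, 0, 0, 0, - 1, 0, 0, 0, 1, 0, 0, 0, 0, 0, - 1, 0, 0, 0, 1, 0, 0, 0, 0, 0, - 1, 0, 0] 6"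
  unfolding unit_seqs_check_def by code_simp

lemma unit_seqs_5: "unit_seqs_check [0, 0, 0, 0, 0, 0, 1, - 1, 0, 1, 1, - 1, 0, 1, 0, 0, 0, 0, 0, - 1, 0, 1, - 1, - 1, 0, 1, - 1, 0, 0, 0, 0, 0]
    [0, 0, 0, 0, 0, 0, 0, 0, 0, 0, 0, 1, 0, 0, 0, - 1, 0, 1, 0, 1, 0, 0, 0, - 1, 0, 1, 0, 0, 0, 0, 0, 0, 0, 0, 0, 0, 0, 0, 0, - 1, 0, 1, 0, 0, 0, - 1, 0, - 1, 0, 1, 0, 0, 0, - 1, 0, 0, 0, 0, 0, 0, 0, 0, 0, 0] 12"
  unfolding unit_seqs_check_def by code_simp

lemma unit_seqs_6: "unit_seqs_check [0, 1, 0, - 1, 0, 0, 1, 0, - 1, 0, 0, 1, 0, - 1, 0, 0, 1, 0, - 1, 0, 0, 1, 0, - 1, 0, 0, 1, 0, - 1, 0, 0, 1, 0, - 1, 0, 0, 1, 0, - 1, 0, 0, 1, 0, - 1, 0, 0, 1, 0, - 1, 0, 0, 1, 0, - 1, 0, 0, 1, 0, - 1, 0, 0, 1, 0, - 1]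
    [0, 1, 0, 0, 0, 0, 0, - 1, 0, 0, 0, 1, 0, 0, 0, 0, 0, - 1, 0, 0, 0, 1, 0, 0, 0, 0, 0, - 1, 0, 0, 0, 1, 0, 0, 0, 0, 0, - 1, 0, 0, 0, 1, 0, 0, 0, 0, 0, - 1, 0, 0, 0, 1, 0, 0, 0, 0, 0, - 1, 0, 0, 0, 1, 0, 0, 0, 0, 0, - 1, 0, 0, 0, 1, 0, 0, 0, 0, 0, - 1, 0, 0, 0, 1, 0, 0, 0, 0, 0, - 1, 0, 0, 0, 1, 0, 0, 0, 0, 0, - 1, 0, 0, 0, 1, 0, 0, 0, 0, 0, - 1, 0, 0, 0, 1, 0, 0, 0, 0, 0, - 1, 0, 0, 0, 1, 0, 0, 0, 0, 0, - 1] 26"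
  unfolding unit_seqs_check_def by code_simp

lemma RE_plus_exists:
  assumes "m \<le> 5"
  shows "\<exists>\<epsilon>\<in>RE_plus (Suc m) - {1, - 1}.
    field_trace \<rat> (BB (Suc m)) (\<epsilon>\<^sup>2) = 2 ^ Suc m * (1 + 8 * real_of_int (c_seq (Suc m)))"
proof -
  have "\<exists>C F. unit_seqs m C F \<and> conv (4 * 2 ^ m) F F 0 = c_seq (Suc m)"
  proof -
    have "m \<in> {0, 1, 2, 3, 4, 5}" using assms by auto
    then consider "m = 0" | "m = 1" | "m = 2" | "m = 3" | "m = 4" | "m = 5" by blast
    then show ?thesis
    proof cases
      case 1
      then have "Suc m = 1" by simp
      then show ?thesis
        using unit_seqs_checkD[OF unit_seqs_1, of m] c_seq_values(1) 1 by (simp add: eval_nat_numeral)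
    next
      case 2
      then have "Suc m = 2" by simp
      then show ?thesis
        using unit_seqs_checkD[OF unit_seqs_2, of m] c_seq_values(2) 2 by (simp add: eval_nat_numeral)
    next
      case 3
      then have "Suc m = 3" by simp
      then show ?thesis
        using unit_seqs_checkD[OF unit_seqs_3, of m] c_seq_values(3) 3 by (simp add: eval_nat_numeral)
    next
      case 4
      then have "Suc m = 4" by simp
      then show ?thesis
        using unit_seqs_checkD[OF unit_seqs_4, of m] c_seq_values(4) 4 by (simp add: eval_nat_numeral)
    next
      case 5
      then have "Suc m = 5" by simp
      then show ?thesis
        using unit_seqs_checkD[OF unit_seqs_5, of m] c_seq_values(5) 5 by (simp add: eval_nat_numeral)
    next
      case 6
      then have "Suc m = 6" by simp
      then show ?thesis
        using unit_seqs_checkD[OF unit_seqs_6, of m] c_seq_values(6) 6 by (simp add: eval_nat_numeral)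
    qed
  qed
  then show ?thesis using RE_plus_of_unit_seqs by metis
qed


section \<open>The equation modulo 2 and modulo 4\<close>

text \<open>Terms pair up under reflection about \<open>h\<close>. The two fixed points give the
  squares, the only terms that survive modulo 2; for an odd index (\<open>conv_self_odd\<close>)
  there are none.\<close>

lemma conv_self_even:
  assumes "H > 0" "aseq (2 * H) V"
  shows "conv (2 * H) V V (2 * h) = V h * V h - V (h + H) * V (h + H) + 2 * (\<Sum>t\<in>{1..<H}. V (h + t) * V (h - t))"
proof -
  let ?g = "\<lambda>t. V (h + t) * V (h - t)"
  have "conv (2 * H) V V (2 * h) = (\<Sum>t\<in>{0..<2 * H}. V (t + h) * V (2 * h - (t + h)))"
    unfolding conv_def
    by (rule sum_periodic_shift[of "2 * H" "\<lambda>k. V k * V (2 * h - k)" h, symmetric])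
      (use assms conv_term_periodic in auto)
  also have "\<dots> = (\<Sum>t\<in>{0..<2 * H}. ?g t)" by (simp add: add.commute)
  also have "\<dots> = ?g 0 + ?g H + 2 * (\<Sum>t\<in>{1..<H}. ?g t)"
  proof (rule sum_symmetric_half[OF assms(1)])
    fix k
    have "h + (2 * H - k) = (h - k) + 2 * H" "h - (2 * H - k) = (h + k) - 2 * H" by simp_all
    then have "V (h + (2 * H - k)) = - V (h - k)" "V (h - (2 * H - k)) = - V (h + k)"
      by (simp_all only: aseqD(1,3)[OF assms(2)])
    then show "?g (2 * H - k) = ?g k" by simp
  qed
  also have "V (h - H) = - V (h + H)" using aseqD(3)[OF assms(2), of "h + H"] by (simp add: algebra_simps)
  finally show ?thesis by simp
qed

lemma conv_self_odd:
  assumes "H > 0" "aseq (2 * H) V"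
  shows "conv (2 * H) V V (2 * h + 1) = 2 * (\<Sum>t\<in>{1..H}. V (h + t) * V (h + 1 - t))"
proof -
  let ?g = "\<lambda>t. V (h + 1 + t) * V (h - t)"
  have "conv (2 * H) V V (2 * h + 1) = (\<Sum>t\<in>{0..<2 * H}. V (t + (h + 1)) * V (2 * h + 1 - (t + (h + 1))))"
    unfolding conv_def
    by (rule sum_periodic_shift[of "2 * H" "\<lambda>k. V k * V (2 * h + 1 - k)" "h + 1", symmetric])
      (use assms conv_term_periodic in auto)
  also have "\<dots> = (\<Sum>t\<in>{0..<2 * H}. ?g t)" by (intro sum.cong refl) (simp add: algebra_simps)
  also have "{0..<2 * H} = {0..<H} \<union> {H..<2 * H}" using assms(1) by auto
  also have "sum ?g \<dots> = sum ?g {0..<H} + sum ?g {H..<2 * H}" by (rule sum.union_disjoint) auto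
  also have "sum ?g {H..<2 * H} = (\<Sum>t\<in>{0..<H}. ?g (2 * H - 1 - t))"
    by (rule sum.reindex_bij_witness[of _ "\<lambda>t. 2 * H - 1 - t" "\<lambda>t. 2 * H - 1 - t"]) auto
  also have "(\<Sum>t\<in>{0..<H}. ?g (2 * H - 1 - t)) = sum ?g {0..<H}"
  proof (rule sum.cong[OF refl])
    fix t
    have "h + 1 + (2 * H - 1 - t) = (h - t) + 2 * H" "h - (2 * H - 1 - t) = (h + 1 + t) - 2 * H" by simp_all
    then have "V (h + 1 + (2 * H - 1 - t)) = - V (h - t)" "V (h - (2 * H - 1 - t)) = - V (h + 1 + t)"
      by (simp_all only: aseqD(1,3)[OF assms(2)])
    then show "?g (2 * H - 1 - t) = ?g t" by simp
  qed
  also have "sum ?g {0..<H} = (\<Sum>t\<in>{1..H}. V (h + t) * V (h + 1 - t))"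
    by (rule sum.reindex_bij_witness[of _ "\<lambda>t. t - 1" "\<lambda>t. t + 1"]) (auto simp: algebra_simps)
  finally show ?thesis by simp
qed

declare add_bit_eq_xor [simp del] mult_bit_eq_and [simp del]

lemma bit_double [simp]: "(x::bit) + x = 0" "x * x = x" "x + (x + y) = y"
  by (cases x; cases y; simp)+

lemma bit_add_eq_0_iff: "(x::bit) + y = 0 \<longleftrightarrow> x = y" "x + y = z \<longleftrightarrow> x = y + z"
  by (cases x; cases y; cases z; simp)+

lemma of_int_bit_eq_0_iff: "(of_int k :: bit) = 0 \<longleftrightarrow> even k"
proof (cases "even k")
  case True then show ?thesis by (auto elim!: evenE)
next
  case False then show ?thesis by (auto elim!: oddE)
qed

lemma of_int_bit_eq_iff: "(of_int x :: bit) = of_int y \<longleftrightarrow> (even x \<longleftrightarrow> even y)"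
proof -
  have "(of_int x :: bit) = of_int y \<longleftrightarrow> (of_int (x + y) :: bit) = 0" by (simp add: bit_add_eq_0_iff)
  then show ?thesis unfolding of_int_bit_eq_0_iff by simp
qed

lemma bit_move: "(x::bit) = y + z \<Longrightarrow> y = x + z"
  by (cases x; cases y; cases z; simp)

text \<open>Equal terms cancel in characteristic 2, which leaves the fixed point of the
  reflection.\<close>

lemma sum_bit_symmetric:
  fixes h :: "int \<Rightarrow> bit"
  assumes "L > 0" "\<And>t. h (2 * L - t) = h t"
  shows "(\<Sum>t\<in>{1..<2 * L}. h t) = h L"
proof -
  have "{0..<2 * L} = insert 0 {1..<2 * L}" using assms(1) by auto
  then have "(\<Sum>t\<in>{0..<2 * L}. h t) = h 0 + (\<Sum>t\<in>{1..<2 * L}. h t)" by simp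
  moreover have "(\<Sum>t\<in>{0..<2 * L}. h t) = h 0 + h L"
    using sum_symmetric_half[of L h, OF assms] by simp
  ultimately have "h 0 + (\<Sum>t\<in>{1..<2 * L}. h t) = h 0 + h L" by simp
  then show ?thesis by simp
qed

lemma sum_both_sides:
  fixes h :: "int \<Rightarrow> 'a :: comm_monoid_add"
  assumes "L > 0"
  shows "(\<Sum>t\<in>{- L + 1..<L}. h t) = h 0 + (\<Sum>t\<in>{1..<L}. h t + h (- t))"
proof -
  have "{- L + 1..<L} = {0} \<union> {1..<L} \<union> uminus ` {1..<L}"
  proof (rule equalityI; rule subsetI)
    fix x assume "x \<in> {- L + 1..<L}"
    then show "x \<in> {0} \<union> {1..<L} \<union> uminus ` {1..<L}"
      by (cases "x < 0") (auto intro: image_eqI[of x uminus "- x"])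
  qed (use assms in auto)
  then have "(\<Sum>t\<in>{- L + 1..<L}. h t) = h 0 + (\<Sum>t\<in>{1..<L}. h t) + (\<Sum>t\<in>uminus ` {1..<L}. h t)"
    by (simp only:) (subst sum.union_disjoint; auto)+
  also have "(\<Sum>t\<in>uminus ` {1..<L}. h t) = (\<Sum>t\<in>{1..<L}. h (- t))"
    by (subst sum.reindex) (auto simp: inj_on_def)
  finally show ?thesis by (simp add: sum.distrib add.assoc)
qed

text \<open>Evenness of \<open>C 0\<close> is no restriction, since c may be replaced by -1 - c;
  \<open>m \<ge> 1\<close> makes \<open>M\<close> even.\<close>

locale unit_solution =
  fixes m :: nat and C F :: "int \<Rightarrow> int" and M :: int
  assumes sol: "unit_seqs m C F" and M_def: "M = 2 ^ m" and m_pos: "m \<ge> 1" and C0: "even (C 0)"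
begin

lemma M_pos: "M > 0" and M_even: "even M"
  using m_pos by (simp_all add: M_def)

lemma aseq_C: "aseq (2 * M) C" and aseq_F: "aseq (4 * M) F"
  and F_even: "even k \<Longrightarrow> F k = 0"
  and law: "C j + conv (2 * M) C C j = conv (2 * (2 * M)) F F (2 * j)"
  using sol by (simp_all add: unit_seqs_def M_def)

lemma aseq_F': "aseq (2 * (2 * M)) F"
  using aseq_F by simp

definition c :: "int \<Rightarrow> bit" where "c k = of_int (C k)"
definition f :: "int \<Rightarrow> bit" where "f k = of_int (F k)"
text \<open>The second binary digit: \<open>c k\<close> and \<open>s k\<close> together determine
  \<open>C k\<close> modulo 4.\<close>

definition s :: "int \<Rightarrow> bit" where "s k = of_int (C k div 2)"

lemma c_periodic: "c (k + 2 * M) = c k" "c (k - 2 * M) = c k" "c (- k) = c k"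
  and f_periodic: "f (k + 4 * M) = f k" "f (k - 4 * M) = f k" "f (- k) = f k"
  using aseqD(1-3)[OF aseq_C] aseqD(1-3)[OF aseq_F] by (simp_all add: c_def f_def)

lemma f_even: "even k \<Longrightarrow> f k = 0"
  by (simp add: f_def F_even)

lemma c_zero: "c 0 = 0" "c M = 0"
  using C0 aseq_mid[OF aseq_C] by (simp_all add: c_def of_int_bit_eq_0_iff)

text \<open>Half of the mixed terms of the coefficient of f^2 at \<open>2 * i\<close>; it remains
  when the law is halved.\<close>

definition T :: "int \<Rightarrow> int" where "T i = (\<Sum>t\<in>{1..<2 * M}. F (i + t) * F (i - t))"

lemma law_T:
  "C i + conv (2 * M) C C i = F i * F i - F (i + 2 * M) * F (i + 2 * M) + 2 * T i"
proof -
  have "conv (2 * (2 * M)) F F (2 * i) = F i * F i - F (i + 2 * M) * F (i + 2 * M) + 2 * T i"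
    unfolding T_def by (rule conv_self_even[OF _ aseq_F']) (use M_pos in simp)
  then show ?thesis using law[of i] by simp
qed

lemma row_even_int:
  "C (2 * h) + (C h * C h - C (h + M) * C (h + M) + 2 * (\<Sum>t\<in>{1..<M}. C (h + t) * C (h - t))) = 2 * T (2 * h)"
  using law_T[of "2 * h"] unfolding conv_self_even[OF M_pos aseq_C] by (simp add: F_even)

text \<open>Squaring is additive modulo 2, so c^2 contributes \<open>c h + c (h + M)\<close>; f^2
  contributes nothing, because its squares would sit at even indices of F.\<close>

lemma c_double: "c (2 * h) = c h + c (h + M)"
proof -
  from arg_cong[OF row_even_int[of h], of "of_int :: int \<Rightarrow> bit"]
  have "c (2 * h) + (c h + c (h + M)) = 0" by (simp add: c_def)
  then show ?thesis by (simp add: bit_add_eq_0_iff)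
qed

lemma row_odd_int:
  assumes "i = 2 * h + 1"
  shows "C i + 2 * (\<Sum>t\<in>{1..M}. C (h + t) * C (h + 1 - t)) = F i * F i - F (i + 2 * M) * F (i + 2 * M) + 2 * T i"
  using law_T[of i] unfolding assms conv_self_odd[OF M_pos aseq_C] .

text \<open>The opposite situation to \<open>c_double\<close>: c^2 has no squares at an odd index,
  and f^2 contributes two.\<close>

lemma c_odd: "odd i \<Longrightarrow> c i = f i + f (i + 2 * M)"
proof -
  assume "odd i"
  then obtain h where "i = 2 * h + 1" by (elim oddE)
  from arg_cong[OF row_odd_int[OF this], of "of_int :: int \<Rightarrow> bit"]
  show ?thesis by (simp add: c_def f_def)
qed

lemma mod4_square: "\<exists>q. x * x = x mod 2 + 4 * (q::int)"
proof (cases "even x")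
  case True
  then obtain y where "x = 2 * y" by (elim evenE)
  then show ?thesis by (intro exI[of _ "y * y"]) simp
next
  case False
  then obtain y where "x = 2 * y + 1" by (elim oddE)
  then show ?thesis by (intro exI[of _ "y * y + y"]) (simp add: algebra_simps)
qed

text \<open>The law at an even index, taken modulo 4 and halved; squares are replaced by parities
  modulo 4.\<close>

lemma row_even:
  "s (2 * h) = c h * c (2 * h) + (\<Sum>t\<in>{1..<M}. c (h + t) * c (h - t)) + of_int (T (2 * h))"
proof -
  note e = row_even_int[of h]
  obtain q where q: "C h * C h = C h mod 2 + 4 * q" using mod4_square by blast
  obtain r where r: "C (h + M) * C (h + M) = C (h + M) mod 2 + 4 * r" using mod4_square by blast
  \<comment> \<open>Exclusive or written with integers: the sum of two bits minus twice the
    carry.\<close>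
  have p: "C (2 * h) mod 2 = C h mod 2 + C (h + M) mod 2 - 2 * ((C h mod 2) * (C (h + M) mod 2))"
  proof -
    have "even (C (2 * h)) \<longleftrightarrow> (even (C h) \<longleftrightarrow> even (C (h + M)))"
      using c_double[of h] unfolding c_def of_int_add[symmetric] of_int_bit_eq_iff by simp
    then show ?thesis by (auto simp: parity_cases[of "C h"] mod_2_eq_odd)
  qed
  have "C (2 * h) = C (2 * h) mod 2 + 2 * (C (2 * h) div 2)" by simp
  then have "C h mod 2 - (C h mod 2) * (C (h + M) mod 2) + C (2 * h) div 2 + 2 * q - 2 * r
      + (\<Sum>t\<in>{1..<M}. C (h + t) * C (h - t)) = T (2 * h)"
    using e p q r by linarith
  from arg_cong[OF this, of "of_int :: int \<Rightarrow> bit"]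
  have "of_int (C h mod 2) - of_int (C h mod 2) * of_int (C (h + M) mod 2) + s (2 * h)
      + (\<Sum>t\<in>{1..<M}. c (h + t) * c (h - t)) = of_int (T (2 * h))"
    by (simp add: s_def c_def)
  moreover have m: "of_int (x mod 2) = (of_int x :: bit)" for x
    by (cases "even x") (auto elim!: evenE oddE)
  ultimately have "c h - c h * c (h + M) + s (2 * h) + (\<Sum>t\<in>{1..<M}. c (h + t) * c (h - t)) = of_int (T (2 * h))"
    by (simp add: c_def)
  then have "c h = s (2 * h) + (c h * c (h + M) + (of_int (T (2 * h)) + (\<Sum>t\<in>{1..<M}. c (h + t) * c (h - t))))"
    by (simp add: bit_add_eq_0_iff add_ac)
  from bit_move[OF this] show ?thesis unfolding c_double by (simp add: distrib_left add_ac)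
qed

lemma row_odd:
  assumes "i = 2 * h + 1"
  shows "s i = (\<Sum>t\<in>{1..M}. c (h + t) * c (h + 1 - t)) + c i * f (i + 2 * M) + of_int (T i)"
proof -
  obtain q where q: "F i * F i = F i mod 2 + 4 * q" using mod4_square by blast
  obtain r where r: "F (i + 2 * M) * F (i + 2 * M) = F (i + 2 * M) mod 2 + 4 * r" using mod4_square by blast
  \<comment> \<open>The difference of two bits is their exclusive or minus twice a borrow; the
    borrow is split as 2 - 4 so that it shows a plus sign after halving.\<close>
  have p: "F i mod 2 - F (i + 2 * M) mod 2 = C i mod 2 + 2 * (C i mod 2 * (F (i + 2 * M) mod 2)) - 4 * (C i mod 2 * (F (i + 2 * M) mod 2))"
  proof -
    have "odd i" using assms by simp
    have "even (C i) \<longleftrightarrow> (even (F i) \<longleftrightarrow> even (F (i + 2 * M)))"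
      using c_odd[OF \<open>odd i\<close>] unfolding c_def f_def of_int_add[symmetric] of_int_bit_eq_iff by simp
    then show ?thesis by (auto simp: mod_2_eq_odd)
  qed
  have "C i = C i mod 2 + 2 * (C i div 2)" by simp
  then have "C i div 2 + (\<Sum>t\<in>{1..M}. C (h + t) * C (h + 1 - t)) + C i mod 2 * (F (i + 2 * M) mod 2)
      = 2 * q - 2 * r + T i"
    using row_odd_int[OF assms] p q r by linarith
  from arg_cong[OF this, of "of_int :: int \<Rightarrow> bit"]
  have "s i + (\<Sum>t\<in>{1..M}. c (h + t) * c (h + 1 - t)) + of_int (C i mod 2) * of_int (F (i + 2 * M) mod 2) = of_int (T i)"
    by (simp add: s_def c_def)
  moreover have m: "of_int (x mod 2) = (of_int x :: bit)" for x
    by (cases "even x") (auto elim!: evenE oddE)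
  ultimately have "s i + (\<Sum>t\<in>{1..M}. c (h + t) * c (h + 1 - t)) + c i * f (i + 2 * M) = of_int (T i)"
    by (simp add: c_def f_def)
  then show ?thesis by (simp add: bit_add_eq_0_iff add_ac)
qed

text \<open>\<open>f\<close> has period \<open>4 * M\<close> only. This is the function of period
  \<open>2 * M\<close> that agrees with it on the window from \<open>M\<close> to
  \<open>3 * M\<close>; the correction near 0 is the function \<open>a\<close> below, which depends
  on \<open>c\<close> alone.\<close>

definition g :: "int \<Rightarrow> bit" where "g k = f (M + (k - M) mod (2 * M))"
definition co :: "int \<Rightarrow> bit" where "co k = (if odd k then c k else 0)"
definition a :: "int \<Rightarrow> bit" where "a k = (if - M < k \<and> k < M then co k else 0)"

lemma co_periodic: "co (k + 2 * M) = co k" "co (k - 2 * M) = co k"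
  by (simp_all add: co_def c_periodic)

lemma g_periodic: "g (k + 2 * M) = g k"
proof -
  have "(k + 2 * M - M) mod (2 * M) = (k - M) mod (2 * M)"
    using mod_add_self2[of "k - M" "2 * M"] by (simp add: algebra_simps)
  then show ?thesis by (simp add: g_def)
qed

text \<open>Inside the inner window \<open>g\<close> is \<open>f\<close> shifted by
  \<open>2 * M\<close>, and by \<open>c_odd\<close> the two values differ by \<open>c\<close>;
  elsewhere in the range \<open>g\<close> and \<open>f\<close> agree.\<close>

lemma f_split:
  assumes "- 2 * M < k" "k < 3 * M"
  shows "f k = g k + a k"
proof -
  consider "M \<le> k" | "- M \<le> k" "k < M" | "k < - M" by linarith
  then show ?thesis
  proof cases
    case 1
    then have "(k - M) mod (2 * M) = k - M" using assms by simp
    then show ?thesis using 1 by (simp add: g_def a_def)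
  next
    case 2
    have "(k - M + 2 * M) mod (2 * M) = k - M + 2 * M" using 2 M_pos by (intro mod_pos_pos_trivial) auto
    then have "(k - M) mod (2 * M) = k + M" by (simp only: mod_add_self2)
    then have g: "g k = f (k + 2 * M)" by (simp add: g_def algebra_simps)
    show ?thesis
    proof (cases "odd k")
      case True
      then have "k \<noteq> - M" using M_even by auto
      then show ?thesis using c_odd[OF True] g 2 True by (simp add: a_def co_def bit_add_eq_0_iff add_ac)
    next
      case False then show ?thesis using g by (simp add: a_def co_def f_even)
    qed
  next
    case 3
    have "(k - M + 2 * (2 * M)) mod (2 * M) = k - M + 2 * (2 * M)"
      using 3 assms by (intro mod_pos_pos_trivial) auto
    then have "(k - M) mod (2 * M) = k + 3 * M" by (simp only: mod_mult_self1)
    then have "g k = f (k + 4 * M)" by (simp add: g_def algebra_simps)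
    then show ?thesis using 3 by (simp add: a_def f_periodic)
  qed
qed

text \<open>The summand is invariant under t -> 2M - t, so only t = M remains: the quadratic part in
  the unknowns collapses to one value.\<close>

lemma T_split_gg:
  assumes i: "0 < i" "i < M"
  shows "(\<Sum>t\<in>{1..<2 * M}. g (i + t) * g (i - t)) = f (M + i)"
proof -
  have "(\<Sum>t\<in>{1..<2 * M}. g (i + t) * g (i - t)) = g (i + M) * g (i - M)"
  proof (rule sum_bit_symmetric[OF M_pos])
    fix t
    have e: "i + (2 * M - t) = (i - t) + 2 * M" "i + t = (i - (2 * M - t)) + 2 * M" by simp_all
    show "g (i + (2 * M - t)) * g (i - (2 * M - t)) = g (i + t) * g (i - t)"
      unfolding e(1) g_periodic unfolding e(2) g_periodic by (simp add: mult.commute)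
  qed
  also have "g (i + M) = g (i - M)" using g_periodic[of "i - M"] by (simp add: algebra_simps)
  also have "g (i - M) = f (M + i)"
  proof -
    have "(i - M - M + 1 * (2 * M)) mod (2 * M) = i - M - M + 1 * (2 * M)"
      using i by (intro mod_pos_pos_trivial) auto
    then have "(i - M - M) mod (2 * M) = i" by (simp only: mod_mult_self1)
    then show ?thesis by (simp add: g_def)
  qed
  finally show ?thesis by simp
qed

lemma T_split_aa:
  assumes i: "0 < i" "i < M"
  shows "(\<Sum>t\<in>{1..<2 * M}. a (i + t) * a (i - t)) = (\<Sum>t\<in>{1..<M - i}. co (i + t) * co (i - t))"
  by (rule sum.mono_neutral_cong_right) (use i in \<open>auto simp: a_def\<close>)

text \<open>Both mixed sums together run over positive and negative t, hence over a full period of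
  \<open>g\<close>; they form a cyclic convolution.\<close>

lemma T_split_window:
  assumes i: "0 < i" "i < M"
  shows "(\<Sum>t\<in>{- (2 * M) + 1..<2 * M}. a (i + t) * g (i - t)) = (\<Sum>k\<in>{0..<2 * M}. co (2 * i - M - k) * g (M + k))"
proof -
  have "(\<Sum>t\<in>{- (2 * M) + 1..<2 * M}. a (i + t) * g (i - t)) = (\<Sum>t\<in>{- M - i..<M - i}. co (i + t) * g (i - t))"
  proof (rule sum.mono_neutral_cong_right)
    show "{- M - i..<M - i} \<subseteq> {- (2 * M) + 1..<2 * M}" using i by auto
    show "\<forall>t\<in>{- (2 * M) + 1..<2 * M} - {- M - i..<M - i}. a (i + t) * g (i - t) = 0" by (auto simp: a_def)
    fix t assume t: "t \<in> {- M - i..<M - i}"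
    show "a (i + t) * g (i - t) = co (i + t) * g (i - t)"
    proof (cases "i + t = - M")
      case True then show ?thesis using M_even by (simp add: a_def co_def)
    next
      case False then show ?thesis using t by (simp add: a_def)
    qed
  qed simp
  also have "\<dots> = (\<Sum>k\<in>{0..<2 * M}. co (k - M) * g (2 * i + M - k))"
    by (rule sum.reindex_bij_witness[of _ "\<lambda>k. k - M - i" "\<lambda>t. t + M + i"]) (auto simp: algebra_simps)
  also have "\<dots> = (\<Sum>k\<in>{0..<2 * M}. co (2 * i - k - M) * g (2 * i + M - (2 * i - k)))"
  proof (rule sum_periodic_reflect[symmetric])
    fix k
    have e: "k + 2 * M - M = k - M + 2 * M" by simp
    have "2 * i + M - k = 2 * i + M - (k + 2 * M) + 2 * M" by simp
    then have "g (2 * i + M - k) = g (2 * i + M - (k + 2 * M))" by (simp only: g_periodic)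
    then show "co (k + 2 * M - M) * g (2 * i + M - (k + 2 * M)) = co (k - M) * g (2 * i + M - k)"
      unfolding e co_periodic by simp
  qed (use M_pos in simp)
  also have "\<dots> = (\<Sum>k\<in>{0..<2 * M}. co (2 * i - M - k) * g (M + k))"
    by (intro sum.cong refl) (simp add: algebra_simps)
  finally show ?thesis .
qed

text \<open>The values \<open>f (M + k)\<close> are symmetric under k -> 2M - k, so the unknowns
  with \<open>0 < k < M\<close> suffice.\<close>

lemma T_split_full:
  "(\<Sum>k\<in>{0..<2 * M}. co (2 * i - M - k) * g (M + k)) =
    (\<Sum>k\<in>{1..<M}. f (M + k) * (c (2 * i + M - k) + c (2 * i + M + k)))"
proof -
  let ?h = "\<lambda>k. co (2 * i - M - k) * f (M + k)"
  have "(\<Sum>k\<in>{0..<2 * M}. co (2 * i - M - k) * g (M + k)) = (\<Sum>k\<in>{0..<2 * M}. ?h k)"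
    by (intro sum.cong refl) (simp add: g_def)
  also have "\<dots> = sum ?h ({0} \<union> {1..<M} \<union> {M} \<union> {M + 1..<2 * M})"
    by (rule arg_cong[where f = "sum ?h"]) (use M_pos in auto)
  also have "\<dots> = ?h 0 + sum ?h {1..<M} + ?h M + sum ?h {M + 1..<2 * M}"
    using M_pos by (simp add: sum.union_disjoint)
  also have "sum ?h {M + 1..<2 * M} = (\<Sum>k\<in>{1..<M}. ?h (2 * M - k))"
    by (rule sum.reindex_bij_witness[of _ "\<lambda>k. 2 * M - k" "\<lambda>k. 2 * M - k"]) auto
  also have "?h M = 0" using f_even[of "M + M"] by simp
  also have "?h 0 = 0" using f_even[of "M + 0"] M_even by simp
  also have "0 + sum ?h {1..<M} + 0 + (\<Sum>k\<in>{1..<M}. ?h (2 * M - k)) = (\<Sum>k\<in>{1..<M}. ?h k + ?h (2 * M - k))"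
    by (simp add: sum.distrib)
  also have "\<dots> = (\<Sum>k\<in>{1..<M}. f (M + k) * (c (2 * i + M - k) + c (2 * i + M + k)))"
  proof (rule sum.cong[OF refl])
    fix k
    have "2 * i + M - k = 2 * i - M - k + 2 * M" by simp
    then have 1: "co (2 * i - M - k) = co (2 * i + M - k)" by (simp only: co_periodic)
    have "2 * i + M + k = (2 * i - M - (2 * M - k) + 2 * M) + 2 * M" by simp
    then have 2: "co (2 * i - M - (2 * M - k)) = co (2 * i + M + k)" by (simp only: co_periodic)
    have "M + (2 * M - k) = - (M + k) + 4 * M" by simp
    then have 3: "f (M + (2 * M - k)) = f (M + k)" by (simp only: f_periodic)
    show "?h k + ?h (2 * M - k) = f (M + k) * (c (2 * i + M - k) + c (2 * i + M + k))"
      unfolding 1 2 3 using M_even f_even[of "M + k"] by (cases "even k") (simp_all add: co_def algebra_simps)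
  qed
  finally show ?thesis .
qed

text \<open>The point of the splitting: given \<open>c\<close>, the quadratic expression
  \<open>T i\<close> is affine in the unknown parities \<open>f (M + k)\<close>.\<close>

lemma T_split:
  assumes i: "0 < i" "i < M"
  shows "of_int (T i) = f (M + i) + a i * g i + (\<Sum>k\<in>{1..<M}. f (M + k) * (c (2 * i + M - k) + c (2 * i + M + k)))
    + (\<Sum>t\<in>{1..<M - i}. co (i + t) * co (i - t))"
proof -
  let ?x = "\<Sum>t\<in>{1..<2 * M}. a (i + t) * g (i - t) + a (i + - t) * g (i - - t)"
  have x: "(\<Sum>k\<in>{1..<M}. f (M + k) * (c (2 * i + M - k) + c (2 * i + M + k))) = a i * g i + ?x"
    using sum_both_sides[of "2 * M" "\<lambda>t. a (i + t) * g (i - t)"] M_pos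
    unfolding T_split_window[OF i] T_split_full by simp
  have "of_int (T i) = (\<Sum>t\<in>{1..<2 * M}. f (i + t) * f (i - t))" by (simp add: T_def f_def)
  also have "\<dots> = (\<Sum>t\<in>{1..<2 * M}. g (i + t) * g (i - t)
      + (a (i + t) * g (i - t) + a (i + - t) * g (i - - t)) + a (i + t) * a (i - t))"
  proof (rule sum.cong[OF refl])
    fix t assume "t \<in> {1..<2 * M}"
    then have "f (i + t) = g (i + t) + a (i + t)" "f (i - t) = g (i - t) + a (i - t)"
      using i by (intro f_split; simp)+
    then show "f (i + t) * f (i - t) = g (i + t) * g (i - t)
        + (a (i + t) * g (i - t) + a (i + - t) * g (i - - t)) + a (i + t) * a (i - t)"
      by (simp add: distrib_left distrib_right add_ac mult.commute)
  qed
  also have "\<dots> = f (M + i) + ?x + (\<Sum>t\<in>{1..<M - i}. co (i + t) * co (i - t))"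
    unfolding sum.distrib T_split_gg[OF i] T_split_aa[OF i] ..
  finally show ?thesis unfolding x by (simp add: add_ac)
qed

text \<open>The rows of the linear system over \<open>\<int>/2\<close> that links \<open>C div 2\<close> to \<open>F\<close>, given \<open>C mod 2\<close>.\<close>

lemma linear_row_even:
  assumes "0 < 2 * h" "2 * h < M"
  shows "s (2 * h) + (\<Sum>k\<in>{1..<M}. f (M + k) * (c (2 * (2 * h) + M - k) + c (2 * (2 * h) + M + k))) =
    c h * c (2 * h) + (\<Sum>t\<in>{1..<M}. c (h + t) * c (h - t)) + (\<Sum>t\<in>{1..<M - 2 * h}. co (2 * h + t) * co (2 * h - t))"
proof -
  have "f (M + 2 * h) = 0" "a (2 * h) = 0" using f_even M_even by (simp_all add: a_def co_def)
  then show ?thesis unfolding row_even T_split[OF assms] by (simp add: add_ac)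
qed

lemma linear_row_odd:
  assumes "i = 2 * h + 1" "0 < i" "i < M"
  shows "s i + (f (M + i) + (\<Sum>k\<in>{1..<M}. f (M + k) * (c (2 * i + M - k) + c (2 * i + M + k)))) =
    (\<Sum>t\<in>{1..M}. c (h + t) * c (h + 1 - t)) + (\<Sum>t\<in>{1..<M - i}. co (i + t) * co (i - t))"
proof -
  have "a i = c i" using assms by (simp add: a_def co_def)
  moreover have "g i = f (i + 2 * M)"
  proof -
    have "(i - M + 1 * (2 * M)) mod (2 * M) = i - M + 1 * (2 * M)"
      using assms by (intro mod_pos_pos_trivial) auto
    then have "(i - M) mod (2 * M) = i + M" by (simp only: mod_mult_self1)
    then show ?thesis by (simp add: g_def algebra_simps)
  qed
  ultimately show ?thesis unfolding row_odd[OF assms(1)] T_split[OF assms(2,3)] by (simp add: add_ac)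
qed

end


subsection \<open>The search program\<close>

text \<open>The functions below are evaluated by rewriting only. They pass large constants as arguments and
  branch by pattern matching, since the simplifier would normalise the arguments of a conditional anew.\<close>

fun and_bool :: "bool \<Rightarrow> bool \<Rightarrow> bool" where
  "and_bool True b = b"
| "and_bool False b = False"

fun xor_bool :: "bool \<Rightarrow> bool \<Rightarrow> bool" where
  "xor_bool True True = False"
| "xor_bool True False = True"
| "xor_bool False b = b"

fun xor_list :: "bool list \<Rightarrow> bool list \<Rightarrow> bool list" where
  "xor_list (True # xs) (True # ys) = False # xor_list xs ys"
| "xor_list (True # xs) (False # ys) = True # xor_list xs ys"
| "xor_list (False # xs) (y # ys) = y # xor_list xs ys"
| "xor_list xs [] = []"
| "xor_list [] ys = []"

fun dot :: "bool list \<Rightarrow> bool list \<Rightarrow> bool" where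
  "dot (True # xs) (True # ys) = (\<not> dot xs ys)"
| "dot (True # xs) (False # ys) = dot xs ys"
| "dot (False # xs) (y # ys) = dot xs ys"
| "dot xs [] = False"
| "dot [] ys = False"

fun take_by :: "'a list \<Rightarrow> 'b list \<Rightarrow> 'b list" where
  "take_by (t # ts) (x # xs) = x # take_by ts xs"
| "take_by ts [] = []"
| "take_by [] xs = []"

fun skip :: "nat \<Rightarrow> 'a list \<Rightarrow> 'a list" where
  "skip 0 xs = xs"
| "skip (Suc n) [] = []"
| "skip (Suc n) (x # xs) = skip n xs"

fun rev_onto :: "'a list \<Rightarrow> 'a list \<Rightarrow> 'a list" where
  "rev_onto [] ys = ys"
| "rev_onto (x # xs) ys = rev_onto xs (x # ys)"

fun back_onto :: "nat \<Rightarrow> 'a list \<Rightarrow> 'a list \<Rightarrow> 'a list" where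
  "back_onto 0 xs ys = ys"
| "back_onto (Suc n) [] ys = ys"
| "back_onto (Suc n) (x # xs) ys = back_onto n xs (x # ys)"

fun head :: "bool list \<Rightarrow> bool" where
  "head (x # xs) = x"
| "head [] = False"

fun flip_nth :: "nat \<Rightarrow> bool list \<Rightarrow> bool list" where
  "flip_nth n [] = []"
| "flip_nth 0 (x # xs) = xor_bool True x # xs"
| "flip_nth (Suc n) (x # xs) = x # flip_nth n xs"

fun double :: "nat \<Rightarrow> nat" where
  "double 0 = 0"
| "double (Suc n) = Suc (Suc (double n))"

text \<open>Gaussian elimination over \<open>\<int>/2\<close>; a row \<open>r\<close> stands for the equation \<open>\<not> dot r x\<close>.\<close>

fun pivot :: "bool list list \<Rightarrow> bool list option" where
  "pivot [] = None"
| "pivot ((True # r) # rs) = Some r"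
| "pivot ((False # r) # rs) = pivot rs"
| "pivot ([] # rs) = pivot rs"

fun reduce :: "bool list option \<Rightarrow> bool list list \<Rightarrow> bool list list" where
  "reduce p [] = []"
| "reduce p ([] # rs) = reduce p rs"
| "reduce p ((False # q) # rs) = q # reduce p rs"
| "reduce (Some r) ((True # q) # rs) = xor_list r q # reduce (Some r) rs"
| "reduce None ((True # q) # rs) = q # reduce None rs"

fun drop_columns :: "'a list \<Rightarrow> bool list list \<Rightarrow> bool list list" where
  "drop_columns [] eqs = eqs"
| "drop_columns (t # ts) eqs = drop_columns ts (reduce (pivot eqs) eqs)"

text \<open>A pivot row expresses its unknown through those that come later. The accumulator
  reverses the order, so \<open>search\<close> starts with the last unknown, and a forced bit is a
  product of the pivot row with the bits already chosen. The entry \<open>True\<close> at the bottom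
  of the history stands for the constant 1.\<close>

fun solve_columns :: "'a list \<Rightarrow> bool list list \<Rightarrow> ('a \<times> bool list option) list \<Rightarrow> ('a \<times> bool list option) list" where
  "solve_columns [] eqs acc = acc"
| "solve_columns (c # cs) eqs acc = solve_columns cs (reduce (pivot eqs) eqs) ((c, pivot eqs) # acc)"

text \<open>A cell \<open>(p, u, n)\<close> describes an unknown coefficient of parity \<open>p\<close>, with the residues modulo 257
  of its multiplier (\<open>u\<close>) and of the negated multiplier (\<open>n\<close>) under several embeddings; \<open>None\<close> marks
  a coefficient known to be positive. A state \<open>(h, r, vs)\<close> records the bits \<open>coefficient div 2\<close>
  chosen so far, the remaining budget, and the multipliers to be added up.\<close>

type_synonym cell = "bool \<times> int list \<times> int list option"
type_synonym state = "bool list \<times> nat \<times> int list list"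

fun sub4 :: "nat option \<Rightarrow> nat option" where
  "sub4 (Some (Suc (Suc (Suc (Suc n))))) = Some n"
| "sub4 _ = None"

fun push3 :: "nat option \<Rightarrow> bool list \<Rightarrow> int list \<Rightarrow> int list list \<Rightarrow> state list \<Rightarrow> state list" where
  "push3 None h u vs acc = acc"
| "push3 (Some r) h u vs acc = (h, r, u # u # u # vs) # acc"

fun push2 :: "nat option \<Rightarrow> bool list \<Rightarrow> int list \<Rightarrow> int list list \<Rightarrow> state list \<Rightarrow> state list" where
  "push2 None h u vs acc = acc"
| "push2 (Some r) h u vs acc = (h, r, u # u # vs) # acc"

text \<open>The bit is the parity of \<open>z div 2\<close>: for odd parity, \<open>False\<close>
  means 1 or -3 and \<open>True\<close> means -1 or 3; for even parity, \<open>False\<close> means 0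
  and \<open>True\<close> means 2 or -2. The values of size 2 and 3 cost 4 and 8 of the
  budget.\<close>

fun branch_False :: "cell \<Rightarrow> state \<Rightarrow> state list \<Rightarrow> state list" where
  "branch_False (True, u, None) (h, r, vs) acc = (False # h, r, u # vs) # acc"
| "branch_False (True, u, Some n) (h, r, vs) acc =
     (False # h, r, u # vs) # push3 (sub4 (sub4 (Some r))) (False # h) n vs acc"
| "branch_False (False, u, None) (h, r, vs) acc = acc"
| "branch_False (False, u, Some n) (h, r, vs) acc = (False # h, r, vs) # acc"

fun branch_True :: "cell \<Rightarrow> state \<Rightarrow> state list \<Rightarrow> state list" where
  "branch_True (True, u, None) (h, r, vs) acc = push3 (sub4 (sub4 (Some r))) (True # h) u vs acc"
| "branch_True (True, u, Some n) (h, r, vs) acc =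
     (True # h, r, n # vs) # push3 (sub4 (sub4 (Some r))) (True # h) u vs acc"
| "branch_True (False, u, None) (h, r, vs) acc = push2 (sub4 (Some r)) (True # h) u vs acc"
| "branch_True (False, u, Some n) (h, r, vs) acc =
     push2 (sub4 (Some r)) (True # h) u vs (push2 (sub4 (Some r)) (True # h) n vs acc)"

fun branch :: "bool option \<Rightarrow> cell \<Rightarrow> state \<Rightarrow> state list \<Rightarrow> state list" where
  "branch None c s acc = branch_False c s (branch_True c s acc)"
| "branch (Some True) c s acc = branch_True c s acc"
| "branch (Some False) c s acc = branch_False c s acc"

fun forced :: "bool list option \<Rightarrow> state \<Rightarrow> bool option" where
  "forced None s = None"
| "forced (Some q) (h, r, vs) = Some (dot q h)"

fun step :: "cell \<Rightarrow> bool list option \<Rightarrow> state list \<Rightarrow> state list" where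
  "step c q [] = []"
| "step c q (s # st) = branch (forced q s) c s (step c q st)"

fun search :: "(cell \<times> bool list option) list \<Rightarrow> state list \<Rightarrow> state list" where
  "search [] st = st"
| "search ((c, q) # cs) st = search cs (step c q st)"

text \<open>A set of positive numerals, addressed by binary digits from the lowest one, so that
  lookup rewrites directly on the constructors of \<open>num\<close>.\<close>

datatype bit_tree = Node bool bit_tree bit_tree | Leaf

fun lookup :: "bit_tree \<Rightarrow> num \<Rightarrow> bool" where
  "lookup (Node b l r) num.One = b"
| "lookup (Node b l r) (num.Bit0 n) = lookup l n"
| "lookup (Node b l r) (num.Bit1 n) = lookup r n"
| "lookup Leaf n = False"

definition lookup_int :: "bit_tree \<Rightarrow> int \<Rightarrow> bool" where
  "lookup_int t k = (k > 0 \<and> lookup t (num_of_nat (nat k)))"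

lemma lookup_int_code [code]:
  "lookup_int t (Int.Pos n) = lookup t n" "lookup_int t (Int.Neg n) = False" "lookup_int t 0 = False"
  by (simp_all add: lookup_int_def numeral_num_of_nat num_of_nat_numeral_eq)

fun sum_heads :: "int list list \<Rightarrow> int \<Rightarrow> int" where
  "sum_heads [] a = a"
| "sum_heads ((x # xs) # ls) a = sum_heads ls (x + a)"
| "sum_heads ([] # ls) a = sum_heads ls a"

fun tails :: "int list list \<Rightarrow> int list list" where
  "tails [] = []"
| "tails ((x # xs) # ls) = xs # tails ls"
| "tails ([] # ls) = [] # tails ls"

text \<open>The embeddings are tried in turn; \<open>a\<close> is the constant coefficient, and the
  flag holds the verdict of the previous embedding.\<close>

fun refuted :: "bit_tree \<Rightarrow> 'a list \<Rightarrow> bool \<Rightarrow> int \<Rightarrow> int list list \<Rightarrow> bool" where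
  "refuted t fs True a vs = True"
| "refuted t [] False a vs = False"
| "refuted t (f # fs) False a vs = refuted t fs (lookup_int t (sum_heads vs a mod 257)) a (tails vs)"

text \<open>The constant coefficient \<open>a\<close> costs \<open>(a\<^sup>2 + a) / 2\<close>, hence \<open>a \<in> {0, -2, 2, -4, 4}\<close>.\<close>

fun leaf3 :: "bit_tree \<Rightarrow> 'a list \<Rightarrow> nat \<Rightarrow> int list list \<Rightarrow> bool" where
  "leaf3 t fs (Suc (Suc (Suc (Suc n)))) vs = refuted t fs False 4 vs"
| "leaf3 t fs _ vs = True"

fun leaf2 :: "bit_tree \<Rightarrow> 'a list \<Rightarrow> nat \<Rightarrow> int list list \<Rightarrow> bool" where
  "leaf2 t fs (Suc (Suc (Suc n))) vs = and_bool (refuted t fs False (- 4) vs) (leaf3 t fs n vs)"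
| "leaf2 t fs _ vs = True"

fun leaf1 :: "bit_tree \<Rightarrow> 'a list \<Rightarrow> nat \<Rightarrow> int list list \<Rightarrow> bool" where
  "leaf1 t fs (Suc (Suc (Suc n))) vs = and_bool (refuted t fs False 2 vs) (leaf2 t fs n vs)"
| "leaf1 t fs _ vs = True"

fun leaves :: "bit_tree \<Rightarrow> 'a list \<Rightarrow> state list \<Rightarrow> bool" where
  "leaves t fs [] = True"
| "leaves t fs ((h, r, vs) # st) = and_bool (refuted t fs False 0 vs)
     (and_bool (refuted t fs False (- 2) vs) (and_bool (leaf1 t fs r vs) (leaves t fs st)))"

text \<open>Below \<open>N\<close> lists the parities of \<open>C 1, C 2, \<dots>\<close>, \<open>W\<close> those of \<open>C 1, C 3, \<dots>\<close>, \<open>E\<close> those of a whole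
  period \<open>C 0, C 1, \<dots>\<close>, and \<open>RW\<close>, \<open>G\<close> those of \<open>C (M + 1), C (M + 3), \<dots>\<close>.\<close>

fun rhs_even :: "nat \<Rightarrow> bool list \<Rightarrow> bool list \<Rightarrow> bool list \<Rightarrow> bool \<Rightarrow> bool" where
  "rhs_even h N E W p = xor_bool (and_bool p (head (skip h E)))
     (xor_bool (dot (take_by N (skip (Suc h) E)) (back_onto h E (tl E))) (dot (skip h W) (back_onto h W W)))"

fun rhs_odd :: "nat \<Rightarrow> bool list \<Rightarrow> bool list \<Rightarrow> bool list \<Rightarrow> bool" where
  "rhs_odd h N E W = xor_bool (dot (take_by (False # N) (skip (Suc h) E)) (back_onto (Suc h) E (tl E)))
     (dot (skip (Suc h) W) (back_onto h W W))"

text \<open>The coefficients \<open>c (2 * i + M - k) + c (2 * i + M + k)\<close> of the unknowns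
  \<open>f (M + k)\<close> for k = 1, 3, 5, and so on.\<close>

fun lhs_row :: "nat \<Rightarrow> bool list \<Rightarrow> bool list \<Rightarrow> bool list \<Rightarrow> bool list" where
  "lhs_row i W RW G = take_by W (xor_list (skip i G) (back_onto i G RW))"

type_synonym row = "cell \<times> bool list \<times> bool"
type_synonym entry = "int list \<times> int list option"

fun even_rows :: "nat \<Rightarrow> bool list \<Rightarrow> entry list \<Rightarrow> bool list \<Rightarrow> bool list \<Rightarrow> bool list \<Rightarrow> bool list \<Rightarrow> bool list \<Rightarrow> row list \<Rightarrow> row list" where
  "even_rows h (p # ps) (u # us) N E W RW G acc =
     ((p, u), lhs_row (double h) W RW G, rhs_even h N E W p) # even_rows (Suc h) ps us N E W RW G acc"
| "even_rows h [] us N E W RW G acc = acc"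
| "even_rows h (p # ps) [] N E W RW G acc = acc"

fun odd_rows :: "nat \<Rightarrow> bool list \<Rightarrow> entry list \<Rightarrow> bool list \<Rightarrow> bool list \<Rightarrow> bool list \<Rightarrow> bool list \<Rightarrow> bool list \<Rightarrow> row list" where
  "odd_rows h (p # ps) (u # us) N E W RW G =
     ((p, u), flip_nth h (lhs_row (Suc (double h)) W RW G), rhs_odd h N E W) # odd_rows (Suc h) ps us N E W RW G"
| "odd_rows h [] us N E W RW G = []"
| "odd_rows h (p # ps) [] N E W RW G = []"

fun filter_even :: "row list \<Rightarrow> row list \<Rightarrow> row list" where
  "filter_even [] acc = acc"
| "filter_even (((True, u), w, s) # rs) acc = filter_even rs acc"
| "filter_even (((False, u), w, s) # rs) acc = filter_even rs (((False, u), w, s) # acc)"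

fun filter_odd :: "row list \<Rightarrow> row list \<Rightarrow> row list" where
  "filter_odd [] acc = acc"
| "filter_odd (((False, u), w, s) # rs) acc = filter_odd rs acc"
| "filter_odd (((True, u), w, s) # rs) acc = filter_odd rs (((True, u), w, s) # acc)"

fun cells :: "row list \<Rightarrow> cell list" where
  "cells [] = []"
| "cells ((c, w, s) # rs) = c # cells rs"

fun zeros :: "'a list \<Rightarrow> bool list \<Rightarrow> bool list" where
  "zeros [] acc = acc"
| "zeros (x # xs) acc = False # zeros xs acc"

text \<open>Each row consists of the coefficients of the unknowns from F, an identity block for the
  digits of C, and the right hand side as coefficient of the constant 1.\<close>

fun system :: "row list \<Rightarrow> bool list \<Rightarrow> bool list list" where
  "system [] pre = []"
| "system ((c, w, s) # rs) pre = (w @ (pre @ (True # zeros rs [s]))) # system rs (False # pre)"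

fun solve_rows :: "bit_tree \<Rightarrow> 'a list \<Rightarrow> bool list \<Rightarrow> row list \<Rightarrow> nat \<Rightarrow> bool" where
  "solve_rows t fs W rs r =
     leaves t fs (search (solve_columns (cells rs) (drop_columns W (system rs [])) []) [([True], r, [])])"

text \<open>Does a relation fail between rows whose unknowns vanish when the budget is below 4? Here \<open>h\<close> and
  \<open>k\<close> run through the pairs with \<open>h + k = M / 2\<close>, for which the left hand sides agree.\<close>

fun violated :: "bool \<Rightarrow> 'a list \<Rightarrow> nat \<Rightarrow> nat \<Rightarrow> bool list \<Rightarrow> bool list \<Rightarrow> bool list \<Rightarrow> bool list \<Rightarrow> bool list \<Rightarrow> bool" where
  "violated True ts h k ps qs N E W = True"
| "violated False [] h k (False # ps) qs N E W = rhs_even h N E W False"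
| "violated False (t # ts) h (Suc k) (False # ps) (False # qs) N E W =
     violated (xor_bool (rhs_even h N E W False) (rhs_even (Suc k) N E W False)) ts (Suc h) k ps qs N E W"
| "violated False (t # ts) h (Suc k) (p # ps) (q # qs) N E W = violated False ts (Suc h) k ps qs N E W"
| "violated False ts h k ps qs N E W = False"

fun skip_word :: "'a list \<Rightarrow> nat \<Rightarrow> nat \<Rightarrow> bool list \<Rightarrow> bool list \<Rightarrow> bool list \<Rightarrow> bool list \<Rightarrow> bool" where
  "skip_word ts k (Suc (Suc (Suc (Suc r)))) Ne N E W = False"
| "skip_word ts k r Ne N E W = violated False ts (Suc 0) k Ne (rev_onto Ne []) N E W"

type_synonym params = "bit_tree \<times> bool list \<times> entry list \<times> entry list \<times> bool list \<times> nat"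

text \<open>Odd coefficients come first and are eliminated first. The search thus begins with the
  even ones, where every nonzero choice costs budget, and pivots found for the odd ones force their
  signs.\<close>

fun arrange :: "row list \<Rightarrow> row list" where
  "arrange rs = filter_odd rs (filter_even rs [])"

fun solve_word :: "bool \<Rightarrow> params \<Rightarrow> bool list \<Rightarrow> bool list \<Rightarrow> bool list \<Rightarrow> bool list \<Rightarrow> nat \<Rightarrow> bool" where
  "solve_word True p Ne N E W r = True"
| "solve_word False (t, fs, te, to, ts, k) Ne N E W r = solve_rows t fs W
     (arrange (even_rows (Suc 0) Ne te N E W (rev_onto W []) (rev_onto W (W @ rev_onto W []))
       (odd_rows 0 W to N E W (rev_onto W []) (rev_onto W (W @ rev_onto W []))))) r"

fun check_word2 :: "params \<Rightarrow> bool list \<Rightarrow> bool list \<Rightarrow> bool list \<Rightarrow> bool list \<Rightarrow> nat \<Rightarrow> bool" where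
  "check_word2 (t, fs, te, to, ts, k) Ne N E W r =
     solve_word (skip_word ts k r Ne N E W) (t, fs, te, to, ts, k) Ne N E W r"

fun evens :: "'a list \<Rightarrow> 'a list" where
  "evens (x # y # xs) = y # evens xs"
| "evens xs = []"

fun odds :: "'a list \<Rightarrow> 'a list" where
  "odds (x # y # xs) = x # odds xs"
| "odds xs = xs"

fun check_word :: "params \<Rightarrow> bool list \<Rightarrow> bool list \<Rightarrow> nat \<Rightarrow> bool" where
  "check_word p W N r = check_word2 p (evens N) N (False # (N @ (False # rev_onto N []))) W r"

type_synonym word = "bool list \<times> bool list \<times> nat"

fun check_words :: "params \<Rightarrow> word list \<Rightarrow> bool" where
  "check_words p [] = True"
| "check_words p ((W, N, r) # st) = and_bool (check_word p W N r) (check_words p st)"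

fun interleave :: "bool list \<Rightarrow> bool list \<Rightarrow> bool list" where
  "interleave (x # xs) (y # ys) = x # y # interleave xs ys"
| "interleave xs [] = xs"
| "interleave [] ys = []"

fun sub1 :: "nat option \<Rightarrow> nat option" where
  "sub1 (Some (Suc n)) = Some n"
| "sub1 _ = None"

fun push_word :: "bool list \<Rightarrow> bool list \<Rightarrow> nat \<Rightarrow> word list \<Rightarrow> word list" where
  "push_word W N r acc = (W, interleave W N, r) # acc"

text \<open>The parities at the odd multiples of \<open>2 ^ e\<close> are \<open>qs @ rev (map2 (\<noteq>) qs ws)\<close> for some \<open>qs\<close> if
  those at the odd multiples of \<open>2 ^ (e + 1)\<close> are \<open>ws\<close>.\<close>

fun words_below :: "bool list \<Rightarrow> bool list \<Rightarrow> bool list \<Rightarrow> bool list \<Rightarrow> nat option \<Rightarrow> word list \<Rightarrow> word list" where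
  "words_below ws qa xa N None acc = acc"
| "words_below [] qa xa N (Some r) acc = push_word (rev_onto qa xa) N r acc"
| "words_below (False # ws) qa xa N (Some r) acc =
     words_below ws (False # qa) (False # xa) N (Some r)
       (words_below ws (True # qa) (True # xa) N (sub1 (sub1 (Some r))) acc)"
| "words_below (True # ws) qa xa N (Some r) acc =
     words_below ws (True # qa) (False # xa) N (sub1 (Some r))
       (words_below ws (False # qa) (True # xa) N (sub1 (Some r)) acc)"

fun all_False :: "bool list \<Rightarrow> bool" where
  "all_False [] = True"
| "all_False (True # xs) = False"
| "all_False (False # xs) = all_False xs"

text \<open>By the normalization, the first parity of a level is odd unless the whole level is even;
  the latter requires the coarser level to be even as well.\<close>

fun expand1 :: "bool \<Rightarrow> word \<Rightarrow> word list \<Rightarrow> word list" where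
  "expand1 z (True # ws, N, r) acc = words_below ws [True] [False] N (sub1 (Some r)) acc"
| "expand1 False (False # ws, N, r) acc = words_below ws [True] [True] N (sub1 (sub1 (Some r))) acc"
| "expand1 True (False # ws, N, r) acc =
     push_word (False # ws @ (False # ws)) N r (words_below ws [True] [True] N (sub1 (sub1 (Some r))) acc)"
| "expand1 z ([], N, r) acc = acc"

fun expand :: "word list \<Rightarrow> word list" where
  "expand [] = []"
| "expand ((W, N, r) # st) = expand1 (all_False W) (W, N, r) (expand st)"

fun expands :: "bool list \<Rightarrow> word list \<Rightarrow> word list" where
  "expands [] st = st"
| "expands (x # xs) st = expands xs (expand st)"

text \<open>The multipliers satisfy the Chebyshev recurrence \<open>u (j + 1) = u 1 * u j - u (j - 1)\<close>.\<close>

fun chebyshev :: "int list \<Rightarrow> int list \<Rightarrow> int list \<Rightarrow> int list" where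
  "chebyshev (u # us) (b # bs) (a # as) = (u * b - a) mod 257 # chebyshev us bs as"
| "chebyshev _ _ _ = []"

fun multipliers :: "'a list \<Rightarrow> int list \<Rightarrow> int list \<Rightarrow> int list \<Rightarrow> int list list" where
  "multipliers [] us a b = []"
| "multipliers (t # ts) us a b = b # multipliers ts us b (chebyshev us b a)"

fun negatives :: "int list \<Rightarrow> int list" where
  "negatives [] = []"
| "negatives (x # xs) = (257 - x) # negatives xs"

fun entries :: "int list list \<Rightarrow> entry list" where
  "entries [] = []"
| "entries (b # bs) = (b, Some (negatives b)) # entries bs"

fun first_positive :: "entry list \<Rightarrow> entry list" where
  "first_positive [] = []"
| "first_positive ((b, n) # es) = (b, None) # es"

fun all_twos :: "int list \<Rightarrow> int list" where
  "all_twos [] = []"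
| "all_twos (x # xs) = 2 # all_twos xs"

fun make_params :: "bit_tree \<Rightarrow> bool list \<Rightarrow> bool list \<Rightarrow> nat \<Rightarrow> entry list \<Rightarrow> params" where
  "make_params t fs ts k es = (t, fs, evens es, odds es, ts, k)"

text \<open>The lists \<open>fs\<close>, \<open>js\<close>, \<open>es\<close> and \<open>ts\<close>
  only count, in unary: embeddings, coefficients, levels to descend, and pairs of rows.\<close>

fun run :: "bit_tree \<Rightarrow> int list \<Rightarrow> bool list \<Rightarrow> bool list \<Rightarrow> bool list \<Rightarrow> bool list \<Rightarrow> nat \<Rightarrow> word list \<Rightarrow> bool" where
  "run t us fs js es ts k st = check_words
     (make_params t fs ts k (first_positive (entries (multipliers js us (all_twos us) us)))) (expands es st)"


subsection \<open>Soundness of the search\<close>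

abbreviation bb :: "bool \<Rightarrow> bit" where "bb \<equiv> of_bool"

lemma and_bool_iff [simp]: "and_bool a b \<longleftrightarrow> a \<and> b"
  by (cases a; cases b) simp_all

lemma xor_bool_iff [simp]: "xor_bool a b \<longleftrightarrow> a \<noteq> b"
  by (cases a; cases b) simp_all

lemma bb_not [simp]: "bb (\<not> a) = 1 + bb a"
  by (cases a) simp_all

lemma bb_neq: "bb (a \<noteq> b) = bb a + bb b"
  by (cases a; cases b) simp_all

lemma bb_conj: "bb (a \<and> b) = bb a * bb b"
  by (cases a; cases b) simp_all

lemma bb_inject: "bb a = bb b \<longleftrightarrow> a = b"
  by (cases a; cases b) simp_all

lemma bb_odd: "bb (odd k) = of_int k"
  by (cases "even k") (auto elim!: evenE oddE)

lemma xor_list_eq: "xor_list xs ys = map2 (\<noteq>) xs ys"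
  by (induction xs ys rule: xor_list.induct) auto

lemma take_by_eq: "take_by ts xs = take (length ts) xs"
  by (induction ts xs rule: take_by.induct) auto

lemma skip_eq: "skip n xs = drop n xs"
  by (induction n xs rule: skip.induct) auto

lemma rev_onto_eq: "rev_onto xs ys = rev xs @ ys"
  by (induction xs ys rule: rev_onto.induct) auto

lemma back_onto_eq: "back_onto n xs ys = rev (take n xs) @ ys"
  by (induction n xs ys rule: back_onto.induct) auto

lemma double_eq: "double n = 2 * n"
  by (induction n) auto

lemma zeros_eq: "zeros xs acc = replicate (length xs) False @ acc"
  by (induction xs) auto

lemma head_eq: "0 < length xs \<Longrightarrow> head xs = xs ! 0"
  by (cases xs) auto

lemma length_flip_nth [simp]: "length (flip_nth n xs) = length xs"
  by (induction n xs rule: flip_nth.induct) auto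

lemma nth_flip_nth: "i < length xs \<Longrightarrow> flip_nth n xs ! i = (if i = n then \<not> xs ! i else xs ! i)"
proof (induction n xs arbitrary: i rule: flip_nth.induct)
  case (2 x xs) then show ?case by (cases i) auto
next
  case (3 n x xs) then show ?case by (cases i) auto
qed simp

lemma length_evens: "length (evens xs) = length xs div 2"
  and length_odds: "length (odds xs) = (length xs + 1) div 2"
  by (induction xs rule: evens.induct) auto

lemma nth_evens: "2 * i + 1 < length xs \<Longrightarrow> evens xs ! i = xs ! (2 * i + 1)"
proof (induction xs arbitrary: i rule: evens.induct)
  case (1 x y xs) then show ?case by (cases i) auto
qed auto

lemma nth_odds: "2 * i < length xs \<Longrightarrow> odds xs ! i = xs ! (2 * i)"
proof (induction xs arbitrary: i rule: odds.induct)
  case (1 x y xs) then show ?case by (cases i) auto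
qed auto

lemma bb_dot: "length xs \<le> length ys \<Longrightarrow> bb (dot xs ys) = (\<Sum>t<length xs. bb (xs ! t) * bb (ys ! t))"
  by (induction xs ys rule: dot.induct) (simp_all add: sum.lessThan_Suc_shift del: sum.lessThan_Suc)

lemma dot_xor_list:
  "length r = length q \<Longrightarrow> length q = length x \<Longrightarrow> dot (xor_list r q) x \<longleftrightarrow> dot r x \<noteq> dot q x"
proof (induction r q x rule: list_induct3)
  case (Cons a r b q v x)
  then show ?case by (cases a; cases b; cases v) auto
qed simp

lemma dot_append:
  "length xs = length us \<Longrightarrow> dot (xs @ ys) (us @ vs) \<longleftrightarrow> dot xs us \<noteq> dot ys vs"
proof (induction xs us rule: list_induct2)
  case (Cons x xs u us)
  then show ?case by (cases x; cases u) auto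
qed simp

lemma dot_zeros: "dot (replicate n False @ xs) ys \<longleftrightarrow> dot xs (drop n ys)"
proof (induction n arbitrary: ys)
  case (Suc n) then show ?case by (cases ys) auto
qed simp

definition sat :: "bool list \<Rightarrow> bool list list \<Rightarrow> bool" where
  "sat x eqs \<longleftrightarrow> (\<forall>r\<in>set eqs. length r = length x \<and> \<not> dot r x)"

lemma pivot_Some: "pivot eqs = Some r \<Longrightarrow> True # r \<in> set eqs"
  by (induction eqs rule: pivot.induct) auto

lemma pivot_None: "pivot eqs = None \<Longrightarrow> True # q \<notin> set eqs"
  by (induction eqs rule: pivot.induct) auto

lemma sat_simps [simp]:
  "sat x []" "sat x (r # rs) \<longleftrightarrow> length r = length x \<and> \<not> dot r x \<and> sat x rs"
  by (simp_all add: sat_def)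

lemma dot_False_Cons [simp]: "dot (False # q) (v # x) = dot q x"
  and dot_True_Cons [simp]: "dot (True # q) (v # x) \<longleftrightarrow> dot q x \<noteq> v"
  by (cases v; simp)+

lemma reduce_sat_Some:
  assumes "length r = length x" "v = dot r x"
  shows "sat (v # x) eqs \<Longrightarrow> sat x (reduce (Some r) eqs)"
proof (induction eqs)
  case (Cons e es)
  then obtain b q where e: "e = b # q" by (cases e) auto
  show ?case
  proof (cases b)
    case True
    then have "dot q x = v" "length q = length x" using Cons.prems e by auto
    then show ?thesis
      using Cons e True assms dot_xor_list[of r q x] by (simp add: xor_list_eq)
  next
    case False then show ?thesis using Cons e by simp
  qed
qed simp

lemma reduce_sat_None: "(\<And>q. True # q \<notin> set eqs) \<Longrightarrow> sat (v # x) eqs \<Longrightarrow> sat x (reduce None eqs)"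
proof (induction eqs)
  case (Cons e es)
  then obtain b q where e: "e = b # q" by (cases e) auto
  have "\<not> b" using Cons.prems(1)[of q] e by auto
  moreover have "\<And>q. True # q \<notin> set es" using Cons.prems(1) by auto
  ultimately show ?case using Cons.IH Cons.prems(2) e by simp
qed simp

lemma pivot_sat:
  assumes "sat (v # x) eqs"
  shows "pivot eqs = Some r \<Longrightarrow> length r = length x \<and> v = dot r x" and "sat x (reduce (pivot eqs) eqs)"
proof -
  show *: "length r = length x \<and> v = dot r x" if "pivot eqs = Some r" for r
  proof -
    have "length (True # r) = length (v # x)" "\<not> dot (True # r) (v # x)"
      using pivot_Some[OF that] assms unfolding sat_def by blast+
    then show ?thesis by (cases v) auto
  qed
  show "sat x (reduce (pivot eqs) eqs)"
  proof (cases "pivot eqs")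
    case None then show ?thesis using reduce_sat_None[OF pivot_None[OF None] assms] by simp
  next
    case (Some r) then show ?thesis using reduce_sat_Some[OF _ _ assms] *[OF Some] by simp
  qed
qed

lemma drop_columns_sat:
  "length ts = length xs \<Longrightarrow> sat (xs @ y) eqs \<Longrightarrow> sat y (drop_columns ts eqs)"
proof (induction ts xs arbitrary: eqs rule: list_induct2)
  case (Cons t ts x xs)
  then show ?case using pivot_sat(2)[of x "xs @ y" eqs] by simp
qed simp

text \<open>The values obey the recorded pivots when read in the order of the search,
  \<open>h\<close> being the history at the start.\<close>

fun chain :: "('a \<times> bool list option) list \<Rightarrow> bool list \<Rightarrow> bool list \<Rightarrow> bool" where
  "chain [] [] h \<longleftrightarrow> True"
| "chain ((c, q) # cs) (v # vs) h \<longleftrightarrow> (\<forall>r. q = Some r \<longrightarrow> v = dot r h) \<and> chain cs vs (v # h)"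
| "chain _ _ h \<longleftrightarrow> False"

lemma solve_columns_chain:
  "length cs = length xs \<Longrightarrow> sat (xs @ y) eqs \<Longrightarrow> chain acc vacc (xs @ y) \<Longrightarrow>
    chain (solve_columns cs eqs acc) (rev xs @ vacc) y"
proof (induction cs xs arbitrary: eqs acc vacc rule: list_induct2)
  case (Cons c cs x xs)
  have "chain ((c, pivot eqs) # acc) (x # vacc) (xs @ y)"
    using Cons.prems pivot_sat(1)[of x "xs @ y" eqs] by auto
  then show ?case
    using Cons.IH[OF pivot_sat(2)[of x "xs @ y" eqs]] Cons.prems by simp
qed simp

lemma map_fst_solve_columns: "map fst (solve_columns cs eqs acc) = rev cs @ map fst acc"
  by (induction cs eqs acc rule: solve_columns.induct) auto

definition admissible :: "cell \<Rightarrow> int \<Rightarrow> bool" where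
  "admissible c z \<longleftrightarrow> fst c = odd z \<and> - 3 \<le> z \<and> z \<le> 3 \<and> (snd (snd c) = None \<longrightarrow> z > 0)"

text \<open>The part of z^2 that is not already charged to the parity pattern.\<close>

definition extra_cost :: "int \<Rightarrow> nat" where
  "extra_cost z = nat (z * z - z mod 2)"

definition contribution :: "cell \<Rightarrow> int \<Rightarrow> int list list" where
  "contribution c z = (if z \<ge> 0 then replicate (nat z) (fst (snd c)) else replicate (nat (- z)) (the (snd (snd c))))"

lemma push_mono: "x \<in> set acc \<Longrightarrow> x \<in> set (push3 ro h u vs acc)" "x \<in> set acc \<Longrightarrow> x \<in> set (push2 ro h u vs acc)"
  by (cases ro; simp)+

lemma branch_mono: "set acc \<subseteq> set (branch_False c s acc)" "set acc \<subseteq> set (branch_True c s acc)"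
proof -
  obtain p u n where c: "c = (p, u, n)" by (rule prod_cases3)
  obtain h r vs where s: "s = (h, r, vs)" by (rule prod_cases3)
  have "x \<in> set (branch_False c s acc) \<and> x \<in> set (branch_True c s acc)" if "x \<in> set acc" for x
    unfolding c s using that by (cases p; cases n; simp add: push_mono)
  then show "set acc \<subseteq> set (branch_False c s acc)" "set acc \<subseteq> set (branch_True c s acc)" by blast+
qed

lemma branch_mono': "set acc \<subseteq> set (branch b c s acc)"
proof (cases b)
  case None then show ?thesis using order_trans[OF branch_mono(2) branch_mono(1)] by simp
next
  case (Some x) then show ?thesis using branch_mono[of acc c s] by (cases x) simp_all
qed

lemma sub4_Some: "4 \<le> r \<Longrightarrow> sub4 (Some r) = Some (r - 4)"
proof -
  assume "4 \<le> r"
  then obtain k where "r = Suc (Suc (Suc (Suc k)))" by (auto dest!: le_Suc_ex simp: eval_nat_numeral)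
  then show ?thesis by simp
qed

lemma branch_value:
  assumes adm: "admissible c z" and cost: "extra_cost z \<le> r"
  shows "odd (z div 2) \<Longrightarrow> (odd (z div 2) # h, r - extra_cost z, contribution c z @ vs) \<in> set (branch_True c (h, r, vs) acc)"
    and "\<not> odd (z div 2) \<Longrightarrow> (odd (z div 2) # h, r - extra_cost z, contribution c z @ vs) \<in> set (branch_False c (h, r, vs) acc)"
proof -
  obtain p u n where c: "c = (p, u, n)" by (rule prod_cases3)
  have "z \<in> {- 3, - 2, - 1, 0, 1, 2, 3}" using adm by (auto simp: admissible_def)
  then consider "z = - 3" | "z = - 2" | "z = - 1" | "z = 0" | "z = 1" | "z = 2" | "z = 3" by blast
  then have "(odd (z div 2) \<longrightarrow> (odd (z div 2) # h, r - extra_cost z, contribution c z @ vs) \<in> set (branch_True c (h, r, vs) acc)) \<and>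
    (\<not> odd (z div 2) \<longrightarrow> (odd (z div 2) # h, r - extra_cost z, contribution c z @ vs) \<in> set (branch_False c (h, r, vs) acc))"
  proof cases
    case 1
    have e: "extra_cost z = 8" "nat (- z) = 3" "\<not> odd (z div 2)" "odd z" using 1 by (simp_all add: extra_cost_def)
    have "sub4 (sub4 (Some r)) = Some (r - 8)" using cost e by (simp add: sub4_Some)
    then show ?thesis using adm 1 e by (cases n) (auto simp: c admissible_def contribution_def numeral_3_eq_3)
  next
    case 2
    have e: "extra_cost z = 4" "nat (- z) = 2" "odd (z div 2)" "\<not> odd z" using 2 by (simp_all add: extra_cost_def)
    have "sub4 (Some r) = Some (r - 4)" using cost e by (simp add: sub4_Some)
    then show ?thesis using adm 2 e by (cases n) (auto simp: c admissible_def contribution_def numeral_2_eq_2)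
  next
    case 3
    have e: "extra_cost z = 0" "nat (- z) = 1" "odd (z div 2)" "odd z" using 3 by (simp_all add: extra_cost_def)
    then show ?thesis using adm 3 by (cases n) (auto simp: c admissible_def contribution_def)
  next
    case 4
    have e: "extra_cost z = 0" "nat z = 0" "\<not> odd (z div 2)" "\<not> odd z" using 4 by (simp_all add: extra_cost_def)
    then show ?thesis using adm 4 by (cases n) (auto simp: c admissible_def contribution_def)
  next
    case 5
    have e: "extra_cost z = 0" "nat z = 1" "\<not> odd (z div 2)" "odd z" using 5 by (simp_all add: extra_cost_def)
    then show ?thesis using adm 5 by (cases n) (auto simp: c admissible_def contribution_def)
  next
    case 6
    have e: "extra_cost z = 4" "nat z = 2" "odd (z div 2)" "\<not> odd z" using 6 by (simp_all add: extra_cost_def)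
    have "sub4 (Some r) = Some (r - 4)" using cost e by (simp add: sub4_Some)
    then show ?thesis using adm 6 e by (cases n) (auto simp: c admissible_def contribution_def numeral_2_eq_2)
  next
    case 7
    have e: "extra_cost z = 8" "nat z = 3" "odd (z div 2)" "odd z" using 7 by (simp_all add: extra_cost_def)
    have "sub4 (sub4 (Some r)) = Some (r - 8)" using cost e by (simp add: sub4_Some)
    then show ?thesis using adm 7 e by (cases n) (auto simp: c admissible_def contribution_def numeral_3_eq_3)
  qed
  then show "odd (z div 2) \<Longrightarrow> (odd (z div 2) # h, r - extra_cost z, contribution c z @ vs) \<in> set (branch_True c (h, r, vs) acc)"
    and "\<not> odd (z div 2) \<Longrightarrow> (odd (z div 2) # h, r - extra_cost z, contribution c z @ vs) \<in> set (branch_False c (h, r, vs) acc)"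
    by blast+
qed

lemma step_sound:
  assumes "admissible c z" "extra_cost z \<le> r" "\<And>q'. q = Some q' \<Longrightarrow> odd (z div 2) = dot q' h" "(h, r, vs) \<in> set st"
  shows "(odd (z div 2) # h, r - extra_cost z, contribution c z @ vs) \<in> set (step c q st)"
  using assms(4)
proof (induction st)
  case (Cons s st)
  show ?case
  proof (cases "s = (h, r, vs)")
    case True
    show ?thesis
    proof (cases q)
      case None
      show ?thesis
      proof (cases "odd (z div 2)")
        case odd: True
        show ?thesis
          using subsetD[OF branch_mono(1) branch_value(1)[OF assms(1,2) odd]] True None by simp
      next
        case False
        then show ?thesis using branch_value(2)[OF assms(1,2) False] True None by simp
      qed
    next
      case (Some q')
      show ?thesis
      proof (cases "dot q' h")
        case d: True
        then have "odd (z div 2)" using assms(3)[OF Some] by simp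
        then show ?thesis using branch_value(1)[OF assms(1,2)] True Some d by simp
      next
        case d: False
        then have "\<not> odd (z div 2)" using assms(3)[OF Some] by simp
        then show ?thesis using branch_value(2)[OF assms(1,2)] True Some d by simp
      qed
    qed
  next
    case False
    then have "(odd (z div 2) # h, r - extra_cost z, contribution c z @ vs) \<in> set (step c q st)"
      using Cons by simp
    then show ?thesis using subsetD[OF branch_mono'] by simp
  qed
qed simp

text \<open>What is needed is completeness: every admissible assignment that respects the pivots and
  the budget is among the final states, with its multipliers collected.\<close>

lemma search_sound:
  "chain cqs (map (\<lambda>z. odd (z div 2)) zs) h \<Longrightarrow> list_all2 admissible (map fst cqs) zs \<Longrightarrow>
    sum_list (map extra_cost zs) \<le> r \<Longrightarrow> (h, r, vs) \<in> set st \<Longrightarrow>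
    \<exists>h'. (h', r - sum_list (map extra_cost zs), concat (rev (map2 contribution (map fst cqs) zs)) @ vs) \<in> set (search cqs st)"
proof (induction cqs arbitrary: zs h r vs st)
  case Nil
  then have "zs = []" by (cases zs) auto
  then show ?case using Nil by auto
next
  case (Cons cq cqs)
  obtain c q where cq: "cq = (c, q)" by (cases cq)
  obtain z zs' where z: "zs = z # zs'" using Cons.prems(1) cq by (cases zs) auto
  have 1: "(odd (z div 2) # h, r - extra_cost z, contribution c z @ vs) \<in> set (step c q st)"
    by (rule step_sound) (use Cons.prems cq z in auto)
  have "\<exists>h'. (h', (r - extra_cost z) - sum_list (map extra_cost zs'),
      concat (rev (map2 contribution (map fst cqs) zs')) @ (contribution c z @ vs)) \<in> set (search cqs (step c q st))"
    by (rule Cons.IH[OF _ _ _ 1]) (use Cons.prems cq z in auto)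
  then show ?case unfolding cq z by (simp add: diff_diff_left)
qed

lemma sum_heads_eq: "(\<And>l. l \<in> set vs \<Longrightarrow> l \<noteq> []) \<Longrightarrow> sum_heads vs a = a + sum_list (map hd vs)"
proof (induction vs arbitrary: a)
  case (Cons l vs)
  then obtain x xs where "l = x # xs" by (cases l) auto
  then show ?case using Cons by simp
qed simp

lemma tails_eq: "tails vs = map tl vs"
  by (induction vs rule: tails.induct) auto

lemma refuted_sound:
  "refuted t fs b a vs \<Longrightarrow> \<not> b \<Longrightarrow> (\<And>l. l \<in> set vs \<Longrightarrow> length fs \<le> length l) \<Longrightarrow>
    \<exists>g<length fs. lookup_int t ((a + sum_list (map (\<lambda>l. l ! g) vs)) mod 257)"
proof (induction t fs b a vs rule: refuted.induct)
  case (3 t f fs a vs)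
  show ?case
  proof (cases "lookup_int t (sum_heads vs a mod 257)")
    case True
    have ne: "l \<noteq> []" if "l \<in> set vs" for l using 3(4)[OF that] by auto
    then have m: "map hd vs = map (\<lambda>l. l ! 0) vs" by (auto simp: hd_conv_nth)
    have e: "sum_heads vs a = a + sum_list (map hd vs)" by (rule sum_heads_eq) (rule ne)
    show ?thesis using True unfolding e m by (intro exI[of _ 0]) simp
  next
    case False
    have "\<exists>g<length fs. lookup_int t ((a + sum_list (map (\<lambda>l. l ! g) (tails vs))) mod 257)"
    proof (rule 3(1))
      show "refuted t fs (lookup_int t (sum_heads vs a mod 257)) a (tails vs)" using 3(2) by simp
      show "\<not> lookup_int t (sum_heads vs a mod 257)" by (rule False)
      fix l assume "l \<in> set (tails vs)"
      then show "length fs \<le> length l" using 3(4) by (fastforce simp: tails_eq)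
    qed
    then obtain g where g: "g < length fs" "lookup_int t ((a + sum_list (map (\<lambda>l. l ! g) (tails vs))) mod 257)" by blast
    have "map (\<lambda>l. l ! g) (tails vs) = map (\<lambda>l. l ! Suc g) vs"
      unfolding tails_eq using 3(4) g(1) by (force simp: nth_tl)
    then show ?thesis using g by (intro exI[of _ "Suc g"]) simp
  qed
qed auto

lemma leaves_sound:
  "leaves t fs st \<Longrightarrow> (h, r, vs) \<in> set st \<Longrightarrow> refuted t fs False 0 vs \<and> refuted t fs False (- 2) vs \<and>
    (3 \<le> r \<longrightarrow> refuted t fs False 2 vs) \<and> (6 \<le> r \<longrightarrow> refuted t fs False (- 4) vs) \<and>
    (10 \<le> r \<longrightarrow> refuted t fs False 4 vs)"
proof (induction st)
  case (Cons s st)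
  show ?case
  proof (cases "s = (h, r, vs)")
    case True
    then have *: "refuted t fs False 0 vs" "refuted t fs False (- 2) vs" "leaf1 t fs r vs" using Cons.prems by auto
    have 1: "refuted t fs False 2 vs \<and> leaf2 t fs (r - 3) vs" if "3 \<le> r"
    proof -
      have k: "r = Suc (Suc (Suc (r - 3)))" using that by simp
      show ?thesis using *(3) by (subst (asm) k) simp
    qed
    have 2: "refuted t fs False (- 4) vs \<and> leaf3 t fs (r - 6) vs" if "6 \<le> r"
    proof -
      have k: "r - 3 = Suc (Suc (Suc (r - 6)))" using that by simp
      have "leaf2 t fs (r - 3) vs" using 1 that by simp
      then show ?thesis by (subst (asm) k) simp
    qed
    have 3: "refuted t fs False 4 vs" if "10 \<le> r"
    proof -
      have k: "r - 6 = Suc (Suc (Suc (Suc (r - 10))))" using that by simp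
      have "leaf3 t fs (r - 6) vs" using 2 that by simp
      then show ?thesis by (subst (asm) k) simp
    qed
    show ?thesis using * 1 2 3 by blast
  next
    case False then show ?thesis using Cons by (cases s) auto
  qed
qed simp


section \<open>The rows computed by the program are the rows of the linear system\<close>

lemma sum_int_shift: "(\<Sum>t<n. h (int t + 1)) = (\<Sum>\<tau>\<in>{1..<int n + 1}. h \<tau>)"
  by (rule sum.reindex_bij_witness[of _ "\<lambda>\<tau>. nat (\<tau> - 1)" "\<lambda>t. int t + 1"]) auto

lemma sum_odd_part:
  fixes h :: "int \<Rightarrow> bit"
  assumes "\<And>\<tau>. even \<tau> \<Longrightarrow> h \<tau> = 0"
  shows "(\<Sum>\<tau>\<in>{1..<2 * int n}. h \<tau>) = (\<Sum>t<n. h (2 * int t + 1))"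
proof -
  have "(\<Sum>\<tau>\<in>{1..<2 * int n}. h \<tau>) = (\<Sum>\<tau>\<in>(\<lambda>t. 2 * int t + 1) ` {..<n}. h \<tau>)"
  proof (rule sum.mono_neutral_right)
    show "\<forall>\<tau>\<in>{1..<2 * int n} - (\<lambda>t. 2 * int t + 1) ` {..<n}. h \<tau> = 0"
    proof
      fix \<tau> assume t: "\<tau> \<in> {1..<2 * int n} - (\<lambda>t. 2 * int t + 1) ` {..<n}"
      have "even \<tau>"
      proof (rule ccontr)
        assume "odd \<tau>"
        then obtain j where "\<tau> = 2 * j + 1" by (elim oddE)
        then have "\<tau> \<in> (\<lambda>t. 2 * int t + 1) ` {..<n}" using t by (intro image_eqI[of _ _ "nat j"]) auto
        then show False using t by blast
      qed
      then show "h \<tau> = 0" by (rule assms)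
    qed
  qed auto
  also have "\<dots> = (\<Sum>t<n. h (2 * int t + 1))" by (subst sum.reindex) (auto simp: inj_on_def)
  finally show ?thesis .
qed

lemma sum_even_part:
  fixes h :: "int \<Rightarrow> bit"
  assumes "\<And>\<tau>. odd \<tau> \<Longrightarrow> h \<tau> = 0"
  shows "(\<Sum>\<tau>\<in>{1..<2 * int n + 1}. h \<tau>) = (\<Sum>t<n. h (2 * int t + 2))"
proof -
  have "(\<Sum>\<tau>\<in>{1..<2 * int n + 1}. h \<tau>) = (\<Sum>\<tau>\<in>(\<lambda>t. 2 * int t + 2) ` {..<n}. h \<tau>)"
  proof (rule sum.mono_neutral_right)
    show "\<forall>\<tau>\<in>{1..<2 * int n + 1} - (\<lambda>t. 2 * int t + 2) ` {..<n}. h \<tau> = 0"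
    proof
      fix \<tau> assume t: "\<tau> \<in> {1..<2 * int n + 1} - (\<lambda>t. 2 * int t + 2) ` {..<n}"
      have "odd \<tau>"
      proof
        assume "even \<tau>"
        then obtain j where "\<tau> = 2 * j" by (elim evenE)
        then have "\<tau> \<in> (\<lambda>t. 2 * int t + 2) ` {..<n}" using t by (intro image_eqI[of _ _ "nat (j - 1)"]) auto
        then show False using t by blast
      qed
      then show "h \<tau> = 0" by (rule assms)
    qed
  qed auto
  also have "\<dots> = (\<Sum>t<n. h (2 * int t + 2))" by (subst sum.reindex) (auto simp: inj_on_def)
  finally show ?thesis .
qed

lemma dot_flip_nth:
  "n < length xs \<Longrightarrow> length xs = length ys \<Longrightarrow> bb (dot (flip_nth n xs) ys) = bb (dot xs ys) + bb (ys ! n)"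
proof (induction n xs arbitrary: ys rule: flip_nth.induct)
  case (2 x xs)
  then obtain y ys' where "ys = y # ys'" by (cases ys) auto
  then show ?case by (cases x; cases y; cases "dot xs ys'") auto
next
  case (3 n x xs)
  then obtain y ys' where y: "ys = y # ys'" by (cases ys) auto
  then have "bb (dot (flip_nth n xs) ys') = bb (dot xs ys') + bb (ys' ! n)" using 3 by auto
  then show ?case unfolding y by (cases x; cases y) (auto simp: add.assoc)
qed simp

context unit_solution
begin

definition p :: "int \<Rightarrow> bool" where "p k = odd (C k)"

definition H :: nat where "H = 2 ^ (m - 1)"

lemma M_eq: "M = 2 * int H" and Mn_eq: "(2::nat) ^ m = 2 * H"
proof -
  show e: "(2::nat) ^ m = 2 * H" unfolding H_def using m_pos by (cases m) auto
  have "M = int (2 ^ m)" by (simp add: M_def)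
  then show "M = 2 * int H" unfolding e by simp
qed

lemma bb_p: "bb (p k) = c k"
  by (simp add: p_def c_def bb_odd del: bb_not)

lemma p_sym: "p (- k) = p k" "p (k + 2 * M) = p k" "p (k - 2 * M) = p k" "\<not> p 0" "\<not> p M"
proof -
  show "p (- k) = p k" "p (k + 2 * M) = p k" "p (k - 2 * M) = p k"
    unfolding bb_inject[symmetric] bb_p c_periodic by (rule refl)+
  have "bb (p 0) = bb False" "bb (p M) = bb False" unfolding bb_p c_zero by simp_all
  then show "\<not> p 0" "\<not> p M" unfolding bb_inject by simp_all
qed

definition all_parities :: "bool list" where "all_parities = map (\<lambda>j. p (int j)) [1..<2 * H]"
definition odd_parities :: "bool list" where "odd_parities = map (\<lambda>t. p (2 * int t + 1)) [0..<H]"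
definition period :: "bool list" where
  "period = False # (all_parities @ (False # rev_onto all_parities []))"
definition w_vec :: "bool list" where "w_vec = map (\<lambda>t. odd (F (M + 2 * int t + 1))) [0..<H]"

lemma length_lists [simp]: "length all_parities = 2 * H - 1" "length odd_parities = H" "length w_vec = H"
  by (simp_all add: all_parities_def odd_parities_def w_vec_def)

lemma H_pos: "H > 0"
  by (simp add: H_def)

lemma length_period [simp]: "length period = 4 * H"
proof -
  have "length period = 2 * (2 * H - 1) + 2" by (simp add: period_def rev_onto_eq)
  then show ?thesis using H_pos by linarith
qed

lemma all_parities_nth: "i < 2 * H - 1 \<Longrightarrow> all_parities ! i = p (int i + 1)"
  by (simp add: all_parities_def add.commute)

lemma odd_parities_nth: "t < H \<Longrightarrow> odd_parities ! t = p (2 * int t + 1)"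
  by (simp add: odd_parities_def)

lemma period_nth:
  assumes "i < 4 * H"
  shows "period ! i = p (int i)"
proof -
  consider "i = 0" | "0 < i" "i < 2 * H" | "i = 2 * H" | "2 * H < i" by linarith
  then show ?thesis
  proof cases
    case 1 then show ?thesis using p_sym by (simp add: period_def)
  next
    case 2
    then obtain j where j: "i = Suc j" "j < 2 * H - 1" by (cases i) auto
    then show ?thesis by (simp add: period_def nth_append all_parities_nth add.commute)
  next
    case 3
    then obtain j where "i = Suc j" "j = 2 * H - 1" using H_pos by (cases i) auto
    then have "period ! i = False" by (simp add: period_def nth_append)
    moreover have "int i = M" using 3 M_eq by simp
    ultimately show ?thesis using p_sym by simp
  next
    case 4
    then obtain x where x: "i = 2 * H + Suc x" by (metis less_iff_Suc_add add_Suc_right)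
    have xl: "x < 2 * H - 1" using assms x by linarith
    have "i = Suc ((2 * H - 1) + Suc x)" using x H_pos by linarith
    then have "period ! i = rev all_parities ! x"
      by (simp only: period_def nth_Cons_Suc) (simp add: nth_append rev_onto_eq)
    also have "\<dots> = p (int (2 * H - 1 - Suc x) + 1)" using xl by (simp add: rev_nth all_parities_nth)
    also have "int (2 * H - 1 - Suc x) + 1 = - (int i) + 2 * M" using xl x M_eq H_pos by (simp add: of_nat_diff)
    finally show ?thesis unfolding p_sym .
  qed
qed

lemma back_period:
  assumes "h \<le> 2 * H" "t < 2 * H"
  shows "back_onto h period (tl period) ! t = p (int h - 1 - int t)"
proof (cases "t < h")
  case True
  then have "back_onto h period (tl period) ! t = period ! (h - 1 - t)"
    using assms by (simp add: back_onto_eq nth_append rev_nth)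
  also have "\<dots> = p (int (h - 1 - t))" by (rule period_nth) (use assms in linarith)
  also have "int (h - 1 - t) = int h - 1 - int t" using True by linarith
  finally show ?thesis .
next
  case False
  then have "back_onto h period (tl period) ! t = period ! Suc (t - h)"
    using assms H_pos by (simp add: back_onto_eq nth_append nth_tl)
  also have "\<dots> = p (int (Suc (t - h)))" by (rule period_nth) (use assms H_pos in linarith)
  also have "int (Suc (t - h)) = - (int h - 1 - int t)" using False by (simp add: of_nat_diff)
  finally show ?thesis unfolding p_sym .
qed

lemma dot_period:
  assumes "n \<le> 2 * H" "h + n \<le> 4 * H" "h' \<le> 2 * H" "length N = n"
  shows "bb (dot (take_by N (skip h period)) (back_onto h' period (tl period))) =
    (\<Sum>t<n. c (int h + int t) * c (int h' - 1 - int t))"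
proof -
  have l: "length (take_by N (skip h period)) = n" using assms by (simp add: take_by_eq skip_eq)
  have "bb (dot (take_by N (skip h period)) (back_onto h' period (tl period))) =
      (\<Sum>t<n. bb (take_by N (skip h period) ! t) * bb (back_onto h' period (tl period) ! t))"
    using assms H_pos by (subst bb_dot) (simp_all add: l, simp_all add: back_onto_eq)
  also have "\<dots> = (\<Sum>t<n. c (int h + int t) * c (int h' - 1 - int t))"
  proof (rule sum.cong[OF refl])
    fix t assume "t \<in> {..<n}"
    then have t: "t < n" by simp
    have "take_by N (skip h period) ! t = p (int (h + t))"
      using assms t period_nth[of "h + t"] by (simp add: take_by_eq skip_eq)
    moreover have "back_onto h' period (tl period) ! t = p (int h' - 1 - int t)"
      by (rule back_period) (use assms t in linarith)+
    ultimately show "bb (take_by N (skip h period) ! t) * bb (back_onto h' period (tl period) ! t) =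
        c (int h + int t) * c (int h' - 1 - int t)" by (simp add: bb_p)
  qed
  finally show ?thesis .
qed

lemma dot_odd_parities:
  assumes "h \<le> H" "h' \<le> H"
  shows "bb (dot (skip h odd_parities) (back_onto h' odd_parities odd_parities)) =
    (\<Sum>t<H - h. c (2 * int h + 2 * int t + 1) * c (2 * int h' - 2 * int t - 1))"
proof -
  have "bb (dot (skip h odd_parities) (back_onto h' odd_parities odd_parities)) =
      (\<Sum>t<H - h. bb (skip h odd_parities ! t) * bb (back_onto h' odd_parities odd_parities ! t))"
    using assms by (subst bb_dot) (simp_all add: skip_eq back_onto_eq)
  also have "\<dots> = (\<Sum>t<H - h. c (2 * int h + 2 * int t + 1) * c (2 * int h' - 2 * int t - 1))"
  proof (rule sum.cong[OF refl])
    fix t assume t: "t \<in> {..<H - h}"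
    have "skip h odd_parities ! t = p (2 * int h + 2 * int t + 1)"
      using t by (simp add: skip_eq odd_parities_nth algebra_simps)
    moreover have "back_onto h' odd_parities odd_parities ! t = p (2 * int h' - 2 * int t - 1)"
    proof (cases "t < h'")
      case True
      then have "back_onto h' odd_parities odd_parities ! t = p (2 * int (h' - 1 - t) + 1)"
        using assms by (simp add: back_onto_eq nth_append rev_nth odd_parities_nth)
      then show ?thesis using True by (simp add: of_nat_diff algebra_simps)
    next
      case False
      then have "back_onto h' odd_parities odd_parities ! t = p (2 * int (t - h') + 1)"
        using assms t by (simp add: back_onto_eq nth_append odd_parities_nth)
      also have "2 * int (t - h') + 1 = - (2 * int h' - 2 * int t - 1)" using False by (simp add: of_nat_diff)
      finally show ?thesis unfolding p_sym .
    qed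
    ultimately show "bb (skip h odd_parities ! t) * bb (back_onto h' odd_parities odd_parities ! t) =
        c (2 * int h + 2 * int t + 1) * c (2 * int h' - 2 * int t - 1)" by (simp add: bb_p)
  qed
  finally show ?thesis .
qed

lemma co_odd: "odd k \<Longrightarrow> co k = c k" "even k \<Longrightarrow> co k = 0"
  by (simp_all add: co_def)

lemma rhs_even_eq:
  assumes "0 < h" "h < H"
  shows "bb (rhs_even h all_parities period odd_parities (p (2 * int h))) = c (int h) * c (2 * int h) +
    (\<Sum>t\<in>{1..<M}. c (int h + t) * c (int h - t)) + (\<Sum>t\<in>{1..<M - 2 * int h}. co (2 * int h + t) * co (2 * int h - t))"
proof -
  have 1: "head (skip h period) = p (int h)"
    using assms by (subst head_eq) (simp_all add: skip_eq period_nth)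
  have "bb (dot (take_by all_parities (skip (Suc h) period)) (back_onto h period (tl period))) =
      (\<Sum>t<2 * H - 1. c (int (Suc h) + int t) * c (int h - 1 - int t))"
    by (rule dot_period) (use assms in \<open>simp_all\<close>)
  also have "\<dots> = (\<Sum>t<2 * H - 1. c (int h + (int t + 1)) * c (int h - (int t + 1)))"
    by (intro sum.cong refl) (simp add: algebra_simps)
  also have "\<dots> = (\<Sum>t\<in>{1..<int (2 * H - 1) + 1}. c (int h + t) * c (int h - t))" by (rule sum_int_shift)
  also have "int (2 * H - 1) + 1 = M" using M_eq H_pos by (simp add: of_nat_diff)
  finally have 2: "bb (dot (take_by all_parities (skip (Suc h) period)) (back_onto h period (tl period))) =
      (\<Sum>t\<in>{1..<M}. c (int h + t) * c (int h - t))" .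
  have "(\<Sum>t\<in>{1..<M - 2 * int h}. co (2 * int h + t) * co (2 * int h - t)) =
      (\<Sum>t\<in>{1..<2 * int (H - h)}. co (2 * int h + t) * co (2 * int h - t))"
    using assms M_eq by (simp add: of_nat_diff algebra_simps)
  also have "\<dots> = (\<Sum>t<H - h. co (2 * int h + (2 * int t + 1)) * co (2 * int h - (2 * int t + 1)))"
    by (rule sum_odd_part) (simp add: co_odd)
  also have "\<dots> = (\<Sum>t<H - h. c (2 * int h + 2 * int t + 1) * c (2 * int h - 2 * int t - 1))"
    by (intro sum.cong refl) (simp add: co_odd algebra_simps)
  also have "\<dots> = bb (dot (skip h odd_parities) (back_onto h odd_parities odd_parities))"
    by (rule dot_odd_parities[symmetric]) (use assms in simp_all)
  finally show ?thesis
    unfolding rhs_even.simps xor_bool_iff and_bool_iff bb_neq bb_conj 1 2 bb_p by (simp add: mult.commute add.assoc)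
qed

lemma rhs_odd_eq:
  assumes "h < H" "i = 2 * int h + 1"
  shows "bb (rhs_odd h all_parities period odd_parities) =
    (\<Sum>t\<in>{1..M}. c (int h + t) * c (int h + 1 - t)) + (\<Sum>t\<in>{1..<M - i}. co (i + t) * co (i - t))"
proof -
  have "bb (dot (take_by (False # all_parities) (skip (Suc h) period)) (back_onto (Suc h) period (tl period))) =
      (\<Sum>t<2 * H. c (int (Suc h) + int t) * c (int (Suc h) - 1 - int t))"
    by (rule dot_period) (use assms in \<open>simp_all\<close>)
  also have "\<dots> = (\<Sum>t<2 * H. c (int h + (int t + 1)) * c (int h + 1 - (int t + 1)))"
    by (intro sum.cong refl) (simp add: algebra_simps)
  also have "\<dots> = (\<Sum>t\<in>{1..<int (2 * H) + 1}. c (int h + t) * c (int h + 1 - t))" by (rule sum_int_shift)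
  also have "{1..<int (2 * H) + 1} = {1..M}" using M_eq by auto
  finally have 2: "bb (dot (take_by (False # all_parities) (skip (Suc h) period)) (back_onto (Suc h) period (tl period))) =
      (\<Sum>t\<in>{1..M}. c (int h + t) * c (int h + 1 - t))" .
  have "M - i = 2 * int (H - Suc h) + 1" using assms M_eq by (simp add: of_nat_diff)
  then have "(\<Sum>t\<in>{1..<M - i}. co (i + t) * co (i - t)) = (\<Sum>t\<in>{1..<2 * int (H - Suc h) + 1}. co (i + t) * co (i - t))"
    by simp
  also have "\<dots> = (\<Sum>t<H - Suc h. co (i + (2 * int t + 2)) * co (i - (2 * int t + 2)))"
    by (rule sum_even_part) (simp add: co_odd assms)
  also have "\<dots> = (\<Sum>t<H - Suc h. c (2 * int (Suc h) + 2 * int t + 1) * c (2 * int h - 2 * int t - 1))"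
    by (intro sum.cong refl) (simp add: co_odd assms algebra_simps)
  also have "\<dots> = bb (dot (skip (Suc h) odd_parities) (back_onto h odd_parities odd_parities))"
    by (rule dot_odd_parities[symmetric]) (use assms in simp_all)
  finally show ?thesis unfolding rhs_odd.simps xor_bool_iff bb_neq 2 by simp
qed

abbreviation rev_odd :: "bool list" where "rev_odd \<equiv> rev_onto odd_parities []"
abbreviation odd_circle :: "bool list" where "odd_circle \<equiv> rev_onto odd_parities (odd_parities @ rev_onto odd_parities [])"

lemma rev_odd_nth: "t < H \<Longrightarrow> rev_odd ! t = p (M - 1 - 2 * int t)"
  using M_eq by (simp add: rev_onto_eq rev_nth odd_parities_nth of_nat_diff algebra_simps)

lemma odd_circle_nth:
  assumes "t < 3 * H"
  shows "odd_circle ! t = p (M + 1 + 2 * int t)"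
proof -
  have sym: "p (M - 1 - 2 * int t) = p (M + 1 + 2 * int t)" for t
  proof -
    have "M - 1 - 2 * int t = - (M + 1 + 2 * int t) + 2 * M" by simp
    then show ?thesis by (simp only: p_sym)
  qed
  consider "t < H" | "H \<le> t" "t < 2 * H" | "2 * H \<le> t" by linarith
  then show ?thesis
  proof cases
    case 1
    then have "odd_circle ! t = rev_odd ! t" by (simp add: rev_onto_eq nth_append)
    then show ?thesis using rev_odd_nth[OF 1] sym by simp
  next
    case 2
    then have "t - H < H" by linarith
    then have "odd_circle ! t = p (2 * int (t - H) + 1)" using 2 by (simp add: rev_onto_eq nth_append odd_parities_nth)
    moreover have "M + 1 + 2 * int t = (2 * int (t - H) + 1) + 2 * M" using 2 M_eq by (simp add: of_nat_diff)
    ultimately show ?thesis by (simp only: p_sym)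
  next
    case 3
    then have "\<not> t < H" "\<not> t - H < H" by linarith+
    then have "odd_circle ! t = rev_odd ! (t - 2 * H)" by (simp add: rev_onto_eq nth_append diff_diff_left mult_2)
    also have "\<dots> = p (M - 1 - 2 * int (t - 2 * H))" using 3 assms by (intro rev_odd_nth) linarith
    also have "\<dots> = p (M + 1 + 2 * int (t - 2 * H))" by (rule sym)
    also have "M + 1 + 2 * int (t - 2 * H) = (M + 1 + 2 * int t) - 2 * M" using 3 M_eq by (simp add: of_nat_diff)
    finally show ?thesis by (simp only: p_sym)
  qed
qed

lemma lhs_row_eq:
  assumes "i < 2 * H"
  shows "length (lhs_row i odd_parities rev_odd odd_circle) = H"
    and "bb (dot (lhs_row i odd_parities rev_odd odd_circle) w_vec) =
      (\<Sum>k\<in>{1..<M}. f (M + k) * (c (2 * int i + M - k) + c (2 * int i + M + k)))"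
proof -
  have l1: "length odd_circle = 3 * H" "length rev_odd = H" by (simp_all add: rev_onto_eq)
  have l: "length (skip i odd_circle) = 3 * H - i" "length (back_onto i odd_circle rev_odd) = i + H"
    using assms l1 by (simp_all add: skip_eq back_onto_eq)
  show len: "length (lhs_row i odd_parities rev_odd odd_circle) = H"
    using assms l by (simp add: take_by_eq xor_list_eq)
  have nth: "lhs_row i odd_parities rev_odd odd_circle ! t =
      (p (2 * int i + M + (2 * int t + 1)) \<noteq> p (2 * int i + M - (2 * int t + 1)))" if t: "t < H" for t
  proof -
    have "lhs_row i odd_parities rev_odd odd_circle ! t =
        (skip i odd_circle ! t \<noteq> back_onto i odd_circle rev_odd ! t)"
      using t assms l by (simp add: take_by_eq xor_list_eq)
    moreover have "skip i odd_circle ! t = p (2 * int i + M + (2 * int t + 1))"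
      using t assms l1 odd_circle_nth[of "i + t"] by (simp add: skip_eq algebra_simps)
    moreover have "back_onto i odd_circle rev_odd ! t = p (2 * int i + M - (2 * int t + 1))"
    proof (cases "t < i")
      case True
      then have "back_onto i odd_circle rev_odd ! t = odd_circle ! (i - 1 - t)"
        using assms l1 by (simp add: back_onto_eq nth_append rev_nth)
      also have "\<dots> = p (M + 1 + 2 * int (i - 1 - t))" using assms by (intro odd_circle_nth) linarith
      finally show ?thesis using True by (simp add: of_nat_diff algebra_simps)
    next
      case False
      then have "back_onto i odd_circle rev_odd ! t = rev_odd ! (t - i)"
        using assms l1 by (simp add: back_onto_eq nth_append)
      also have "\<dots> = p (M - 1 - 2 * int (t - i))" using t by (intro rev_odd_nth) linarith
      finally show ?thesis using False by (simp add: of_nat_diff algebra_simps)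
    qed
    ultimately show ?thesis by simp
  qed
  have "bb (dot (lhs_row i odd_parities rev_odd odd_circle) w_vec) =
      (\<Sum>t<H. bb (lhs_row i odd_parities rev_odd odd_circle ! t) * bb (w_vec ! t))"
    using len by (subst bb_dot) simp_all
  also have "\<dots> = (\<Sum>t<H. f (M + (2 * int t + 1)) *
      (c (2 * int i + M - (2 * int t + 1)) + c (2 * int i + M + (2 * int t + 1))))"
  proof (rule sum.cong[OF refl])
    fix t assume "t \<in> {..<H}"
    then have t: "t < H" by simp
    have "bb (w_vec ! t) = f (M + (2 * int t + 1))"
      using t by (simp add: w_vec_def f_def bb_odd add.assoc del: bb_not)
    then show "bb (lhs_row i odd_parities rev_odd odd_circle ! t) * bb (w_vec ! t) =
        f (M + (2 * int t + 1)) * (c (2 * int i + M - (2 * int t + 1)) + c (2 * int i + M + (2 * int t + 1)))"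
      unfolding nth[OF t] bb_neq bb_p by (simp add: mult.commute add.commute)
  qed
  also have "\<dots> = (\<Sum>k\<in>{1..<2 * int H}. f (M + k) * (c (2 * int i + M - k) + c (2 * int i + M + k)))"
    by (rule sum_odd_part[symmetric]) (use M_even f_even in simp)
  finally show "bb (dot (lhs_row i odd_parities rev_odd odd_circle) w_vec) =
      (\<Sum>k\<in>{1..<M}. f (M + k) * (c (2 * int i + M - k) + c (2 * int i + M + k)))" unfolding M_eq .
qed

text \<open>A row is good for the index \<open>j\<close> if it records the parity of \<open>C j\<close> and a valid equation for \<open>C j div 2\<close>.\<close>

definition good :: "(int \<Rightarrow> entry) \<Rightarrow> int \<Rightarrow> row \<Rightarrow> bool" where
  "good tab j r \<longleftrightarrow> fst r = (p j, tab j) \<and> length (fst (snd r)) = H \<and>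
     bb (dot (fst (snd r)) w_vec) + s j = bb (snd (snd r))"

lemma good_even_row:
  assumes "0 < h" "h < H"
  shows "good tab (2 * int h) ((p (2 * int h), tab (2 * int h)),
    lhs_row (double h) odd_parities rev_odd odd_circle, rhs_even h all_parities period odd_parities (p (2 * int h)))"
proof -
  have h: "2 * h < 2 * H" "0 < 2 * int h" "2 * int h < M" using assms M_eq by simp_all
  have "s (2 * int h) + bb (dot (lhs_row (2 * h) odd_parities rev_odd odd_circle) w_vec) =
      bb (rhs_even h all_parities period odd_parities (p (2 * int h)))"
    unfolding rhs_even_eq[OF assms] lhs_row_eq(2)[OF h(1)] using linear_row_even[OF h(2,3)] by simp
  then show ?thesis unfolding good_def double_eq using lhs_row_eq(1)[OF h(1)] by (simp add: add.commute)
qed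

lemma good_odd_row:
  assumes "h < H"
  shows "good tab (2 * int h + 1) ((p (2 * int h + 1), tab (2 * int h + 1)),
    flip_nth h (lhs_row (Suc (double h)) odd_parities rev_odd odd_circle), rhs_odd h all_parities period odd_parities)"
proof -
  let ?i = "2 * int h + 1"
  have h: "Suc (2 * h) < 2 * H" "0 < ?i" "?i < M" using assms M_eq by simp_all
  have i: "2 * int (Suc (2 * h)) = 2 * ?i" by simp
  have "bb (w_vec ! h) = f (M + ?i)"
    using assms by (simp add: w_vec_def f_def bb_odd add.assoc del: bb_not)
  then have "bb (dot (flip_nth h (lhs_row (Suc (2 * h)) odd_parities rev_odd odd_circle)) w_vec) =
      (\<Sum>k\<in>{1..<M}. f (M + k) * (c (2 * ?i + M - k) + c (2 * ?i + M + k))) + f (M + ?i)"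
    using assms lhs_row_eq[OF h(1)] unfolding i by (simp add: dot_flip_nth)
  then show ?thesis
    unfolding good_def double_eq using lhs_row_eq(1)[OF h(1)] linear_row_odd[OF refl h(2,3)] rhs_odd_eq[OF assms refl]
    by (simp add: add_ac)
qed

end


lemma even_rows_map:
  "even_rows h (map P [h..<n]) (map u [h..<n]) N E W RW G acc =
    map (\<lambda>h. ((P h, u h), lhs_row (double h) W RW G, rhs_even h N E W (P h))) [h..<n] @ acc"
proof (induction "n - h" arbitrary: h)
  case (Suc d)
  then have h: "[h..<n] = h # [Suc h..<n]" by (intro upt_conv_Cons) linarith
  show ?case using Suc(1)[of "Suc h"] Suc(2) unfolding h by simp
qed simp

lemma odd_rows_map:
  "odd_rows h (map P [h..<n]) (map u [h..<n]) N E W RW G =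
    map (\<lambda>h. ((P h, u h), flip_nth h (lhs_row (Suc (double h)) W RW G), rhs_odd h N E W)) [h..<n]"
proof (induction "n - h" arbitrary: h)
  case (Suc d)
  then have h: "[h..<n] = h # [Suc h..<n]" by (intro upt_conv_Cons) linarith
  show ?case using Suc(1)[of "Suc h"] Suc(2) unfolding h by simp
qed simp

lemma mset_filter_even: "mset (filter_even rs acc) = filter_mset (\<lambda>r. \<not> fst (fst r)) (mset rs) + mset acc"
  by (induction rs acc rule: filter_even.induct) simp_all

lemma mset_filter_odd: "mset (filter_odd rs acc) = filter_mset (\<lambda>r. fst (fst r)) (mset rs) + mset acc"
  by (induction rs acc rule: filter_odd.induct) simp_all

lemma mset_arrange: "mset (arrange rs) = mset rs"
  by (simp add: mset_filter_even mset_filter_odd)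

lemma cells_eq: "cells rs = map fst rs"
  by (induction rs rule: cells.induct) auto

lemma evens_upt: "evens (map u [1..<2 * n]) = map (\<lambda>h. u (2 * h)) [1..<n]"
proof (rule nth_equalityI)
  fix i assume "i < length (evens (map u [1..<2 * n]))"
  then have "i < n - 1" by (simp add: length_evens)
  then show "evens (map u [1..<2 * n]) ! i = map (\<lambda>h. u (2 * h)) [1..<n] ! i"
    by (subst nth_evens) (simp_all)
qed (simp add: length_evens)

lemma odds_upt: "odds (map u [1..<2 * n]) = map (\<lambda>h. u (2 * h + 1)) [0..<n]"
proof (rule nth_equalityI)
  fix i assume "i < length (odds (map u [1..<2 * n]))"
  then have "i < n" by (auto simp: length_odds)
  then show "odds (map u [1..<2 * n]) ! i = map (\<lambda>h. u (2 * h + 1)) [0..<n] ! i"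
    by (subst nth_odds) simp_all
qed (cases n; simp add: length_odds)

text \<open>Only index 1 is marked as positive, since solutions are normalized by
  \<open>C 1 > 0\<close>.\<close>

definition table :: "(nat \<Rightarrow> int \<Rightarrow> int) \<Rightarrow> nat \<Rightarrow> int \<Rightarrow> entry" where
  "table U l j = (map (\<lambda>g. U g j) [0..<l], if j = 1 then None else Some (map (\<lambda>g. 257 - U g j) [0..<l]))"

lemma contribution_sum:
  assumes "g < l" "admissible (q, table U l j) z"
  shows "sum_list (map (\<lambda>x. x ! g) (contribution (q, table U l j) z)) mod 257 = z * U g j mod 257"
proof -
  have "z > 0" if "j = 1" using assms(2) that by (auto simp: admissible_def table_def)
  then have n: "snd (table U l j) = Some (map (\<lambda>g. 257 - U g j) [0..<l])" if "z < 0" using that by (auto simp: table_def)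
  show "sum_list (map (\<lambda>x. x ! g) (contribution (q, table U l j) z)) mod 257 = z * U g j mod 257"
  proof (cases "z \<ge> 0")
    case True then show ?thesis using assms(1) by (simp add: contribution_def table_def sum_list_replicate)
  next
    case False
    then have "sum_list (map (\<lambda>x. x ! g) (contribution (q, table U l j) z)) = - z * (257 - U g j)"
      using assms(1) n by (simp add: contribution_def sum_list_replicate)
    also have "\<dots> = z * U g j + 257 * (- z)" by (simp add: algebra_simps)
    finally show ?thesis by (simp only: mod_mult_self2)
  qed
qed

lemma length_contribution:
  assumes "admissible (q, table U l j) z" "x \<in> set (contribution (q, table U l j) z)"
  shows "length x = l"
proof -
  have "z > 0" if "j = 1" using assms(1) that by (auto simp: admissible_def table_def)
  then have n: "snd (table U l j) = Some (map (\<lambda>g. 257 - U g j) [0..<l])" if "z < 0" using that by (auto simp: table_def)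
  show ?thesis
  proof (cases "z \<ge> 0")
    case True then show ?thesis using assms(2) by (simp add: contribution_def table_def)
  next
    case False then show ?thesis using assms(2) n by (simp add: contribution_def)
  qed
qed

lemma contributions_sum:
  assumes "g < l"
  shows "\<forall>j\<in>set js. admissible (P j, table U l j) (z j) \<Longrightarrow>
    sum_list (map (\<lambda>x. x ! g) (concat (rev (map2 contribution (map (\<lambda>j. (P j, table U l j)) js) (map z js))))) mod 257 =
      (\<Sum>j\<leftarrow>js. z j * U g j) mod 257"
proof (induction js)
  case (Cons j js)
  let ?A = "sum_list (map (\<lambda>x. x ! g) (contribution (P j, table U l j) (z j)))"
  let ?B = "\<lambda>js. sum_list (map (\<lambda>x. x ! g) (concat (rev (map2 contribution (map (\<lambda>j. (P j, table U l j)) js) (map z js)))))"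
  have B: "?B js mod 257 = (\<Sum>j\<leftarrow>js. z j * U g j) mod 257"
    by (rule Cons.IH) (use Cons.prems in simp)
  have A: "?A mod 257 = z j * U g j mod 257"
    by (rule contribution_sum[OF assms, of "P j"]) (use Cons.prems in simp)
  have "?B (j # js) = ?A + ?B js"
    unfolding list.map zip_Cons_Cons prod.case rev.simps concat_append map_append sum_list_append
    by (simp only: concat.simps append_Nil2 add.commute)
  then show ?case using mod_add_cong[OF A B] by (simp only: list.map sum_list.Cons)
qed simp

lemma violated_sound:
  assumes "\<And>h. 0 < h \<Longrightarrow> h < n \<Longrightarrow> \<not> P h \<Longrightarrow> \<not> P (n - h) \<Longrightarrow> rhs_even h N E W False = rhs_even (n - h) N E W False"
    and "\<not> P (n div 2) \<Longrightarrow> \<not> rhs_even (n div 2) N E W False"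
  shows "0 < h \<Longrightarrow> n = 2 * (length ts + h) \<Longrightarrow>
    \<not> violated False ts h (n - h) (map P [h..<n]) (map (\<lambda>h. P (n - h)) [h..<n]) N E W"
proof (induction ts arbitrary: h)
  case Nil
  then have h: "[h..<n] = h # [Suc h..<n]" "h = n div 2" by (auto intro!: upt_conv_Cons)
  show ?case using assms(2) unfolding h(1) h(2)[symmetric] by (cases "P h") simp_all
next
  case (Cons t ts)
  then have h: "[h..<n] = h # [Suc h..<n]" by (intro upt_conv_Cons) auto
  have k: "n - h = Suc (n - Suc h)" using Cons by auto
  have IH: "\<not> violated False ts (Suc h) (n - Suc h) (map P [Suc h..<n]) (map (\<lambda>h. P (n - h)) [Suc h..<n]) N E W"
    by (rule Cons.IH) (use Cons.prems in auto)
  show ?case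
  proof (cases "P h \<or> P (n - h)")
    case True
    then show ?thesis using IH unfolding h by (cases "P h"; cases "P (n - h)") (simp_all add: k)
  next
    case False
    then have "rhs_even h N E W False = rhs_even (n - h) N E W False" using Cons.prems by (intro assms) auto
    then show ?thesis using IH False unfolding h by (simp add: k)
  qed
qed

lemma skip_word_ge: "4 \<le> r \<Longrightarrow> \<not> skip_word ts k r Ne N E W"
proof -
  assume "4 \<le> r"
  then obtain k where "r = Suc (Suc (Suc (Suc k)))" by (auto dest!: le_Suc_ex simp: eval_nat_numeral)
  then show ?thesis by simp
qed

lemma skip_word_less: "r < 4 \<Longrightarrow> skip_word ts k r Ne N E W = violated False ts (Suc 0) k Ne (rev_onto Ne []) N E W"
  by (cases "(ts, k, r, Ne, N, E, W)" rule: skip_word.cases) simp_all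

lemma dot_row:
  assumes "length w = length v" "length x = k" "length xs = n"
  shows "dot (w @ replicate k False @ True # replicate n False @ [b]) (v @ x @ y # xs @ [True]) \<longleftrightarrow> dot w v \<noteq> (y \<noteq> b)"
  using assms by (cases b) (auto simp: dot_append dot_zeros)

context unit_solution
begin

definition half :: "int \<Rightarrow> bool" where "half j = odd (C j div 2)"

lemma bb_half: "bb (half j) = s j"
  by (simp add: half_def s_def bb_odd del: bb_not)

lemma system_sat:
  "list_all2 (good tab) js rs \<Longrightarrow> length x = k \<Longrightarrow>
    sat (w_vec @ x @ map half js @ [True]) (system rs (replicate k False))"
proof (induction js rs arbitrary: x k rule: list_all2_induct)
  case (Cons j js r rs)
  obtain q w b where r: "r = (q, w, b)" by (rule prod_cases3)
  have len: "length js = length rs" using Cons.hyps(2) by (rule list_all2_lengthD)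
  have g: "length w = H" "bb (dot w w_vec) + s j = bb b" using Cons.hyps(1) by (auto simp: good_def r)
  have "bb (dot w w_vec \<noteq> (half j \<noteq> b)) = bb (dot w w_vec) + s j + bb b"
    unfolding bb_neq bb_half by (simp add: add.assoc)
  then have d: "\<not> (dot w w_vec \<noteq> (half j \<noteq> b))" unfolding g by simp
  have "sat (w_vec @ (x @ [half j]) @ map half js @ [True]) (system rs (replicate (Suc k) False))"
    by (rule Cons.IH) (use Cons.prems in simp)
  moreover have "\<not> dot (w @ replicate k False @ True # replicate (length rs) False @ [b])
      (w_vec @ x @ half j # map half js @ [True])"
    by (subst dot_row) (use g Cons.prems len d in simp_all)
  ultimately show ?case using g Cons.prems len by (simp add: r zeros_eq replicate_app_Cons_same)
qed simp

text \<open>Half of the contribution of \<open>C 0\<close> to the trace identity.\<close>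

definition cost0 :: nat where "cost0 = nat ((C 0 * C 0 + C 0) div 2)"

text \<open>With \<open>C 0 = 2 * k\<close> the cost is k (2k + 1); outside -2 <= k <= 2 it is at
  least 15.\<close>

lemma cost0_cases:
  assumes "cost0 < 15"
  obtains "C 0 = 0" | "C 0 = - 2" | "C 0 = 2" "cost0 = 3" | "C 0 = - 4" "cost0 = 6" | "C 0 = 4" "cost0 = 10"
proof -
  obtain k where k: "C 0 = 2 * k" using C0 by (elim evenE)
  then have e: "(C 0 * C 0 + C 0) div 2 = k * (2 * k + 1)" by (simp add: algebra_simps)
  have lt: "k * (2 * k + 1) < 15" using assms unfolding cost0_def e by linarith
  have "k \<le> 2"
  proof (rule ccontr)
    assume "\<not> k \<le> 2"
    then have "3 * 7 \<le> k * (2 * k + 1)" by (intro mult_mono) auto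
    then show False using lt by simp
  qed
  moreover have "- 2 \<le> k"
  proof (rule ccontr)
    assume "\<not> - 2 \<le> k"
    then have "3 * 5 \<le> (- k) * (- (2 * k + 1))" by (intro mult_mono) auto
    then show False using lt unfolding minus_mult_minus by simp
  qed
  ultimately have "k = - 2 \<or> k = - 1 \<or> k = 0 \<or> k = 1 \<or> k = 2" by arith
  then show thesis using that k unfolding cost0_def e by auto
qed

text \<open>The digits of an actual solution satisfy the system, so the solution survives
  elimination and search up to a leaf; there its value under some embedding was found in the
  tree.\<close>

lemma solve_rows_sound:
  assumes "solve_rows t fs W rs r" "length W = H" "list_all2 (good (table U l)) js rs" "distinct js" "set js = {1..<M}"
    and "length fs = l" "\<And>j. j \<in> {1..<M} \<Longrightarrow> \<bar>C j\<bar> \<le> 3" "C 1 > 0"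
    and "(\<Sum>j\<in>{1..<M}. extra_cost (C j)) + cost0 \<le> r" "r < 15"
  shows "\<exists>g<l. lookup_int t ((C 0 + (\<Sum>j\<in>{1..<M}. C j * U g j)) mod 257)"
proof -
  define cqs where "cqs = solve_columns (cells rs) (drop_columns W (system rs [])) []"
  define vs where "vs = concat (rev (map2 contribution (map (\<lambda>j. (p j, table U l j)) (rev js)) (map C (rev js))))"
  have adm: "admissible (p j, table U l j) (C j)" if "j \<in> set js" for j
    using assms(7)[of j] that assms(5,8) by (simp add: admissible_def p_def table_def abs_le_iff)
  have len: "length js = length rs" using assms(3) by (rule list_all2_lengthD)
  have "fst (rs ! i) = (p (js ! i), table U l (js ! i))" if "i < length rs" for i
    using list_all2_nthD2[OF assms(3) that] by (simp add: good_def)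
  then have cells: "cells rs = map (\<lambda>j. (p j, table U l j)) js"
    unfolding cells_eq using len by (intro nth_equalityI) auto
  have "sat (w_vec @ map half js @ [True]) (system rs [])"
    using system_sat[OF assms(3), of "[]" 0] by simp
  then have "sat (map half js @ [True]) (drop_columns W (system rs []))"
    by (rule drop_columns_sat[rotated]) (simp add: assms(2))
  then have "chain cqs (rev (map half js) @ []) [True]"
    unfolding cqs_def by (rule solve_columns_chain[rotated]) (simp_all add: cells)
  then have ch: "chain cqs (map (\<lambda>z. odd (z div 2)) (map C (rev js))) [True]"
    by (simp add: rev_map half_def[abs_def] comp_def)
  have fst: "map fst cqs = map (\<lambda>j. (p j, table U l j)) (rev js)"
    by (simp add: cqs_def map_fst_solve_columns cells rev_map)
  have sumlist: "(\<Sum>j\<leftarrow>js. h j) = (\<Sum>j\<in>{1..<M}. h j)" for h :: "int \<Rightarrow> 'b::comm_monoid_add"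
    using assms(4,5) by (simp add: sum_list_distinct_conv_sum_set)
  have sumrev: "(\<Sum>j\<leftarrow>rev js. h j) = (\<Sum>j\<in>{1..<M}. h j)" for h :: "int \<Rightarrow> 'b::comm_monoid_add"
    using assms(4,5) by (simp add: sum_list_distinct_conv_sum_set)
  have cost: "sum_list (map extra_cost (map C (rev js))) = (\<Sum>j\<in>{1..<M}. extra_cost (C j))"
    unfolding map_map comp_def by (rule sumrev)
  have ex: "\<exists>h'. (h', r - sum_list (map extra_cost (map C (rev js))),
      concat (rev (map2 contribution (map fst cqs) (map C (rev js)))) @ []) \<in> set (search cqs [([True], r, [])])"
  proof (rule search_sound[OF ch])
    show "list_all2 admissible (map fst cqs) (map C (rev js))"
      unfolding fst by (simp add: list.rel_map list_all2_same adm)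
    show "sum_list (map extra_cost (map C (rev js))) \<le> r" unfolding cost using assms(9) by simp
  qed simp
  then obtain h' where h': "(h', r - (\<Sum>j\<in>{1..<M}. extra_cost (C j)), vs) \<in> set (search cqs [([True], r, [])])"
    unfolding cost fst append_Nil2 vs_def[symmetric] by (elim exE)
  have lv: "leaves t fs (search cqs [([True], r, [])])" using assms(1) by (simp add: cqs_def)
  have b: "cost0 \<le> r - (\<Sum>j\<in>{1..<M}. extra_cost (C j))" "cost0 < 15" using assms(9,10) by auto
  \<comment> \<open>The remaining budget covers \<open>cost0\<close>, so the leaf has tested this
    constant coefficient.\<close>
  have "refuted t fs False (C 0) vs"
    using leaves_sound[OF lv h'] b(1) by (rule_tac cost0_cases[OF b(2)]) simp_all
  moreover have "length fs \<le> length x" if "x \<in> set vs" for x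
  proof -
    have "\<exists>j\<in>set js. x \<in> set (contribution (p j, table U l j) (C j))"
    proof -
      have m: "map2 contribution (map (\<lambda>j. (p j, table U l j)) (rev js)) (map C (rev js)) =
          map (\<lambda>j. contribution (p j, table U l j) (C j)) (rev js)"
        by (rule nth_equalityI) simp_all
      show ?thesis using that unfolding vs_def m by simp
    qed
    then obtain j where j: "j \<in> set js" "x \<in> set (contribution (p j, table U l j) (C j))" by (elim bexE)
    have "length x = l" by (rule length_contribution[OF adm[OF j(1)] j(2)])
    then show ?thesis using assms(6) by simp
  qed
  ultimately have "\<exists>g<length fs. lookup_int t ((C 0 + sum_list (map (\<lambda>x. x ! g) vs)) mod 257)"
    by (intro refuted_sound[of t fs False "C 0" vs]) simp_all
  then obtain g where g: "g < length fs" "lookup_int t ((C 0 + sum_list (map (\<lambda>x. x ! g) vs)) mod 257)"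
    by (elim exE conjE)
  have "sum_list (map (\<lambda>x. x ! g) vs) mod 257 = (\<Sum>j\<leftarrow>rev js. C j * U g j) mod 257"
    unfolding vs_def by (rule contributions_sum) (use g(1) assms(6) adm in simp_all)
  also have "(\<Sum>j\<leftarrow>rev js. C j * U g j) = (\<Sum>j\<in>{1..<M}. C j * U g j)" by (rule sumrev)
  finally have "(C 0 + sum_list (map (\<lambda>x. x ! g) vs)) mod 257 = (C 0 + (\<Sum>j\<in>{1..<M}. C j * U g j)) mod 257"
    by (intro mod_add_cong refl)
  then show ?thesis using g assms(6) by (intro exI[of _ g]) simp
qed

text \<open>The left hand side involves \<open>c\<close> at 4h + M - k and 4h + M + k. As
  \<open>c\<close> is even of period \<open>2 * M\<close>, replacing h by H - h exchanges these two
  values; for 2h = H they are equal and cancel.\<close>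

lemma paired_rows:
  assumes "0 < h" "h < H" "C (2 * int h) = 0"
  shows "C (2 * int (H - h)) = 0 \<Longrightarrow> rhs_even h all_parities period odd_parities False =
      rhs_even (H - h) all_parities period odd_parities False"
    and "H = 2 * h \<Longrightarrow> \<not> rhs_even h all_parities period odd_parities False"
proof -
  let ?L = "\<lambda>i. \<Sum>k\<in>{1..<M}. f (M + k) * (c (2 * i + M - k) + c (2 * i + M + k))"
  have row: "bb (rhs_even h all_parities period odd_parities False) = ?L (2 * int h)"
    if "0 < h" "h < H" "C (2 * int h) = 0" for h
  proof -
    have h: "0 < 2 * int h" "2 * int h < M" using that M_eq by simp_all
    have "s (2 * int h) = 0" "p (2 * int h) = False" using that by (simp_all add: s_def p_def)
    then show ?thesis using trans[OF rhs_even_eq[OF that(1,2)] linear_row_even[OF h, symmetric]] by (simp only: add_0)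
  qed
  show "rhs_even h all_parities period odd_parities False = rhs_even (H - h) all_parities period odd_parities False"
    if z: "C (2 * int (H - h)) = 0"
  proof -
    have "?L (2 * int h) = ?L (2 * int (H - h))"
    proof (rule sum.cong[OF refl])
      fix k
      have 1: "2 * (2 * int (H - h)) + M - k = - (2 * (2 * int h) + M + k) + 2 * M + 2 * M"
        and 2: "2 * (2 * int (H - h)) + M + k = - (2 * (2 * int h) + M - k) + 2 * M + 2 * M"
        using assms M_eq by (simp_all add: of_nat_diff)
      show "f (M + k) * (c (2 * (2 * int h) + M - k) + c (2 * (2 * int h) + M + k)) =
          f (M + k) * (c (2 * (2 * int (H - h)) + M - k) + c (2 * (2 * int (H - h)) + M + k))"
        unfolding 1 2 c_periodic by (simp only: add.commute)
    qed
    moreover have "0 < H - h" "H - h < H" using assms by simp_all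
    ultimately show ?thesis using row[OF assms] row[of "H - h", OF _ _ z] unfolding bb_inject[symmetric] by (simp only:)
  qed
  show "\<not> rhs_even h all_parities period odd_parities False" if "H = 2 * h"
  proof -
    have "?L (2 * int h) = 0"
    proof (rule sum.neutral, rule ballI)
      fix k
      have 1: "2 * (2 * int h) + M - k = - k + 2 * M" and 2: "2 * (2 * int h) + M + k = k + 2 * M"
        using that M_eq by simp_all
      show "f (M + k) * (c (2 * (2 * int h) + M - k) + c (2 * (2 * int h) + M + k)) = 0"
        unfolding 1 2 c_periodic by simp
    qed
    then have "bb (rhs_even h all_parities period odd_parities False) = bb False"
      using row[OF assms] by (simp only: of_bool_eq)
    then show ?thesis unfolding bb_inject by simp
  qed
qed

lemma check_word_sound:
  assumes "check_word (make_params t fs ts (H - 1) (map (\<lambda>j. table U l (int j)) [1..<2 * H])) odd_parities all_parities r"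
    and "2 * (length ts + 1) = H"
    and "length fs = l" "\<And>j. j \<in> {1..<M} \<Longrightarrow> \<bar>C j\<bar> \<le> 3" "C 1 > 0"
    and "(\<Sum>j\<in>{1..<M}. extra_cost (C j)) + cost0 \<le> r" "r < 15"
  shows "\<exists>g<l. lookup_int t ((C 0 + (\<Sum>j\<in>{1..<M}. C j * U g j)) mod 257)"
proof -
  let ?tab = "\<lambda>j. table U l j"
  define Ne where "Ne = map (\<lambda>h. p (2 * int h)) [1..<H]"
  have Ne: "evens all_parities = Ne" unfolding all_parities_def evens_upt Ne_def by simp
  have te: "evens (map (\<lambda>j. ?tab (int j)) [1..<2 * H]) = map (\<lambda>h. ?tab (2 * int h)) [1..<H]"
    unfolding evens_upt by simp
  have to: "odds (map (\<lambda>j. ?tab (int j)) [1..<2 * H]) = map (\<lambda>h. ?tab (2 * int h + 1)) [0..<H]"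
    unfolding odds_upt by (simp add: add.commute)
  have W: "odd_parities = map (\<lambda>h. p (2 * int h + 1)) [0..<H]" by (simp add: odd_parities_def)
  \<comment> \<open>A nonzero even coefficient costs at least 4, so a smaller budget makes all even
    coefficients vanish.\<close>
  have small: "C j = 0" if r4: "r < 4" and j: "j \<in> {1..<M}" and ev: "\<not> p j" for j
  proof (rule ccontr)
    assume nz: "C j \<noteq> 0"
    obtain k where k: "C j = 2 * k" using ev by (auto simp: p_def elim: evenE)
    have "1 \<le> \<bar>k\<bar>" using nz k by simp
    then have "1 * 1 \<le> \<bar>k\<bar> * \<bar>k\<bar>" by (intro mult_mono) auto
    then have "4 \<le> extra_cost (C j)" unfolding k extra_cost_def by simp
    also have "extra_cost (C j) \<le> (\<Sum>j\<in>{1..<M}. extra_cost (C j))" by (rule member_le_sum) (use j in auto)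
    finally show False using assms(6) r4 by simp
  qed
  have sk: "\<not> skip_word ts (H - 1) r Ne all_parities period odd_parities"
  proof (cases "4 \<le> r")
    case True then show ?thesis by (rule skip_word_ge)
  next
    case False
    then have r: "r < 4" by simp
    have zero: "C (2 * int h) = 0" if "0 < h" "h < H" "\<not> p (2 * int h)" for h
      by (rule small[OF r]) (use that M_eq in auto)
    have "rev Ne = map (\<lambda>h. p (2 * int (H - h))) [1..<H]"
      unfolding Ne_def by (intro nth_equalityI) (auto simp: rev_nth of_nat_diff algebra_simps)
    moreover have "\<not> violated False ts 1 (H - 1) (map (\<lambda>h. p (2 * int h)) [1..<H]) (map (\<lambda>h. p (2 * int (H - h))) [1..<H])
        all_parities period odd_parities"
    proof (rule violated_sound)
      fix h assume h: "0 < h" "h < H" "\<not> p (2 * int h)" "\<not> p (2 * int (H - h))"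
      show "rhs_even h all_parities period odd_parities False = rhs_even (H - h) all_parities period odd_parities False"
        by (rule paired_rows(1)[OF h(1,2)]) (use h zero[of h] zero[of "H - h"] in auto)
    next
      assume h: "\<not> p (2 * int (H div 2))"
      have h2: "0 < H div 2" "H div 2 < H" "H = 2 * (H div 2)" using assms(2) by presburger+
      show "\<not> rhs_even (H div 2) all_parities period odd_parities False"
        by (rule paired_rows(2)[OF h2(1,2) zero[OF h2(1,2) h] h2(3)])
    qed (use assms(2) in auto)
    ultimately show ?thesis unfolding skip_word_less[OF r] Ne_def[symmetric] rev_onto_eq by simp
  qed
  define rs where "rs = map (\<lambda>h. ((p (2 * int h), ?tab (2 * int h)),
      lhs_row (double h) odd_parities rev_odd odd_circle, rhs_even h all_parities period odd_parities (p (2 * int h)))) [1..<H] @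
    map (\<lambda>h. ((p (2 * int h + 1), ?tab (2 * int h + 1)),
      flip_nth h (lhs_row (Suc (double h)) odd_parities rev_odd odd_circle), rhs_odd h all_parities period odd_parities)) [0..<H]"
  have er: "even_rows (Suc 0) Ne (map (\<lambda>h. ?tab (2 * int h)) [1..<H]) all_parities period odd_parities rev_odd odd_circle
      (odd_rows 0 odd_parities (map (\<lambda>h. ?tab (2 * int h + 1)) [0..<H]) all_parities period odd_parities rev_odd odd_circle) = rs"
    unfolding Ne_def rs_def One_nat_def even_rows_map
    by (subst (2) W, subst odd_rows_map) (rule refl)
  have solve: "solve_rows t fs odd_parities (arrange rs) r"
  proof -
    have sk': "skip_word ts (H - 1) r Ne all_parities period odd_parities = False" using sk by simp
    show ?thesis
      using assms(1) unfolding make_params.simps check_word.simps check_word2.simps Ne te to period_def[symmetric]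
        sk' solve_word.simps er .
  qed
  define js where "js = map (\<lambda>h. 2 * int h) [1..<H] @ map (\<lambda>h. 2 * int h + 1) [0..<H]"
  have good: "list_all2 (good ?tab) js rs"
    unfolding js_def rs_def
    by (intro list_all2_appendI; unfold list.rel_map list_all2_same; intro ballI good_even_row good_odd_row) simp_all
  \<comment> \<open>Each row is valid by itself, so the indices may be permuted along with the
    rearranged rows.\<close>
  have "list_all2 (\<lambda>r j. good ?tab j r) rs js" using good by (simp add: list_all2_conv_all_nth)
  from list_all2_reorder_left_invariance[OF this mset_arrange]
  obtain js' where "list_all2 (\<lambda>r j. good ?tab j r) (arrange rs) js'" and js_mset: "mset js' = mset js"
    by (elim exE conjE)
  then have js': "list_all2 (good ?tab) js' (arrange rs)" by (simp add: list_all2_conv_all_nth)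
  have "set js = {1..<M}"
  proof (intro equalityI subsetI)
    fix j assume "j \<in> {1..<M}"
    then have j: "0 < j" "j < 2 * int H" using M_eq by auto
    show "j \<in> set js"
      proof (cases "even j")
        case True
        then obtain k where "j = 2 * k" by (elim evenE)
        then have "j = 2 * int (nat k)" "nat k \<in> set [1..<H]" using j by auto
        then show ?thesis unfolding js_def set_append set_map by (intro UnI1 image_eqI)
      next
        case False
        then obtain k where "j = 2 * k + 1" by (elim oddE)
        then have "j = 2 * int (nat k) + 1" "nat k \<in> set [0..<H]" using j by auto
        then show ?thesis unfolding js_def set_append set_map by (intro UnI2 image_eqI)
      qed
  qed (use M_eq in \<open>auto simp: js_def\<close>)
  moreover have "distinct js" unfolding js_def unfolding distinct_append distinct_map inj_on_def disjoint_iff by auto presburger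
  ultimately have "set js' = {1..<M}" "distinct js'"
    using mset_eq_setD[OF js_mset] mset_eq_imp_distinct_iff[OF js_mset] by simp_all
  then show ?thesis
    using solve_rows_sound[OF solve length_lists(2) js' _ _ assms(3-7)] by simp
qed

end


section \<open>Completeness of the list of parity patterns\<close>

abbreviation trues :: "bool list \<Rightarrow> nat" where "trues xs \<equiv> count_list xs True"

lemma sub1_Some: "0 < r \<Longrightarrow> sub1 (Some r) = Some (r - 1)"
  by (cases r) simp_all

lemma words_below_mono: "x \<in> set acc \<Longrightarrow> x \<in> set (words_below ws qa xa N b acc)"
  by (induction ws qa xa N b acc rule: words_below.induct) simp_all

lemma words_below_sound:
  "length qs = length ws \<Longrightarrow> trues qs + trues (map2 (\<noteq>) qs ws) \<le> r \<Longrightarrow>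
    W = rev qa @ qs @ rev (map2 (\<noteq>) qs ws) @ xa \<Longrightarrow>
    (W, interleave W N, r - (trues qs + trues (map2 (\<noteq>) qs ws))) \<in> set (words_below ws qa xa N (Some r) acc)"
proof (induction qs ws arbitrary: qa xa r acc rule: list_induct2)
  case Nil
  then show ?case by (simp add: rev_onto_eq)
next
  case (Cons q qs w ws)
  let ?x = "q \<noteq> w" and ?c = "(if q then 1 else 0) + (if q \<noteq> w then 1 else 0 :: nat)"
  have c: "?c \<le> r" using Cons.prems by auto
  have "(W, interleave W N, (r - ?c) - (trues qs + trues (map2 (\<noteq>) qs ws))) \<in>
      set (words_below ws (q # qa) (?x # xa) N (Some (r - ?c)) acc)" for acc
    by (rule Cons.IH) (use Cons.prems in auto)
  moreover have "(r - ?c) - (trues qs + trues (map2 (\<noteq>) qs ws)) = r - (trues (q # qs) + trues (map2 (\<noteq>) (q # qs) (w # ws)))"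
    by auto
  ultimately have *: "(W, interleave W N, r - (trues (q # qs) + trues (map2 (\<noteq>) (q # qs) (w # ws)))) \<in>
      set (words_below ws (q # qa) (?x # xa) N (Some (r - ?c)) acc)" for acc
    by (simp only:)
  show ?case
  proof (cases w; cases q)
    assume w: "w" and q: "q"
    then have "sub1 (Some r) = Some (r - 1)" using c by (intro sub1_Some) simp
    then show ?thesis using *[of "words_below ws (False # qa) (True # xa) N (sub1 (Some r)) acc"] w q by simp
  next
    assume w: "w" and q: "\<not> q"
    then have "sub1 (Some r) = Some (r - 1)" using c by (intro sub1_Some) simp
    then show ?thesis using words_below_mono[OF *[of acc]] w q by simp
  next
    assume w: "\<not> w" and q: "q"
    then have "sub1 (Some r) = Some (r - 1)" "sub1 (Some (r - 1)) = Some (r - 2)"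
      using c sub1_Some[of r] sub1_Some[of "r - 1"] by simp_all
    then show ?thesis using words_below_mono[OF *[of acc]] w q by (simp add: numeral_2_eq_2)
  next
    assume w: "\<not> w" and q: "\<not> q"
    then show ?thesis using *[of "words_below ws (True # qa) (True # xa) N (sub1 (sub1 (Some r))) acc"] by simp
  qed
qed

lemma all_False_eq: "all_False xs \<longleftrightarrow> True \<notin> set xs"
  by (induction xs rule: all_False.induct) auto

lemma expand1_mono: "x \<in> set acc \<Longrightarrow> x \<in> set (expand1 z w acc)"
  by (cases "(z, w, acc)" rule: expand1.cases) (simp_all add: words_below_mono del: words_below.simps)

lemma expand1_sound:
  assumes "length qs = length ws" "W = qs @ rev (map2 (\<noteq>) qs ws)" "ws \<noteq> []" "trues W \<le> r"
    and "hd qs \<or> True \<notin> set W"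
  shows "(W, interleave W N, r - trues W) \<in> set (expand1 (all_False ws) (ws, N, r) acc)"
proof -
  obtain w ws' where w: "ws = w # ws'" using assms(3) by (cases ws) auto
  then obtain q qs' where q: "qs = q # qs'" "length qs' = length ws'" using assms(1) by (cases qs) auto
  let ?t = "trues qs' + trues (map2 (\<noteq>) qs' ws')"
  have t: "trues W = ?t + (if q then 1 else 0) + (if q \<noteq> w then 1 else 0)"
    unfolding assms(2) w q by auto
  show ?thesis
  proof (cases q)
    case True
    have W: "W = rev [True] @ qs' @ rev (map2 (\<noteq>) qs' ws') @ [\<not> w]" unfolding assms(2) w q using True by simp
    have *: "(W, interleave W N, k - ?t) \<in> set (words_below ws' [True] [\<not> w] N (Some k) acc)" if "?t \<le> k" for k
      by (rule words_below_sound[OF q(2) that W])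
    show ?thesis
    proof (cases w)
      case w': True
      then have "sub1 (Some r) = Some (r - 1)" "?t \<le> r - 1" "r - trues W = r - 1 - ?t"
        using sub1_Some[of r] assms(4) t True by simp_all
      then show ?thesis using *[of "r - 1"] w' by (simp add: w)
    next
      case w': False
      then have "sub1 (Some r) = Some (r - 1)" "sub1 (Some (r - 1)) = Some (r - 2)" "?t \<le> r - 2" "r - trues W = r - 2 - ?t"
        using sub1_Some[of r] sub1_Some[of "r - 1"] assms(4) t True by (simp_all add: numeral_2_eq_2)
      then show ?thesis using *[of "r - 2"] w' by (cases "all_False ws") (simp_all add: w numeral_2_eq_2)
    qed
  next
    case False
    then have nW: "True \<notin> set W" using assms(5) q by simp
    have "ws ! i = False" if "i < length ws" for i
    proof -
      have "i < length (map2 (\<noteq>) qs ws)" using that assms(1) by simp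
      then have "map2 (\<noteq>) qs ws ! i \<in> set W" unfolding assms(2) set_append set_rev by (intro UnI2 nth_mem)
      moreover have "qs ! i \<in> set W" unfolding assms(2) set_append using that assms(1) by (intro UnI1 nth_mem) simp
      ultimately show ?thesis using nW that assms(1) by (cases "ws ! i"; cases "qs ! i") simp_all
    qed
    then have ws: "ws = replicate (length ws) False" by (intro nth_equalityI) simp_all
    have lW: "length W = length ws + length ws" unfolding assms(2) using assms(1) by simp
    have "W ! i = False" if "i < length W" for i using nW nth_mem[OF that] by (cases "W ! i") simp_all
    then have "W = replicate (length ws + length ws) False" using lW by (intro nth_equalityI) simp_all
    then have "W = ws @ ws" using ws by (simp add: replicate_add)
    moreover have "\<not> w" using ws w by simp
    moreover have "all_False ws" using ws unfolding all_False_eq by (metis in_set_replicate)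
    moreover have "trues W = 0" using nW by simp
    ultimately show ?thesis by (simp add: w)
  qed
qed

lemma expand_sound:
  assumes "length qs = length ws" "W = qs @ rev (map2 (\<noteq>) qs ws)" "ws \<noteq> []" "trues W \<le> r"
    and "hd qs \<or> True \<notin> set W" "(ws, N, r) \<in> set st"
  shows "(W, interleave W N, r - trues W) \<in> set (expand st)"
  using assms(6)
proof (induction st)
  case (Cons x st)
  show ?case
  proof (cases "x = (ws, N, r)")
    case True then show ?thesis using expand1_sound[OF assms(1-5)] by simp
  next
    case False
    then have "(W, interleave W N, r - trues W) \<in> set (expand st)" using Cons by simp
    then show ?thesis using expand1_mono by (cases x) simp
  qed
qed simp

lemma interleave_upt:
  "interleave (map (\<lambda>i. u (2 * i)) [a..<Suc (a + n)]) (map (\<lambda>i. u (2 * i + 1)) [a..<a + n]) = map u [2 * a..<2 * (a + n) + 1]"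
proof (induction n arbitrary: a)
  case (Suc n)
  have 1: "[a..<Suc (a + Suc n)] = a # [Suc a..<Suc (Suc a + n)]" "[a..<a + Suc n] = a # [Suc a..<Suc a + n]"
    by (simp_all add: upt_conv_Cons del: upt_Suc)
  have 2: "[2 * a..<2 * (a + Suc n) + 1] = 2 * a # (2 * a + 1) # [2 * Suc a..<2 * (Suc a + n) + 1]"
    by (simp add: upt_conv_Cons del: upt_Suc)
  show ?case unfolding 1 2 using Suc[of "Suc a"] by (simp del: upt_Suc)
qed simp

text \<open>For u = r^2 + r^-2 this represents r^(2j) + r^(-2j) modulo 257.\<close>

fun cheb :: "int \<Rightarrow> nat \<Rightarrow> int" where
  "cheb u 0 = 2"
| "cheb u (Suc 0) = u"
| "cheb u (Suc (Suc j)) = (u * cheb u (Suc j) - cheb u j) mod 257"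

lemma chebyshev_eq:
  "chebyshev us (map (\<lambda>u. cheb u (Suc k)) us) (map (\<lambda>u. cheb u k) us) = map (\<lambda>u. cheb u (Suc (Suc k))) us"
  by (induction us) simp_all

lemma multipliers_eq:
  "multipliers js us (map (\<lambda>u. cheb u k) us) (map (\<lambda>u. cheb u (Suc k)) us) =
    map (\<lambda>j. map (\<lambda>u. cheb u j) us) [Suc k..<Suc k + length js]"
proof (induction js arbitrary: k)
  case (Cons t js)
  have "[Suc k..<Suc k + length (t # js)] = Suc k # [Suc (Suc k)..<Suc (Suc k) + length js]"
    by (simp add: upt_conv_Cons del: upt_Suc)
  then show ?case using Cons[of "Suc k"] by (simp add: chebyshev_eq del: upt_Suc)
qed simp

lemma negatives_eq: "negatives xs = map (\<lambda>x. 257 - x) xs"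
  by (induction xs) simp_all

lemma entries_eq: "entries bs = map (\<lambda>b. (b, Some (map (\<lambda>x. 257 - x) b))) bs"
  by (induction bs) (simp_all add: negatives_eq)

lemma all_twos_eq: "all_twos us = map (\<lambda>u. cheb u 0) us"
  by (induction us) simp_all

lemma table_entries:
  "first_positive (entries (multipliers js us (all_twos us) us)) =
    map (\<lambda>j. table (\<lambda>g j. cheb (us ! g) (nat j)) (length us) (int j)) [1..<Suc (length js)]"
proof (cases js)
  case (Cons t js')
  let ?tab = "\<lambda>j. table (\<lambda>g j. cheb (us ! g) (nat j)) (length us) (int j)"
  have us: "map (\<lambda>g. h (us ! g)) [0..<length us] = map h us" for h :: "int \<Rightarrow> int"
    by (rule nth_equalityI) simp_all
  have "multipliers js us (all_twos us) us = map (\<lambda>j. map (\<lambda>u. cheb u j) us) [1..<Suc (length js)]"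
    using multipliers_eq[of js us 0] by (simp add: all_twos_eq del: upt_Suc)
  also have "[1..<Suc (length js)] = 1 # [2..<Suc (length js)]"
    unfolding Cons by (simp add: upt_conv_Cons numeral_2_eq_2 del: upt_Suc)
  finally have "first_positive (entries (multipliers js us (all_twos us) us)) =
      (map (\<lambda>u. cheb u 1) us, None) #
      map (\<lambda>j. (map (\<lambda>u. cheb u j) us, Some (map (\<lambda>u. 257 - cheb u j) us))) [2..<Suc (length js)]"
    by (simp add: entries_eq comp_def del: upt_Suc)
  also have "\<dots> = ?tab 1 # map ?tab [2..<Suc (length js)]"
    unfolding table_def us using us[of "\<lambda>u. cheb u 1"] by (simp add: us[of "\<lambda>u. cheb u _"] us[of "\<lambda>u. 257 - cheb u _"] del: upt_Suc)
  also have "\<dots> = map ?tab [1..<Suc (length js)]"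
    unfolding Cons by (subst (2) upt_conv_Cons) (simp_all add: numeral_2_eq_2 del: upt_Suc)
  finally show ?thesis .
qed simp

lemma check_words_iff: "check_words q st \<longleftrightarrow> (\<forall>(W, N, r)\<in>set st. check_word q W N r)"
  by (induction q st rule: check_words.induct) (simp_all del: check_word.simps)

context unit_solution
begin

text \<open>Indices are stratified by their 2-adic valuation: the odd multiples of
  \<open>2 ^ e\<close> below \<open>M\<close>, whereas \<open>level\<close> collects all
  multiples.\<close>

definition odd_level :: "nat \<Rightarrow> bool list" where
  "odd_level e = map (\<lambda>i. p (2 ^ e * (2 * int i + 1))) [0..<2 ^ (m - 1 - e)]"
definition level :: "nat \<Rightarrow> bool list" where
  "level e = map (\<lambda>j. p (2 ^ e * int j)) [1..<2 ^ (m - e)]"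

lemma level_step:
  assumes "Suc e < m"
  shows "level e = interleave (odd_level e) (level (Suc e))" "trues (level e) = trues (odd_level e) + trues (level (Suc e))"
proof -
  define n where "n = (2::nat) ^ (m - 1 - e) - 1"
  have n: "2 ^ (m - 1 - e) = Suc n" unfolding n_def by simp
  have n2: "2 ^ (m - e) = Suc (2 * n + 1)"
  proof -
    have "m - e = Suc (m - 1 - e)" using assms by simp
    then have "(2::nat) ^ (m - e) = 2 * 2 ^ (m - 1 - e)" by (simp only: power_Suc)
    then show ?thesis unfolding n by simp
  qed
  define u where "u j = p (2 ^ e * (int j + 1))" for j
  have 1: "odd_level e = map (\<lambda>i. u (2 * i)) [0..<Suc (0 + n)]"
    unfolding odd_level_def n u_def by (simp del: upt_Suc)
  have "level (Suc e) = map (\<lambda>j. p (2 ^ e * (2 * int j))) [Suc 0..<Suc n]"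
    using assms n by (simp add: level_def mult_ac del: upt_Suc)
  also have "\<dots> = map (\<lambda>i. u (2 * i + 1)) [0..<0 + n]"
    unfolding map_Suc_upt[symmetric] map_map u_def by (simp add: comp_def algebra_simps del: upt_Suc)
  finally have 2: "level (Suc e) = map (\<lambda>i. u (2 * i + 1)) [0..<0 + n]" .
  have 3: "level e = map u [2 * 0..<2 * (0 + n) + 1]"
    unfolding level_def n2 One_nat_def map_Suc_upt[symmetric] map_map u_def by (simp add: comp_def algebra_simps del: upt_Suc)
  show "level e = interleave (odd_level e) (level (Suc e))" unfolding 1 2 3 interleave_upt ..
  have "length ys \<le> length xs \<Longrightarrow> trues (interleave xs ys) = trues xs + trues ys" for xs ys
    by (induction xs ys rule: interleave.induct) auto
  moreover have "length (level (Suc e)) \<le> length (odd_level e)" unfolding 1 2 by simp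
  ultimately show "trues (level e) = trues (odd_level e) + trues (level (Suc e))"
    unfolding \<open>level e = interleave (odd_level e) (level (Suc e))\<close> by blast
qed

text \<open>In \<open>c_double\<close>, \<open>c (h + M)\<close> equals \<open>c (M - h)\<close>. So
  the second half of a level, read backwards, is the sum of its first half and the next coarser
  level.\<close>

lemma odd_level_step:
  assumes "Suc e < m" "n = 2 ^ (m - 1 - Suc e)"
  shows "odd_level e = take n (odd_level e) @ rev (map2 (\<noteq>) (take n (odd_level e)) (odd_level (Suc e)))"
proof -
  have m: "m - 1 - e = Suc (m - 1 - Suc e)" "m = e + Suc (Suc (m - 1 - Suc e))" using assms(1) by simp_all
  have n2: "2 ^ (m - 1 - e) = 2 * n" unfolding m(1) power_Suc assms(2) ..
  have "M = 2 ^ (e + Suc (Suc (m - 1 - Suc e)))" unfolding M_def using m(2) by (rule arg_cong)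
  also have "\<dots> = 2 ^ e * (4 * 2 ^ (m - 1 - Suc e))" by (simp add: power_add)
  finally have Mn: "M = 2 ^ e * (4 * int n)" unfolding assms(2) of_nat_power by simp
  have nth: "odd_level e ! i = p (2 ^ e * (2 * int i + 1))" if "i < 2 * n" for i
    using that unfolding odd_level_def n2 by simp
  have len: "length (odd_level e) = 2 * n" "length (odd_level (Suc e)) = n" unfolding odd_level_def n2 assms(2)[symmetric] by simp_all
  show ?thesis
  proof (rule nth_equalityI)
    fix i assume "i < length (odd_level e)"
    then have i: "i < 2 * n" using len by simp
    show "odd_level e ! i = (take n (odd_level e) @ rev (map2 (\<noteq>) (take n (odd_level e)) (odd_level (Suc e)))) ! i"
    proof (cases "i < n")
      case True then show ?thesis using len by (simp add: nth_append)
    next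
      case False
      define k where "k = 2 * n - 1 - i"
      have k: "k < n" "2 * int i + 1 = 4 * int n - (2 * int k + 1)" using False i by (auto simp: k_def of_nat_diff)
      let ?h = "2 ^ e * (2 * int k + 1)"
      have "bb (p (2 * ?h)) = bb (p ?h) + bb (p (?h + M))" unfolding bb_p c_double ..
      also have "?h + M = - (2 ^ e * (4 * int n - (2 * int k + 1))) + 2 * M" unfolding Mn right_diff_distrib by linarith
      also have "\<dots> = - (2 ^ e * (2 * int i + 1)) + 2 * M" unfolding k(2) ..
      finally have "bb (p (2 * ?h)) = bb (p ?h) + bb (p (2 ^ e * (2 * int i + 1)))" unfolding p_sym .
      then have "p (2 ^ e * (2 * int i + 1)) = (p ?h \<noteq> p (2 * ?h))"
        by (cases "p (2 * ?h)"; cases "p ?h"; cases "p (2 ^ e * (2 * int i + 1))") simp_all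
      moreover have "odd_level (Suc e) ! k = p (2 * ?h)"
        using k(1) unfolding odd_level_def assms(2)[symmetric] power_Suc mult.assoc by simp
      moreover have "(take n (odd_level e) @ rev (map2 (\<noteq>) (take n (odd_level e)) (odd_level (Suc e)))) ! i =
          map2 (\<noteq>) (take n (odd_level e)) (odd_level (Suc e)) ! k"
      proof -
        have "n - Suc (i - n) = k" using False i by (simp add: k_def)
        then show ?thesis using False i len by (simp add: nth_append rev_nth)
      qed
      ultimately show ?thesis using nth[OF i] nth[of k] k(1) len by simp
    qed
  qed (simp add: len)
qed

lemma expands_sound:
  assumes norm: "\<And>e i. e < m \<Longrightarrow> odd i \<Longrightarrow> p (2 ^ e * i) \<Longrightarrow> p (2 ^ e)" and bound: "trues (level 0) \<le> S"
  shows "length es < m \<Longrightarrow> (odd_level (length es), level (length es), S - trues (level (length es))) \<in> set st \<Longrightarrow>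
    (odd_level 0, level 0, S - trues (level 0)) \<in> set (expands es st)"
proof (induction es arbitrary: st)
  case (Cons x es)
  let ?e = "length es"
  have e: "Suc ?e < m" using Cons.prems by simp
  have b: "trues (level e) \<le> S" if "e < m" for e
    using that
  proof (induction e)
    case (Suc e) then show ?case using level_step(2)[of e] by simp
  qed (rule bound)
  have "(odd_level ?e, interleave (odd_level ?e) (level (Suc ?e)), S - trues (level (Suc ?e)) - trues (odd_level ?e)) \<in> set (expand st)"
  proof (rule expand_sound[OF _ odd_level_step[OF e refl]])
    show "trues (odd_level ?e) \<le> S - trues (level (Suc ?e))"
      using level_step(2)[OF e] b[of ?e] e by simp
    show "hd (take (2 ^ (m - 1 - Suc ?e)) (odd_level ?e)) \<or> True \<notin> set (odd_level ?e)"
    proof (rule disjCI)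
      assume "\<not> True \<notin> set (odd_level ?e)"
      then obtain i where "p (2 ^ ?e * (2 * int i + 1))" by (auto simp: odd_level_def)
      then have "p (2 ^ ?e)" using norm[of ?e "2 * int i + 1"] e by simp
      then show "hd (take (2 ^ (m - 1 - Suc ?e)) (odd_level ?e))" by (simp add: odd_level_def hd_map upt_conv_Cons)
    qed
    show "(odd_level (Suc ?e), level (Suc ?e), S - trues (level (Suc ?e))) \<in> set st" using Cons.prems by simp
    have le: "(2::nat) ^ (m - 1 - Suc ?e) \<le> 2 ^ (m - 1 - ?e)" by (rule power_increasing) simp_all
    show "length (take (2 ^ (m - 1 - Suc ?e)) (odd_level ?e)) = length (odd_level (Suc ?e))"
      using le by (simp add: odd_level_def)
    show "odd_level (Suc ?e) \<noteq> []" by (simp add: odd_level_def)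
  qed
  then have "(odd_level ?e, level ?e, S - trues (level ?e)) \<in> set (expand st)"
    unfolding level_step(1)[OF e, symmetric] level_step(2)[OF e] by (simp add: add.commute)
  then show ?case using Cons.IH[of "expand st"] e by simp
qed simp

text \<open>The pattern of an actual solution occurs in the expanded list with the budget left after
  paying 1 for each odd coefficient, so it has been checked.\<close>

lemma run_sound:
  assumes run: "run t us fs js es ts (H - 1) st" and st: "([p (int H)], [p (int H)], S - of_bool (p (int H))) \<in> set st"
    and len: "length fs = length us" "length js = 2 * H - 1" "length es = m - 1" "2 * (length ts + 1) = H"
    and norm: "\<And>e i. e < m \<Longrightarrow> odd i \<Longrightarrow> p (2 ^ e * i) \<Longrightarrow> p (2 ^ e)" and pos: "C 1 > 0"
    and bound: "(\<Sum>j\<in>{1..<M}. C j * C j) + int cost0 \<le> int S" "S < 15"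
  shows "\<exists>g<length us. lookup_int t ((C 0 + (\<Sum>j\<in>{1..<M}. C j * cheb (us ! g) (nat j))) mod 257)"
proof -
  have m1: "m - (m - 1) = 1" using m_pos by simp
  have start: "odd_level (m - 1) = [p (int H)]" "level (m - 1) = [p (int H)]"
    unfolding odd_level_def level_def m1 H_def by (simp_all add: numeral_2_eq_2)
  have lev: "odd_level 0 = odd_parities" "level 0 = all_parities"
    by (simp_all add: odd_level_def odd_parities_def level_def all_parities_def Mn_eq H_def)
  \<comment> \<open>Each square is the parity of its base plus the extra cost, so the budget is
    shared between pattern and search.\<close>
  have split: "int (\<Sum>j\<in>{1..<M}. extra_cost (C j)) + int (trues all_parities) = (\<Sum>j\<in>{1..<M}. C j * C j)"
  proof -
    have "int (trues (map P xs)) = (\<Sum>j\<leftarrow>xs. of_bool (P j))" for P :: "nat \<Rightarrow> bool" and xs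
      by (induction xs) simp_all
    then have "int (trues all_parities) = (\<Sum>j\<in>{1..<2 * H}. of_bool (p (int j)))"
      unfolding all_parities_def using interv_sum_list_conv_sum_set_nat[of "\<lambda>j. of_bool (p (int j))" 1 "2 * H"]
      by (simp only: set_upt)
    also have "\<dots> = (\<Sum>j\<in>{1..<M}. C j mod 2)"
      by (rule sum.reindex_bij_witness[of _ nat int]) (auto simp: M_eq p_def mod2_eq_if)
    finally have 1: "int (trues all_parities) = (\<Sum>j\<in>{1..<M}. C j mod 2)" .
    have "int (\<Sum>j\<in>{1..<M}. extra_cost (C j)) = (\<Sum>j\<in>{1..<M}. C j * C j - C j mod 2)"
      unfolding of_nat_sum
    proof (rule sum.cong[OF refl])
      fix j
      have "C j mod 2 \<le> C j * C j"
      proof (cases "C j = 0")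
        case False
        then have "0 < C j * C j" by (simp add: zero_less_mult_iff) linarith
        moreover have "C j mod 2 < 2" by simp
        ultimately show ?thesis by linarith
      qed simp
      then show "int (extra_cost (C j)) = C j * C j - C j mod 2" by (simp add: extra_cost_def)
    qed
    then show ?thesis unfolding 1 by (simp add: sum_subtractf)
  qed
  have tr: "trues (level 0) \<le> S" using split bound(1) unfolding lev by linarith
  have mem: "(odd_parities, all_parities, S - trues all_parities) \<in> set (expands es st)"
    unfolding lev[symmetric]
  proof (rule expands_sound)
    show "p (2 ^ e)" if "e < m" "odd i" "p (2 ^ e * i)" for e i using that by (rule norm)
    have "trues [p (int H)] = of_bool (p (int H))" by simp
    then show "(odd_level (length es), level (length es), S - trues (level (length es))) \<in> set st"
      using st unfolding len(3) start by (simp only:)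
  qed (use tr len(3) m_pos in auto)
  let ?U = "\<lambda>g j. cheb (us ! g) (nat j)"
  have "Suc (2 * H - 1) = 2 * H" using H_pos by simp
  then have "check_words (make_params t fs ts (H - 1) (map (\<lambda>j. table ?U (length us) (int j)) [1..<2 * H])) (expands es st)"
    using run unfolding run.simps table_entries len(2) by simp
  then have cw: "check_word (make_params t fs ts (H - 1) (map (\<lambda>j. table ?U (length us) (int j)) [1..<2 * H]))
      odd_parities all_parities (S - trues all_parities)"
    using mem unfolding check_words_iff by (elim ballE[of _ _ "(odd_parities, all_parities, S - trues all_parities)"]) (simp_all only: prod.case)
  have small: "\<bar>C j\<bar> \<le> 3" if "j \<in> {1..<M}" for j
  proof (rule ccontr)
    assume "\<not> \<bar>C j\<bar> \<le> 3"
    then have "4 * 4 \<le> \<bar>C j\<bar> * \<bar>C j\<bar>" by (intro mult_mono) auto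
    also have "\<bar>C j\<bar> * \<bar>C j\<bar> = C j * C j" by simp
    also have "\<dots> \<le> (\<Sum>j\<in>{1..<M}. C j * C j)" by (rule member_le_sum) (use that in auto)
    finally show False using bound by linarith
  qed
  show ?thesis
  proof (rule check_word_sound[OF cw len(4,1) small pos])
    show "(\<Sum>j\<in>{1..<M}. extra_cost (C j)) + cost0 \<le> S - trues all_parities"
      using split bound(1) tr unfolding lev by linarith
  qed (use bound in auto)
qed

end


section \<open>The search results and the obstruction modulo 257\<close>

text \<open>Residues k for which k (k + 1) is not a square modulo 257, as certified by
  \<open>nonresidue_entries\<close>.\<close>

definition nonres_tree :: bit_tree where
  "nonres_tree = (Node False (Node True (Node True (Node False (Node False (Node True (Node True (Node False (Node False Leaf Leaf) Leaf) (Node True Leaf Leaf)) (Node False (Node False Leaf Leaf) (Node True Leaf Leaf))) (Node True (Node True (Node True Leaf Leaf) (Node True Leaf Leaf)) (Node True (Node True Leaf Leaf) (Node False Leaf Leaf)))) (Node True (Node False (Node False (Node False Leaf Leaf) (Node True Leaf Leaf)) (Node True (Node False Leaf Leaf) (Node True Leaf Leaf))) (Node True (Node False (Node True Leaf Leaf) (Node False Leaf Leaf)) (Node False (Node False Leaf Leaf) (Node False Leaf Leaf))))) (Node True (Node True (Node True (Node True (Node True Leaf Leaf) (Node False Leaf Leaf)) (Node True (Node True Leaf Leaf) (Node True Leaf Leaf))) (Node True (Node True (Node False Leaf Leaf) (Node True Leaf Leaf)) (Node False (Node False Leaf Leaf) (Node True Leaf Leaf)))) (Node True (Node True (Node False (Node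 False Leaf Leaf) (Node True Leaf Leaf)) (Node False (Node True Leaf Leaf) (Node True Leaf Leaf))) (Node False (Node True (Node True Leaf Leaf) (Node True Leaf Leaf)) (Node True (Node True Leaf Leaf) (Node True Leaf Leaf)))))) (Node False (Node True (Node True (Node False (Node True (Node False Leaf Leaf) (Node True Leaf Leaf)) (Node False (Node True Leaf Leaf) (Node False Leaf Leaf))) (Node True (Node False (Node True Leaf Leaf) (Node True Leaf Leaf)) (Node True (Node True Leaf Leaf) (Node True Leaf Leaf)))) (Node True (Node True (Node False (Node True Leaf Leaf) (Node False Leaf Leaf)) (Node False (Node False Leaf Leaf) (Node False Leaf Leaf))) (Node False (Node False (Node False Leaf Leaf) (Node False Leaf Leaf)) (Node False (Node True Leaf Leaf) (Node False Leaf Leaf))))) (Node True (Node False (Node False (Node True (Node False Leaf Leaf) (Node False Leaf Leaf)) (Node False (Node False Leaf Leaf) (Node True Leaf Leaf))) (Node False (Node False (Node False Leaf Leaf) (Node True Leaf Leaf)) (Node True (Node False Leaf Leaf) (Node True Leaf Leaf)))) (Node False (Node True (Node True (Node True Leaf Leaf) (Node True Leaf Leaf)) (Node True (Node False Leaf Leaf) (Node True Leaf Leaf))) (Node True (Node True (Node False Leaf Leaf) (Node False Leaf Leaf)) (Node False (Node True Leaf Leaf) (Node True Leaf Leaf))))))) (Node True (Node False (Node True (Node False (Node True (Node False (Node True Leaf Leaf) (Node True Leaf Leaf)) (Node True (Node True Leaf Leaf) (Node False Leaf Leaf))) (Node False (Node True (Node True Leaf Leaf) (Node False Leaf Leaf))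 (Node False (Node True Leaf Leaf) (Node False Leaf Leaf)))) (Node False (Node True (Node True (Node True Leaf Leaf) (Node False Leaf Leaf)) (Node False (Node True Leaf Leaf) (Node True Leaf Leaf))) (Node False (Node True (Node True Leaf Leaf) (Node False Leaf Leaf)) (Node False (Node True Leaf Leaf) (Node True Leaf Leaf))))) (Node True (Node False (Node False (Node True (Node False Leaf Leaf) (Node False Leaf Leaf)) (Node False (Node True Leaf Leaf) (Node False Leaf Leaf))) (Node False (Node False (Node False Leaf Leaf) (Node True Leaf Leaf)) (Node False (Node False Leaf Leaf) (Node True Leaf Leaf)))) (Node False (Node True (Node False (Node True Leaf Leaf) (Node True Leaf Leaf)) (Node False (Node True Leaf Leaf) (Node False Leaf Leaf))) (Node False (Node False (Node False Leaf Leaf) (Node False Leaf Leaf)) (Node False (Node False Leaf Leaf) (Node True Leaf Leaf)))))) (Node True (Node True (Node False (Node False (Node False (Node False Leaf Leaf) (Node False Leaf Leaf)) (Node False (Node False Leaf Leaf) (Node False Leaf Leaf))) (Node True (Node True (Node False Leaf Leaf) (Node True Leaf Leaf)) (Node True (Node False Leaf Leaf) (Node True Leaf Leaf)))) (Node False (Node True (Node False (Node False Leaf Leaf) (Node False Leaf Leaf)) (Node False (Node False Leaf Leaf) (Node False Leaf Leaf))) (Node False (Node True (Node False Leaf Leaf) (Node False Leaf Leaf)) (Node False (Node True Leaf Leaf) (Node False Leaf Leaf))))) (Node False (Node True (Node False (Node True (Node False Leaf Leaf) (Node False Leaf Leaf)) (Node True (Node True Leaf Leaf) (Node False Leaf Leaf)))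 (Node False (Node True (Node False Leaf Leaf) (Node True Leaf Leaf)) (Node True (Node True Leaf Leaf) (Node True Leaf Leaf)))) (Node False (Node False (Node True (Node False Leaf Leaf) (Node False Leaf Leaf)) (Node True (Node True Leaf Leaf) (Node False Leaf Leaf))) (Node True (Node True (Node True Leaf Leaf) (Node True Leaf Leaf)) (Node True (Node False Leaf Leaf) (Node False Leaf Leaf))))))))"

text \<open>In \<open>run_m\<close> the budget is half of the excluded trace
  \<open>c_seq (m + 1) - 2\<close>, lowered by 1 if the middle coefficient is odd; the two starting
  words are the two parities of that coefficient.\<close>

lemma run_2: "run nonres_tree [24, 131, 126, 233]
    [True, True, True, True] [True, True, True] [True] [] (Suc 0) [([False], [False], (Suc 0)), ([True], [True], 0)]"
  by code_simp

lemma run_3: "run nonres_tree [119, 167, 34, 135, 122, 223, 90, 138]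
    [True, True, True, True, True, True, True, True] [True, True, True, True, True, True, True] [True, True] [True] (Suc (Suc (Suc 0))) [([False], [False], (Suc (Suc 0))), ([True], [True], (Suc 0))]"
  by code_simp

lemma run_4: "run nonres_tree [246, 244, 6, 213, 155, 242, 116, 198, 59, 141, 15, 102]
    [True, True, True, True, True, True, True, True, True, True, True, True] [True, True, True, True, True, True, True, True, True, True, True, True, True, True, True] [True, True, True] [True, True, True] (Suc (Suc (Suc (Suc (Suc (Suc (Suc 0))))))) [([False], [False], (Suc (Suc (Suc (Suc (Suc 0)))))), ([True], [True], (Suc (Suc (Suc (Suc 0)))))]"
  by code_simp

lemma run_5a: "run nonres_tree [209, 62, 137, 230, 160, 66, 142, 171, 33, 237, 187, 19]
    [True, True, True, True, True, True, True, True, True, True, True, True] [True, True, True, True, True, True, True, True, True, True, True, True, True, True, True, True, True, True, True, True, True, True, True, True, True, True, True, True, True, True, True] [True, True, True, True] [True, True, True, True, True, True, True] (Suc (Suc (Suc (Suc (Suc (Suc (Suc (Suc (Suc (Suc (Suc (Suc (Suc (Suc (Suc 0))))))))))))))) [([False], [False], (Suc (Suc (Suc (Suc (Suc (Suc (Suc (Suc (Suc (Suc (Suc (Suc 0)))))))))))))]"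
  by code_simp

lemma run_5b: "run nonres_tree [209, 62, 137, 230, 160, 66, 142, 171, 33, 237, 187, 19]
    [True, True, True, True, True, True, True, True, True, True, True, True] [True, True, True, True, True, True, True, True, True, True, True, True, True, True, True, True, True, True, True, True, True, True, True, True, True, True, True, True, True, True, True] [True, True, True, True] [True, True, True, True, True, True, True] (Suc (Suc (Suc (Suc (Suc (Suc (Suc (Suc (Suc (Suc (Suc (Suc (Suc (Suc (Suc 0))))))))))))))) [([True], [True], (Suc (Suc (Suc (Suc (Suc (Suc (Suc (Suc (Suc (Suc (Suc 0))))))))))))]"
  by code_simp


fun squarings :: "nat \<Rightarrow> int \<Rightarrow> int" where
  "squarings 0 x = x"
| "squarings (Suc n) x = squarings n (x * x mod 257)"

declare squarings.simps [simp del]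

text \<open>Euler's criterion: the 128th power is -1, represented by 256.\<close>

definition nonresidue_entry :: "int \<Rightarrow> bool" where
  "nonresidue_entry k \<longleftrightarrow> (lookup_int nonres_tree k \<longrightarrow> squarings (Suc (Suc (Suc (Suc (Suc (Suc (Suc 0))))))) (k * (k + 1) mod 257) = 256)"

text \<open>The 256th power of a residue is never -1; hence the 128th power of a square is never
  -1.\<close>

definition fermat_entry :: "int \<Rightarrow> bool" where
  "fermat_entry k \<longleftrightarrow> (squarings (Suc (Suc (Suc (Suc (Suc (Suc (Suc (Suc 0)))))))) k \<noteq> 256)"

lemma nonresidue_entries: "list_all nonresidue_entry [0..256]"
  by code_simp

lemma fermat_entries: "list_all fermat_entry [0..256]"
  by code_simp


lemma of_int_257_eq_0_iff: "(of_int x :: 257) = 0 \<longleftrightarrow> 257 dvd x"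
  by (simp add: of_int_eq_0_iff_char_dvd)

lemma of_int_257_mod: "(of_int (x mod 257) :: 257) = of_int x"
proof -
  have "(of_int (x mod 257 - x) :: 257) = 0"
    unfolding of_int_257_eq_0_iff by (simp add: mod_eq_dvd_iff[symmetric])
  then show ?thesis by simp
qed

lemma nonres_tree_sound:
  assumes "lookup_int nonres_tree (e mod 257)"
  shows "(of_int e :: 257) * of_int e + of_int e \<noteq> y * y"
proof
  assume eq: "(of_int e :: 257) * of_int e + of_int e = y * y"
  obtain z where "y = of_int z" by (cases y) auto
  then have "(of_int (e * e + e - z * z) :: 257) = 0" using eq by simp
  then have "257 dvd e * (e + 1) - z * z" unfolding of_int_257_eq_0_iff by (simp add: algebra_simps)
  then have "e * (e + 1) mod 257 = z * z mod 257" by (simp only: mod_eq_dvd_iff)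
  then have *: "(e mod 257) * (e mod 257 + 1) mod 257 = (z mod 257) * (z mod 257) mod 257"
    using mod_mult_cong[of "e mod 257" 257 e "e mod 257 + 1" "e + 1"] by (simp add: mod_simps)
  have "e mod 257 \<in> set [0..256]" "z mod 257 \<in> set [0..256]" by auto
  then have "nonresidue_entry (e mod 257)" "fermat_entry (z mod 257)"
    using nonresidue_entries fermat_entries unfolding list_all_iff by blast+
  then show False using assms * unfolding nonresidue_entry_def fermat_entry_def squarings.simps(2)[of _ "z mod 257"]
    by simp
qed

definition evaluate :: "int \<Rightarrow> (int \<Rightarrow> 'a) \<Rightarrow> (int \<Rightarrow> int) \<Rightarrow> 'a::comm_ring_1" where
  "evaluate N \<rho> V = (\<Sum>k\<in>{0..<N}. of_int (V k) * \<rho> k)"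

text \<open>A multiplicative \<open>\<rho>\<close> with \<open>\<rho> N = - 1\<close> respects
  antiperiodicity, so evaluation is multiplicative.\<close>

lemma evaluate_conv:
  assumes "N > 0" "aseq N U" "aseq N V" and hom: "\<And>k l. \<rho> (k + l) = \<rho> k * \<rho> l" and "\<rho> N = - 1"
  shows "evaluate N \<rho> (conv N U V) = evaluate N \<rho> U * evaluate N \<rho> V"
proof -
  have per: "of_int (V (k + N)) * \<rho> (k + N) = of_int (V k) * \<rho> k" for k
    unfolding hom assms(5) aseqD(1)[OF assms(3)] by simp
  have "evaluate N \<rho> (conv N U V) = (\<Sum>j\<in>{0..<N}. \<Sum>k\<in>{0..<N}. of_int (U k) * of_int (V (j - k)) * \<rho> j)"
    unfolding evaluate_def conv_def of_int_sum of_int_mult sum_distrib_right ..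
  also have "\<dots> = (\<Sum>k\<in>{0..<N}. \<Sum>j\<in>{0..<N}. of_int (U k) * of_int (V (j - k)) * \<rho> j)" by (rule sum.swap)
  also have "\<dots> = (\<Sum>k\<in>{0..<N}. of_int (U k) * \<rho> k * (\<Sum>j\<in>{0..<N}. of_int (V (j + - k)) * \<rho> (j + - k)))"
    unfolding sum_distrib_left
  proof (intro sum.cong refl)
    fix k j
    have "\<rho> j = \<rho> (j + - k) * \<rho> k" unfolding hom[symmetric] by simp
    then show "of_int (U k) * of_int (V (j - k)) * \<rho> j = of_int (U k) * \<rho> k * (of_int (V (j + - k)) * \<rho> (j + - k))"
      by (simp add: mult_ac)
  qed
  also have "\<dots> = (\<Sum>k\<in>{0..<N}. of_int (U k) * \<rho> k * evaluate N \<rho> V)"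
    unfolding evaluate_def by (intro sum.cong refl arg_cong2[of _ _ _ _ "(*)"] sum_periodic_shift assms(1) per)
  also have "\<dots> = evaluate N \<rho> U * evaluate N \<rho> V" unfolding evaluate_def by (rule sum_distrib_right[symmetric])
  finally show ?thesis .
qed

lemma evaluate_half:
  assumes "H > 0" "aseq (2 * H) V" and hom: "\<And>k l. \<rho> (k + l) = \<rho> k * \<rho> l" and "\<rho> (2 * H) = - 1" "\<rho> 0 = 1"
  shows "evaluate (2 * H) \<rho> V = of_int (V 0) + (\<Sum>k\<in>{1..<H}. of_int (V k) * (\<rho> k + \<rho> (- k)))"
proof -
  let ?g = "\<lambda>k. of_int (V k) * \<rho> k"
  have g: "?g (2 * H - k) = of_int (V k) * \<rho> (- k)" for k
    using hom[of "2 * H" "- k"] aseqD(4)[OF assms(2), of k] assms(4) by simp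
  have "{0..<2 * H} = {0} \<union> {1..<H} \<union> {H} \<union> {H + 1..<2 * H}" using assms(1) by auto
  then have "evaluate (2 * H) \<rho> V = ?g 0 + (\<Sum>k\<in>{1..<H}. ?g k) + ?g H + (\<Sum>k\<in>{H + 1..<2 * H}. ?g k)"
    unfolding evaluate_def using assms(1) by (simp add: sum.union_disjoint)
  also have "(\<Sum>k\<in>{H + 1..<2 * H}. ?g k) = (\<Sum>k\<in>{1..<H}. ?g (2 * H - k))"
    by (rule sum.reindex_bij_witness[of _ "\<lambda>k. 2 * H - k" "\<lambda>k. 2 * H - k"]) auto
  also have "\<dots> = (\<Sum>k\<in>{1..<H}. of_int (V k) * \<rho> (- k))" unfolding g ..
  also have "?g H = 0" using aseq_mid[OF assms(2)] by simp
  finally show ?thesis using assms(5) by (simp add: sum.distrib[symmetric] distrib_left add.assoc)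
qed

text \<open>The equation c^2 + c = f^2 is transported along a homomorphism that sends the root of
  unity to a root of x^(4M) + 1 in any commutative ring.\<close>

lemma unit_seqs_evaluate:
  fixes \<rho> :: "int \<Rightarrow> 'a::comm_ring_1"
  assumes "unit_seqs m C F" "M = 2 ^ m" and hom: "\<And>k l. \<rho> (k + l) = \<rho> k * \<rho> l" and "\<rho> (4 * M) = - 1" "\<rho> 0 = 1"
    and e: "e = of_int (C 0) + (\<Sum>j\<in>{1..<M}. of_int (C j) * (\<rho> (2 * j) + \<rho> (- (2 * j))))"
  shows "\<exists>y. e * e + e = y * y"
proof -
  let ?\<sigma> = "\<lambda>k. \<rho> (2 * k)"
  have M: "M > 0" unfolding assms(2) by simp
  have C: "aseq (2 * M) C" and F: "aseq (4 * M) F" "\<And>k. even k \<Longrightarrow> F k = 0"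
    and law: "C j + conv (2 * M) C C j = conv (4 * M) F F (2 * j)" for j
    using assms(1) unfolding unit_seqs_def assms(2) by blast+
  have hom': "?\<sigma> (k + l) = ?\<sigma> k * ?\<sigma> l" for k l unfolding distrib_left by (rule hom)
  have s: "?\<sigma> (2 * M) = - 1" "?\<sigma> 0 = 1" using assms(4,5) by simp_all
  have e': "e = evaluate (2 * M) ?\<sigma> C" unfolding e by (subst evaluate_half[OF M C hom' s]) simp
  have "evaluate (4 * M) \<rho> F * evaluate (4 * M) \<rho> F = evaluate (4 * M) \<rho> (conv (4 * M) F F)"
    by (rule evaluate_conv[symmetric]) (use M F hom assms(4) in auto)
  also have "\<dots> = (\<Sum>k\<in>(\<lambda>j. 2 * j) ` {0..<2 * M}. of_int (conv (4 * M) F F k) * \<rho> k)"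
    unfolding evaluate_def
  proof (rule sum.mono_neutral_right)
    show "\<forall>k\<in>{0..<4 * M} - (\<lambda>j. 2 * j) ` {0..<2 * M}. of_int (conv (4 * M) F F k) * \<rho> k = 0"
    proof
      fix k assume k: "k \<in> {0..<4 * M} - (\<lambda>j. 2 * j) ` {0..<2 * M}"
      have "odd k"
      proof
        assume "even k"
        then obtain j where "k = 2 * j" by (elim evenE)
        then show False using k by auto
      qed
      then show "of_int (conv (4 * M) F F k) * \<rho> k = 0" using conv_odd[OF F(2)] by simp
    qed
  qed auto
  also have "\<dots> = (\<Sum>j\<in>{0..<2 * M}. of_int (conv (4 * M) F F (2 * j)) * ?\<sigma> j)"
    by (subst sum.reindex) (auto simp: inj_on_def)
  also have "\<dots> = evaluate (2 * M) ?\<sigma> C + evaluate (2 * M) ?\<sigma> (conv (2 * M) C C)"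
    unfolding law[symmetric] evaluate_def by (simp add: distrib_right sum.distrib)
  also have "evaluate (2 * M) ?\<sigma> (conv (2 * M) C C) = e * e"
    unfolding e' by (rule evaluate_conv) (use M C hom' s in auto)
  finally show ?thesis unfolding e'[symmetric] by (intro exI[of _ "evaluate (4 * M) \<rho> F"]) (simp add: add.commute)
qed

text \<open>The multiplier \<open>u = r\<^sup>2 + r\<^sup>-\<^sup>2\<close> comes from a root \<open>r\<close> of \<open>x ^ (4 * M) + 1\<close> modulo 257.\<close>

definition multiplier_root :: "nat \<Rightarrow> int \<Rightarrow> int \<Rightarrow> bool" where
  "multiplier_root n u r \<longleftrightarrow> (squarings n r = 256 \<and> (u * (r * r) - r * r * (r * r) - 1) mod 257 = 0 \<and>
    squarings (Suc (Suc (Suc (Suc (Suc (Suc (Suc (Suc 0)))))))) r = 1)"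

lemma of_int_squarings: "(of_int (squarings n x) :: 257) = of_int x ^ (2 ^ n)"
  by (induction n arbitrary: x) (simp_all add: squarings.simps of_int_257_mod power2_eq_square[symmetric] power_mult[symmetric])

lemma multiplier_character:
  assumes "multiplier_root (m + 2) u r"
  obtains \<rho> :: "int \<Rightarrow> 257" where "\<And>k l. \<rho> (k + l) = \<rho> k * \<rho> l" "\<rho> (4 * 2 ^ m) = - 1" "\<rho> 0 = 1" "of_int u = \<rho> 2 + \<rho> (- 2)"
proof
  define R :: 257 where "R = of_int r"
  \<comment> \<open>Since r^256 = 1, exponents may be reduced modulo 256, which extends the powers
    of r to negative exponents.\<close>
  define \<rho> where "\<rho> k = R ^ nat (k mod 256)" for k
  have "(of_int (squarings 8 r) :: 257) = R ^ (2 ^ 8)" unfolding R_def by (rule of_int_squarings)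
  moreover have "squarings 8 r = 1" using assms unfolding multiplier_root_def by (simp add: eval_nat_numeral)
  ultimately have R: "R ^ 256 = 1" by simp
  have red: "R ^ n = R ^ (n mod 256)" for n
  proof -
    have "R ^ n = R ^ (256 * (n div 256) + n mod 256)" by simp
    also have "\<dots> = R ^ (n mod 256)" unfolding power_add power_mult R by simp
    finally show ?thesis .
  qed
  show hom: "\<rho> (k + l) = \<rho> k * \<rho> l" for k l
  proof -
    have "nat (k mod 256 + l mod 256) mod nat 256 = nat ((k mod 256 + l mod 256) mod 256)"
      by (rule nat_mod_distrib[symmetric]) simp_all
    then have "(nat (k mod 256) + nat (l mod 256)) mod 256 = nat ((k + l) mod 256)"
      by (simp add: nat_add_distrib mod_simps)
    then show ?thesis unfolding \<rho>_def power_add[symmetric] using red[of "nat (k mod 256) + nat (l mod 256)"] by simp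
  qed
  show "\<rho> 0 = 1" by (simp add: \<rho>_def)
  have pos: "\<rho> (int n) = R ^ n" for n
  proof -
    have "nat (int n mod 256) = n mod 256" by (simp add: nat_mod_distrib)
    then show ?thesis unfolding \<rho>_def using red[of n] by simp
  qed
  have "\<rho> (4 * 2 ^ m) = R ^ (2 ^ (m + 2))" using pos[of "2 ^ (m + 2)"] by (simp add: power_add mult.commute)
  also have "\<dots> = of_int (squarings (m + 2) r)" unfolding R_def of_int_squarings ..
  also have "squarings (m + 2) r = 256" using assms unfolding multiplier_root_def by blast
  also have "(of_int 256 :: 257) = - 1" using of_int_257_eq_0_iff[of 257] by simp
  finally show "\<rho> (4 * 2 ^ m) = - 1" .
  have "(of_int (u * (r * r) - r * r * (r * r) - 1) :: 257) = 0"
    using assms unfolding of_int_257_eq_0_iff multiplier_root_def by (simp only: dvd_eq_mod_eq_0)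
  then have u: "of_int u * R ^ 2 = R ^ 2 * R ^ 2 + 1" by (simp add: R_def power2_eq_square algebra_simps)
  have inv: "\<rho> 2 * \<rho> (- 2) = 1" unfolding hom[symmetric] by (simp add: \<rho>_def)
  have "\<rho> 2 = R ^ 2" using pos[of 2] by simp
  then have "of_int u * (\<rho> 2 * \<rho> (- 2)) = (\<rho> 2 * \<rho> (- 2)) * \<rho> 2 + \<rho> (- 2)"
    using arg_cong[OF u, of "\<lambda>x. x * \<rho> (- 2)"] by (simp add: algebra_simps)
  then show "of_int u = \<rho> 2 + \<rho> (- 2)" unfolding inv by simp
qed

lemma of_int_cheb:
  assumes hom: "\<And>k l. \<rho> (k + l) = \<rho> k * \<rho> l" and "\<rho> 0 = (1::257)" "of_int u = \<rho> 2 + \<rho> (- 2)"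
  shows "of_int (cheb u j) = \<rho> (2 * int j) + \<rho> (- (2 * int j))"
  using assms(3)
proof (induction u j rule: cheb.induct)
  case (3 u j)
  have 1: "\<rho> (2 * int (Suc (Suc j))) = \<rho> 2 * \<rho> (2 * int (Suc j))" "\<rho> (2 * int j) = \<rho> (- 2) * \<rho> (2 * int (Suc j))"
    "\<rho> (- (2 * int (Suc (Suc j)))) = \<rho> (- 2) * \<rho> (- (2 * int (Suc j)))" "\<rho> (- (2 * int j)) = \<rho> 2 * \<rho> (- (2 * int (Suc j)))"
    unfolding hom[symmetric] by (simp_all add: algebra_simps)
  show ?case unfolding cheb.simps of_int_257_mod of_int_diff of_int_mult 3(1,2)[OF 3(3)] 1
    by (simp only: 3(3) distrib_left distrib_right) (simp only: add_diff_eq diff_add_eq ac_simps; simp)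
qed (use assms(2) in simp_all)

context unit_solution
begin

lemma not_nonresidue:
  assumes "multiplier_root (m + 2) u r"
  shows "\<not> lookup_int nonres_tree ((C 0 + (\<Sum>j\<in>{1..<M}. C j * cheb u (nat j))) mod 257)"
proof
  let ?e = "C 0 + (\<Sum>j\<in>{1..<M}. C j * cheb u (nat j))"
  assume l: "lookup_int nonres_tree (?e mod 257)"
  obtain \<rho> :: "int \<Rightarrow> 257" where \<rho>: "\<And>k l. \<rho> (k + l) = \<rho> k * \<rho> l" "\<rho> (4 * 2 ^ m) = - 1" "\<rho> 0 = 1" "of_int u = \<rho> 2 + \<rho> (- 2)"
    by (rule multiplier_character[OF assms]) (rule that)
  have "of_int (cheb u (nat j)) = \<rho> (2 * j) + \<rho> (- (2 * j))" if "j \<in> {1..<M}" for j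
    using of_int_cheb[of \<rho> u "nat j", OF \<rho>(1,3,4)] that by simp
  then have e: "of_int ?e = of_int (C 0) + (\<Sum>j\<in>{1..<M}. of_int (C j) * (\<rho> (2 * j) + \<rho> (- (2 * j))))"
    by (simp add: of_int_sum)
  have "\<exists>y. of_int ?e * of_int ?e + of_int ?e = (y * y :: 257)"
    by (rule unit_seqs_evaluate[OF sol M_def \<rho>(1) _ \<rho>(3) e]) (use \<rho>(2) in \<open>simp add: M_def\<close>)
  then show False using nonres_tree_sound[OF l] by blast
qed

end


section \<open>Symmetries of the equation: reflection and Galois dilation\<close>

text \<open>The coefficient sequence of the constant 1.\<close>

definition unit_seq :: "int \<Rightarrow> int \<Rightarrow> int" where
  "unit_seq N k = (if N dvd k then (if even (k div N) then 1 else - 1) else 0)"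

lemma aseq_unit_seq: "N > 0 \<Longrightarrow> aseq N (unit_seq N)"
proof -
  assume N: "N > 0"
  have "(- k) div N = - (k div N)" if "N dvd k" for k using that by (simp add: dvd_neg_div)
  then show "aseq N (unit_seq N)" unfolding aseq_def unit_seq_def using N by auto
qed

lemma conv_unit_seq:
  assumes "N > 0"
  shows "conv N (unit_seq N) V j = V j"
proof -
  have "unit_seq N k * V (j - k) = (if k = 0 then V j else 0)" if "k \<in> {0..<N}" for k
  proof (cases "k = 0")
    case False
    then have "\<not> N dvd k" using that zdvd_imp_le[of N k] by auto
    then show ?thesis using False by (simp add: unit_seq_def)
  qed (simp add: unit_seq_def)
  then have "conv N (unit_seq N) V j = (\<Sum>k\<in>{0..<N}. if k = 0 then V j else 0)"
    unfolding conv_def by (intro sum.cong refl)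
  then show ?thesis using assms by simp
qed

text \<open>If \<open>c\<close> solves \<open>c\<^sup>2 + c = f\<^sup>2\<close> then so does \<open>- 1 - c\<close>.\<close>

lemma unit_seqs_reflect:
  assumes "unit_seqs m C F"
  shows "unit_seqs m (\<lambda>k. - unit_seq (2 * 2 ^ m) k - C k) F"
proof -
  let ?N = "2 * 2 ^ m :: int" and ?d = "unit_seq (2 * 2 ^ m)"
  let ?C = "\<lambda>k. - ?d k - C k"
  have N: "?N > 0" by simp
  have C: "aseq ?N C" and law: "C j + conv ?N C C j = conv (4 * 2 ^ m) F F (2 * j)" for j
    using assms unfolding unit_seqs_def by blast+
  have d: "aseq ?N ?d" by (rule aseq_unit_seq[OF N])
  have "aseq ?N ?C" using C d unfolding aseq_def by simp
  moreover have "?C j + conv ?N ?C ?C j = conv (4 * 2 ^ m) F F (2 * j)" for j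
  proof -
    have "conv ?N ?C ?C j = conv ?N ?d ?d j + conv ?N ?d C j + conv ?N C ?d j + conv ?N C C j"
      unfolding conv_def sum.distrib[symmetric] by (intro sum.cong refl) (simp add: algebra_simps)
    also have "conv ?N C ?d j = conv ?N ?d C j" by (rule conv_commute[OF N C d])
    finally show ?thesis unfolding law[symmetric] conv_unit_seq[OF N] by simp
  qed
  ultimately show ?thesis using assms unfolding unit_seqs_def by blast
qed

lemma conv_dilate:
  assumes "N > 0" "aseq N V" "aseq N Y" "coprime u N"
  shows "conv N (\<lambda>k. V (u * k)) (\<lambda>k. Y (u * k)) j = conv N V Y (u * j)"
proof -
  have per: "V (k + N) * Y (u * j - (k + N)) = V k * Y (u * j - k)" for k
    by (rule conv_term_periodic[OF assms(2,3)])
  show ?thesis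
    unfolding conv_def using sum_periodic_affine[of N "\<lambda>k. V k * Y (u * j - k)" u 0, OF assms(1) per assms(4)]
    by (simp add: right_diff_distrib)
qed

lemma aseq_dilate:
  assumes "aseq N V" "odd u"
  shows "aseq N (\<lambda>k. V (u * k))"
proof -
  obtain q where q: "u = 2 * q + 1" using assms(2) by (elim oddE)
  have "V (u * (k + N)) = - V (u * k)" for k
  proof -
    have "u * (k + N) = (u * k + N) + q * (2 * N)" unfolding q by (simp add: algebra_simps)
    then show ?thesis using aseq_periodic[OF assms(1), of "u * k + N" q] aseqD(1)[OF assms(1)] by simp
  qed
  then show ?thesis using aseqD(2)[OF assms(1)] unfolding aseq_def by simp
qed

lemma conv_self_0:
  assumes "aseq N V"
  shows "conv N V V 0 = (\<Sum>k\<in>{0..<N}. V k * V k)"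
  unfolding conv_def using aseqD(2)[OF assms] by simp

lemma unit_seqs_positive:
  assumes "unit_seqs m C F"
  shows "conv (4 * 2 ^ m) F F 0 > 0"
proof -
  let ?N = "4 * 2 ^ m :: int"
  have F: "aseq ?N F" using assms unfolding unit_seqs_def by blast
  obtain k where k: "F k \<noteq> 0" using assms unfolding unit_seqs_def by blast
  have "k = k mod (2 * ?N) + (k div (2 * ?N)) * (2 * ?N)" by (simp only: mod_div_mult_eq)
  then have nz: "F (k mod (2 * ?N)) \<noteq> 0" using aseq_periodic[OF F, of "k mod (2 * ?N)" "k div (2 * ?N)"] k by simp
  have b: "0 \<le> k mod (2 * ?N)" "k mod (2 * ?N) < 2 * ?N" by simp_all
  obtain i where i: "i \<in> {0..<?N}" "F i \<noteq> 0"
  proof (cases "k mod (2 * ?N) < ?N")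
    case True then show thesis using that[of "k mod (2 * ?N)"] nz b by simp
  next
    case False
    have "F (k mod (2 * ?N) - ?N) \<noteq> 0" using nz aseqD(3)[OF F] by simp
    then show thesis using that[of "k mod (2 * ?N) - ?N"] False b by simp
  qed
  have "0 < F i * F i" using i(2) by (simp add: zero_less_mult_iff) linarith
  also have "\<dots> \<le> (\<Sum>k\<in>{0..<?N}. F k * F k)" by (rule member_le_sum) (use i in auto)
  finally show ?thesis unfolding conv_self_0[OF F] .
qed

text \<open>The Galois automorphisms act on the coefficient sequences by dilation.\<close>

lemma unit_seqs_dilate:
  assumes "unit_seqs m C F" "odd u"
  shows "unit_seqs m (\<lambda>k. C (u * k)) (\<lambda>k. F (u * k))"
    and "conv (4 * 2 ^ m) (\<lambda>k. F (u * k)) (\<lambda>k. F (u * k)) 0 = conv (4 * 2 ^ m) F F 0"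
proof -
  let ?N = "2 * 2 ^ m :: int" and ?N2 = "4 * 2 ^ m :: int"
  have C: "aseq ?N C" and F: "aseq ?N2 F" and ev: "\<And>k. even k \<Longrightarrow> F k = 0"
    and law: "C j + conv ?N C C j = conv ?N2 F F (2 * j)" for j
    using assms(1) unfolding unit_seqs_def by blast+
  have cop: "coprime u (2 ^ n)" for n using assms(2) by simp
  have c1: "coprime u ?N" using cop[of "Suc m"] by simp
  have c2: "coprime u ?N2" using cop[of "Suc (Suc m)"] by (simp add: mult.assoc[symmetric])
  have conv: "conv ?N2 (\<lambda>k. F (u * k)) (\<lambda>k. F (u * k)) j = conv ?N2 F F (u * j)" for j
    by (rule conv_dilate[OF _ F F c2]) simp
  show z: "conv ?N2 (\<lambda>k. F (u * k)) (\<lambda>k. F (u * k)) 0 = conv ?N2 F F 0" using conv[of 0] by simp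
  have "\<exists>k. F (u * k) \<noteq> 0"
  proof (rule ccontr)
    assume "\<not> (\<exists>k. F (u * k) \<noteq> 0)"
    then have "conv ?N2 (\<lambda>k. F (u * k)) (\<lambda>k. F (u * k)) 0 = 0" by (simp add: conv_def)
    then show False using z unit_seqs_positive[OF assms(1)] by simp
  qed
  moreover have "C (u * j) + conv ?N (\<lambda>k. C (u * k)) (\<lambda>k. C (u * k)) j =
      conv ?N2 (\<lambda>k. F (u * k)) (\<lambda>k. F (u * k)) (2 * j)" for j
    unfolding conv using law[of "u * j"] conv_dilate[OF _ C C c1, of j] by (simp add: mult.left_commute)
  ultimately show "unit_seqs m (\<lambda>k. C (u * k)) (\<lambda>k. F (u * k))"
    unfolding unit_seqs_def using aseq_dilate[OF C assms(2)] aseq_dilate[OF F assms(2)] ev by simp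
qed

text \<open>What the computation establishes for units with \<open>\<Sum>k. F k ^ 2 = 2 * S\<close>, separately for both
  parities of the middle coefficient.\<close>

definition search_fails :: "nat \<Rightarrow> nat \<Rightarrow> bool" where
  "search_fails m S \<longleftrightarrow> (\<forall>b. \<exists>us rs fs js es ts k st. run nonres_tree us fs js es ts k st \<and> k = 2 ^ (m - 1) - 1 \<and>
    ([b], [b], S - of_bool b) \<in> set st \<and> length fs = length us \<and> length js = 2 * 2 ^ (m - 1) - 1 \<and>
    length es = m - 1 \<and> 2 * (length ts + 1) = 2 ^ (m - 1) \<and> list_all2 (multiplier_root (m + 2)) us rs \<and> us \<noteq> [])"

lemma multiplier_roots_2: "list_all2 (multiplier_root (Suc (Suc (Suc (Suc 0)))))
    [24, 131, 126, 233] [136, 197, 223, 15]"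
  by code_simp

lemma multiplier_roots_3: "list_all2 (multiplier_root (Suc (Suc (Suc (Suc (Suc 0))))))
    [119, 167, 34, 135, 122, 223, 90, 138] [81, 222, 123, 23, 44, 73, 162, 187]"
  by code_simp

lemma multiplier_roots_4: "list_all2 (multiplier_root (Suc (Suc (Suc (Suc (Suc (Suc 0)))))))
    [246, 244, 6, 213, 155, 242, 116, 198, 59, 141, 15, 102] [9, 215, 196, 199, 185, 79, 231, 207, 62, 139, 208, 143]"
  by code_simp

lemma multiplier_roots_5: "list_all2 (multiplier_root (Suc (Suc (Suc (Suc (Suc (Suc (Suc 0))))))))
    [209, 62, 137, 230, 160, 66, 142, 171, 33, 237, 187, 19] [3, 27, 243, 131, 151, 74, 152, 83, 233, 41, 112, 237]"
  by code_simp

lemma search_failsI: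
  assumes "run nonres_tree us fs js es ts k st" "list_all2 (multiplier_root n) us rs" "n = m + 2" "k = 2 ^ (m - 1) - 1"
    "length fs = length us" "length js = 2 * 2 ^ (m - 1) - 1" "length es = m - 1" "2 * (length ts + 1) = 2 ^ (m - 1)"
    and "run nonres_tree us fs js es ts k st'" "([False], [False], S) \<in> set st" "([True], [True], S - 1) \<in> set st'" "us \<noteq> []"
  shows "search_fails m S"
  unfolding search_fails_def
proof
  fix b
  show "\<exists>us rs fs js es ts k st. run nonres_tree us fs js es ts k st \<and> k = 2 ^ (m - 1) - 1 \<and>
    ([b], [b], S - of_bool b) \<in> set st \<and> length fs = length us \<and> length js = 2 * 2 ^ (m - 1) - 1 \<and>
    length es = m - 1 \<and> 2 * (length ts + 1) = 2 ^ (m - 1) \<and> list_all2 (multiplier_root (m + 2)) us rs \<and> us \<noteq> []"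
    by (rule exI[of _ us], rule exI[of _ rs], rule exI[of _ fs], rule exI[of _ js], rule exI[of _ es],
        rule exI[of _ ts], rule exI[of _ k], rule exI[of _ "if b then st' else st"])
      (use assms in \<open>cases b; simp only: if_True if_False; simp del: run.simps\<close>)
qed

lemma search_fails_2: "search_fails 2 1"
  by (rule search_failsI[OF run_2 multiplier_roots_2 _ _ _ _ _ _ run_2]) (simp_all add: eval_nat_numeral)

lemma search_fails_3: "search_fails 3 2"
  by (rule search_failsI[OF run_3 multiplier_roots_3 _ _ _ _ _ _ run_3]) (simp_all add: eval_nat_numeral)

lemma search_fails_4: "search_fails 4 5"
  by (rule search_failsI[OF run_4 multiplier_roots_4 _ _ _ _ _ _ run_4]) (simp_all add: eval_nat_numeral)

lemma search_fails_5: "search_fails 5 12"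
  by (rule search_failsI[OF run_5a multiplier_roots_5 _ _ _ _ _ _ run_5b]) (simp_all add: eval_nat_numeral)

context unit_solution
begin

text \<open>The constant coefficient of c + c^2 = f^2. It turns a bound on the trace into a bound on
  all coefficients of c, which makes the search finite.\<close>

lemma trace_identity: "conv (4 * M) F F 0 = C 0 + C 0 * C 0 + 2 * (\<Sum>j\<in>{1..<M}. C j * C j)"
proof -
  have M: "M > 0" unfolding M_def by simp
  have "conv (2 * M) C C 0 = (\<Sum>k\<in>{0..<2 * M}. C k * C k)" by (rule conv_self_0[OF aseq_C])
  also have "\<dots> = C 0 * C 0 + C M * C M + 2 * (\<Sum>j\<in>{1..<M}. C j * C j)"
    by (rule sum_symmetric_half[OF M]) (simp add: aseqD(4)[OF aseq_C])
  also have "C M = 0" by (rule aseq_mid[OF aseq_C])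
  finally show ?thesis using law[of 0] by simp
qed

text \<open>A normalized solution within the bound would be visited by the search and refuted at
  some embedding, although its image there must satisfy the equation.\<close>

lemma normalized_solution:
  assumes "search_fails m S" "S < 15"
    and norm: "\<And>e i. e < m \<Longrightarrow> odd i \<Longrightarrow> p (2 ^ e * i) \<Longrightarrow> p (2 ^ e)" and pos: "C 1 > 0"
  shows "conv (4 * M) F F 0 > 2 * int S"
proof (rule ccontr)
  assume "\<not> conv (4 * M) F F 0 > 2 * int S"
  then have le: "C 0 + C 0 * C 0 + 2 * (\<Sum>j\<in>{1..<M}. C j * C j) \<le> 2 * int S" unfolding trace_identity by simp
  have "0 \<le> C 0 * C 0 + C 0"
  proof (cases "0 \<le> C 0")
    case False
    then have "0 \<le> (- C 0) * (- C 0 - 1)" by (intro mult_nonneg_nonneg) auto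
    then show ?thesis by (simp add: algebra_simps)
  qed simp
  moreover have "2 * ((C 0 * C 0 + C 0) div 2) = C 0 * C 0 + C 0" by (rule even_two_times_div_two) (use C0 in simp)
  ultimately have "2 * int cost0 = C 0 * C 0 + C 0" unfolding cost0_def by linarith
  then have bound: "(\<Sum>j\<in>{1..<M}. C j * C j) + int cost0 \<le> int S" using le by linarith
  obtain us rs fs js es ts k st where r: "run nonres_tree us fs js es ts k st" "k = 2 ^ (m - 1) - 1"
    "([p (int H)], [p (int H)], S - of_bool (p (int H))) \<in> set st" "length fs = length us" "length js = 2 * 2 ^ (m - 1) - 1"
    "length es = m - 1" "2 * (length ts + 1) = 2 ^ (m - 1)" "list_all2 (multiplier_root (m + 2)) us rs"
    using assms(1)[unfolded search_fails_def, rule_format, of "p (int H)"] by (elim exE conjE)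
  have "\<exists>g<length us. lookup_int nonres_tree ((C 0 + (\<Sum>j\<in>{1..<M}. C j * cheb (us ! g) (nat j))) mod 257)"
  proof (rule run_sound[OF _ r(3,4) _ r(6) _ _ pos bound assms(2)])
    show "run nonres_tree us fs js es ts (H - 1) st" using r(1) unfolding r(2) H_def .
    show "p (2 ^ e)" if "e < m" "odd i" "p (2 ^ e * i)" for e i using that by (rule norm)
  qed (use r(5,7) in \<open>simp_all add: H_def\<close>)
  then obtain g where g: "g < length us"
    "lookup_int nonres_tree ((C 0 + (\<Sum>j\<in>{1..<M}. C j * cheb (us ! g) (nat j))) mod 257)" by (elim exE conjE)
  have "multiplier_root (m + 2) (us ! g) (rs ! g)" by (rule list_all2_nthD[OF r(8) g(1)])
  then show False using not_nonresidue g(2) by blast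
qed

lemma p_double: "p (2 * h) \<longleftrightarrow> p h \<noteq> p (h + M)"
proof -
  have "bb (p (2 * h)) = bb (p h \<noteq> p (h + M))" unfolding bb_neq bb_p by (rule c_double)
  then show ?thesis unfolding bb_inject .
qed

lemma M_split: "e \<le> m \<Longrightarrow> M = 2 ^ e * 2 ^ (m - e)"
  unfolding M_def by (simp flip: power_add)

text \<open>By the doubling rule the parities of the next coarser level are sums of two parities of
  this one.\<close>

lemma p_level_up:
  assumes "e < m" "\<And>i. odd i \<Longrightarrow> \<not> p (2 ^ e * i)" "odd i"
  shows "\<not> p (2 ^ Suc e * i)"
proof -
  have s: "2 ^ e * i + M = 2 ^ e * (i + 2 ^ (m - e))"
    unfolding M_split[OF less_imp_le[OF assms(1)]] by (simp add: distrib_left)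
  have "odd (i + 2 ^ (m - e))" using assms(1,3) by simp
  then show ?thesis using p_double[of "2 ^ e * i"] assms(2)[OF assms(3)] assms(2)[of "i + 2 ^ (m - e)"]
    unfolding s by (simp add: mult.assoc)
qed

lemma p_levels_up:
  assumes "\<And>i. odd i \<Longrightarrow> \<not> p (2 ^ e * i)" "e \<le> e'" "e' < m" "odd i"
  shows "\<not> p (2 ^ e' * i)"
  using assms(2,3,4)
proof (induction e' arbitrary: i rule: dec_induct)
  case base then show ?case using assms(1) by blast
next
  case (step n)
  show ?case by (rule p_level_up) (use step in auto)
qed

text \<open>Dilation by \<open>u\<close> moves an odd coefficient of level \<open>e'\<close>, if
  there is one, to the index \<open>2 ^ e'\<close>, for all levels from \<open>e\<close> on.\<close>

definition normalizes :: "nat \<Rightarrow> int \<Rightarrow> bool" where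
  "normalizes e u \<longleftrightarrow> odd u \<and> (\<forall>e' i. e \<le> e' \<longrightarrow> e' < m \<longrightarrow> odd i \<longrightarrow> p (2 ^ e' * i) \<longrightarrow> p (2 ^ e' * u))"

lemma normalizesI:
  assumes "odd u" "\<And>e' i. e \<le> e' \<Longrightarrow> e' < m \<Longrightarrow> odd i \<Longrightarrow> p (2 ^ e' * i) \<Longrightarrow> p (2 ^ e' * u)"
  shows "normalizes e u"
  unfolding normalizes_def using assms by simp

lemma normalizesD: "normalizes e u \<Longrightarrow> e \<le> e' \<Longrightarrow> e' < m \<Longrightarrow> odd i \<Longrightarrow> p (2 ^ e' * i) \<Longrightarrow> p (2 ^ e' * u)"
  unfolding normalizes_def by simp

lemma p_shift: "p (k + q * (2 * M)) = p k"
proof (cases "even q")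
  case True
  then obtain r where "q = 2 * r" by (elim evenE)
  then have "k + q * (2 * M) = k + r * (2 * (2 * M))" by simp
  then show ?thesis unfolding p_def using aseq_periodic[OF aseq_C, of k r] by (simp only:)
next
  case False
  then obtain r where "q = 2 * r + 1" by (elim oddE)
  then have "k + q * (2 * M) = (k + 2 * M) + r * (2 * (2 * M))" by (simp add: algebra_simps)
  then have "C (k + q * (2 * M)) = - C k"
    using aseq_periodic[OF aseq_C, of "k + 2 * M" r] aseqD(1)[OF aseq_C, of k] by (simp only:)
  then show ?thesis by (simp add: p_def)
qed

text \<open>If the next coarser level is even, so are all coarser ones, and any odd coefficient of
  level \<open>e\<close> can be chosen. Otherwise \<open>u\<close> or \<open>u + 2 ^ (m - e)\<close>
  works.\<close>

lemma normalizes_step: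
  assumes e: "e < m" and u: "normalizes (Suc e) u" and i0: "odd i0" "p (2 ^ e * i0)"
  shows "\<exists>u. normalizes e u"
proof (cases "\<exists>i. Suc e < m \<and> odd i \<and> p (2 ^ Suc e * i)")
  case False
  have "normalizes e i0"
  proof (rule normalizesI[OF i0(1)])
    fix e' i assume *: "e \<le> e'" "e' < m" "odd i" "p (2 ^ e' * i)"
    have "e' = e"
    proof (rule ccontr)
      assume "e' \<noteq> e"
      then have "Suc e \<le> e'" using *(1) by simp
      moreover have "\<not> p (2 ^ Suc e * i)" if "odd i" for i using False that calculation *(2) by auto
      ultimately show False using p_levels_up[of "Suc e" e' i] * by simp
    qed
    then show "p (2 ^ e' * i0)" using i0(2) by simp
  qed
  then show ?thesis ..
next
  case True
  then obtain i where "Suc e < m" "odd i" "p (2 ^ Suc e * i)" by (elim exE conjE)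
  then have "p (2 ^ Suc e * u)" by (intro normalizesD[OF u]) simp_all
  \<comment> \<open>The coefficient at the doubled index is odd, so exactly one of the two
    candidates is odd.\<close>
  then have d: "p (2 ^ e * u) \<noteq> p (2 ^ e * u + M)" using p_double[of "2 ^ e * u"] by (simp add: mult.assoc)
  have odd: "odd u" using u by (simp add: normalizes_def)
  show ?thesis
  proof (cases "p (2 ^ e * u)")
    case True
    have "normalizes e u"
    proof (rule normalizesI[OF odd])
      fix e' i assume *: "e \<le> e'" "e' < m" "odd i" "p (2 ^ e' * i)"
      show "p (2 ^ e' * u)"
      proof (cases "e' = e")
        case False then show ?thesis using normalizesD[OF u _ *(2-4)] *(1) by simp
      qed (use True in simp)
    qed
    then show ?thesis ..
  next
    case False
    have s: "2 ^ e * (u + 2 ^ (m - e)) = 2 ^ e * u + M" using M_split[of e] e by (simp add: distrib_left)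
    have "normalizes e (u + 2 ^ (m - e))"
    proof (rule normalizesI)
      fix e' i assume *: "e \<le> e'" "e' < m" "odd i" "p (2 ^ e' * i)"
      show "p (2 ^ e' * (u + 2 ^ (m - e)))"
      proof (cases "e' = e")
        case True then show ?thesis using d False s by simp
      next
        case ne: False
        then have le: "Suc e \<le> e'" using *(1) by simp
        then obtain k where k: "e' = Suc e + k" using le_Suc_ex by blast
        \<comment> \<open>On coarser levels the correction of \<open>u\<close> is a multiple of
          \<open>2 * M\<close> and leaves parities unchanged.\<close>
        have "2 ^ e' * (u + 2 ^ (m - e)) = 2 ^ e' * u + 2 ^ k * (2 * M)"
          unfolding k M_split[OF less_imp_le[OF e]] by (simp add: power_add distrib_left)
        then show ?thesis using normalizesD[OF u le *(2-4)] by (simp only: p_shift)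
      qed
    qed (use odd e in simp)
    then show ?thesis ..
  qed
qed

lemma normalizing_dilation: "e \<le> m \<Longrightarrow> \<exists>u. normalizes e u"
proof (induction "m - e" arbitrary: e)
  case 0
  have "normalizes e 1" by (rule normalizesI) (use 0 in auto)
  then show ?case ..
next
  case (Suc d)
  then have e: "e < m" by linarith
  show ?case
  proof (cases "\<exists>i. odd i \<and> p (2 ^ e * i)")
    case False
    have "normalizes e 1"
    proof (rule normalizesI)
      fix e' i assume *: "e \<le> e'" "e' < m" "odd i" "p (2 ^ e' * i)"
      have "\<not> p (2 ^ e * i)" if "odd i" for i using False that by blast
      then show "p (2 ^ e' * 1)" using p_levels_up[of e e' i] * by simp
    qed simp
    then show ?thesis ..
  next
    case True
    then obtain i0 where i0: "odd i0" "p (2 ^ e * i0)" by (elim exE conjE)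
    have "\<exists>u. normalizes (Suc e) u" by (rule Suc(1)) (use Suc(2) e in auto)
    then obtain u where "normalizes (Suc e) u" ..
    then show ?thesis by (rule normalizes_step[OF e _ i0])
  qed
qed

lemma p_eq_False:
  assumes "\<And>e i. e < m \<Longrightarrow> odd i \<Longrightarrow> \<not> p (2 ^ e * i)"
  shows "\<not> p j"
proof (cases "M dvd j")
  case True
  then obtain q where q: "j = M * q" by (elim dvdE)
  obtain r where "q = 2 * r \<or> q = 2 * r + 1" by (metis evenE oddE)
  then have "j = 0 + r * (2 * M) \<or> j = M + r * (2 * M)" unfolding q by (auto simp: algebra_simps)
  then show ?thesis using p_shift[of 0 r] p_shift[of M r] p_sym(4,5) by metis
next
  case False
  then have "j \<noteq> 0" by auto
  obtain i where "j = 2 ^ multiplicity 2 j * i" "\<not> 2 dvd i"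
    by (rule multiplicity_decompose'[OF \<open>j \<noteq> 0\<close>, of 2]) simp_all
  then obtain e where e: "odd i" "j = 2 ^ e * i" by blast
  have "e < m"
  proof (rule ccontr)
    assume "\<not> e < m"
    then have "(2::int) ^ m dvd 2 ^ e" by (simp add: le_imp_power_dvd)
    then show False using False unfolding e(2) M_def by (meson dvd_mult2)
  qed
  then show ?thesis using assms e by blast
qed

end


section \<open>From normalized to arbitrary solutions\<close>

lemma nonres_tree_small: "lookup_int nonres_tree 2" "lookup_int nonres_tree 4" "lookup_int nonres_tree 253"
  by code_simp+

definition normalized :: "nat \<Rightarrow> (int \<Rightarrow> int) \<Rightarrow> bool" where
  "normalized m C \<longleftrightarrow> (\<forall>e i. e < m \<longrightarrow> odd i \<longrightarrow> odd (C (2 ^ e * i)) \<longrightarrow> odd (C (2 ^ e)))"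

context unit_solution
begin

lemma dilate: "odd u \<Longrightarrow> unit_solution m (\<lambda>k. C (u * k)) (\<lambda>k. F (u * k)) M"
  using unit_seqs_dilate(1)[OF sol] m_pos by unfold_locales (simp_all add: M_def C0)

lemma dilate_trace: "odd u \<Longrightarrow> conv (4 * M) (\<lambda>k. F (u * k)) (\<lambda>k. F (u * k)) 0 = conv (4 * M) F F 0"
  unfolding M_def by (rule unit_seqs_dilate(2)[OF sol])

lemma normalized_iff: "normalized m C \<longleftrightarrow> (\<forall>e i. e < m \<longrightarrow> odd i \<longrightarrow> p (2 ^ e * i) \<longrightarrow> p (2 ^ e))"
  unfolding normalized_def p_def ..

lemma ex_normalized: "\<exists>u. odd u \<and> normalized m (\<lambda>k. C (u * k))"
proof -
  have "\<exists>u. normalizes 0 u" by (rule normalizing_dilation) simp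
  then obtain u where u: "normalizes 0 u" ..
  then have odd: "odd u" by (simp add: normalizes_def)
  have "odd (C (u * 2 ^ e))" if "e < m" "odd i" "odd (C (u * (2 ^ e * i)))" for e i
  proof -
    have "p (2 ^ e * (u * i))" using that(3) by (simp add: p_def mult.left_commute)
    then have "p (2 ^ e * u)" by (rule normalizesD[OF u _ that(1), rotated 2]) (use odd that in simp_all)
    then show ?thesis by (simp add: p_def mult.commute)
  qed
  then show ?thesis using odd unfolding normalized_def by blast
qed

text \<open>If \<open>C 1\<close> is even, the normalization makes every level even. The condition
  is then empty, so dilation by \<open>i\<close> itself is allowed.\<close>

lemma ex_nonzero_normalized:
  assumes "normalized m C" "odd i" "C i \<noteq> 0"
  shows "\<exists>v. odd v \<and> normalized m (\<lambda>k. C (v * k)) \<and> C v \<noteq> 0"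
proof (cases "p 1")
  case True
  then have "C 1 \<noteq> 0" by (auto simp: p_def)
  then show ?thesis using assms(1) by (intro exI[of _ 1]) simp
next
  case False
  have "\<not> p (2 ^ 0 * j)" if "odd j" for j
    using assms(1)[unfolded normalized_iff, rule_format, of 0 j] m_pos that False by auto
  then have "\<not> p (2 ^ e * j)" if "e < m" "odd j" for e j by (rule p_levels_up[OF _ _ that]) simp_all
  then have "\<not> odd (C (i * (2 ^ e * j)))" if "e < m" "odd j" for e j
    using that assms(2) unfolding p_def[symmetric] mult.left_commute[of i] by simp
  then have "normalized m (\<lambda>k. C (i * k))" unfolding normalized_def by blast
  then show ?thesis using assms by blast
qed

text \<open>Dilation by \<open>1 + 2 * M\<close> negates the coefficients at odd indices and
  preserves all parities.\<close>

lemma ex_positive_normalized: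
  assumes "normalized m C" "C 1 \<noteq> 0"
  shows "\<exists>w. odd w \<and> normalized m (\<lambda>k. C (w * k)) \<and> C w > 0"
proof (cases "C 1 > 0")
  case True
  then show ?thesis using assms(1) by (intro exI[of _ 1]) simp
next
  case False
  let ?w = "1 + 2 * M"
  have "C ?w > 0" using False assms(2) aseqD(1)[OF aseq_C, of 1] by simp
  moreover have "odd (C (?w * k)) = odd (C k)" for k
  proof -
    have "?w * k = k + k * (2 * M)" by (simp add: algebra_simps)
    then show ?thesis using p_shift[of k k] unfolding p_def by (simp only:)
  qed
  then have "normalized m (\<lambda>k. C (?w * k))" using assms(1) unfolding normalized_def by (simp only:) 
  moreover have "odd ?w" by simp
  ultimately show ?thesis by blast
qed

text \<open>Half the trace is the sum of F_k^2 over 0 < k < 2M. Modulo 2 its terms agree in pairs k,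
  2M - k, because \<open>c_odd\<close> with \<open>c = 0\<close> makes \<open>f\<close> symmetric;
  the middle term vanishes as \<open>M\<close> is even.\<close>

lemma trace_even_half:
  assumes "\<And>j. \<not> p j" "conv (4 * M) F F 0 = 2 * t"
  shows "even t"
proof -
  have M: "M > 0" unfolding M_def by simp
  have F0: "F 0 = 0" "F (2 * M) = 0" using F_even by simp_all
  have c0: "c k = 0" for k using assms(1)[of k] unfolding bb_p[symmetric] by simp
  have "conv (4 * M) F F 0 = (\<Sum>k\<in>{0..<2 * (2 * M)}. F k * F k)" using conv_self_0[OF aseq_F] by simp
  also have "\<dots> = F 0 * F 0 + F (2 * M) * F (2 * M) + 2 * (\<Sum>k\<in>{1..<2 * M}. F k * F k)"
  proof (rule sum_symmetric_half)
    show "F (2 * (2 * M) - k) * F (2 * (2 * M) - k) = F k * F k" for k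
      using aseqD(4)[OF aseq_F, of k] by simp
  qed (use M in simp)
  finally have t: "t = (\<Sum>k\<in>{1..<2 * M}. F k * F k)" using assms(2) F0 by simp
  have sq: "f k * f k = f k" for k by (cases "f k") simp_all
  have sym: "f (2 * M - k) = f k" for k
  proof (cases "even k")
    case False
    then have "f (- k) + f (- k + 2 * M) = 0" using c_odd[of "- k"] c0 by simp
    then have "f (- k + 2 * M) = f (- k)" by (cases "f (- k)"; cases "f (- k + 2 * M)") simp_all
    then show ?thesis by (simp add: f_periodic)
  qed (use f_even in simp)
  have "{0..<2 * M} = insert 0 {1..<2 * M}" using M by auto
  then have "(\<Sum>k\<in>{1..<2 * M}. f k) = (\<Sum>k\<in>{0..<2 * M}. f k)" using f_even[of 0] by simp
  also have "\<dots> = f 0 + f M + 2 * (\<Sum>k\<in>{1..<M}. f k)" by (rule sum_symmetric_half[of M f, OF M sym])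
  also have "\<dots> = 0" using f_even M_even by simp
  finally have "(of_int t :: bit) = 0" unfolding t of_int_sum of_int_mult f_def[symmetric] sq .
  then show ?thesis by (simp add: of_int_bit_eq_0_iff)
qed

text \<open>With \<open>c = 0\<close> the linear system at even indices reads \<open>s = 0\<close>,
  so the C_j there are divisible by 4 and must vanish by the bound. Only the constant C_0
  remains.\<close>

lemma even_solution:
  assumes "\<And>j. \<not> p j" "\<And>j. odd j \<Longrightarrow> C j = 0" "multiplier_root (m + 2) u r"
  shows "conv (4 * M) F F 0 > 24"
proof (rule ccontr)
  assume "\<not> conv (4 * M) F F 0 > 24"
  then have le: "C 0 + C 0 * C 0 + 2 * (\<Sum>j\<in>{1..<M}. C j * C j) \<le> 24" unfolding trace_identity by simp
  have pos: "C 0 + C 0 * C 0 + 2 * (\<Sum>j\<in>{1..<M}. C j * C j) > 0"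
    using unit_seqs_positive[OF sol] trace_identity unfolding M_def by simp
  obtain d where d: "C 0 = 2 * d" using C0 by (elim evenE)
  have nonneg: "0 \<le> C 0 + C 0 * C 0"
  proof (cases "0 \<le> C 0")
    case False
    then have "0 \<le> (- C 0) * (- C 0 - 1)" by (intro mult_nonneg_nonneg) auto
    then show ?thesis by (simp add: algebra_simps)
  qed simp
  have c0: "c k = 0" "co k = 0" for k using assms(1)[of k] unfolding co_def bb_p[symmetric] by simp_all
  have zero: "C j = 0" if j: "j \<in> {1..<M}" for j
  proof (rule ccontr)
    assume nz: "C j \<noteq> 0"
    then have "even j" using assms(2) by blast
    then obtain h where h: "j = 2 * h" by (elim evenE)
    have "s (2 * h) = 0" using linear_row_even[of h] j unfolding h c0 by simp
    then have "even (C j div 2)" unfolding h s_def by (simp add: of_int_bit_eq_0_iff)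
    moreover have "even (C j)" using assms(1)[of j] by (simp add: p_def)
    ultimately obtain k where k: "C j = 4 * k" by (auto elim!: evenE)
    have "1 \<le> \<bar>k\<bar>" using nz k by simp
    then have "1 * 1 \<le> \<bar>k\<bar> * \<bar>k\<bar>" by (intro mult_mono) auto
    then have "16 \<le> C j * C j" unfolding k by simp
    also have "\<dots> \<le> (\<Sum>j\<in>{1..<M}. C j * C j)" by (rule member_le_sum) (use j in auto)
    finally show False using le nonneg by linarith
  qed
  then have sq: "(\<Sum>j\<in>{1..<M}. C j * C j) = 0" and ch: "(\<Sum>j\<in>{1..<M}. C j * cheb u (nat j)) = 0" by simp_all
  have T: "d * (2 * d + 1) \<le> 12" "d * (2 * d + 1) > 0" using le pos unfolding sq d by (simp_all add: algebra_simps)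
  have "d \<le> 2"
  proof (rule ccontr)
    assume "\<not> d \<le> 2"
    then have "3 * 7 \<le> d * (2 * d + 1)" by (intro mult_mono) auto
    then show False using T by simp
  qed
  moreover have "- 2 \<le> d"
  proof (rule ccontr)
    assume "\<not> - 2 \<le> d"
    then have "3 * 5 \<le> (- d) * (- (2 * d + 1))" by (intro mult_mono) auto
    then show False using T unfolding minus_mult_minus by simp
  qed
  ultimately have "d = - 2 \<or> d = - 1 \<or> d = 0 \<or> d = 1 \<or> d = 2" by arith
  \<comment> \<open>The constants 2, 4 and -4 (253 modulo 257) are in the tree and d = 0 gives trace
    0. What remains, C_0 = -2 of trace 2, is excluded by \<open>trace_even_half\<close>.\<close>
  then have "d = - 1"
    using T(2) not_nonresidue[OF assms(3)] nonres_tree_small unfolding ch d by auto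
  then have "conv (4 * M) F F 0 = 2 * 1" unfolding trace_identity sq d by simp
  then show False using trace_even_half[OF assms(1)] by fastforce
qed

text \<open>Two cases: a nonzero coefficient at an odd index can be moved to index 1 and made
  positive, as the search requires; otherwise all parities vanish and \<open>even_solution\<close>
  applies.\<close>

lemma normalized_trace:
  assumes "search_fails m S" "S \<le> 12" "normalized m C"
  shows "conv (4 * M) F F 0 > 2 * int S"
proof (cases "\<exists>i. odd i \<and> C i \<noteq> 0")
  case True
  then obtain i where "odd i" "C i \<noteq> 0" by (elim exE conjE)
  then obtain v where v: "odd v" "normalized m (\<lambda>k. C (v * k))" "C v \<noteq> 0"
    using ex_nonzero_normalized[OF assms(3) \<open>odd i\<close> \<open>C i \<noteq> 0\<close>] by (elim exE conjE)
  interpret v: unit_solution m "\<lambda>k. C (v * k)" "\<lambda>k. F (v * k)" M by (rule dilate[OF v(1)])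
  have "\<exists>w. odd w \<and> normalized m (\<lambda>k. C (v * (w * k))) \<and> C (v * w) > 0"
    by (rule v.ex_positive_normalized) (use v in simp_all)
  then obtain w where w: "odd w" "normalized m (\<lambda>k. C (v * (w * k)))" "C (v * w) > 0" by (elim exE conjE)
  interpret w: unit_solution m "\<lambda>k. C (v * (w * k))" "\<lambda>k. F (v * (w * k))" M by (rule v.dilate[OF w(1)])
  have "conv (4 * M) (\<lambda>k. F (v * (w * k))) (\<lambda>k. F (v * (w * k))) 0 > 2 * int S"
  proof (rule w.normalized_solution[OF assms(1)])
    show "w.p (2 ^ e)" if "e < m" "odd i" "w.p (2 ^ e * i)" for e i
      using w(2)[unfolded w.normalized_iff, rule_format, OF that] .
  qed (use assms(2) w(3) in simp_all)
  then show ?thesis unfolding v.dilate_trace[OF w(1)] dilate_trace[OF v(1)] .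
next
  case False
  then have z: "C j = 0" if "odd j" for j using that by blast
  then have "\<not> p (2 ^ 0 * j)" if "odd j" for j using that by (simp add: p_def)
  then have "\<not> p (2 ^ e * j)" if "e < m" "odd j" for e j by (rule p_levels_up[OF _ _ that]) simp_all
  then have np: "\<not> p j" for j by (rule p_eq_False)
  obtain us rs where r: "list_all2 (multiplier_root (m + 2)) us rs" "us \<noteq> []"
    using assms(1)[unfolded search_fails_def, rule_format, of True] by (elim exE conjE) (rule that)
  obtain u r where "multiplier_root (m + 2) u r" using r by (cases us) (auto simp: list_all2_Cons1)
  then show ?thesis using even_solution[OF np z] assms(2) by fastforce
qed

lemma trace_gt:
  assumes "search_fails m S" "S \<le> 12"
  shows "conv (4 * M) F F 0 > 2 * int S"
proof -
  obtain u where u: "odd u" "normalized m (\<lambda>k. C (u * k))" using ex_normalized by (elim exE conjE)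
  interpret u: unit_solution m "\<lambda>k. C (u * k)" "\<lambda>k. F (u * k)" M by (rule dilate[OF u(1)])
  show ?thesis using u.normalized_trace[OF assms u(2)] unfolding dilate_trace[OF u(1)] .
qed

end

section \<open>The lower bound and the minimum\<close>

lemma unit_seqs_trace_gt:
  assumes "unit_seqs m C F" "search_fails m S" "S \<le> 12" "m \<ge> 1"
  shows "conv (4 * 2 ^ m) F F 0 > 2 * int S"
proof -
  have gt: "conv (4 * 2 ^ m) F F 0 > 2 * int S" if "unit_seqs m C' F" "even (C' 0)" for C'
  proof -
    interpret unit_solution m C' F "2 ^ m" using that assms(4) by unfold_locales simp_all
    show ?thesis by (rule trace_gt[OF assms(2,3)])
  qed
  show ?thesis
  proof (cases "even (C 0)")
    case True then show ?thesis by (rule gt[OF assms(1)])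
  next
    case False
    then show ?thesis using gt[OF unit_seqs_reflect[OF assms(1)]] by (simp add: unit_seq_def)
  qed
qed

lemma unit_seqs_trace_even:
  assumes "unit_seqs m C F"
  shows "even (conv (4 * 2 ^ m) F F 0)"
proof -
  let ?K = "2 * 2 ^ m :: int"
  have F: "aseq (2 * ?K) F" "F 0 = 0" "F ?K = 0" using assms unfolding unit_seqs_def by simp_all
  have "conv (2 * ?K) F F 0 = F 0 * F 0 + F ?K * F ?K + 2 * (\<Sum>k\<in>{1..<?K}. F k * F k)"
    unfolding conv_self_0[OF F(1)]
  proof (rule sum_symmetric_half)
    show "F (2 * ?K - k) * F (2 * ?K - k) = F k * F k" for k unfolding aseqD(4)[OF F(1)] by simp
  qed simp
  then show ?thesis using F(2,3) by simp
qed

text \<open>The trace is even, so exceeding 2S means at least 2S + 2. This is \<open>c_seq\<close>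
  for S = 1, 2, 5, 12 and n = 3, 4, 5, 6; for n = 1 and 2, a positive even number is at least
  2.\<close>

lemma c_seq_le_trace:
  assumes "unit_seqs m C F" "m \<le> 5"
  shows "c_seq (Suc m) \<le> conv (4 * 2 ^ m) F F 0"
proof -
  let ?T = "conv (4 * 2 ^ m) F F 0"
  obtain b where b: "?T = 2 * b" using unit_seqs_trace_even[OF assms(1)] by (elim evenE)
  have gt: "2 * int S + 2 \<le> ?T" if "search_fails m S" "S \<le> 12" "1 \<le> m" for S
  proof -
    have "?T > 2 * int S" by (rule unit_seqs_trace_gt[OF assms(1) that])
    then have "int S < b" unfolding b by simp
    then show ?thesis unfolding b by simp
  qed
  have "0 < b" using unit_seqs_positive[OF assms(1)] unfolding b by simp
  then have two: "2 \<le> ?T" unfolding b by simp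
  have "m \<in> {0, 1, 2, 3, 4, 5}" using assms(2) by auto
  then consider "m = 0" | "m = 1" | "m = 2" | "m = 3" | "m = 4" | "m = 5" by blast
  then show ?thesis
  proof cases
    case 3 then show ?thesis using gt[of 1] search_fails_2 c_seq_values by simp
  next
    case 4 then show ?thesis using gt[of 2] search_fails_3 c_seq_values by simp
  next
    case 5 then show ?thesis using gt[of 5] search_fails_4 c_seq_values by simp
  next
    case 6 then show ?thesis using gt[of 12] search_fails_5 c_seq_values by simp
  qed (use two c_seq_values in \<open>simp_all add: numeral_2_eq_2\<close>)
qed

theorem theorem2p7:
  fixes n :: nat
  assumes "1 \<le> n" and "n \<le> 6"
  shows "(\<exists>\<epsilon> \<in> RE_plus n - {1, -1}.
            field_trace \<rat> (BB n) (\<epsilon>\<^sup>2) = 2 ^ n * (1 + 8 * real_of_int (c_seq n))) \<and>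
         (\<forall>\<epsilon> \<in> RE_plus n - {1, -1}.
            2 ^ n * (1 + 8 * real_of_int (c_seq n)) \<le> field_trace \<rat> (BB n) (\<epsilon>\<^sup>2))"
proof -
  obtain m where m: "n = Suc m" "m \<le> 5" using assms by (cases n) auto
  have "2 ^ n * (1 + 8 * real_of_int (c_seq n)) \<le> field_trace \<rat> (BB n) (\<epsilon>\<^sup>2)" if "\<epsilon> \<in> RE_plus n - {1, -1}" for \<epsilon>
  proof -
    have "\<epsilon> \<in> RE_plus (Suc m)" "\<epsilon> \<noteq> 1" "\<epsilon> \<noteq> - 1" using that m(1) by simp_all
    then obtain C F where CF: "unit_seqs m C F"
      "field_trace \<rat> (BB (Suc m)) (\<epsilon>\<^sup>2) = 2 ^ Suc m * (1 + 8 * of_int (conv (4 * 2 ^ m) F F 0))"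
      using RE_plus_coefficients[OF \<open>\<epsilon> \<in> RE_plus (Suc m)\<close> \<open>\<epsilon> \<noteq> 1\<close> \<open>\<epsilon> \<noteq> - 1\<close>] by (elim exE conjE)
    have "real_of_int (c_seq (Suc m)) \<le> of_int (conv (4 * 2 ^ m) F F 0)"
      using c_seq_le_trace[OF CF(1) m(2)] by (simp only: of_int_le_iff)
    then show ?thesis unfolding m(1) CF(2) by (intro mult_left_mono) simp_all
  qed
  then show ?thesis using RE_plus_exists[OF m(2)] unfolding m(1) by blast
qed

end
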